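(* Let $p>1$, let $(M,g)$ be a complete Riemannian manifold and let $\Omega\subset M$ be an open set. Let $\rho\in W^{1,p}_{loc}(\Omega)$ be a nonnegative function with $-\Delta_p\rho\ge0$ on $\Omega$ in weak sense. Let $\delta>0$ and $0\le b\le1$, and let $s,q$ be defined by $$\frac1s=\frac bp+\frac{1-b}{\delta},\qquad \frac{1}{q(p-1)}=\frac1p+\frac{1-b}{b\delta}$$ (for $b=0$ the second relation is read as $q=0$). Then for every $u\in C_0^1(\Omega)$ $$\left(\int_\Omega|u|^s\frac{|\nabla\rho|^{q(p-1)}}{\rho^{q(p-1)}}\,dv_g\right)^{1/s}\le\left(\frac{p}{p-1}\right)^{q(p-1)/s}\left(\int_\Omega|\nabla u|^p\,dv_g\right)^{b/p}\left(\int_\Omega|u|^\delta\,dv_g\right)^{(1-b)/\delta}.$$ In particular, if $\rho=d^\alpha$ for some $\alpha\ne0$ with $|\nabla d|=1$, then for every $u\in C_0^1(\Omega)$ $$\int_\Omega\frac{|u|^s}{d^{p-1}}\,dv_g\le\left(\frac{p}{|\alpha|(p-1)}\right)^{p-1}\left(\int_\Omega|\nabla u|^p\,dv_g\right)^{1/p'}\left(\int_\Omega|u|^\delta\,dv_g\right)^{1/p},$$ where now $s=p-1+\frac{\delta}{p}$.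
   Context: $p'=p/(p-1)$. $dv_g$, $\nabla$, $\mathrm{div}$ are the volume form, gradient and divergence of $g$; $\Delta_p u=\mathrm{div}(|\nabla u|^{p-2}\nabla u)$. $C_0^1(\Omega)$ denotes compactly supported $C^1$ functions in $\Omega$. "$-\Delta_p\rho\ge0$ on $\Omega$ in weak sense" (i.e. $\rho$ is $p$-superharmonic) means $\int_\Omega|\nabla\rho|^{p-2}(\nabla\rho\cdot\nabla\varphi)\,dv_g\ge0$ for every nonnegative $\varphi\in C_0^1(\Omega)$. *)

theory Defs
  imports "HOL-Analysis.Analysis"
begin

section \<open>Powers\<close>

text \<open>Real powers of nonnegative reals with \<open>t\<^sup>0 = 1\<close> for every \<open>t \<ge> 0\<close>. The library has
  \<open>0 powr 0 = 0\<close>, which is wrong for the degenerate exponents \<open>b = 0\<close>, \<open>q = 0\<close> and \<open>b = 1\<close>.\<close>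

definition rpow :: "real \<Rightarrow> real \<Rightarrow> real"
  where "rpow t a = (if a = 0 then 1 else t powr a)"


section \<open>Differentiability classes on open subsets of Euclidean space\<close>

primrec Ck_on :: "nat \<Rightarrow> ('a::real_normed_vector \<Rightarrow> 'b::real_normed_vector) \<Rightarrow> 'a set \<Rightarrow> bool"
  where
    "Ck_on 0 f S \<longleftrightarrow> continuous_on S f"
  | "Ck_on (Suc k) f S \<longleftrightarrow> (\<forall>x\<in>S. f differentiable (at x)) \<and>
       (\<forall>v. Ck_on k (\<lambda>x. frechet_derivative f (at x) v) S)"

definition smooth_on :: "('a::real_normed_vector \<Rightarrow> 'b::real_normed_vector) \<Rightarrow> 'a set \<Rightarrow> bool"
  where "smooth_on f S \<longleftrightarrow> (\<forall>k. Ck_on k f S)"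


section \<open>Smooth and Riemannian manifolds\<close>

text \<open>A manifold is (the whole of) a Hausdorff, second countable type \<open>'m\<close> with a smooth atlas of
  charts \<open>(U, \<phi>)\<close> into \<open>real ^ 'n\<close>. Connectedness is not required. Only the values of \<open>\<phi>\<close> on \<open>U\<close>
  matter.\<close>

type_synonym ('m, 'n) chart = "'m set \<times> ('m \<Rightarrow> real ^ 'n)"

definition chart_inv :: "('m, 'n::finite) chart \<Rightarrow> real ^ 'n \<Rightarrow> 'm"
  where "chart_inv c = inv_into (fst c) (snd c)"

definition transition :: "('m, 'n::finite) chart \<Rightarrow> ('m, 'n) chart \<Rightarrow> real ^ 'n \<Rightarrow> real ^ 'n"
  where "transition c c' = snd c' \<circ> chart_inv c"

text \<open>The differential at the point \<open>x\<close> of the change of coordinates from \<open>c\<close> to \<open>c'\<close>.\<close>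

definition dtransition ::
    "('m, 'n::finite) chart \<Rightarrow> ('m, 'n) chart \<Rightarrow> 'm \<Rightarrow> real ^ 'n \<Rightarrow> real ^ 'n"
  where "dtransition c c' x = frechet_derivative (transition c c') (at (snd c x))"

locale smooth_manifold =
  fixes A :: "('m::{second_countable_topology, t2_space}, 'n::finite) chart set"
  assumes chart_open: "c \<in> A \<Longrightarrow> open (fst c)"
    and chart_image_open: "c \<in> A \<Longrightarrow> open (snd c ` fst c)"
    and chart_homeomorphism:
      "c \<in> A \<Longrightarrow> homeomorphism (fst c) (snd c ` fst c) (snd c) (chart_inv c)"
    and charts_cover: "(\<Union>c\<in>A. fst c) = UNIV"
    and transition_smooth:
      "c \<in> A \<Longrightarrow> c' \<in> A \<Longrightarrow> smooth_on (transition c c') (snd c ` (fst c \<inter> fst c'))"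

text \<open>A tangent vector at \<open>x\<close> is given by its components in every chart around \<open>x\<close>, and the metric
  by its component forms: \<open>g c x v w\<close> is the inner product of the tangent vectors at \<open>x\<close> whose
  components in the chart \<open>c\<close> are \<open>v\<close> and \<open>w\<close>.\<close>

type_synonym ('m, 'n) metric = "('m, 'n) chart \<Rightarrow> 'm \<Rightarrow> real ^ 'n \<Rightarrow> real ^ 'n \<Rightarrow> real"
type_synonym ('m, 'n) vfield = "('m, 'n) chart \<Rightarrow> 'm \<Rightarrow> real ^ 'n"

locale riemannian_manifold = smooth_manifold A
  for A :: "('m::{second_countable_topology, t2_space}, 'n::finite) chart set" +
  fixes g :: "('m, 'n) metric"
  assumes metric_bilinear: "c \<in> A \<Longrightarrow> x \<in> fst c \<Longrightarrow> bilinear (g c x)"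
    and metric_symmetric: "c \<in> A \<Longrightarrow> x \<in> fst c \<Longrightarrow> g c x v w = g c x w v"
    and metric_positive: "c \<in> A \<Longrightarrow> x \<in> fst c \<Longrightarrow> v \<noteq> 0 \<Longrightarrow> g c x v v > 0"
    and metric_smooth: "c \<in> A \<Longrightarrow> smooth_on (\<lambda>y. g c (chart_inv c y) v w) (snd c ` fst c)"
    and metric_transform: "c \<in> A \<Longrightarrow> c' \<in> A \<Longrightarrow> x \<in> fst c \<inter> fst c' \<Longrightarrow>
      g c x v w = g c' x (dtransition c c' x v) (dtransition c c' x w)"

definition chart_at :: "('m, 'n::finite) chart set \<Rightarrow> 'm \<Rightarrow> ('m, 'n) chart"
  where "chart_at A x = (SOME c. c \<in> A \<and> x \<in> fst c)"

definition vector_field ::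
    "('m, 'n::finite) chart set \<Rightarrow> 'm set \<Rightarrow> ('m, 'n) vfield \<Rightarrow> bool"
  where "vector_field A \<Omega> X \<longleftrightarrow>
    (\<forall>c\<in>A. \<forall>c'\<in>A. \<forall>x\<in>fst c \<inter> fst c' \<inter> \<Omega>. X c' x = dtransition c c' x (X c x))"

text \<open>The pointwise inner product and norm of vector fields; for vector fields they do not depend
  on the chart that is picked.\<close>

definition ginner :: "('m, 'n::finite) chart set \<Rightarrow> ('m, 'n) metric \<Rightarrow>
    ('m, 'n) vfield \<Rightarrow> ('m, 'n) vfield \<Rightarrow> 'm \<Rightarrow> real"
  where "ginner A g X Y x =
    g (chart_at A x) x (X (chart_at A x) x) (Y (chart_at A x) x)"

definition gnorm :: "('m, 'n::finite) chart set \<Rightarrow> ('m, 'n) metric \<Rightarrow>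
    ('m, 'n) vfield \<Rightarrow> 'm \<Rightarrow> real"
  where "gnorm A g X x = sqrt (ginner A g X X x)"


subsection \<open>Volume\<close>

text \<open>\<open>vol\<close> is the Riemannian volume measure: the (unique) Borel measure with density
  \<open>sqrt (det (g\<^sub>i\<^sub>j))\<close> with respect to Lebesgue measure in every chart.\<close>

definition gram :: "('m, 'n::finite) metric \<Rightarrow> ('m, 'n) chart \<Rightarrow> 'm \<Rightarrow> real ^ 'n ^ 'n"
  where "gram g c x = (\<chi> i j. g c x (axis i 1) (axis j 1))"

definition riemannian_volume :: "('m::topological_space, 'n::finite) chart set \<Rightarrow>
    ('m, 'n) metric \<Rightarrow> 'm measure \<Rightarrow> bool"
  where "riemannian_volume A g vol \<longleftrightarrow> sets vol = sets borel \<and>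
    (\<forall>c\<in>A. \<forall>B\<in>sets borel. B \<subseteq> fst c \<longrightarrow>
      emeasure vol B =
        (\<integral>\<^sup>+y\<in>snd c ` B. ennreal (sqrt (det (gram g c (chart_inv c y)))) \<partial>lborel))"


subsection \<open>Completeness\<close>

definition speed :: "('m, 'n::finite) chart set \<Rightarrow> ('m, 'n) metric \<Rightarrow> (real \<Rightarrow> 'm) \<Rightarrow> real \<Rightarrow> real"
  where "speed A g \<gamma> t =
    gnorm A g (\<lambda>c x. vector_derivative (snd c \<circ> \<gamma>) (at t)) (\<gamma> t)"

definition piecewise_C1_curve ::
    "('m::topological_space, 'n::finite) chart set \<Rightarrow> (real \<Rightarrow> 'm) \<Rightarrow> bool"
  where "piecewise_C1_curve A \<gamma> \<longleftrightarrow> path \<gamma> \<and>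
    (\<forall>c\<in>A. \<forall>a b. {a..b} \<subseteq> {0..1} \<and> \<gamma> ` {a..b} \<subseteq> fst c \<longrightarrow>
      (snd c \<circ> \<gamma>) piecewise_C1_differentiable_on {a..b})"

definition riemannian_dist :: "('m::topological_space, 'n::finite) chart set \<Rightarrow>
    ('m, 'n) metric \<Rightarrow> 'm \<Rightarrow> 'm \<Rightarrow> ennreal"
  where "riemannian_dist A g x y =
    (INF \<gamma>\<in>{\<gamma>. piecewise_C1_curve A \<gamma> \<and> pathstart \<gamma> = x \<and> pathfinish \<gamma> = y}.
      \<integral>\<^sup>+t\<in>{0..1}. ennreal (speed A g \<gamma> t) \<partial>lborel)"

text \<open>Metric completeness for the Riemannian distance, which is \<open>\<infinity>\<close> between different components.\<close>

definition riemannian_complete ::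
    "('m::topological_space, 'n::finite) chart set \<Rightarrow> ('m, 'n) metric \<Rightarrow> bool"
  where "riemannian_complete A g \<longleftrightarrow>
    (\<forall>\<sigma> :: nat \<Rightarrow> 'm.
      (\<forall>e>0. \<exists>N. \<forall>m\<ge>N. \<forall>n\<ge>N. riemannian_dist A g (\<sigma> m) (\<sigma> n) < e) \<longrightarrow>
      (\<exists>x. (\<lambda>n. riemannian_dist A g (\<sigma> n) x) \<longlonglongrightarrow> 0))"


section \<open>Function spaces and gradients\<close>

text \<open>\<open>C\<^sub>0\<^sup>1(\<Omega>)\<close>; its elements are extended by zero to the whole space.\<close>

definition C1_0 :: "('m::topological_space, 'n::finite) chart set \<Rightarrow> 'm set \<Rightarrow> ('m \<Rightarrow> real) set"
  where "C1_0 A \<Omega> = {u. (\<forall>c\<in>A. Ck_on 1 (u \<circ> chart_inv c) (snd c ` fst c)) \<and>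
    compact (closure {x. u x \<noteq> 0}) \<and> closure {x. u x \<noteq> 0} \<subseteq> \<Omega>}"

definition C1_0_euclidean :: "(real ^ 'n::finite) set \<Rightarrow> (real ^ 'n \<Rightarrow> real) set"
  where "C1_0_euclidean V = {\<psi>. Ck_on 1 \<psi> UNIV \<and>
    compact (closure {y. \<psi> y \<noteq> 0}) \<and> closure {y. \<psi> y \<noteq> 0} \<subseteq> V}"

definition gradient :: "('m, 'n::finite) metric \<Rightarrow> ('m \<Rightarrow> real) \<Rightarrow> ('m, 'n) vfield"
  where "gradient g u c x =
    (THE v. \<forall>w. g c x v w = frechet_derivative (u \<circ> chart_inv c) (at (snd c x)) w)"

definition locally_integrable :: "'a::topological_space measure \<Rightarrow> 'a set \<Rightarrow> ('a \<Rightarrow> real) \<Rightarrow> bool"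
  where "locally_integrable \<mu> V f \<longleftrightarrow>
    (\<forall>K. compact K \<and> K \<subseteq> V \<longrightarrow> set_integrable \<mu> K f)"

definition weak_partial ::
    "(real ^ 'n::finite) set \<Rightarrow> (real ^ 'n \<Rightarrow> real) \<Rightarrow> 'n \<Rightarrow> (real ^ 'n \<Rightarrow> real) \<Rightarrow> bool"
  where "weak_partial V f i h \<longleftrightarrow>
    locally_integrable lborel V f \<and> locally_integrable lborel V h \<and>
    (\<forall>\<psi>\<in>C1_0_euclidean V.
      (LINT y:V|lborel. f y * frechet_derivative \<psi> (at y) (axis i 1)) =
      - (LINT y:V|lborel. h y * \<psi> y))"

text \<open>\<open>X\<close> is a weak gradient of \<open>f\<close> on \<open>\<Omega>\<close> if in every chart the components \<open>g(X, \<partial>\<^sub>i)\<close> of the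
  corresponding covector field are the weak partial derivatives of \<open>f\<close>. It is unique up to null
  sets, so the choice made in \<open>weak_grad\<close> is immaterial.\<close>

definition weak_gradient :: "('m, 'n::finite) chart set \<Rightarrow> ('m, 'n) metric \<Rightarrow>
    'm set \<Rightarrow> ('m \<Rightarrow> real) \<Rightarrow> ('m, 'n) vfield \<Rightarrow> bool"
  where "weak_gradient A g \<Omega> f X \<longleftrightarrow> vector_field A \<Omega> X \<and>
    (\<forall>c\<in>A. \<forall>i. weak_partial (snd c ` (fst c \<inter> \<Omega>)) (f \<circ> chart_inv c) i
      (\<lambda>y. g c (chart_inv c y) (X c (chart_inv c y)) (axis i 1)))"

definition weak_grad :: "('m, 'n::finite) chart set \<Rightarrow> ('m, 'n) metric \<Rightarrow>
    'm set \<Rightarrow> ('m \<Rightarrow> real) \<Rightarrow> ('m, 'n) vfield"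
  where "weak_grad A g \<Omega> f = (SOME X. weak_gradient A g \<Omega> f X)"

definition W1p_loc :: "('m::topological_space, 'n::finite) chart set \<Rightarrow> ('m, 'n) metric \<Rightarrow>
    'm measure \<Rightarrow> real \<Rightarrow> 'm set \<Rightarrow> ('m \<Rightarrow> real) set"
  where "W1p_loc A g vol p \<Omega> = {f. (\<exists>X. weak_gradient A g \<Omega> f X) \<and>
    locally_integrable vol \<Omega> (\<lambda>x. \<bar>f x\<bar> powr p) \<and>
    locally_integrable vol \<Omega> (\<lambda>x. gnorm A g (weak_grad A g \<Omega> f) x powr p)}"

text \<open>\<open>-\<Delta>\<^sub>p f \<ge> 0\<close> on \<open>\<Omega>\<close> in the weak sense. Where \<open>\<nabla>f = 0\<close> the integrand is \<open>0\<close>, also for \<open>p < 2\<close>.\<close>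

definition p_superharmonic :: "('m::topological_space, 'n::finite) chart set \<Rightarrow>
    ('m, 'n) metric \<Rightarrow> 'm measure \<Rightarrow> real \<Rightarrow> 'm set \<Rightarrow> ('m \<Rightarrow> real) \<Rightarrow> bool"
  where "p_superharmonic A g vol p \<Omega> f \<longleftrightarrow>
    (\<forall>\<phi>\<in>C1_0 A \<Omega>. (\<forall>x. \<phi> x \<ge> 0) \<longrightarrow>
      (LINT x:\<Omega>|vol. gnorm A g (weak_grad A g \<Omega> f) x powr (p - 2) *
        ginner A g (weak_grad A g \<Omega> f) (gradient g \<phi>) x) \<ge> 0)"

end

theory Submission
  imports Defs
begin

text \<open>Testing superharmonicity of \<open>\<rho>\<close> with \<open>\<bar>u\<bar>\<^sup>p / (\<rho> + \<epsilon>)\<^sup>p\<^sup>-\<^sup>1\<close> and applying Young's inequality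
  pointwise gives \<open>\<integral> (\<bar>u\<bar> \<bar>\<nabla>\<rho>\<bar> / (\<rho> + \<epsilon>))\<^sup>p \<le> (p / (p - 1))\<^sup>p \<integral> \<bar>\<nabla>u\<bar>\<^sup>p\<close>; Fatou's lemma as
  \<open>\<epsilon> \<rightarrow> 0\<close> yields Hardy's inequality, the case \<open>b = 1\<close>. Since \<open>q (p - 1) = b s\<close>, the general case is
  Hoelder's inequality between this and \<open>\<integral> \<bar>u\<bar>\<^sup>\<delta>\<close>, and the second statement is the case
  \<open>b = (p - 1) / s\<close>, where \<open>\<bar>\<nabla>\<rho>\<bar> / \<rho> = \<bar>\<alpha>\<bar> / d\<close> by the chain rule.

  The test function is only weakly differentiable. It is reached from \<open>C\<^sup>1\<close> test functions by
  localizing to a chart and mollifying \<open>\<rho>\<close> there; the gradients of the mollifications are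
  dominated, by Jensen's inequality, by functions that converge in \<open>L\<^sup>1\<close>.\<close>

section \<open>Continuously differentiable functions\<close>

text \<open>The obstacle is a mismatch of regularity: the tests in \<open>p_superharmonic\<close>
  are C^1, while \<rho> is only weakly differentiable. The flux |grad \<rho>|^(p-2) grad \<rho> is
  never regularized; only the copy of \<rho> inside the test function is mollified. The shift by
  \<epsilon> keeps the weight and its derivative bounded on nonnegative arguments, and the positive
  kernel keeps the mollified \<rho> nonnegative, so the weight can be applied to it. Convergence of
  gradients in L^p is bypassed: one subsequence gives pointwise convergence, and the p-th powers
  have majorants that converge in L^1, so the L^1 theory of mollification is enough. The constant
  comes from scaling |grad u| by p/(p-1) before Young's inequality. In the second statement \<rho> =
  d^\<alpha> relates two functions whose weak gradients are given independently, and the power is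
  not C^1 with bounded derivative on the half line. Both functions are therefore composed with C^1
  bumps supported away from 0 and infinity, and the gradients are compared by uniqueness of weak
  derivatives.\<close>

lemma Ck_on_1_I:
  assumes "\<And>x. x \<in> S \<Longrightarrow> (f has_derivative D x) (at x)"
    and "\<And>v. continuous_on S (\<lambda>x. D x v)"
  shows "Ck_on 1 f S"
proof -
  have "frechet_derivative f (at x) = D x" if "x \<in> S" for x
    using frechet_derivative_at[OF assms(1)[OF that]] by simp
  then have "continuous_on S (\<lambda>x. frechet_derivative f (at x) v)" for v
    using assms(2)[of v] by (simp cong: continuous_on_cong)
  then show ?thesis
    using assms(1) by (auto simp: differentiable_def)
qed

lemma Ck_on_1_has_derivative:
  assumes "Ck_on 1 f S" "x \<in> S"
  shows "(f has_derivative frechet_derivative f (at x)) (at x)"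
  using assms by (auto simp: frechet_derivative_works)

lemma Ck_on_1_continuous_derivative:
  assumes "Ck_on 1 f S"
  shows "continuous_on S (\<lambda>x. frechet_derivative f (at x) v)"
  using assms by auto

lemma Ck_on_1_linear:
  assumes "Ck_on 1 f S" "x \<in> S"
  shows "linear (frechet_derivative f (at x))"
  using has_derivative_linear[OF Ck_on_1_has_derivative[OF assms]] .

lemma Ck_on_1_continuous:
  assumes "Ck_on 1 f S"
  shows "continuous_on S f"
  using Ck_on_1_has_derivative[OF assms]
  by (meson continuous_at_imp_continuous_on has_derivative_continuous)

lemma Ck_on_1_subset:
  assumes "Ck_on 1 f S" "T \<subseteq> S"
  shows "Ck_on 1 f T"
  using assms by (auto intro: continuous_on_subset)

lemma Ck_on_1_cong:
  assumes "Ck_on 1 f S" "open S" "\<And>x. x \<in> S \<Longrightarrow> f x = h x"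
  shows "Ck_on 1 h S"
proof (rule Ck_on_1_I)
  show "(h has_derivative frechet_derivative f (at x)) (at x)" if "x \<in> S" for x
    by (rule has_derivative_transform_within_open[OF Ck_on_1_has_derivative[OF assms(1) that] assms(2) that])
      (rule assms(3))
qed (use assms(1) in \<open>rule Ck_on_1_continuous_derivative\<close>)

lemma Ck_on_1_Un:
  assumes "Ck_on 1 f S" "Ck_on 1 f T" "open S" "open T"
  shows "Ck_on 1 f (S \<union> T)"
  using assms by (auto intro: continuous_on_open_Un)

lemma Ck_on_1_const: "Ck_on 1 (\<lambda>x. c) S"
  by (rule Ck_on_1_I[where D = "\<lambda>_ _. 0"]) auto

lemma linear_sum_Basis:
  fixes L :: "'a::euclidean_space \<Rightarrow> 'b::real_normed_vector"
  assumes "linear L"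
  shows "L v = (\<Sum>b\<in>Basis. (v \<bullet> b) *\<^sub>R L b)"
proof -
  have "(\<Sum>b\<in>Basis. (v \<bullet> b) *\<^sub>R L b) = L (\<Sum>b\<in>Basis. (v \<bullet> b) *\<^sub>R b)"
    by (simp add: linear_sum[OF assms] linear_cmul[OF assms])
  then show ?thesis
    by (simp add: euclidean_representation)
qed

text \<open>\<open>Ck_on\<close> provides continuity of the derivative in each fixed direction; for
  a direction that moves with the point, linearity expands it in the basis.\<close>

lemma Ck_on_1_derivative_continuous_vec:
  fixes f :: "'a::euclidean_space \<Rightarrow> 'b::real_normed_vector"
  assumes "Ck_on 1 f S" "continuous_on T w" "continuous_on T \<tau>" "\<tau> ` T \<subseteq> S"
  shows "continuous_on T (\<lambda>x. frechet_derivative f (at (\<tau> x)) (w x))"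
proof -
  have "continuous_on T (\<lambda>x. \<Sum>b\<in>Basis. (w x \<bullet> b) *\<^sub>R frechet_derivative f (at (\<tau> x)) b)"
    using assms
    by (intro continuous_intros continuous_on_compose2[OF Ck_on_1_continuous_derivative[OF assms(1)]]) auto
  then show ?thesis
  proof (rule continuous_on_eq)
    fix x assume "x \<in> T"
    then have "linear (frechet_derivative f (at (\<tau> x)))"
      using assms(4) by (intro Ck_on_1_linear[OF assms(1)]) auto
    then show "(\<Sum>b\<in>Basis. (w x \<bullet> b) *\<^sub>R frechet_derivative f (at (\<tau> x)) b) =
        frechet_derivative f (at (\<tau> x)) (w x)"
      by (rule linear_sum_Basis[symmetric])
  qed
qed

lemma Ck_on_1_compose:
  fixes f :: "'b::euclidean_space \<Rightarrow> 'c::real_normed_vector"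
  assumes "Ck_on 1 f T" "Ck_on 1 \<tau> S" "\<tau> ` S \<subseteq> T"
  shows "Ck_on 1 (\<lambda>x. f (\<tau> x)) S"
proof (rule Ck_on_1_I)
  show "((\<lambda>x. f (\<tau> x)) has_derivative
      (\<lambda>v. frechet_derivative f (at (\<tau> x)) (frechet_derivative \<tau> (at x) v))) (at x)" if "x \<in> S" for x
    using has_derivative_compose[OF Ck_on_1_has_derivative[OF assms(2) that]]
      Ck_on_1_has_derivative[OF assms(1), of "\<tau> x"] assms(3) that by (auto simp: image_subset_iff)
  show "continuous_on S (\<lambda>x. frechet_derivative f (at (\<tau> x)) (frechet_derivative \<tau> (at x) v))" for v
    using assms Ck_on_1_continuous Ck_on_1_continuous_derivative
    by (intro Ck_on_1_derivative_continuous_vec) auto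
qed

lemma Ck_on_1_mult:
  fixes f h :: "'a::real_normed_vector \<Rightarrow> real"
  assumes "Ck_on 1 f S" "Ck_on 1 h S"
  shows "Ck_on 1 (\<lambda>x. f x * h x) S"
  by (rule Ck_on_1_I[OF has_derivative_mult[OF Ck_on_1_has_derivative[OF assms(1)]
        Ck_on_1_has_derivative[OF assms(2)]]], assumption, assumption)
    (intro continuous_intros assms[THEN Ck_on_1_continuous] assms[THEN Ck_on_1_continuous_derivative])

lemma frechet_derivative_mult_real:
  fixes f h :: "'a::real_normed_vector \<Rightarrow> real"
  assumes "Ck_on 1 f S" "Ck_on 1 h S" "x \<in> S"
  shows "frechet_derivative (\<lambda>x. f x * h x) (at x) v =
    f x * frechet_derivative h (at x) v + frechet_derivative f (at x) v * h x"
  using fun_cong[OF frechet_derivative_at[OF has_derivative_mult[OF Ck_on_1_has_derivative[OF assms(1,3)]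
        Ck_on_1_has_derivative[OF assms(2,3)]]], of v] by (rule sym)

lemma Ck_on_1_diff:
  fixes f h :: "'a::real_normed_vector \<Rightarrow> real"
  assumes "Ck_on 1 f S" "Ck_on 1 h S"
  shows "Ck_on 1 (\<lambda>x. f x - h x) S"
  by (rule Ck_on_1_I[OF has_derivative_diff[OF Ck_on_1_has_derivative[OF assms(1)]
        Ck_on_1_has_derivative[OF assms(2)]]], assumption, assumption)
    (intro continuous_intros assms[THEN Ck_on_1_continuous_derivative])

text \<open>The set \<open>T\<close> makes room for outer functions such as
  \<open>(t + \<epsilon>) powr (1 - p)\<close>, which is differentiated on t > - \<epsilon>.\<close>

lemma Ck_on_1_real_compose:
  fixes f :: "'a::real_normed_vector \<Rightarrow> real" and F :: "real \<Rightarrow> real"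
  assumes f: "Ck_on 1 f S" and F: "\<And>t. t \<in> T \<Longrightarrow> (F has_real_derivative F' t) (at t)"
    and F': "continuous_on T F'" and "f ` S \<subseteq> T"
  shows "Ck_on 1 (\<lambda>x. F (f x)) S"
    and "x \<in> S \<Longrightarrow> frechet_derivative (\<lambda>x. F (f x)) (at x) v = F' (f x) * frechet_derivative f (at x) v"
proof -
  have *: "((\<lambda>x. F (f x)) has_derivative (\<lambda>v. F' (f x) * frechet_derivative f (at x) v)) (at x)"
    if "x \<in> S" for x
    using has_derivative_compose[OF Ck_on_1_has_derivative[OF f that]
        has_field_derivative_imp_has_derivative[OF F]] assms(4) that
    by (auto simp: image_subset_iff)
  show "Ck_on 1 (\<lambda>x. F (f x)) S"
    by (rule Ck_on_1_I[OF *], assumption)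
      (intro continuous_intros Ck_on_1_continuous_derivative[OF f]
         continuous_on_compose2[OF F' Ck_on_1_continuous[OF f] assms(4)])
  show "frechet_derivative (\<lambda>x. F (f x)) (at x) v = F' (f x) * frechet_derivative f (at x) v"
    if "x \<in> S"
    using fun_cong[OF frechet_derivative_at[OF *[OF that]], of v] by (rule sym)
qed

lemma frechet_derivative_zero_open:
  assumes "open S" "x \<in> S" "\<And>y. y \<in> S \<Longrightarrow> f y = 0"
  shows "frechet_derivative f (at x) = (\<lambda>v. 0)"
proof -
  have "(f has_derivative (\<lambda>v. 0)) (at x)"
    by (rule has_derivative_transform_within_open[OF has_derivative_const assms(1,2)])
      (use assms(3) in auto)
  then show ?thesis
    by (rule frechet_derivative_at[symmetric])
qed

lemma frechet_derivative_outside_support: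
  assumes "x \<notin> closure {y. f y \<noteq> 0}"
  shows "frechet_derivative f (at x) = (\<lambda>v. 0)"
  by (rule frechet_derivative_zero_open[of "- closure {y. f y \<noteq> 0}"])
    (use assms closure_subset[of "{y. f y \<noteq> 0}"] in auto)

text \<open>The open sets \<open>S\<close> and \<open>- K\<close> cover the space, and the function
  is constant on the second. This extends the product of a cutoff with a local function by
  zero.\<close>

lemma Ck_on_1_zero_outside:
  fixes f :: "'a::real_normed_vector \<Rightarrow> 'b::real_normed_vector"
  assumes "Ck_on 1 f S" "open S" "closed K" "K \<subseteq> S" "\<And>x. x \<notin> K \<Longrightarrow> f x = 0"
  shows "Ck_on 1 f UNIV"
proof -
  have "Ck_on 1 f (- K)"
    by (rule Ck_on_1_cong[OF Ck_on_1_const[of 0]]) (use assms in auto)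
  then have "Ck_on 1 f (S \<union> - K)"
    using assms by (intro Ck_on_1_Un) auto
  moreover have "S \<union> - K = UNIV"
    using assms(4) by auto
  ultimately show ?thesis by simp
qed

lemma continuous_compact_support_bounded:
  fixes f :: "'a::topological_space \<Rightarrow> real"
  assumes "continuous_on UNIV f" "compact K" "\<And>x. x \<notin> K \<Longrightarrow> f x = 0"
  obtains B where "B > 0" "\<And>x. \<bar>f x\<bar> \<le> B"
proof -
  have "bounded (f ` K)"
    using assms(2)     by (intro compact_imp_bounded compact_continuous_image continuous_on_subset[OF assms(1)]) auto
  then obtain B where B: "\<And>x. x \<in> K \<Longrightarrow> \<bar>f x\<bar> \<le> B"
    by (auto simp: bounded_iff)
  have "\<bar>f x\<bar> \<le> max 1 B" for x
    using B[of x] assms(3)[of x] by (cases "x \<in> K") auto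
  then show ?thesis
    using that[of "max 1 B"] by auto
qed

text \<open>A C^1 substitute for the positive part. One continuous derivative is all that the test
  functions here have to possess, so the C^1 cutoffs below are assembled from this piecewise
  quadratic function.\<close>

definition psq :: "real \<Rightarrow> real"
  where "psq t = (max 0 t)\<^sup>2"

text \<open>The derivative \<open>2 * max 0 t\<close> is 2-Lipschitz, which bounds the first-order
  remainder by the square of the increment, uniformly in the base point. The uniformity is what
  later permits differentiation under the integral sign.\<close>

lemma psq_remainder: fixes a b :: real shows "\<bar>psq b - psq a - 2 * max 0 a * (b - a)\<bar> \<le> (b - a)\<^sup>2"
proof -
  consider "a \<le> 0" "b \<le> 0" | "a \<le> 0" "b > 0" | "a > 0" "b \<le> 0" | "a > 0" "b > 0" by linarith
  then show ?thesis
  proof cases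
    case 2
    then have "b\<^sup>2 \<le> (b - a)\<^sup>2" by (intro power_mono) auto
    with 2 show ?thesis by (simp add: psq_def max_def)
  next
    case 3
    have "b \<le> 0" "a > 0" by fact+
    have "\<bar>- a\<^sup>2 - 2 * a * (b - a)\<bar> \<le> (b - a)\<^sup>2"
    proof (rule abs_leI)
      show "- a\<^sup>2 - 2 * a * (b - a) \<le> (b - a)\<^sup>2"
        using zero_le_power2[of b] by (simp add: power2_eq_square algebra_simps)
      have "a * b \<le> 0" using 3 by (simp add: mult_nonneg_nonpos)
      moreover have "- (- a\<^sup>2 - 2 * a * (b - a)) = 2 * (a * b) - a\<^sup>2"
        by (simp add: power2_eq_square algebra_simps)
      ultimately show "- (- a\<^sup>2 - 2 * a * (b - a)) \<le> (b - a)\<^sup>2"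
        using zero_le_power2[of "b - a"] zero_le_power2[of a] by linarith
    qed
    moreover have "psq b = 0" "psq a = a\<^sup>2" "max 0 a = a"
      using 3 by (auto simp: psq_def max_def)
    ultimately show ?thesis by simp
  next
    case 4
    then have "psq b - psq a - 2 * max 0 a * (b - a) = (b - a)\<^sup>2"
      by (simp add: psq_def power2_eq_square algebra_simps)
    then show ?thesis by simp
  qed (auto simp: psq_def)
qed

lemma psq_has_derivative: "(psq has_real_derivative 2 * max 0 t) (at t)"
  unfolding DERIV_def
proof (rule LIM_zero_cancel, rule Lim_null_comparison)
  have "norm ((psq (t + h) - psq t) / h - 2 * max 0 t) \<le> \<bar>h\<bar>" if "h \<noteq> 0" for h
  proof -
    have "(psq (t + h) - psq t) / h - 2 * max 0 t = (psq (t + h) - psq t - 2 * max 0 t * h) / h"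
      using that by (simp add: diff_divide_distrib)
    moreover have "\<bar>psq (t + h) - psq t - 2 * max 0 t * h\<bar> \<le> \<bar>h\<bar> * \<bar>h\<bar>"
      using psq_remainder[of "t+h" t] by (simp add: power2_eq_square)
    ultimately show ?thesis
      using that by (simp add: divide_le_eq)
  qed
  then show "\<forall>\<^sub>F h in at 0. norm ((psq (t + h) - psq t) / h - 2 * max 0 t) \<le> \<bar>h\<bar>"
    by (simp add: eventually_at_filter)
  show "((\<lambda>h. \<bar>h\<bar>) \<longlongrightarrow> 0) (at (0::real))"
    by (rule tendsto_rabs_zero[OF tendsto_ident_at])
qed

lemma continuous_on_psq: "continuous_on S psq"
  unfolding psq_def by (intro continuous_intros)

lemma psq_nonneg: "psq t \<ge> 0"
  by (simp add: psq_def)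

lemma psq_eq_0: "psq t = 0 \<longleftrightarrow> t \<le> 0"
  by (auto simp: psq_def max_def)

lemma psq_le_1: "t \<le> 1 \<Longrightarrow> psq t \<le> 1"
  unfolding psq_def by (rule power_le_one) auto

section \<open>A mollifier\<close>

text \<open>For r > 0 this is the squared positive part of 1 - |y|^2/r^2: positive exactly on the
  open ball of radius \<open>r\<close>, equal to 1 at the centre and C^1 across the bounding
  sphere.\<close>

definition bump :: "real \<Rightarrow> 'a::euclidean_space \<Rightarrow> real"
  where "bump r y = psq (1 - (y \<bullet> y) / r\<^sup>2)"

definition bump_deriv :: "real \<Rightarrow> 'a::euclidean_space \<Rightarrow> 'a \<Rightarrow> real"
  where "bump_deriv r z v = - 4 * max 0 (1 - (z \<bullet> z) / r\<^sup>2) * (z \<bullet> v) / r\<^sup>2"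

lemma bump_nonneg: "bump r y \<ge> 0"
  by (simp add: bump_def psq_nonneg)

lemma bump_le_1: "bump r y \<le> 1"
  by (simp add: bump_def psq_le_1)

lemma bump_uminus: "bump r (- y) = bump r y"
  by (simp add: bump_def)

lemma bump_eq_0_iff:
  assumes "r > 0"
  shows "bump r y = 0 \<longleftrightarrow> r \<le> norm y"
proof -
  have "bump r y = 0 \<longleftrightarrow> r\<^sup>2 \<le> (norm y)\<^sup>2"
    using assms by (simp add: bump_def psq_eq_0 dot_square_norm le_divide_eq)
  also have "\<dots> \<longleftrightarrow> r \<le> norm y"
    using assms by (simp add: power2_le_iff_abs_le)
  finally show ?thesis .
qed

lemma continuous_on_bump: "continuous_on S (bump r)"
  unfolding bump_def divide_inverse
  by (rule continuous_on_compose2[OF continuous_on_psq[of UNIV]]) (auto intro!: continuous_intros)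

lemma bump_measurable [measurable]: "bump r \<in> borel_measurable borel"
  by (rule borel_measurable_continuous_onI[OF continuous_on_bump])

lemma continuous_on_bump_deriv: "continuous_on S (\<lambda>z. bump_deriv r z v)"
  unfolding bump_deriv_def divide_inverse by (intro continuous_intros)

lemma bump_deriv_eq_0:
  assumes "r > 0" "r \<le> norm z"
  shows "bump_deriv r z v = 0"
proof -
  have "r\<^sup>2 \<le> z \<bullet> z"
    using assms by (simp add: dot_square_norm power_mono)
  then show ?thesis
    using assms by (simp add: bump_deriv_def max_def)
qed

lemma bump_deriv_bound:
  assumes "r > 0"
  shows "\<bar>bump_deriv r z v\<bar> \<le> 4 / r * norm v"
proof (cases "r \<le> norm z")
  case True
  then show ?thesis using assms by (simp add: bump_deriv_eq_0)
next
  case False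
  have "max 0 (1 - (z \<bullet> z) / r\<^sup>2) * \<bar>z \<bullet> v\<bar> \<le> 1 * (norm z * norm v)"
    by (intro mult_mono Cauchy_Schwarz_ineq2) auto
  also have "\<dots> \<le> r * norm v"
    using False by (simp add: mult_right_mono)
  finally have "4 * (max 0 (1 - (z \<bullet> z) / r\<^sup>2) * \<bar>z \<bullet> v\<bar>) / r\<^sup>2 \<le> 4 * (r * norm v) / r\<^sup>2"
    by (intro divide_right_mono mult_left_mono) auto
  then show ?thesis
    using assms by (simp add: bump_deriv_def abs_mult power2_eq_square)
qed

lemma linear_bump_deriv: "linear (bump_deriv r z)"
  by (rule linearI) (simp_all add: bump_deriv_def inner_add_right distrib_left diff_divide_distrib)

text \<open>If \<open>norm z\<close> is at least r + 1, a step of length at most 1 stays where the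
  bump is 0. Otherwise the argument of \<open>psq\<close> changes by at most (2 r + 3) |h| / r^2,
  which gives the squared constant. The summand 2 / r^2 accounts for the term |h|^2 in the increment
  of |z|^2 that \<open>bump_deriv\<close> leaves out; its factor \<open>2 * max 0 a\<close> is at
  most 2.\<close>

lemma bump_remainder:
  assumes r: "r > 0" and h: "norm h \<le> 1"
  shows "\<bar>bump r (z + h) - bump r z - bump_deriv r z h\<bar>
    \<le> (((2 * r + 3) / r\<^sup>2)\<^sup>2 + 2 / r\<^sup>2) * (norm h)\<^sup>2"
proof (cases "r + 1 \<le> norm z")
  case True
  have "r \<le> norm (z + h)"
    using True h norm_triangle_ineq4[of "z + h" h] by simp
  with True show ?thesis
    using bump_eq_0_iff[OF r, of z] bump_eq_0_iff[OF r, of "z + h"] bump_deriv_eq_0[OF r, of z h]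
    by simp
next
  case False
  define a b where "a = 1 - (z \<bullet> z) / r\<^sup>2" and "b = 1 - ((z + h) \<bullet> (z + h)) / r\<^sup>2"
  have ba: "b - a = - ((2 * (z \<bullet> h) + h \<bullet> h) / r\<^sup>2)"
    by (simp add: a_def b_def inner_add_left inner_add_right inner_commute add_divide_distrib)
  have "\<bar>2 * (z \<bullet> h) + h \<bullet> h\<bar> \<le> 2 * (norm z * norm h) + norm h * norm h"
    using Cauchy_Schwarz_ineq2[of z h] abs_triangle_ineq[of "2 * (z \<bullet> h)" "norm h * norm h"]
    by (simp add: dot_square_norm power2_eq_square abs_mult)
  also have "\<dots> \<le> 2 * ((r + 1) * norm h) + 1 * norm h"
    using False h by (intro add_mono mult_left_mono mult_right_mono) auto
  also have "\<dots> = (2 * r + 3) * norm h"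
    by (simp add: algebra_simps)
  finally have "\<bar>b - a\<bar> \<le> (2 * r + 3) * norm h / r\<^sup>2"
    unfolding ba by (simp add: divide_right_mono)
  then have "\<bar>b - a\<bar>\<^sup>2 \<le> ((2 * r + 3) * norm h / r\<^sup>2)\<^sup>2"
    by (intro power_mono) auto
  then have 1: "(b - a)\<^sup>2 \<le> ((2 * r + 3) / r\<^sup>2)\<^sup>2 * (norm h)\<^sup>2"
    by (simp add: power_mult_distrib power_divide)
  have "max 0 a * (norm h)\<^sup>2 \<le> 1 * (norm h)\<^sup>2"
    by (intro mult_right_mono) (auto simp: a_def)
  then have 2: "2 * max 0 a * (norm h)\<^sup>2 / r\<^sup>2 \<le> 2 / r\<^sup>2 * (norm h)\<^sup>2"
    using r by (simp add: divide_right_mono)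
  have "bump r (z + h) - bump r z - bump_deriv r z h =
      (psq b - psq a - 2 * max 0 a * (b - a)) - 2 * max 0 a * (norm h)\<^sup>2 / r\<^sup>2"
  proof -
    have "bump r (z + h) = psq b" "bump r z = psq a"
      "bump_deriv r z h = - (4 * max 0 a * (z \<bullet> h) / r\<^sup>2)"
      by (simp_all add: bump_def bump_deriv_def a_def b_def)
    then show ?thesis
      unfolding ba dot_square_norm[of h] by (simp add: add_divide_distrib algebra_simps)
  qed
  also have "\<bar>\<dots>\<bar> \<le> \<bar>psq b - psq a - 2 * max 0 a * (b - a)\<bar> + \<bar>2 * max 0 a * (norm h)\<^sup>2 / r\<^sup>2\<bar>"
    by (rule abs_triangle_ineq4)
  also have "\<bar>2 * max 0 a * (norm h)\<^sup>2 / r\<^sup>2\<bar> = 2 * max 0 a * (norm h)\<^sup>2 / r\<^sup>2"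
    by simp
  also note psq_remainder[of b a]
  finally show ?thesis
    using 1 2 by (simp add: distrib_right)
qed

lemma has_derivative_quadratic_bound:
  fixes f :: "'a::real_normed_vector \<Rightarrow> real"
  assumes "bounded_linear D" "\<And>h. norm h \<le> 1 \<Longrightarrow> \<bar>f (x + h) - f x - D h\<bar> \<le> C * (norm h)\<^sup>2"
  shows "(f has_derivative D) (at x)"
  unfolding has_derivative_at
proof (rule conjI[OF assms(1)], rule Lim_null_comparison)
  have "norm (norm (f (x + h) - f x - D h) / norm h) \<le> C * norm h" if "norm h \<le> 1" "h \<noteq> 0" for h
    using assms(2)[OF that(1)] that(2) by (simp add: divide_le_eq power2_eq_square mult.assoc)
  then show "\<forall>\<^sub>F h in at 0. norm (norm (f (x + h) - f x - D h) / norm h) \<le> C * norm h"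
    by (auto simp: eventually_at intro!: exI[of _ 1])
  show "((\<lambda>h. C * norm h) \<longlongrightarrow> 0) (at 0)"
    by (rule tendsto_mult_right_zero[OF tendsto_norm_zero[OF tendsto_ident_at]])
qed

lemma bump_has_derivative:
  assumes "r > 0"
  shows "(bump r has_derivative bump_deriv r z) (at z)"
  by (rule has_derivative_quadratic_bound)
    (use linear_bump_deriv linear_conv_bounded_linear bump_remainder[OF assms] in blast)+

lemma Ck_on_1_bump: "r > 0 \<Longrightarrow> Ck_on 1 (bump r) S"
  by (rule Ck_on_1_I[OF bump_has_derivative continuous_on_bump_deriv])

lemma bump_integrable:
  assumes "r > 0"
  shows "integrable lborel (bump r :: 'a::euclidean_space \<Rightarrow> real)"
proof (rule Bochner_Integration.integrable_bound)
  show "integrable lborel (indicator (cball 0 r) :: 'a \<Rightarrow> real)"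
    using emeasure_lborel_cball_finite[of "0::'a" r] by (intro integrable_real_indicator) auto
  show "AE x in lborel. norm (bump r (x::'a)) \<le> norm (indicator (cball 0 r) x :: real)"
  proof (rule AE_I2)
    show "norm (bump r x) \<le> norm (indicator (cball 0 r) x :: real)" for x :: 'a
      using bump_eq_0_iff[OF assms, of x]
      by (cases "norm x \<le> r") (simp_all add: bump_nonneg bump_le_1)
  qed
qed measurable

text \<open>If the integral vanished, the nonnegative bump would vanish almost everywhere, making
  the open ball a null set.\<close>

lemma bump_integral_pos:
  assumes "r > 0"
  shows "(LINT z|lborel. bump r (z::'a::euclidean_space)) > 0"
proof -
  have "(LINT z|lborel. bump r (z::'a)) \<noteq> 0"
  proof
    assume "(LINT z|lborel. bump r (z::'a)) = 0"
    then have "AE z in lborel. bump r (z::'a) = 0"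
      using integral_nonneg_eq_0_iff_AE[OF bump_integrable[OF assms, where 'a = 'a]]
      by (simp add: bump_nonneg)
    then have "AE z in lborel. (z::'a) \<notin> ball 0 r"
      by eventually_elim (simp add: bump_eq_0_iff[OF assms])
    then have "emeasure lborel (ball (0::'a) r) = 0"
      by (subst (asm) AE_iff_measurable[OF _ refl]) (auto simp: ball_def)
    then show False
      using content_ball_pos[OF assms, of "0::'a"] by (simp add: measure_def)
  qed
  moreover have "(LINT z|lborel. bump r (z::'a)) \<ge> 0"
    by (intro Bochner_Integration.integral_nonneg) (simp add: bump_nonneg)
  ultimately show ?thesis by simp
qed

definition moll :: "real \<Rightarrow> 'a::euclidean_space \<Rightarrow> real"
  where "moll r x = bump r x / (LINT z|lborel. bump r (z::'a))"

definition moll_deriv :: "real \<Rightarrow> 'a::euclidean_space \<Rightarrow> 'a \<Rightarrow> real"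
  where "moll_deriv r z v = bump_deriv r z v / (LINT z|lborel. bump r (z::'a))"

text \<open>The integral runs over the whole space, so a function given on an open set is first
  multiplied by the indicator of a compact subset.\<close>

definition mollify :: "('a::euclidean_space \<Rightarrow> real) \<Rightarrow> real \<Rightarrow> 'a \<Rightarrow> real"
  where "mollify f r x = (LINT y|lborel. moll r (x - y) * f y)"

lemma moll_measurable [measurable]: "moll r \<in> borel_measurable borel"
  unfolding moll_def by measurable

lemma continuous_on_moll: "continuous_on S (moll r)"
  unfolding moll_def divide_inverse by (intro continuous_intros continuous_on_bump)

lemma continuous_on_moll_deriv: "continuous_on S (\<lambda>z. moll_deriv r z v)"
  unfolding moll_deriv_def divide_inverse[of "bump_deriv _ _ _"]
  by (intro continuous_on_mult_right continuous_on_bump_deriv)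

context
  fixes r :: real
  assumes r: "r > 0"
begin

lemma moll_nonneg: "moll r x \<ge> 0"
  using bump_integral_pos[OF r] by (simp add: moll_def bump_nonneg less_imp_le)

lemma moll_eq_0: "r \<le> norm x \<Longrightarrow> moll r x = 0"
  by (simp add: moll_def bump_eq_0_iff[OF r])

lemma moll_deriv_eq_0: "r \<le> norm x \<Longrightarrow> moll_deriv r x v = 0"
  by (simp add: moll_deriv_def bump_deriv_eq_0[OF r])

lemma moll_uminus: "moll r (x - y) = moll r (y - x)"
  using bump_uminus[of r "x - y"] by (simp add: moll_def)

lemma moll_deriv_uminus: "moll_deriv r (x - y) v = - moll_deriv r (y - x) v"
proof -
  have "(x - y) \<bullet> (x - y) = (y - x) \<bullet> (y - x)"
    by (simp add: inner_diff_left inner_diff_right inner_commute)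
  moreover have "(x - y) \<bullet> v = - ((y - x) \<bullet> v)"
    by (simp add: inner_diff_left)
  ultimately show ?thesis
    unfolding moll_deriv_def bump_deriv_def by simp
qed

lemma moll_has_derivative: "(moll r has_derivative moll_deriv r z) (at z)"
  unfolding moll_def[abs_def] moll_deriv_def[abs_def] divide_inverse
  by (intro has_derivative_mult_left bump_has_derivative r)

lemma moll_integrable: "integrable lborel (moll r :: 'a::euclidean_space \<Rightarrow> real)"
  unfolding moll_def by (intro integrable_divide_zero impI bump_integrable r)

lemma moll_integral: "(LINT x|lborel. moll r (x :: 'a::euclidean_space)) = 1"
  using bump_integral_pos[OF r, where 'a = 'a] by (simp add: moll_def)

lemma moll_bound:
  obtains B where "B > 0" "\<And>x::'a::euclidean_space. \<bar>moll r x\<bar> \<le> B"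
  using continuous_compact_support_bounded[OF continuous_on_moll compact_cball[of "0::'a" r], of r]
    moll_eq_0 by (metis dist_0_norm linorder_le_cases mem_cball)

end

section \<open>Convolution with bounded continuous kernels\<close>

lemma lborel_integrable_shift:
  fixes f :: "'a::euclidean_space \<Rightarrow> real"
  assumes "integrable lborel f"
  shows "integrable lborel (\<lambda>x. f (x + c))"
    and "(LINT x|lborel. f (x + c)) = (LINT x|lborel. f x)"
proof -
  have *: "integrable (distr lborel borel ((+) c)) f"
    using assms by (simp add: lborel_distr_plus)
  have [measurable]: "f \<in> borel_measurable borel"
    using assms by simp
  show "integrable lborel (\<lambda>x. f (x + c))"
    using integrable_distr[OF _ *] by (simp add: add.commute)
  have "(LINT x|lborel. f x) = (LINT x|distr lborel borel ((+) c). f x)"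
    by (simp add: lborel_distr_plus)
  also have "\<dots> = (LINT x|lborel. f (c + x))"
    by (subst integral_distr) auto
  finally show "(LINT x|lborel. f (x + c)) = (LINT x|lborel. f x)"
    by (simp add: add.commute)
qed

lemma moll_shift:
  fixes y :: "'a::euclidean_space"
  assumes "r > 0"
  shows "integrable lborel (\<lambda>x. moll r (x - y))" "(LINT x|lborel. moll r (x - y)) = 1"
    and "integrable lborel (\<lambda>x. moll r (y - x))" "(LINT x|lborel. moll r (y - x)) = 1"
  using lborel_integrable_shift[OF moll_integrable[OF assms], of "-y"] moll_integral[OF assms, where 'a = 'a]
  by (simp_all add: moll_uminus[OF assms, of y])

lemma kernel_integrable:
  fixes f :: "'a::euclidean_space \<Rightarrow> real"
  assumes f: "integrable lborel f" and k: "continuous_on UNIV k" "\<And>x. \<bar>k x\<bar> \<le> B"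
  shows "integrable lborel (\<lambda>y. k (x - y) * f y)"
proof (rule Bochner_Integration.integrable_bound)
  show "integrable lborel (\<lambda>y. B * f y)"
    using f by simp
  have [measurable]: "k \<in> borel_measurable borel"
    using k by (rule_tac borel_measurable_continuous_onI)
  have [measurable]: "f \<in> borel_measurable borel"
    using f by simp
  show "(\<lambda>y. k (x - y) * f y) \<in> borel_measurable lborel"
    by measurable
  have "\<bar>k (x - y) * f y\<bar> \<le> \<bar>B * f y\<bar>" for y
    using k(2)[of "x - y"] by (simp add: abs_mult mult_right_mono)
  then show "AE y in lborel. norm (k (x - y) * f y) \<le> norm (B * f y)"
    by simp
qed

lemma kernel_continuous:
  fixes f :: "'a::euclidean_space \<Rightarrow> real"
  assumes f: "integrable lborel f" and k: "continuous_on UNIV k" "\<And>x. \<bar>k x\<bar> \<le> B"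
  shows "continuous_on UNIV (\<lambda>x. LINT y|lborel. k (x - y) * f y)"
proof (intro continuous_at_imp_continuous_on ballI continuous_at_sequentiallyI)
  fix x :: 'a and u :: "nat \<Rightarrow> 'a" assume u: "u \<longlonglongrightarrow> x"
  have [measurable]: "f \<in> borel_measurable borel"
    using f by simp
  have [measurable]: "k \<in> borel_measurable borel"
    using k by (rule_tac borel_measurable_continuous_onI)
  show "(\<lambda>n. LINT y|lborel. k (u n - y) * f y) \<longlonglongrightarrow> (LINT y|lborel. k (x - y) * f y)"
  proof (rule integral_dominated_convergence)
    show "integrable lborel (\<lambda>y. B * \<bar>f y\<bar>)"
      using f by simp
    have "\<bar>k (u n - y) * f y\<bar> \<le> B * \<bar>f y\<bar>" for n y
      using k(2)[of "u n - y"] by (simp add: abs_mult mult_right_mono)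
    then show "AE y in lborel. norm (k (u n - y) * f y) \<le> B * \<bar>f y\<bar>" for n
      by simp
    have "(\<lambda>n. k (u n - y)) \<longlonglongrightarrow> k (x - y)" for y
      using k(1) u by (intro continuous_on_tendsto_compose[of UNIV k] tendsto_intros) auto
    then show "AE y in lborel. (\<lambda>n. k (u n - y) * f y) \<longlonglongrightarrow> k (x - y) * f y"
      by (intro AE_I2 tendsto_intros)
  qed measurable
qed

lemma moll_deriv_bound:
  assumes "r > 0"
  obtains B where "B > 0" "\<And>(z::'a::euclidean_space) v. \<bar>moll_deriv r z v\<bar> \<le> B * norm v"
proof (rule that)
  define c where "c = (LINT z|lborel. bump r (z::'a))"
  have "c > 0" using bump_integral_pos[OF assms] by (simp add: c_def)
  then show "4 / r / c > 0" using assms by simp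
  have "\<bar>bump_deriv r z v\<bar> / c \<le> 4 / r * norm v / c" for z v :: 'a
    using \<open>c > 0\<close> bump_deriv_bound[OF assms] by (intro divide_right_mono) auto
  then show "\<bar>moll_deriv r z v\<bar> \<le> 4 / r / c * norm v" for z v :: 'a
    using \<open>c > 0\<close> by (simp add: moll_deriv_def c_def[symmetric])
qed

text \<open>The second-order remainder of the kernel is bounded uniformly in its argument;
  integrated against |f| it becomes a quadratic remainder for the convolution.\<close>

lemma mollify_has_derivative:
  fixes f :: "'a::euclidean_space \<Rightarrow> real"
  assumes r: "r > 0" and f: "integrable lborel f"
  shows "(mollify f r has_derivative (\<lambda>v. LINT y|lborel. moll_deriv r (x - y) v * f y)) (at x)"
proof -
  define c where "c = (LINT z|lborel. bump r (z::'a))"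
  have c: "c > 0" using bump_integral_pos[OF assms(1)] by (simp add: c_def)
  obtain B where B: "B > 0" "\<And>(z::'a) v. \<bar>moll_deriv r z v\<bar> \<le> B * norm v"
    using moll_deriv_bound[OF r] by blast
  obtain B0 where B0: "\<And>z::'a. \<bar>moll r z\<bar> \<le> B0"
    using moll_bound[OF r] by blast
  define C where "C = (((2 * r + 3) / r\<^sup>2)\<^sup>2 + 2 / r\<^sup>2) / c"
  have rem: "\<bar>moll r (z + h) - moll r z - moll_deriv r z h\<bar> \<le> C * (norm h)\<^sup>2"
    if "norm h \<le> 1" for z h :: 'a
  proof -
    have "moll r (z + h) - moll r z - moll_deriv r z h =
        (bump r (z + h) - bump r z - bump_deriv r z h) / c"
      by (simp add: moll_def moll_deriv_def c_def diff_divide_distrib)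
    also have "\<bar>\<dots>\<bar> = \<bar>bump r (z + h) - bump r z - bump_deriv r z h\<bar> / c"
      using c by simp
    also have "\<dots> \<le> C * (norm h)\<^sup>2"
      using bump_remainder[OF r that, of z] c by (simp add: C_def divide_right_mono)
    finally show ?thesis .
  qed
  have int: "integrable lborel (\<lambda>y. moll r (x - y) * f y)" for x
    by (rule kernel_integrable[OF f continuous_on_moll B0])
  have intd: "integrable lborel (\<lambda>y. moll_deriv r (x - y) v * f y)" for x v
    by (rule kernel_integrable[OF f continuous_on_moll_deriv B(2)])
  have lin: "linear (moll_deriv r z)" for z :: 'a
    using linear_bump_deriv[of r z] unfolding moll_deriv_def[abs_def]
    by (auto simp: linear_iff add_divide_distrib)
  show ?thesis
  proof (rule has_derivative_quadratic_bound)
    show "bounded_linear (\<lambda>v. LINT y|lborel. moll_deriv r (x - y) v * f y)"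
    proof (rule bounded_linear_intro)
      show "(LINT y|lborel. moll_deriv r (x - y) (v + w) * f y) =
          (LINT y|lborel. moll_deriv r (x - y) v * f y) + (LINT y|lborel. moll_deriv r (x - y) w * f y)" for v w
        by (simp add: linear_add[OF lin] distrib_right intd)
      show "(LINT y|lborel. moll_deriv r (x - y) (a *\<^sub>R v) * f y) =
          a *\<^sub>R (LINT y|lborel. moll_deriv r (x - y) v * f y)" for a v
        by (simp add: linear_cmul[OF lin] mult.assoc)
      have "norm (LINT y|lborel. moll_deriv r (x - y) v * f y) \<le> (LINT y|lborel. (B * norm v) * \<bar>f y\<bar>)" for v
      proof (rule Bochner_Integration.integral_norm_bound_integral[OF intd])
        show "norm (moll_deriv r (x - y) v * f y) \<le> (B * norm v) * \<bar>f y\<bar>" for y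
          using B(2)[of "x - y" v] by (simp add: abs_mult mult_right_mono)
      qed (use f in simp)
      then show "norm (LINT y|lborel. moll_deriv r (x - y) v * f y) \<le> norm v * (B * (LINT y|lborel. \<bar>f y\<bar>))" for v
        by (simp add: ac_simps)
    qed
    fix h :: 'a assume h: "norm h \<le> 1"
    have "mollify f r (x + h) - mollify f r x - (LINT y|lborel. moll_deriv r (x - y) h * f y) =
        (LINT y|lborel. (moll r (x - y + h) - moll r (x - y) - moll_deriv r (x - y) h) * f y)"
      using int[of x] int[of "x + h"] intd[of x h]
      by (simp add: mollify_def left_diff_distrib algebra_simps)
    also have "\<bar>\<dots>\<bar> \<le> (LINT y|lborel. (C * (norm h)\<^sup>2) * \<bar>f y\<bar>)"
      unfolding real_norm_def[symmetric]
    proof (rule Bochner_Integration.integral_norm_bound_integral)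
      show "integrable lborel (\<lambda>y. (moll r (x - y + h) - moll r (x - y) - moll_deriv r (x - y) h) * f y)"
        using int[of x] int[of "x + h"] intd[of x h] by (simp add: left_diff_distrib algebra_simps)
      show "norm ((moll r (x - y + h) - moll r (x - y) - moll_deriv r (x - y) h) * f y)
          \<le> (C * (norm h)\<^sup>2) * norm (f y)" for y
        using rem[OF h, of "x - y"] by (simp add: abs_mult mult_right_mono)
    qed (use f in simp)
    finally show "\<bar>mollify f r (x + h) - mollify f r x - (LINT y|lborel. moll_deriv r (x - y) h * f y)\<bar>
        \<le> (C * (LINT y|lborel. \<bar>f y\<bar>)) * (norm h)\<^sup>2"
      by (simp add: ac_simps)
  qed
qed

lemma Ck_on_1_mollify:
  fixes f :: "'a::euclidean_space \<Rightarrow> real"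
  assumes r: "r > 0" and f: "integrable lborel f"
  shows "Ck_on 1 (mollify f r) S"
proof (rule Ck_on_1_I[OF mollify_has_derivative[OF assms]])
  fix v :: 'a
  obtain B where B: "B > 0" "\<And>(z::'a) v. \<bar>moll_deriv r z v\<bar> \<le> B * norm v"
    using moll_deriv_bound[OF r] by blast
  have "continuous_on UNIV (\<lambda>x. LINT y|lborel. moll_deriv r (x - y) v * f y)"
    by (rule kernel_continuous[OF f continuous_on_moll_deriv B(2)])
  then show "continuous_on S (\<lambda>x. LINT y|lborel. moll_deriv r (x - y) v * f y)"
    by (rule continuous_on_subset) simp
qed

lemma mollify_nonneg:
  assumes "r > 0" "AE y in lborel. f y \<ge> 0"
  shows "mollify f r x \<ge> 0"
  unfolding mollify_def
  by (intro integral_nonneg_AE, use assms(2) in eventually_elim) (simp add: moll_nonneg[OF assms(1)])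

lemma mollify_integrand_integrable:
  fixes f :: "'a::euclidean_space \<Rightarrow> real"
  assumes "r > 0" "integrable lborel f"
  shows "integrable lborel (\<lambda>y. moll r (x - y) * f y)"
  using moll_bound[OF assms(1)] kernel_integrable[OF assms(2) continuous_on_moll] by metis

lemma mollify_diff:
  fixes f g :: "'a::euclidean_space \<Rightarrow> real"
  assumes "r > 0" "integrable lborel f" "integrable lborel g"
  shows "mollify (\<lambda>y. f y - g y) r x = mollify f r x - mollify g r x"
  using assms unfolding mollify_def by (simp add: right_diff_distrib mollify_integrand_integrable)

section \<open>Convergence of mollifications in the mean\<close>

text \<open>For each fixed \<open>y\<close> the kernel has mass one in the variable
  \<open>x\<close>, so exchanging the order of integration by Tonelli's theorem returns the integral
  of |f|.\<close>

lemma mollify_L1_contraction: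
  fixes f :: "'a::euclidean_space \<Rightarrow> real"
  assumes r: "r > 0" and f: "integrable lborel f"
  shows "integrable lborel (mollify f r)"
    and "(LINT x|lborel. \<bar>mollify f r x\<bar>) \<le> (LINT x|lborel. \<bar>f x\<bar>)"
proof -
  have [measurable]: "f \<in> borel_measurable borel"
    using f by simp
  have [measurable]: "mollify f r \<in> borel_measurable borel"
    by (rule borel_measurable_continuous_onI[OF Ck_on_1_continuous[OF Ck_on_1_mollify[OF assms]]])
  have one: "(\<integral>\<^sup>+x. ennreal (moll r (x - y)) \<partial>lborel) = 1" for y :: 'a
    by (subst nn_integral_eq_integral[OF moll_shift(1)[OF r]])
      (simp_all add: moll_nonneg[OF r] moll_shift(2)[OF r])
  have "(\<integral>\<^sup>+x. ennreal \<bar>mollify f r x\<bar> \<partial>lborel)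
      \<le> (\<integral>\<^sup>+x. (\<integral>\<^sup>+y. ennreal (moll r (x - y) * \<bar>f y\<bar>) \<partial>lborel) \<partial>lborel)"
  proof (rule nn_integral_mono)
    fix x :: 'a
    have "ennreal (norm (LINT y|lborel. moll r (x - y) * f y))
        \<le> (\<integral>\<^sup>+y. ennreal (norm (moll r (x - y) * f y)) \<partial>lborel)"
      by (rule integral_norm_bound_ennreal[OF mollify_integrand_integrable[OF assms]])
    also have "\<dots> = (\<integral>\<^sup>+y. ennreal (moll r (x - y) * \<bar>f y\<bar>) \<partial>lborel)"
      by (simp add: abs_mult moll_nonneg[OF r])
    finally show "ennreal \<bar>mollify f r x\<bar> \<le> (\<integral>\<^sup>+y. ennreal (moll r (x - y) * \<bar>f y\<bar>) \<partial>lborel)"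
      by (simp add: mollify_def)
  qed
  also have "\<dots> = (\<integral>\<^sup>+y. (\<integral>\<^sup>+x. ennreal (moll r (x - y) * \<bar>f y\<bar>) \<partial>lborel) \<partial>lborel)"
    by (rule lborel_pair.Fubini'[symmetric]) measurable
  also have "\<dots> = (\<integral>\<^sup>+y. ennreal \<bar>f y\<bar> \<partial>lborel)"
    by (simp add: ennreal_mult'' nn_integral_multc one)
  finally have *: "(\<integral>\<^sup>+x. ennreal \<bar>mollify f r x\<bar> \<partial>lborel) \<le> (\<integral>\<^sup>+y. ennreal \<bar>f y\<bar> \<partial>lborel)" .
  also have **: "(\<integral>\<^sup>+y. ennreal \<bar>f y\<bar> \<partial>lborel) = ennreal (LINT y|lborel. \<bar>f y\<bar>)"
    using f by (intro nn_integral_eq_integral) auto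
  finally have fin: "(\<integral>\<^sup>+x. ennreal \<bar>mollify f r x\<bar> \<partial>lborel) \<le> ennreal (LINT y|lborel. \<bar>f y\<bar>)" .
  show int: "integrable lborel (mollify f r)"
    by (rule integrableI_bounded) (use fin in \<open>auto simp: le_less_trans[OF fin]\<close>)
  have "(\<integral>\<^sup>+x. ennreal \<bar>mollify f r x\<bar> \<partial>lborel) = ennreal (LINT y|lborel. \<bar>mollify f r y\<bar>)"
    using int by (intro nn_integral_eq_integral) auto
  then show "(LINT x|lborel. \<bar>mollify f r x\<bar>) \<le> (LINT x|lborel. \<bar>f x\<bar>)"
    using fin by (simp add: ennreal_le_iff)
qed

section \<open>Density of compactly supported continuous functions in L^1\<close>

lemma integrable_cont_compact:
  fixes g :: "'a::euclidean_space \<Rightarrow> real"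
  assumes "continuous_on UNIV g" "\<And>x. norm x > R \<Longrightarrow> g x = 0"
  shows "integrable lborel g"
proof -
  have "integrable lborel (\<lambda>x. indicator (cball 0 R) x *\<^sub>R g x)"
    by (rule borel_integrable_compact) (use assms in \<open>auto intro: continuous_on_subset\<close>)
  moreover have "(\<lambda>x. indicator (cball 0 R) x *\<^sub>R g x) = g"
    using assms(2) by (auto simp: indicator_def fun_eq_iff)
  ultimately show ?thesis by simp
qed

text \<open>Induction over integrable functions reduces the density to the indicator of a set of
  finite measure. That set is exhausted from inside by a compact set, whose indicator is the limit
  of tent functions of the distance.\<close>

lemma integrable_approx_continuous:
  fixes f :: "'a::euclidean_space \<Rightarrow> real"
  assumes "integrable lborel f" "e > 0"
  shows "\<exists>g R. continuous_on UNIV g \<and> (\<forall>x. norm x > R \<longrightarrow> g x = 0) \<and> (LINT x|lborel. \<bar>f x - g x\<bar>) < e"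
  using assms
proof (induction f arbitrary: e rule: integrable_induct)
  case (base A c)
  \<comment> \<open>Inner regularity is applied to a finite measure: Lebesgue measure restricted to
    \<open>A\<close>, whose total mass is the measure of \<open>A\<close>.\<close>
  define M where "M = density lborel (indicator A :: 'a \<Rightarrow> ennreal)"
  have A[measurable]: "A \<in> sets borel" using base by simp
  have eM: "emeasure M B = emeasure lborel (A \<inter> B)" if "B \<in> sets borel" for B
    using that unfolding M_def
    by (subst emeasure_density) (auto simp: indicator_inter_arith[symmetric] nn_integral_indicator)
  have "emeasure M (space M) \<noteq> \<infinity>"
    using base eM[of UNIV] by (simp add: M_def)
  then have "emeasure M A = (SUP K \<in> {K. K \<subseteq> A \<and> compact K}. emeasure M K)"
    by (intro inner_regular) (auto simp: M_def)
  then have sup: "emeasure lborel A = (SUP K \<in> {K. K \<subseteq> A \<and> compact K}. emeasure lborel K)"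
  proof -
    have "(SUP K \<in> {K. K \<subseteq> A \<and> compact K}. emeasure M K) =
        (SUP K \<in> {K. K \<subseteq> A \<and> compact K}. emeasure lborel K)"
      by (rule SUP_cong) (auto simp: eM compact_imp_closed Int_absorb1)
    then show ?thesis
      using \<open>emeasure M A = _\<close> eM[OF A] by simp
  qed
  \<comment> \<open>Half of \<open>e\<close> is reserved for \<open>A - K\<close>, weighted by |c|;
    the added 1 keeps \<open>d\<close> positive for \<open>c = 0\<close>.\<close>
  define d where "d = e / (2 * (\<bar>c\<bar> + 1))"
  have "d > 0" using base by (simp add: d_def)
  have fA: "emeasure lborel A = ennreal (measure lborel A)"
    using base by (simp add: emeasure_eq_ennreal_measure)
  obtain K where K: "K \<subseteq> A" "compact K" "measure lborel A - d < measure lborel K"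
  proof (cases "measure lborel A < d")
    \<comment> \<open>Here \<open>measure lborel A - d\<close> is negative and
      \<open>ennreal\<close> would truncate it to 0, so the empty set is taken directly.\<close>
    case True
    then show ?thesis using that[of "{}"] by simp
  next
    case False
    have "ennreal (measure lborel A - d) < emeasure lborel A"
      unfolding fA using False \<open>d > 0\<close> by (intro ennreal_lessI) auto
    then obtain K where "K \<subseteq> A" "compact K" "ennreal (measure lborel A - d) < emeasure lborel K"
      unfolding sup less_SUP_iff by auto
    moreover have "emeasure lborel K = ennreal (measure lborel K)"
      using emeasure_compact_finite[OF \<open>compact K\<close>] by (simp add: emeasure_eq_ennreal_measure)
    ultimately show ?thesis
      using that[of K] False by (simp add: ennreal_less_iff)
  qed
  have [measurable]: "K \<in> sets borel" using K by (simp add: compact_imp_closed)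
  have Kfin: "emeasure lborel K < \<infinity>" by (rule emeasure_compact_finite[OF K(2)])
  have fdiff: "measure lborel (A - K) < d"
    using K Kfin base by (subst measure_Diff) auto
  obtain R where R: "K \<subseteq> cball 0 R" "R \<ge> 0"
    using bounded_subset_ballD[OF compact_imp_bounded[OF K(2)], of 0] ball_subset_cball[of 0]
    by (metis less_imp_le order_trans)
  show ?case
  \<comment> \<open>\<open>infdist\<close> to the empty set is 0 by convention, so the tent
    functions below would be the constant \<open>c\<close>; for an empty \<open>K\<close> the zero
    function is used instead.\<close>
  proof (cases "K = {}")
    case True
    have "(LINT x|lborel. \<bar>indicator A x *\<^sub>R c - 0\<bar>) = measure lborel A * \<bar>c\<bar>"
      using base by (simp add: abs_mult)
    also have "\<dots> \<le> d * \<bar>c\<bar>"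
      using fdiff True by (intro mult_right_mono) auto
    also have "\<dots> \<le> d * (\<bar>c\<bar> + 1)" using \<open>d > 0\<close> by simp
    also have "\<dots> = e / 2" by (simp add: d_def divide_simps)
    also have "\<dots> < e" using base(3) by simp
    finally show ?thesis
      by (intro exI[of _ "\<lambda>_. 0"] exI[of _ 0]) auto
  next
    case False
    \<comment> \<open>The slope is \<open>Suc n\<close> rather than \<open>n\<close>: all these
      functions then vanish at distance at least 1 from \<open>K\<close>, hence outside one fixed
      ball.\<close>
    define g where "g n x = c * max 0 (1 - real (Suc n) * infdist x K)" for n x
    have cont: "continuous_on UNIV (g n)" for n
      unfolding g_def by (intro continuous_intros)
    have supp: "g n x = 0" if "norm x > R + 1" for n x
    proof -
      have "1 \<le> infdist x K"
        unfolding infdist_notempty[OF False]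
      proof (rule cINF_greatest[OF False])
        fix y assume "y \<in> K"
        then have "norm y \<le> R" using R by auto
        then show "1 \<le> dist x y"
          using that norm_triangle_ineq2[of x y] by (simp add: dist_norm)
      qed
      then have "1 * 1 \<le> real (Suc n) * infdist x K"
        by (intro mult_mono) auto
      then show ?thesis by (simp add: g_def)
    qed
    have gint: "integrable lborel (g n)" for n
      by (rule integrable_cont_compact[OF cont supp])
    have lim: "(\<lambda>n. g n x) \<longlonglongrightarrow> indicator K x * c" for x
    proof (cases "x \<in> K")
      case True
      then show ?thesis by (simp add: g_def)
    next
      case False
      then have "infdist x K > 0"
        using in_closed_iff_infdist_zero[of K x] infdist_nonneg[of x K] \<open>K \<noteq> {}\<close> compact_imp_closed[OF K(2)]
        by (auto simp: less_le)
      then obtain N where N: "1 < real N * infdist x K"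
        using reals_Archimedean3 by blast
      have "g n x = 0" if "n \<ge> N" for n
      proof -
        have "real N * infdist x K \<le> real (Suc n) * infdist x K"
          using that by (intro mult_right_mono infdist_nonneg) auto
        then show ?thesis using N by (simp add: g_def)
      qed
      then have "(\<lambda>n. g n x) \<longlonglongrightarrow> 0"
        by (intro tendsto_eventually eventually_sequentiallyI[of N])
      then show ?thesis using False by simp
    qed
    have "(\<lambda>n. LINT x|lborel. \<bar>indicator K x * c - g n x\<bar>) \<longlonglongrightarrow> (LINT x|(lborel::'a measure). 0)"
    proof (rule integral_dominated_convergence[where w = "\<lambda>x. indicator (cball 0 (R + 1)) x * (2 * \<bar>c\<bar>)"])
      show "integrable lborel (\<lambda>x::'a. indicator (cball 0 (R + 1)) x * (2 * \<bar>c\<bar>))"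
        using emeasure_lborel_cball_finite[of "0::'a" "R+1"]
        by (intro integrable_mult_left integrable_real_indicator) auto
      have "\<bar>indicator K x * c - g n x\<bar> \<le> indicator (cball 0 (R + 1)) x * (2 * \<bar>c\<bar>)" for n x
      proof (cases "norm x > R + 1")
        case True
        then show ?thesis using supp[OF True] R by (auto simp: indicator_def)
      next
        case False
        have "real (Suc n) * infdist x K \<ge> 0" by (simp add: infdist_nonneg)
        then have "\<bar>g n x\<bar> \<le> \<bar>c\<bar> * 1"
          unfolding g_def abs_mult by (intro mult_left_mono) auto
        then have "\<bar>indicator K x * c - g n x\<bar> \<le> 2 * \<bar>c\<bar>"
          by (auto simp: indicator_def)
        then show ?thesis using False by (simp add: indicator_def)
      qed
      then show "AE x in lborel. norm \<bar>indicator K x * c - g n x\<bar> \<le> indicator (cball 0 (R + 1)) x * (2 * \<bar>c\<bar>)" for n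
        by simp
      show "AE x in lborel. (\<lambda>n. \<bar>indicator K x * c - g n x\<bar>) \<longlonglongrightarrow> 0"
      proof (rule AE_I2)
        fix x
        show "(\<lambda>n. \<bar>indicator K x * c - g n x\<bar>) \<longlonglongrightarrow> 0"
          using tendsto_rabs[OF tendsto_diff[OF tendsto_const lim[of x]], of "indicator K x * c"] by simp
      qed
      show "(\<lambda>x. \<bar>indicator K x * c - g n x\<bar>) \<in> borel_measurable lborel" for n
        using gint by measurable
    qed simp
    then have "\<forall>\<^sub>F n in sequentially. (LINT x|lborel. \<bar>indicator K x * c - g n x\<bar>) < e / 2"
      using base by (intro order_tendstoD(2)) auto
    then obtain n where n: "(LINT x|lborel. \<bar>indicator K x * c - g n x\<bar>) < e / 2"
      by (auto simp: eventually_sequentially)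
    have intA: "integrable lborel (\<lambda>x. indicator (A - K) x * \<bar>c\<bar>)"
      using base by (intro integrable_mult_left integrable_real_indicator)
        (auto intro: le_less_trans[OF emeasure_mono[of "A - K" A]])
    have intK: "integrable lborel (\<lambda>x. indicator K x * c)"
      using Kfin by (intro integrable_mult_left integrable_real_indicator) auto
    have intA': "integrable lborel (\<lambda>x. indicator A x * c)"
      using base by (intro integrable_mult_left integrable_real_indicator) auto
    have "(LINT x|lborel. \<bar>indicator A x *\<^sub>R c - g n x\<bar>)
        \<le> (LINT x|lborel. indicator (A - K) x * \<bar>c\<bar> + \<bar>indicator K x * c - g n x\<bar>)"
      using gint intA intK intA' K(1) by (intro integral_mono) (auto simp: indicator_def)
    also have "\<dots> = measure lborel (A - K) * \<bar>c\<bar> + (LINT x|lborel. \<bar>indicator K x * c - g n x\<bar>)"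
      using gint intA intK by (subst Bochner_Integration.integral_add) auto
    also have "measure lborel (A - K) * \<bar>c\<bar> \<le> d * (\<bar>c\<bar> + 1)"
      using fdiff \<open>d > 0\<close> by (intro mult_mono) auto
    also have "d * (\<bar>c\<bar> + 1) = e / 2"
      by (simp add: d_def divide_simps)
    finally have "(LINT x|lborel. \<bar>indicator A x *\<^sub>R c - g n x\<bar>) < e"
      using n by simp
    then show ?thesis
      using cont supp by blast
  qed
next
  case (add f1 f2)
  obtain g1 R1 where g1: "continuous_on UNIV g1" "\<forall>x. norm x > R1 \<longrightarrow> g1 x = 0"
    "(LINT x|lborel. \<bar>f1 x - g1 x\<bar>) < e / 2"
    using add.IH(1)[of "e/2"] add.prems by auto
  obtain g2 R2 where g2: "continuous_on UNIV g2" "\<forall>x. norm x > R2 \<longrightarrow> g2 x = 0"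
    "(LINT x|lborel. \<bar>f2 x - g2 x\<bar>) < e / 2"
    using add.IH(2)[of "e/2"] add.prems by auto
  have "integrable lborel g1" "integrable lborel g2"
    using integrable_cont_compact g1 g2 by blast+
  note ints = this add.hyps
  have "(LINT x|lborel. \<bar>(f1 x + f2 x) - (g1 x + g2 x)\<bar>)
      \<le> (LINT x|lborel. \<bar>f1 x - g1 x\<bar> + \<bar>f2 x - g2 x\<bar>)"
    using ints by (intro integral_mono) auto
  also have "\<dots> = (LINT x|lborel. \<bar>f1 x - g1 x\<bar>) + (LINT x|lborel. \<bar>f2 x - g2 x\<bar>)"
    using ints by (intro Bochner_Integration.integral_add) auto
  also have "\<dots> < e" using g1 g2 by simp
  finally show ?case
    using g1 g2 by (intro exI[of _ "\<lambda>x. g1 x + g2 x"] exI[of _ "max R1 R2"]) (auto intro: continuous_intros)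
next
  case (lim f s)
  have "(\<lambda>n. LINT x|lborel. \<bar>f x - s n x\<bar>) \<longlonglongrightarrow> (LINT x|(lborel::'a measure). 0)"
  proof (rule integral_dominated_convergence[where w = "\<lambda>x. 3 * \<bar>f x\<bar>"])
    have "\<bar>f x - s n x\<bar> \<le> 3 * \<bar>f x\<bar>" for n x
      using lim.hyps(3)[of x n] by simp
    then show "AE x in lborel. norm \<bar>f x - s n x\<bar> \<le> 3 * \<bar>f x\<bar>" for n
      by simp
    show "AE x in lborel. (\<lambda>n. \<bar>f x - s n x\<bar>) \<longlonglongrightarrow> 0"
    proof (rule AE_I2)
      fix x
      show "(\<lambda>n. \<bar>f x - s n x\<bar>) \<longlonglongrightarrow> 0"
        using tendsto_rabs[OF tendsto_diff[OF tendsto_const lim.hyps(2)[of x]], of "f x"] by simp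
    qed
    show "(\<lambda>x. \<bar>f x - s n x\<bar>) \<in> borel_measurable lborel" for n
      using lim.hyps(1)[of n] lim.hyps(4) by measurable
  qed (use lim.hyps in simp_all)
  then have "\<forall>\<^sub>F n in sequentially. (LINT x|lborel. \<bar>f x - s n x\<bar>) < e / 2"
    using lim.prems by (intro order_tendstoD(2)) auto
  then obtain n where n: "(LINT x|lborel. \<bar>f x - s n x\<bar>) < e / 2"
    by (auto simp: eventually_sequentially)
  obtain g R where g: "continuous_on UNIV g" "\<forall>x. norm x > R \<longrightarrow> g x = 0"
    "(LINT x|lborel. \<bar>s n x - g x\<bar>) < e / 2"
    using lim.IH[of "e/2" n] lim.prems by auto
  have "integrable lborel g"
    using integrable_cont_compact g by blast
  note ints = this lim.hyps(1)[of n] lim.hyps(4)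
  have "(LINT x|lborel. \<bar>f x - g x\<bar>) \<le> (LINT x|lborel. \<bar>f x - s n x\<bar> + \<bar>s n x - g x\<bar>)"
    using ints by (intro integral_mono) auto
  also have "\<dots> = (LINT x|lborel. \<bar>f x - s n x\<bar>) + (LINT x|lborel. \<bar>s n x - g x\<bar>)"
    using ints by (intro Bochner_Integration.integral_add) auto
  also have "\<dots> < e" using n g by simp
  finally show ?case
    using g by blast
qed

text \<open>For radii below 1 both functions vanish outside the ball of radius R + 1. Inside it
  their difference is an average of values g y - g x over nearby points, small by uniform continuity
  on the ball of radius R + 2, which contains all points involved. Dividing \<open>e\<close> by the
  volume plus 1 makes the final bound strict.\<close>

lemma mollify_L1_continuous:
  fixes g :: "'a::euclidean_space \<Rightarrow> real"
  assumes cont: "continuous_on UNIV g" and supp: "\<And>x. norm x > R \<Longrightarrow> g x = 0" and "e > 0"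
  shows "\<exists>d>0. \<forall>r. 0 < r \<and> r < d \<longrightarrow> (LINT x|lborel. \<bar>mollify g r x - g x\<bar>) < e"
proof -
  define m where "m = measure lborel (cball (0::'a) (R + 1))"
  have "m \<ge> 0" by (simp add: m_def)
  define e' where "e' = e / (m + 1)"
  have e': "e' > 0" using \<open>e > 0\<close> \<open>m \<ge> 0\<close> by (simp add: e'_def)
  have "uniformly_continuous_on (cball 0 (R + 2)) g"
    using compact_uniformly_continuous[OF continuous_on_subset[OF cont]] by auto
  then obtain d where d: "d > 0"
    "\<And>x y. x \<in> cball 0 (R + 2) \<Longrightarrow> y \<in> cball 0 (R + 2) \<Longrightarrow> dist y x < d \<Longrightarrow> dist (g y) (g x) < e'"
    using e' unfolding uniformly_continuous_on_def by metis
  have unif: "\<bar>g y - g x\<bar> \<le> e'" if "norm (x - y) < min d 1" for x y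
  proof (cases "norm x > R + 1")
    case True
    then have "norm y > R" using that norm_triangle_ineq2[of x y] by simp
    then show ?thesis using supp True e' by simp
  next
    case False
    then have "norm y \<le> R + 2"
      using that norm_triangle_ineq2[of y x] by (simp add: norm_minus_commute)
    then show ?thesis
      using d(2)[of x y] False that by (simp add: dist_norm norm_minus_commute)
  qed
  have gint: "integrable lborel g"
    by (rule integrable_cont_compact[OF cont supp])
  have "(LINT x|lborel. \<bar>mollify g r x - g x\<bar>) < e" if r: "0 < r" "r < min d 1" for r
  proof -
    have pt: "\<bar>mollify g r x - g x\<bar> \<le> e' * indicator (cball 0 (R + 1)) x" for x
    proof (cases "norm x > R + 1")
      case True
      have "moll r (x - y) * g y = 0" for y
      proof (cases "norm y > R")
        case False
        then have "r \<le> norm (x - y)"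
          using True r norm_triangle_ineq2[of x y] by simp
        then show ?thesis by (simp add: moll_eq_0[OF r(1)])
      qed (simp add: supp)
      then have "mollify g r x = (LINT y|(lborel::'a measure). 0)"
        unfolding mollify_def by (intro Bochner_Integration.integral_cong[OF refl])
      then have "mollify g r x = 0" by simp
      then show ?thesis using True supp[of x] by simp
    next
      case False
      have i1: "integrable lborel (\<lambda>y. moll r (x - y) * g y)"
        by (rule mollify_integrand_integrable[OF r(1) gint])
      have i2: "integrable lborel (\<lambda>y. moll r (x - y) * g x)"
        using moll_shift(3)[OF r(1)] by (intro integrable_mult_left)
      have "mollify g r x - g x = (LINT y|lborel. moll r (x - y) * (g y - g x))"
        using i1 i2 moll_shift(4)[OF r(1), of x] by (simp add: mollify_def right_diff_distrib)
      also have "\<bar>\<dots>\<bar> \<le> (LINT y|lborel. moll r (x - y) * e')"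
        unfolding real_norm_def[symmetric]
      proof (rule Bochner_Integration.integral_norm_bound_integral)
        show "integrable lborel (\<lambda>y. moll r (x - y) * (g y - g x))"
          using i1 i2 by (simp add: right_diff_distrib)
        show "integrable lborel (\<lambda>y. moll r (x - y) * e')"
          using moll_shift(3)[OF r(1)] by (intro integrable_mult_left)
        show "norm (moll r (x - y) * (g y - g x)) \<le> moll r (x - y) * e'" for y
        proof (cases "r \<le> norm (x - y)")
          case False
          then have "\<bar>g y - g x\<bar> \<le> e'" using r by (intro unif) auto
          then show ?thesis
            using moll_nonneg[OF r(1), of "x - y"] by (simp add: abs_mult mult_left_mono)
        qed (simp add: moll_eq_0[OF r(1)])
      qed
      also have "\<dots> = e'" using moll_shift(4)[OF r(1), of x] by simp
      finally show ?thesis using False by simp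
    qed
    have "(LINT x|lborel. \<bar>mollify g r x - g x\<bar>) \<le> (LINT x|lborel. e' * indicator (cball (0::'a) (R + 1)) x)"
      using pt gint mollify_L1_contraction(1)[OF r(1) gint] emeasure_lborel_cball_finite[of "0::'a" "R+1"]
      by (intro integral_mono integrable_mult_right integrable_real_indicator) auto
    also have "\<dots> = e' * m" by (simp add: m_def)
    also have "\<dots> < e' * (m + 1)" using e' by simp
    also have "\<dots> = e" using \<open>m \<ge> 0\<close> by (simp add: e'_def)
    finally show ?thesis .
  qed
  then show ?thesis using d(1) by (intro exI[of _ "min d 1"]) auto
qed

text \<open>Mollifying the error f - g does not increase its L^1 norm, so the estimate for a
  continuous approximation carries over at the cost of three thirds of \<open>e\<close>.\<close>

lemma mollify_L1:
  fixes f :: "'a::euclidean_space \<Rightarrow> real"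
  assumes f: "integrable lborel f" and "e > 0"
  shows "\<exists>d>0. \<forall>r. 0 < r \<and> r < d \<longrightarrow> (LINT x|lborel. \<bar>mollify f r x - f x\<bar>) < e"
proof -
  obtain g R where g: "continuous_on UNIV g" "\<And>x. norm x > R \<Longrightarrow> g x = 0"
    "(LINT x|lborel. \<bar>f x - g x\<bar>) < e / 3"
    using integrable_approx_continuous[OF f, of "e/3"] \<open>e > 0\<close> by auto
  obtain d where d: "d > 0" "\<And>r. 0 < r \<Longrightarrow> r < d \<Longrightarrow> (LINT x|lborel. \<bar>mollify g r x - g x\<bar>) < e / 3"
    using mollify_L1_continuous[of g R "e/3"] g(1,2) \<open>e > 0\<close> by auto
  have gi: "integrable lborel g"
    by (rule integrable_cont_compact[OF g(1,2)])
  have "(LINT x|lborel. \<bar>mollify f r x - f x\<bar>) < e" if r: "0 < r" "r < d" for r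
  proof -
    have fg: "integrable lborel (\<lambda>x. f x - g x)" using f gi by simp
    note ints = f gi mollify_L1_contraction(1)[OF r(1) f] mollify_L1_contraction(1)[OF r(1) gi]
      mollify_L1_contraction(1)[OF r(1) fg]
    have "(LINT x|lborel. \<bar>mollify f r x - f x\<bar>) \<le>
      (LINT x|lborel. (\<bar>mollify (\<lambda>x. f x - g x) r x\<bar> + \<bar>mollify g r x - g x\<bar>) + \<bar>f x - g x\<bar>)"
      using ints by (intro integral_mono) (auto simp: mollify_diff[OF r(1) f gi])
    also have "\<dots> = (LINT x|lborel. \<bar>mollify (\<lambda>x. f x - g x) r x\<bar>) +
        (LINT x|lborel. \<bar>mollify g r x - g x\<bar>) + (LINT x|lborel. \<bar>f x - g x\<bar>)"
      using ints by simp
    also have "\<dots> < e"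
      using mollify_L1_contraction(2)[OF r(1) fg] d(2)[OF r] g(3) by simp
    finally show ?thesis .
  qed
  then show ?thesis using d(1) by blast
qed

lemma mollify_L1_tendsto:
  fixes f :: "'a::euclidean_space \<Rightarrow> real"
  assumes "integrable lborel f" "r \<longlonglongrightarrow> 0" "\<And>k. r k > 0"
  shows "(\<lambda>k. LINT x|lborel. \<bar>mollify f (r k) x - f x\<bar>) \<longlonglongrightarrow> 0"
proof (rule tendstoI)
  fix e :: real assume "e > 0"
  then obtain d where d: "d > 0" "\<And>r. 0 < r \<Longrightarrow> r < d \<Longrightarrow> (LINT x|lborel. \<bar>mollify f r x - f x\<bar>) < e"
    using mollify_L1[OF assms(1)] by blast
  have "\<forall>\<^sub>F k in sequentially. r k < d"
    using order_tendstoD(2)[OF assms(2) d(1)] .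
  then show "\<forall>\<^sub>F k in sequentially. dist (LINT x|lborel. \<bar>mollify f (r k) x - f x\<bar>) 0 < e"
    by eventually_elim (use d(2) assms(3) in \<open>simp add: Bochner_Integration.integral_nonneg\<close>)
qed

section \<open>Jensen's inequality for mollifications\<close>

lemma powr_above_tangent:
  fixes c m p :: real
  assumes "p \<ge> 1" "c \<ge> 0" "m > 0"
  shows "m powr p + p * m powr (p - 1) * (c - m) \<le> c powr p"
\<comment> \<open>The tangent inequality for convex functions is taken on the open half line; the
  endpoint is checked by hand.\<close>
proof (cases "c = 0")
  case True
  have "m powr p = m powr (p - 1) * m"
    using assms powr_add[of m "p - 1" 1] by simp
  moreover have "m powr (p - 1) * m \<le> p * (m powr (p - 1) * m)"
    using assms mult_right_mono[of 1 p "m powr (p - 1) * m"] by simp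
  moreover have "m powr p + p * m powr (p - 1) * (c - m) = m powr p - p * (m powr (p - 1) * m)"
    using True by simp
  moreover have "c powr p = 0" using True by simp
  ultimately show ?thesis by linarith
next
  case False
  have "c powr p - m powr p \<ge> (p * m powr (p - 1)) * (c - m)"
  proof (rule convex_on_imp_above_tangent[OF powr_convex[OF assms(1)]])
    show "((\<lambda>x. x powr p) has_real_derivative p * m powr (p - 1)) (at m within {0<..})"
      by (rule has_field_derivative_at_within[OF has_real_derivative_powr[OF assms(3)]])
    show "connected {0::real<..}" by simp
    show "m \<in> interior {0<..}" using assms(3) by (simp add: interior_open)
    show "c \<in> {0<..}" using False assms(2) by simp
  qed
  then show ?thesis by simp
qed

text \<open>Jensen's inequality for the probability density \<open>moll r (x - y)\<close>: the
  tangent line to t^p at the mean \<open>m\<close> of |f| lies below the graph, and integrating it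
  against the density returns m^p. If the mean is 0 there is no tangent to use, but then the left
  side is 0.\<close>

lemma mollify_powr_le:
  fixes f :: "'a::euclidean_space \<Rightarrow> real"
  assumes r: "r > 0" and p: "p \<ge> 1" and f: "integrable lborel f" and fp: "integrable lborel (\<lambda>y. \<bar>f y\<bar> powr p)"
  shows "\<bar>mollify f r x\<bar> powr p \<le> mollify (\<lambda>y. \<bar>f y\<bar> powr p) r x"
proof -
  define m where "m = mollify (\<lambda>y. \<bar>f y\<bar>) r x"
  have fa: "integrable lborel (\<lambda>y. \<bar>f y\<bar>)" using f by simp
  have i1: "integrable lborel (\<lambda>y. moll r (x - y) * \<bar>f y\<bar>)"
    by (rule mollify_integrand_integrable[OF r fa])
  have i2: "integrable lborel (\<lambda>y. moll r (x - y) * \<bar>f y\<bar> powr p)"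
    by (rule mollify_integrand_integrable[OF r fp])
  have i3: "integrable lborel (\<lambda>y. moll r (x - y))"
    by (rule moll_shift(3)[OF r])
  have le: "\<bar>mollify f r x\<bar> \<le> m"
    unfolding m_def mollify_def real_norm_def[symmetric]
    by (rule Bochner_Integration.integral_norm_bound_integral)
      (use mollify_integrand_integrable[OF r f] i1 in \<open>auto simp: abs_mult moll_nonneg[OF r]\<close>)
  show ?thesis
  proof (cases "m > 0")
    case True
    define k where "k = p * m powr (p - 1)"
    have "m powr p = m powr p + k * (m - m)" by simp
    also have "\<dots> = (LINT y|lborel. moll r (x - y) * (m powr p - k * m) + k * (moll r (x - y) * \<bar>f y\<bar>))"
      using i1 i3 moll_shift(4)[OF r, of x] unfolding m_def mollify_def
      by (subst Bochner_Integration.integral_add) (auto simp: algebra_simps)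
    also have "\<dots> \<le> (LINT y|lborel. moll r (x - y) * \<bar>f y\<bar> powr p)"
    proof (rule integral_mono)
      fix y
      have "m powr p + k * (\<bar>f y\<bar> - m) \<le> \<bar>f y\<bar> powr p"
        using powr_above_tangent[OF p _ True, of "\<bar>f y\<bar>"] by (simp add: k_def)
      then have "moll r (x - y) * (m powr p + k * (\<bar>f y\<bar> - m)) \<le> moll r (x - y) * \<bar>f y\<bar> powr p"
        by (intro mult_left_mono moll_nonneg[OF r])
      then show "moll r (x - y) * (m powr p - k * m) + k * (moll r (x - y) * \<bar>f y\<bar>)
          \<le> moll r (x - y) * \<bar>f y\<bar> powr p"
        by (simp add: algebra_simps)
    qed (use i1 i2 i3 in auto)
    finally have "m powr p \<le> mollify (\<lambda>y. \<bar>f y\<bar> powr p) r x"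
      by (simp add: mollify_def)
    moreover have "\<bar>mollify f r x\<bar> powr p \<le> m powr p"
      using le p by (intro powr_mono2) auto
    ultimately show ?thesis by simp
  next
    case False
    then have "mollify f r x = 0" using le by simp
    moreover have "mollify (\<lambda>y. \<bar>f y\<bar> powr p) r x \<ge> 0"
      by (rule mollify_nonneg[OF r]) simp
    ultimately show ?thesis using p by simp
  qed
qed

section \<open>Approximation of weakly differentiable functions\<close>

text \<open>Differentiating the convolution puts the derivative on the kernel, and the kernel
  centred at \<open>x\<close> is itself a test function, supported in a ball inside
  \<open>K\<close>. The definition of the weak derivative moves the derivative to \<open>h\<close>;
  its minus sign cancels against the oddness of \<open>moll_deriv\<close>. On that ball the
  indicators are 1.\<close>

lemma mollify_weak_partial:
  fixes V :: "(real ^ 'n::finite) set"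
  assumes wp: "weak_partial V f i h" and r: "r > 0" and K: "compact K" "K \<subseteq> V" and x: "cball x r \<subseteq> K"
  shows "frechet_derivative (mollify (\<lambda>y. indicator K y * f y) r) (at x) (axis i 1) =
    mollify (\<lambda>y. indicator K y * h y) r x"
proof -
  have int: "integrable lborel (\<lambda>y. indicator K y * f y)"
    using wp K by (auto simp: weak_partial_def locally_integrable_def set_integrable_def)
  define \<psi> where "\<psi> y = moll r (y - x)" for y
  have \<psi>d: "(\<psi> has_derivative moll_deriv r (y - x)) (at y)" for y
  proof -
    have "((\<lambda>y. y - x) has_derivative (\<lambda>v. v)) (at y)"
      by (auto intro!: derivative_eq_intros)
    from has_derivative_compose[OF this moll_has_derivative[OF r]] show ?thesis
      by (simp add: \<psi>_def[abs_def])
  qed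
  have D\<psi>: "frechet_derivative \<psi> (at y) = moll_deriv r (y - x)" for y
    using frechet_derivative_at[OF \<psi>d] by simp
  have zero: "\<psi> y = 0" if "y \<notin> cball x r" for y
    using that r by (simp add: \<psi>_def moll_eq_0 dist_norm norm_minus_commute)
  have cl: "closure {y. \<psi> y \<noteq> 0} \<subseteq> cball x r"
    by (rule closure_minimal[OF _ closed_cball]) (use zero in blast)
  have "\<psi> \<in> C1_0_euclidean V"
  proof -
    have "Ck_on 1 \<psi> UNIV"
      by (rule Ck_on_1_I[OF \<psi>d])
        (auto intro!: continuous_on_compose2[OF continuous_on_moll_deriv[of UNIV]] continuous_intros)
    moreover have "compact (closure {y. \<psi> y \<noteq> 0})"
      using cl by (meson bounded_cball bounded_subset closed_closure compact_eq_bounded_closed)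
    ultimately show ?thesis
      using cl x K by (simp add: C1_0_euclidean_def del: Ck_on.simps One_nat_def)
  qed
  then have ibp: "(LINT y:V|lborel. f y * moll_deriv r (y - x) (axis i 1)) = - (LINT y:V|lborel. h y * \<psi> y)"
  proof -
    have "(LINT y:V|lborel. f y * frechet_derivative \<psi> (at y) (axis i 1)) = - (LINT y:V|lborel. h y * \<psi> y)"
      using wp \<open>\<psi> \<in> C1_0_euclidean V\<close> unfolding weak_partial_def by blast
    then show ?thesis unfolding D\<psi> .
  qed
  have "frechet_derivative (mollify (\<lambda>y. indicator K y * f y) r) (at x) (axis i 1) =
      (LINT y|lborel. moll_deriv r (x - y) (axis i 1) * (indicator K y * f y))"
    using fun_cong[OF frechet_derivative_at[OF mollify_has_derivative[OF r int]], of x "axis i 1"] by simp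
  also have "\<dots> = (LINT y|lborel. - (indicator V y *\<^sub>R (f y * moll_deriv r (y - x) (axis i 1))))"
  proof (rule Bochner_Integration.integral_cong[OF refl])
    fix y
    show "moll_deriv r (x - y) (axis i 1) * (indicator K y * f y) =
        - (indicator V y *\<^sub>R (f y * moll_deriv r (y - x) (axis i 1)))"
    proof (cases "y \<in> cball x r")
      case True
      then have "y \<in> K" "y \<in> V" using x K by auto
      then show ?thesis using moll_deriv_uminus[OF r, of x y] by simp
    next
      case False
      then have "moll_deriv r (x - y) (axis i 1) = 0" "moll_deriv r (y - x) (axis i 1) = 0"
        by (simp_all add: dist_norm norm_minus_commute moll_deriv_eq_0[OF r])
      then show ?thesis by simp
    qed
  qed
  also have "\<dots> = - (LINT y:V|lborel. f y * moll_deriv r (y - x) (axis i 1))"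
    by (simp add: set_lebesgue_integral_def)
  also have "\<dots> = (LINT y|lborel. indicator V y *\<^sub>R (h y * \<psi> y))"
    unfolding ibp by (simp add: set_lebesgue_integral_def)
  also have "\<dots> = mollify (\<lambda>y. indicator K y * h y) r x"
    unfolding mollify_def
  proof (rule Bochner_Integration.integral_cong[OF refl])
    fix y
    show "indicator V y *\<^sub>R (h y * \<psi> y) = moll r (x - y) * (indicator K y * h y)"
    proof (cases "y \<in> cball x r")
      case True
      then have "y \<in> K" "y \<in> V" using x K by auto
      then show ?thesis using moll_uminus[OF r, of x y] by (simp add: \<psi>_def)
    next
      case False
      then show ?thesis using zero[OF False] moll_uminus[OF r, of x y] by (simp add: \<psi>_def)
    qed
  qed
  finally show ?thesis .
qed

text \<open>Serves to discard cutoffs: on \<open>K\<close> a mollified truncation differs from the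
  untruncated function by the same amount, so convergence over the whole space restricts to
  \<open>K\<close>.\<close>

lemma set_L1_tendsto:
  fixes A :: "nat \<Rightarrow> 'a \<Rightarrow> real"
  assumes lim: "(\<lambda>k. LINT y|M. \<bar>A k y - a y\<bar>) \<longlonglongrightarrow> 0" and int: "\<And>k. integrable M (A k)" "integrable M a"
    and K: "K \<in> sets M" and eq: "\<And>y k. y \<in> K \<Longrightarrow> B k y - b y = A k y - a y"
  shows "(\<lambda>k. LINT y:K|M. \<bar>B k y - b y\<bar>) \<longlonglongrightarrow> 0"
proof (rule tendsto_sandwich[OF _ _ tendsto_const lim])
  have *: "(LINT y:K|M. \<bar>B k y - b y\<bar>) = (LINT y|M. indicator K y *\<^sub>R \<bar>A k y - a y\<bar>)" for k
    unfolding set_lebesgue_integral_def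
    by (rule Bochner_Integration.integral_cong) (auto simp: indicator_def eq)
  show "\<forall>\<^sub>F k in sequentially. 0 \<le> (LINT y:K|M. \<bar>B k y - b y\<bar>)"
    unfolding * by (intro always_eventually allI Bochner_Integration.integral_nonneg) simp
  show "\<forall>\<^sub>F k in sequentially. (LINT y:K|M. \<bar>B k y - b y\<bar>) \<le> (LINT y|M. \<bar>A k y - a y\<bar>)"
    unfolding *
  proof (intro always_eventually allI integral_mono)
    fix k
    show "integrable M (\<lambda>y. \<bar>A k y - a y\<bar>)" using int by simp
    then show "integrable M (\<lambda>y. indicator K y *\<^sub>R \<bar>A k y - a y\<bar>)"
      using K by (rule integrable_mult_indicator[rotated])
  qed (auto simp: indicator_def)
qed

text \<open>The enlargement is the Minkowski sum of \<open>K\<close> and a closed ball, compact as a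
  sum of compact sets. It leaves room for mollifying at the points of \<open>K\<close>.\<close>

lemma compact_enlargement:
  fixes K :: "'a::euclidean_space set"
  assumes "compact K" "open V" "K \<subseteq> V"
  obtains e K' where "e > 0" "compact K'" "K' \<subseteq> V" "\<And>x. x \<in> K \<Longrightarrow> cball x e \<subseteq> K'"
proof -
  obtain e where e: "e > 0" "(\<Union>x\<in>K. cball x e) \<subseteq> V"
    using compact_subset_open_imp_cball_epsilon_subset[OF assms] by auto
  have "(\<Union>x\<in>K. cball x e) = {x + y |x y. x \<in> K \<and> y \<in> cball 0 e}"
  proof (intro set_eqI iffI)
    fix z assume "z \<in> (\<Union>x\<in>K. cball x e)"
    then obtain x where "x \<in> K" "dist x z \<le> e" by auto
    then show "z \<in> {x + y |x y. x \<in> K \<and> y \<in> cball 0 e}"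
      by (intro CollectI exI[of _ x] exI[of _ "z - x"]) (auto simp: dist_norm norm_minus_commute)
  next
    fix z assume "z \<in> {x + y |x y. x \<in> K \<and> y \<in> cball 0 e}"
    then obtain x y where "z = x + y" "x \<in> K" "norm y \<le> e" by auto
    then have "x \<in> K" "z \<in> cball x e" by (auto simp: dist_norm)
    then show "z \<in> (\<Union>x\<in>K. cball x e)" by blast
  qed
  moreover have "compact {x + y |x y. x \<in> K \<and> y \<in> cball 0 e}"
    by (intro compact_sums assms(1) compact_cball)
  ultimately have "compact (\<Union>x\<in>K. cball x e)"
    by simp
  then show ?thesis
    by (rule that[OF e(1) _ e(2)]) blast
qed

text \<open>\<open>F k\<close> mollifies \<open>f\<close> cut off to a compact neighbourhood of
  \<open>K\<close>, so on \<open>K\<close> its partial derivatives are mollifications of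
  \<open>h i\<close>. \<open>G k i\<close> mollifies |h i|^p, and Jensen's inequality makes it a
  majorant; it converges in L^1 on \<open>K\<close>, which replaces convergence of the gradients in
  L^p. Nonnegativity of \<open>F k\<close> is conditional because the same construction serves
  functions without a sign.\<close>

lemma weak_partial_approx:
  fixes V :: "(real ^ 'n::finite) set"
  assumes V: "open V" and K: "compact K" "K \<subseteq> V" and p: "p \<ge> 1"
    and wp: "\<And>i. weak_partial V f i (h i)"
    and Lp: "\<And>i. locally_integrable lborel V (\<lambda>y. \<bar>h i y\<bar> powr p)"
  obtains F :: "nat \<Rightarrow> real ^ 'n \<Rightarrow> real" and G :: "nat \<Rightarrow> 'n \<Rightarrow> real ^ 'n \<Rightarrow> real"
  where "\<And>k. Ck_on 1 (F k) UNIV"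
    and "\<And>k y. (AE z in lborel. z \<in> V \<longrightarrow> f z \<ge> 0) \<Longrightarrow> F k y \<ge> 0"
    and "AE y in lborel. y \<in> K \<longrightarrow> (\<lambda>k. F k y) \<longlonglongrightarrow> f y"
    and "\<And>i. AE y in lborel. y \<in> K \<longrightarrow>
      (\<lambda>k. frechet_derivative (F k) (at y) (axis i 1)) \<longlonglongrightarrow> h i y"
    and "(\<lambda>k. LINT y:K|lborel. \<bar>F k y - f y\<bar>) \<longlonglongrightarrow> 0"
    and "\<And>k i. integrable lborel (G k i)"
    and "\<And>k i y. y \<in> K \<Longrightarrow> \<bar>frechet_derivative (F k) (at y) (axis i 1)\<bar> powr p \<le> G k i y"
    and "\<And>i. (\<lambda>k. LINT y:K|lborel. \<bar>G k i y - \<bar>h i y\<bar> powr p\<bar>) \<longlonglongrightarrow> 0"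
proof -
  obtain e K' where e: "e > 0" and K': "compact K'" "K' \<subseteq> V" "\<And>x. x \<in> K \<Longrightarrow> cball x e \<subseteq> K'"
    using compact_enlargement[OF K(1) V K(2)] by metis
  have KK': "K \<subseteq> K'" using K'(3) e by fastforce
  have Kb: "K \<in> sets lborel" using K by (simp add: compact_imp_closed)
  define fb where "fb y = indicator K' y * f y" for y
  define hb where "hb i y = indicator K' y * h i y" for i y
  define Hb where "Hb i y = indicator K' y * \<bar>h i y\<bar> powr p" for i y
  have Hb_eq: "Hb i y = \<bar>hb i y\<bar> powr p" for i y
    by (simp add: Hb_def hb_def indicator_def)
  have fi: "integrable lborel fb" and hi: "integrable lborel (hb i)" and Hi: "integrable lborel (Hb i)" for i
    using wp[of i] Lp[of i] K'(1,2)
    by (auto simp: weak_partial_def locally_integrable_def set_integrable_def fb_def[abs_def] hb_def[abs_def] Hb_def[abs_def])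
  have Hi': "integrable lborel (\<lambda>y. \<bar>hb i y\<bar> powr p)" for i
    using Hi[of i] by (simp add: Hb_eq[abs_def])
  \<comment> \<open>Dividing by \<open>Suc k\<close> keeps every radius positive and at most
    \<open>e\<close>, so the balls around points of \<open>K\<close> stay in
    \<open>K'\<close>.\<close>
  define r where "r k = e / real (Suc k)" for k
  have r0: "r k > 0" and re: "r k \<le> e" for k
    using e by (auto simp: r_def divide_le_eq)
  have rlim: "r \<longlonglongrightarrow> 0"
    unfolding r_def by (rule LIMSEQ_Suc[OF lim_const_over_n])
  have ball: "cball y (r k) \<subseteq> K'" if "y \<in> K" for y k
    using K'(3)[OF that] re[of k] by (meson order_trans subset_cball)
  have D: "frechet_derivative (mollify fb (r k)) (at y) (axis i 1) = mollify (hb i) (r k) y"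
    if "y \<in> K" for y k i
    using mollify_weak_partial[OF wp[of i] r0[of k] K'(1,2) ball[OF that]]
    by (simp add: fb_def[abs_def] hb_def[abs_def])
  \<comment> \<open>All L^1 errors are added into one function: a single almost everywhere
    convergent subsequence then serves \<open>f\<close> and every partial derivative.\<close>
  define S where "S k y = \<bar>mollify fb (r k) y - fb y\<bar> + (\<Sum>i\<in>UNIV. \<bar>mollify (hb i) (r k) y - hb i y\<bar>)" for k y
  have mi: "integrable lborel (mollify fb (r k))" "integrable lborel (mollify (hb i) (r k))"
    "integrable lborel (mollify (Hb i) (r k))" for k i
    using mollify_L1_contraction(1)[OF r0] fi hi Hi by auto
  have Si: "integrable lborel (S k)" for k
    unfolding S_def by (intro Bochner_Integration.integrable_add Bochner_Integration.integrable_sum integrable_abs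
        Bochner_Integration.integrable_diff mi fi hi)
  have "(LINT y|lborel. norm (S k y)) = (LINT y|lborel. \<bar>mollify fb (r k) y - fb y\<bar>)
      + (\<Sum>i\<in>UNIV. LINT y|lborel. \<bar>mollify (hb i) (r k) y - hb i y\<bar>)" for k
  proof -
    have "norm (S k y) = S k y" for y
      by (simp add: S_def sum_nonneg)
    then show ?thesis
      using mi fi hi by (simp add: S_def)
  qed
  moreover have "(\<lambda>k. (LINT y|lborel. \<bar>mollify fb (r k) y - fb y\<bar>)
      + (\<Sum>i\<in>UNIV. LINT y|lborel. \<bar>mollify (hb i) (r k) y - hb i y\<bar>)) \<longlonglongrightarrow> 0 + (\<Sum>i\<in>(UNIV::'n set). 0)"
    by (intro tendsto_add tendsto_sum mollify_L1_tendsto rlim r0 fi hi)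
  ultimately have "(\<lambda>k. LINT y|lborel. norm (S k y)) \<longlonglongrightarrow> 0"
    by simp
  from tendsto_L1_AE_subseq[OF Si this] obtain \<sigma> where \<sigma>: "strict_mono \<sigma>"
    and ae: "AE y in lborel. (\<lambda>k. S (\<sigma> k) y) \<longlonglongrightarrow> 0"
    by blast
  have sub: "(\<lambda>k. X (\<sigma> k)) \<longlonglongrightarrow> a" if "X \<longlonglongrightarrow> a" for X :: "nat \<Rightarrow> real" and a
    using LIMSEQ_subseq_LIMSEQ[OF that \<sigma>] by (simp add: comp_def)
  have small: "(\<lambda>k. A k) \<longlonglongrightarrow> a" if "(\<lambda>k. S (\<sigma> k) y) \<longlonglongrightarrow> 0" "\<And>k. \<bar>A k - a\<bar> \<le> S (\<sigma> k) y" for A a y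
  proof (rule LIM_zero_cancel, rule Lim_null_comparison[OF _ that(1)])
    show "\<forall>\<^sub>F k in sequentially. norm (A k - a) \<le> S (\<sigma> k) y"
      using that(2) by simp
  qed
  show ?thesis
  proof (rule that[of "\<lambda>k. mollify fb (r (\<sigma> k))" "\<lambda>k i. mollify (Hb i) (r (\<sigma> k))"])
    show "Ck_on 1 (mollify fb (r (\<sigma> k))) UNIV" for k
      by (rule Ck_on_1_mollify[OF r0 fi])
    show "mollify fb (r (\<sigma> k)) y \<ge> 0" if "AE z in lborel. z \<in> V \<longrightarrow> f z \<ge> 0" for k y
    proof (rule mollify_nonneg[OF r0])
      show "AE z in lborel. fb z \<ge> 0"
        using that by eventually_elim (use K'(2) in \<open>auto simp: fb_def indicator_def\<close>)
    qed
    show "AE y in lborel. y \<in> K \<longrightarrow> (\<lambda>k. mollify fb (r (\<sigma> k)) y) \<longlonglongrightarrow> f y"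
      using ae
    proof eventually_elim
      case (elim y)
      have "(\<lambda>k. mollify fb (r (\<sigma> k)) y) \<longlonglongrightarrow> fb y"
        by (rule small[OF elim]) (simp add: S_def sum_nonneg)
      then show ?case using KK' by (auto simp: fb_def)
    qed
    show "AE y in lborel. y \<in> K \<longrightarrow>
      (\<lambda>k. frechet_derivative (mollify fb (r (\<sigma> k))) (at y) (axis i 1)) \<longlonglongrightarrow> h i y" for i
      using ae
    proof eventually_elim
      case (elim y)
      have "(\<lambda>k. mollify (hb i) (r (\<sigma> k)) y) \<longlonglongrightarrow> hb i y"
      proof (rule small[OF elim])
        fix k
        have "\<bar>mollify (hb i) (r (\<sigma> k)) y - hb i y\<bar> \<le> (\<Sum>i\<in>UNIV. \<bar>mollify (hb i) (r (\<sigma> k)) y - hb i y\<bar>)"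
          by (rule member_le_sum[of i UNIV "\<lambda>i. \<bar>mollify (hb i) (r (\<sigma> k)) y - hb i y\<bar>"]) auto
        then show "\<bar>mollify (hb i) (r (\<sigma> k)) y - hb i y\<bar> \<le> S (\<sigma> k) y"
          by (simp add: S_def)
      qed
      then show ?case using KK' by (auto simp: D hb_def)
    qed
    show "(\<lambda>k. LINT y:K|lborel. \<bar>mollify fb (r (\<sigma> k)) y - f y\<bar>) \<longlonglongrightarrow> 0"
      by (rule set_L1_tendsto[OF sub[OF mollify_L1_tendsto[OF fi rlim r0]] mi(1) fi Kb])
        (use KK' in \<open>auto simp: fb_def\<close>)
    show "integrable lborel (mollify (Hb i) (r (\<sigma> k)))" for k i
      by (rule mi)
    show "\<bar>frechet_derivative (mollify fb (r (\<sigma> k))) (at y) (axis i 1)\<bar> powr p \<le> mollify (Hb i) (r (\<sigma> k)) y"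
      if "y \<in> K" for k i y
      using mollify_powr_le[OF r0[of "\<sigma> k"] p hi[of i] Hi'[of i], of y] by (simp add: D[OF that] Hb_eq[abs_def])
    show "(\<lambda>k. LINT y:K|lborel. \<bar>mollify (Hb i) (r (\<sigma> k)) y - \<bar>h i y\<bar> powr p\<bar>) \<longlonglongrightarrow> 0" for i
      by (rule set_L1_tendsto[OF sub[OF mollify_L1_tendsto[OF Hi rlim r0]] mi(3) Hi Kb])
        (use KK' in \<open>auto simp: Hb_def\<close>)
  qed
qed

text \<open>The difference |f k - f'| is at most |G k - G'| + min |f k - f'| (2 G'). The first
  summand is small in L^1, the second has the fixed majorant 2 G' and tends to 0 pointwise. This
  form fits mollified powers, whose majorants change with the index.\<close>

lemma integral_dominated_convergence_L1:
  fixes f :: "nat \<Rightarrow> 'a \<Rightarrow> real"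
  assumes meas: "\<And>k. f k \<in> borel_measurable M" "f' \<in> borel_measurable M"
    and lim: "AE x in M. (\<lambda>k. f k x) \<longlonglongrightarrow> f' x"
    and G: "\<And>k. integrable M (G k)" "integrable M G'" "(\<lambda>k. LINT x|M. \<bar>G k x - G' x\<bar>) \<longlonglongrightarrow> 0"
    and bound: "\<And>k. AE x in M. \<bar>f k x\<bar> \<le> G k x" "AE x in M. \<bar>f' x\<bar> \<le> G' x"
  shows "integrable M f'" and "(\<lambda>k. LINT x|M. f k x) \<longlonglongrightarrow> (LINT x|M. f' x)"
proof -
  have fi: "integrable M (f k)" for k
    by (rule Bochner_Integration.integrable_bound[OF G(1)[of k] meas(1)])
      (use bound(1)[of k] in eventually_elim, auto)
  show f'i: "integrable M f'"
    by (rule Bochner_Integration.integrable_bound[OF G(2) meas(2)])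
      (use bound(2) in eventually_elim, auto)
  have mini: "integrable M (\<lambda>x. min \<bar>f k x - f' x\<bar> (2 * G' x))" for k
    using fi f'i G(2) by (intro integrable_min) auto
  have "(\<lambda>k. LINT x|M. min \<bar>f k x - f' x\<bar> (2 * G' x)) \<longlonglongrightarrow> (LINT x|M. 0)"
  proof (rule integral_dominated_convergence[where w = "\<lambda>x. 2 * G' x"])
    show "AE x in M. (\<lambda>k. min \<bar>f k x - f' x\<bar> (2 * G' x)) \<longlonglongrightarrow> 0"
      using lim bound(2)
    proof eventually_elim
      case (elim x)
      have "(\<lambda>k. min \<bar>f k x - f' x\<bar> (2 * G' x)) \<longlonglongrightarrow> min \<bar>f' x - f' x\<bar> (2 * G' x)"
        by (intro tendsto_intros elim(1))
      then show ?case using elim(2) by simp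
    qed
    show "AE x in M. norm (min \<bar>f k x - f' x\<bar> (2 * G' x)) \<le> 2 * G' x" for k
      using bound(2) by eventually_elim auto
  qed (use G(2) mini in auto)
  then have "(\<lambda>k. (LINT x|M. \<bar>G k x - G' x\<bar>) + (LINT x|M. min \<bar>f k x - f' x\<bar> (2 * G' x))) \<longlonglongrightarrow> 0 + 0"
    by (intro tendsto_add G(3)) simp
  then have lim0: "(\<lambda>k. (LINT x|M. \<bar>G k x - G' x\<bar>) + (LINT x|M. min \<bar>f k x - f' x\<bar> (2 * G' x))) \<longlonglongrightarrow> 0"
    by simp
  have le: "norm ((LINT x|M. f k x) - (LINT x|M. f' x))
      \<le> (LINT x|M. \<bar>G k x - G' x\<bar>) + (LINT x|M. min \<bar>f k x - f' x\<bar> (2 * G' x))" for k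
  proof -
    have "norm ((LINT x|M. f k x) - (LINT x|M. f' x)) = \<bar>LINT x|M. f k x - f' x\<bar>"
      using fi f'i by simp
    also have "\<dots> \<le> (LINT x|M. \<bar>f k x - f' x\<bar>)"
      by (rule integral_abs_bound)
    also have "\<dots> \<le> (LINT x|M. \<bar>G k x - G' x\<bar> + min \<bar>f k x - f' x\<bar> (2 * G' x))"
    proof (rule integral_mono_AE)
      show "AE x in M. \<bar>f k x - f' x\<bar> \<le> \<bar>G k x - G' x\<bar> + min \<bar>f k x - f' x\<bar> (2 * G' x)"
        using bound(1)[of k] bound(2) by eventually_elim linarith
    qed (use fi f'i G mini in simp_all)
    also have "\<dots> = (LINT x|M. \<bar>G k x - G' x\<bar>) + (LINT x|M. min \<bar>f k x - f' x\<bar> (2 * G' x))"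
      using G mini by simp
    finally show ?thesis .
  qed
  have "(\<lambda>k. (LINT x|M. f k x) - (LINT x|M. f' x)) \<longlonglongrightarrow> 0"
    by (rule Lim_null_comparison[OF always_eventually[OF allI[OF le]] lim0])
  then show "(\<lambda>k. LINT x|M. f k x) \<longlonglongrightarrow> (LINT x|M. f' x)"
    by (rule LIM_zero_cancel)
qed

section \<open>The chain rule for weak derivatives\<close>

text \<open>The integral of a difference quotient vanishes by translation invariance. The mean value
  theorem bounds the quotients by the maximum of the derivative, and steps of length at most |v|
  keep them supported in one ball, so dominated convergence applies. For products this is
  integration by parts.\<close>

lemma integral_derivative_zero:
  fixes \<Phi> :: "'a::euclidean_space \<Rightarrow> real"
  assumes C1: "Ck_on 1 \<Phi> UNIV" and K: "compact K" and supp: "\<And>x. x \<notin> K \<Longrightarrow> \<Phi> x = 0"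
  shows "(LINT x|lborel. frechet_derivative \<Phi> (at x) v) = 0"
proof -
  define D where "D x = frechet_derivative \<Phi> (at x) v" for x
  have Dc: "continuous_on UNIV D"
    unfolding D_def by (rule Ck_on_1_continuous_derivative[OF C1])
  have D0: "D x = 0" if "x \<notin> K" for x
    unfolding D_def
    by (subst frechet_derivative_zero_open[of "- K"]) (use that K supp in \<open>auto simp: compact_imp_closed\<close>)
  obtain B where B: "B > 0" "\<And>x. \<bar>D x\<bar> \<le> B"
    using continuous_compact_support_bounded[OF Dc K D0] by blast
  obtain R where R: "\<And>x. x \<in> K \<Longrightarrow> norm x \<le> R"
    using compact_imp_bounded[OF K] by (auto simp: bounded_iff)
  have \<Phi>i: "integrable lborel \<Phi>"
    by (rule integrable_cont_compact[OF Ck_on_1_continuous[OF C1], of R]) (use supp R in force)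
  have line: "((\<lambda>s. \<Phi> (x + s *\<^sub>R v)) has_real_derivative D (x + s *\<^sub>R v)) (at s)" for x s
  proof -
    have "((\<lambda>s. x + s *\<^sub>R v) has_derivative (\<lambda>t. t *\<^sub>R v)) (at s)"
      by (auto intro!: derivative_eq_intros)
    from has_derivative_compose[OF this Ck_on_1_has_derivative[OF C1 UNIV_I]]
    have "((\<lambda>s. \<Phi> (x + s *\<^sub>R v)) has_derivative
        (\<lambda>t. frechet_derivative \<Phi> (at (x + s *\<^sub>R v)) (t *\<^sub>R v))) (at s)" .
    then show ?thesis
      by (simp add: has_field_derivative_def D_def linear_cmul[OF Ck_on_1_linear[OF C1 UNIV_I]] mult_commute_abs)
  qed
  define t where "t n = 1 / real (Suc n)" for n
  have t: "t n > 0" "t n \<le> 1" for n by (auto simp: t_def)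
  have tlim: "t \<longlonglongrightarrow> 0"
    unfolding t_def by (rule LIMSEQ_Suc[OF lim_const_over_n])
  define u where "u n x = (\<Phi> (x + t n *\<^sub>R v) - \<Phi> x) / t n" for n x
  have "(\<lambda>n. LINT x|lborel. u n x) \<longlonglongrightarrow> (LINT x|lborel. D x)"
  proof (rule integral_dominated_convergence[where w = "\<lambda>x. B * indicator (cball 0 (R + norm v)) x"])
    show "D \<in> borel_measurable lborel"
      using borel_measurable_continuous_onI[OF Dc] by simp
    show "u n \<in> borel_measurable lborel" for n
      using lborel_integrable_shift(1)[OF \<Phi>i, of "t n *\<^sub>R v"] \<Phi>i unfolding u_def by measurable
    show "integrable lborel (\<lambda>x. B * indicator (cball (0::'a) (R + norm v)) x)"
      using emeasure_lborel_cball_finite[of "0::'a" "R + norm v"]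
      by (intro integrable_mult_right integrable_real_indicator) auto
    show "AE x in lborel. (\<lambda>n. u n x) \<longlonglongrightarrow> D x"
    proof (rule AE_I2)
      fix x :: 'a
      have "(\<lambda>h. (\<Phi> (x + h *\<^sub>R v) - \<Phi> x) / h) \<midarrow>0\<rightarrow> D x"
        using line[of x 0] by (simp add: DERIV_def)
      moreover have "filterlim t (at 0) sequentially"
        using tlim t(1) by (auto simp: filterlim_at less_imp_neq[THEN not_sym])
      ultimately show "(\<lambda>n. u n x) \<longlonglongrightarrow> D x"
        unfolding u_def by (rule filterlim_compose)
    qed
    have "\<bar>u n x\<bar> \<le> B * indicator (cball 0 (R + norm v)) x" for n x
    proof (cases "norm x > R + norm v")
      case True
      have "norm (t n *\<^sub>R v) \<le> norm v"
        using t[of n] by (simp add: mult_left_le_one_le)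
      then have "norm (x + t n *\<^sub>R v) > R"
        using True norm_diff_ineq[of x "t n *\<^sub>R v"] by linarith
      moreover have "norm x > R" using True norm_ge_zero[of v] by linarith
      ultimately have "x + t n *\<^sub>R v \<notin> K" "x \<notin> K" using R by force+
      then show ?thesis using supp B(1) by (simp add: u_def)
    next
      case False
      obtain z where "\<Phi> (x + t n *\<^sub>R v) - \<Phi> (x + 0 *\<^sub>R v) = (t n - 0) * D (x + z *\<^sub>R v)"
        using MVT2[OF t(1)[of n], of "\<lambda>s. \<Phi> (x + s *\<^sub>R v)" "\<lambda>s. D (x + s *\<^sub>R v)"] line by metis
      then have "u n x = D (x + z *\<^sub>R v)"
        using t(1)[of n] by (simp add: u_def)
      then show ?thesis using B(2) False by simp
    qed
    then show "AE x in lborel. norm (u n x) \<le> B * indicator (cball 0 (R + norm v)) x" for n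
      by simp
  qed
  moreover have "(LINT x|lborel. u n x) = 0" for n
    unfolding u_def using lborel_integrable_shift[OF \<Phi>i, of "t n *\<^sub>R v"] \<Phi>i by simp
  ultimately show ?thesis
    using LIMSEQ_unique[OF tendsto_const] unfolding D_def by fastforce
qed

lemma C1_0_euclidean_zero:
  assumes "\<psi> \<in> C1_0_euclidean V" "y \<notin> closure {y. \<psi> y \<noteq> 0}"
  shows "\<psi> y = 0" "frechet_derivative \<psi> (at y) v = 0"
  using assms closure_subset[of "{y. \<psi> y \<noteq> 0}"] by (auto simp: frechet_derivative_outside_support)

lemma C1_0_euclideanD:
  assumes "\<psi> \<in> C1_0_euclidean V"
  shows "Ck_on 1 \<psi> UNIV" "compact (closure {y. \<psi> y \<noteq> 0})" "closure {y. \<psi> y \<noteq> 0} \<subseteq> V"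
  using assms unfolding C1_0_euclidean_def by auto

lemma locally_integrable_mult_test:
  fixes f \<eta> :: "'a::euclidean_space \<Rightarrow> real"
  assumes f: "locally_integrable lborel V f" and K: "compact K" "K \<subseteq> V"
    and \<eta>: "continuous_on UNIV \<eta>" "\<And>y. y \<notin> K \<Longrightarrow> \<eta> y = 0"
  shows "set_integrable lborel V (\<lambda>y. f y * \<eta> y)"
proof -
  obtain B where B: "B > 0" "\<And>x. \<bar>\<eta> x\<bar> \<le> B"
    using continuous_compact_support_bounded[OF \<eta>(1) K(1) \<eta>(2)] by blast
  have i: "integrable lborel (\<lambda>y. indicator K y *\<^sub>R f y)"
    using f K by (simp add: locally_integrable_def set_integrable_def)
  have [measurable]: "\<eta> \<in> borel_measurable borel"
    by (rule borel_measurable_continuous_onI[OF \<eta>(1)])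
  have "integrable lborel (\<lambda>y. (indicator K y *\<^sub>R f y) * \<eta> y)"
  proof (rule Bochner_Integration.integrable_bound[OF integrable_mult_right[OF i, of B]])
    show "(\<lambda>y. (indicator K y *\<^sub>R f y) * \<eta> y) \<in> borel_measurable lborel"
      using i by measurable
    show "AE y in lborel. norm ((indicator K y *\<^sub>R f y) * \<eta> y) \<le> norm (B * (indicator K y *\<^sub>R f y))"
    proof (rule AE_I2)
      fix y
      show "norm ((indicator K y *\<^sub>R f y) * \<eta> y) \<le> norm (B * (indicator K y *\<^sub>R f y))"
        using mult_right_mono[OF B(2)[of y], of "\<bar>indicator K y *\<^sub>R f y\<bar>"] B(1)
        by (simp add: abs_mult ac_simps)
    qed
  qed
  moreover have "(\<lambda>y. (indicator K y *\<^sub>R f y) * \<eta> y) = (\<lambda>y. indicator V y *\<^sub>R (f y * \<eta> y))"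
    using K(2) \<eta>(2) by (auto simp: indicator_def fun_eq_iff)
  ultimately show ?thesis unfolding set_integrable_def by (rule subst[rotated])
qed

text \<open>For the C^1 approximations of \<open>f\<close> from \<open>weak_partial_approx\<close>,
  taken with exponent 1, the claim is integration by parts for the product of H(F k) and \<psi>.
  Both sides pass to the limit since \<open>H\<close> grows at most linearly and \<open>H'\<close>
  is bounded.\<close>

lemma weak_partial_chain:
  fixes V :: "(real ^ 'n::finite) set"
  assumes V: "open V" and wp: "\<And>i. weak_partial V f i (h i)"
    and H: "\<And>t. (H has_real_derivative H' t) (at t)" and H'c: "continuous_on UNIV H'"
    and B: "\<And>t. \<bar>H' t\<bar> \<le> B"
  shows "weak_partial V (\<lambda>y. H (f y)) i (\<lambda>y. H' (f y) * h i y)"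
proof -
  have B0: "B \<ge> 0" using B[of 0] by linarith
  have Hc: "continuous_on UNIV H"
    by (rule DERIV_continuous_on[OF has_field_derivative_at_within[OF H]])
  have [measurable]: "H \<in> borel_measurable borel" "H' \<in> borel_measurable borel"
    using borel_measurable_continuous_onI[OF Hc] borel_measurable_continuous_onI[OF H'c] by auto
  have Hb: "\<bar>H t\<bar> \<le> \<bar>H 0\<bar> + B * \<bar>t\<bar>" for t
  proof -
    have "norm (H t - H 0) \<le> B * norm (t - 0)"
      by (rule field_differentiable_bound[of UNIV H H'])
        (use H B in \<open>auto intro: has_field_derivative_at_within\<close>)
    then show ?thesis by simp
  qed
  have fl: "locally_integrable lborel V f" and hl: "locally_integrable lborel V (h i)" for i
    using wp by (auto simp: weak_partial_def)
  have Hl: "locally_integrable lborel V (\<lambda>y. H (f y))" and H'l: "locally_integrable lborel V (\<lambda>y. H' (f y) * h i y)"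
    unfolding locally_integrable_def
  proof (safe)
    fix K assume K: "compact K" "K \<subseteq> V"
    have Kb [measurable]: "K \<in> sets borel" using K by (simp add: compact_imp_closed)
    have fi: "integrable lborel (\<lambda>y. indicator K y * f y)" and hi: "integrable lborel (\<lambda>y. indicator K y * h i y)"
      using fl hl K by (simp_all add: locally_integrable_def set_integrable_def)
    have Ki: "integrable lborel (\<lambda>y. indicator K y * \<bar>H 0\<bar>)"
      using emeasure_compact_finite[OF K(1)] by (intro integrable_mult_left integrable_real_indicator) auto
    have fm [measurable]: "(\<lambda>y. indicator K y * f y) \<in> borel_measurable lborel"
      and hm [measurable]: "(\<lambda>y. indicator K y * h i y) \<in> borel_measurable lborel"
      using fi hi by auto
    have "(\<lambda>y. indicator K y * H (indicator K y * f y)) \<in> borel_measurable lborel"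
      by measurable
    moreover have "indicator K y * H (indicator K y * f y) = indicator K y *\<^sub>R H (f y)" for y
      by (simp add: indicator_def)
    ultimately have m1: "(\<lambda>y. indicator K y *\<^sub>R H (f y)) \<in> borel_measurable lborel"
      by simp
    have "(\<lambda>y. H' (indicator K y * f y) * (indicator K y * h i y)) \<in> borel_measurable lborel"
      by measurable
    moreover have "H' (indicator K y * f y) * (indicator K y * h i y) = indicator K y *\<^sub>R (H' (f y) * h i y)" for y
      by (simp add: indicator_def)
    ultimately have m2: "(\<lambda>y. indicator K y *\<^sub>R (H' (f y) * h i y)) \<in> borel_measurable lborel"
      by simp
    have int1: "integrable lborel (\<lambda>y. indicator K y * \<bar>H 0\<bar> + B * \<bar>indicator K y * f y\<bar>)"
      using fi Ki by simp
    show "set_integrable lborel K (\<lambda>y. H (f y))"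
      unfolding set_integrable_def
      by (rule Bochner_Integration.integrable_bound[OF int1 m1])
        (use Hb B0 in \<open>auto simp: indicator_def intro!: AE_I2\<close>)
    have int2: "integrable lborel (\<lambda>y. B * (indicator K y * h i y))"
      using hi by simp
    show "set_integrable lborel K (\<lambda>y. H' (f y) * h i y)"
      unfolding set_integrable_def
      by (rule Bochner_Integration.integrable_bound[OF int2 m2])
        (use B B0 in \<open>auto simp: indicator_def abs_mult intro!: AE_I2 mult_right_mono\<close>)
  qed
  have "(LINT y:V|lborel. H (f y) * frechet_derivative \<psi> (at y) (axis i 1)) =
      - (LINT y:V|lborel. (H' (f y) * h i y) * \<psi> y)" if \<psi>: "\<psi> \<in> C1_0_euclidean V" for \<psi>
  proof -
    define e :: "real ^ 'n" where "e = axis i 1"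
    define K where "K = closure {y. \<psi> y \<noteq> 0}"
    note \<psi>C = C1_0_euclideanD[OF \<psi>, folded K_def]
    have \<psi>0: "\<psi> y = 0" "frechet_derivative \<psi> (at y) v = 0" if "y \<notin> K" for y v
      by (rule C1_0_euclidean_zero[OF \<psi>, folded K_def, OF that])+
    have Kb [measurable]: "K \<in> sets borel" by (simp add: K_def)
    have cs: "continuous_on UNIV \<psi>" "continuous_on UNIV (\<lambda>y. frechet_derivative \<psi> (at y) e)"
      using Ck_on_1_continuous[OF \<psi>C(1)] Ck_on_1_continuous_derivative[OF \<psi>C(1)] by auto
    obtain M where M: "M > 0" "\<And>y. \<bar>\<psi> y\<bar> \<le> M"
      using continuous_compact_support_bounded[OF cs(1) \<psi>C(2) \<psi>0(1)] by blast
    obtain M' where M': "M' > 0" "\<And>y. \<bar>frechet_derivative \<psi> (at y) e\<bar> \<le> M'"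
      using continuous_compact_support_bounded[OF cs(2) \<psi>C(2) \<psi>0(2)] by blast
    have hl1: "locally_integrable lborel V (\<lambda>y. \<bar>h j y\<bar> powr 1)" for j
      using hl[of j] set_integrable_abs by (auto simp: locally_integrable_def)
    obtain F :: "nat \<Rightarrow> real ^ 'n \<Rightarrow> real" and G :: "nat \<Rightarrow> 'n \<Rightarrow> real ^ 'n \<Rightarrow> real"
      where F1: "\<And>k. Ck_on 1 (F k) UNIV"
      and "\<And>k y. (AE z in lborel. z \<in> V \<longrightarrow> f z \<ge> 0) \<Longrightarrow> F k y \<ge> 0"
      and Flim: "AE y in lborel. y \<in> K \<longrightarrow> (\<lambda>k. F k y) \<longlonglongrightarrow> f y"
      and DFlim: "\<And>j. AE y in lborel. y \<in> K \<longrightarrow>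
        (\<lambda>k. frechet_derivative (F k) (at y) (axis j 1)) \<longlonglongrightarrow> h j y"
      and FL: "(\<lambda>k. LINT y:K|lborel. \<bar>F k y - f y\<bar>) \<longlonglongrightarrow> 0"
      and Gi: "\<And>k j. integrable lborel (G k j)"
      and DFG: "\<And>k j y. y \<in> K \<Longrightarrow> \<bar>frechet_derivative (F k) (at y) (axis j 1)\<bar> powr 1 \<le> G k j y"
      and GL: "\<And>j. (\<lambda>k. LINT y:K|lborel. \<bar>G k j y - \<bar>h j y\<bar> powr 1\<bar>) \<longlonglongrightarrow> 0"
    proof (rule weak_partial_approx[OF V \<psi>C(2,3) order_refl wp hl1], goal_cases)
      case (1 F G)
      from 1(2-9) show ?case by (rule 1(1))
    qed
    have Fc: "continuous_on UNIV (F k)" for k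
      by (rule Ck_on_1_continuous[OF F1])
    define D where "D k y = frechet_derivative (F k) (at y) e" for k y
    define E where "E y = frechet_derivative \<psi> (at y) e" for y
    have Dc: "continuous_on UNIV (D k)" for k
      unfolding D_def by (rule Ck_on_1_continuous_derivative[OF F1])
    have [measurable]: "F k \<in> borel_measurable borel" "D k \<in> borel_measurable borel"
      "\<psi> \<in> borel_measurable borel" "E \<in> borel_measurable borel" for k
      using borel_measurable_continuous_onI[OF Fc] borel_measurable_continuous_onI[OF Dc]
        borel_measurable_continuous_onI[OF cs(1)] borel_measurable_continuous_onI[OF cs(2)] by (auto simp: E_def[abs_def])
    have fi: "integrable lborel (\<lambda>y. indicator K y * f y)" and hi: "integrable lborel (\<lambda>y. indicator K y * h i y)"
      using fl hl \<psi>C by (simp_all add: locally_integrable_def set_integrable_def)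
    have Ki: "integrable lborel (\<lambda>y. indicator K y * \<bar>H 0\<bar>)"
      using emeasure_compact_finite[OF \<psi>C(2)] by (intro integrable_mult_left integrable_real_indicator) auto
    have Fi: "integrable lborel (\<lambda>y. indicator K y * F k y)" for k
      using borel_integrable_compact[OF \<psi>C(2) continuous_on_subset[OF Fc]] by simp
    have s1: "set_integrable lborel V (\<lambda>y. H (f y) * E y)"
      by (rule locally_integrable_mult_test[OF Hl \<psi>C(2,3)]) (use cs \<psi>0 in \<open>auto simp: E_def\<close>)
    have s2: "set_integrable lborel V (\<lambda>y. (H' (f y) * h i y) * \<psi> y)"
      by (rule locally_integrable_mult_test[OF H'l \<psi>C(2,3)]) (use cs \<psi>0 in auto)
    \<comment> \<open>Majorants on the support of \<psi>: |H 0| + B |F k|, times the bound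
      \<open>M'\<close> for the derivative of \<psi>. They converge in L^1 together with
      \<open>F k\<close>.\<close>
    have lim1: "(\<lambda>k. LINT y|lborel. H (F k y) * E y) \<longlonglongrightarrow> (LINT y|lborel. indicator V y *\<^sub>R (H (f y) * E y))"
    proof (rule integral_dominated_convergence_L1(2))
      show "(\<lambda>y. indicator V y *\<^sub>R (H (f y) * E y)) \<in> borel_measurable lborel"
        using s1 by (simp add: set_integrable_def)
      show "AE y in lborel. (\<lambda>k. H (F k y) * E y) \<longlonglongrightarrow> indicator V y *\<^sub>R (H (f y) * E y)"
        using Flim
      proof eventually_elim
        case (elim y)
        show ?case
        proof (cases "y \<in> K")
          case True
          have "(\<lambda>k. H (F k y)) \<longlonglongrightarrow> H (f y)"
            using elim True Hc by (intro continuous_on_tendsto_compose[of UNIV H]) auto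
          then have "(\<lambda>k. H (F k y) * E y) \<longlonglongrightarrow> H (f y) * E y"
            by (rule tendsto_mult_right)
          then show ?thesis using True \<psi>C(3) by auto
        next
          case False
          then show ?thesis using \<psi>0 by (simp add: E_def)
        qed
      qed
      let ?G = "\<lambda>f y. M' * (indicator K y * \<bar>H 0\<bar> + B * \<bar>indicator K y * f y\<bar>)"
      show "integrable lborel (?G (F k))" "integrable lborel (?G f)" for k
        using Ki Fi fi by simp_all
      have le: "norm (LINT y|lborel. \<bar>?G (F k) y - ?G f y\<bar>) \<le> M' * B * (LINT y:K|lborel. \<bar>F k y - f y\<bar>)" for k
      proof -
        have i0: "integrable lborel (\<lambda>y. indicator K y * \<bar>F k y - f y\<bar>)"
        proof -
          have "integrable lborel (\<lambda>y. \<bar>indicator K y * F k y - indicator K y * f y\<bar>)"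
            using Fi fi by simp
          moreover have "\<bar>indicator K y * F k y - indicator K y * f y\<bar> = indicator K y * \<bar>F k y - f y\<bar>" for y
            by (simp add: indicator_def)
          ultimately show ?thesis by simp
        qed
        have "(LINT y|lborel. \<bar>?G (F k) y - ?G f y\<bar>) \<le> (LINT y|lborel. M' * B * (indicator K y * \<bar>F k y - f y\<bar>))"
        proof (rule integral_mono)
          show "\<bar>?G (F k) y - ?G f y\<bar> \<le> M' * B * (indicator K y * \<bar>F k y - f y\<bar>)" for y
          proof (cases "y \<in> K")
            case True
            have "?G (F k) y - ?G f y = M' * B * (\<bar>F k y\<bar> - \<bar>f y\<bar>)"
              using True by (simp add: algebra_simps)
            then have "\<bar>?G (F k) y - ?G f y\<bar> = M' * B * \<bar>\<bar>F k y\<bar> - \<bar>f y\<bar>\<bar>"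
              using M' B0 by (simp add: abs_mult)
            also have "\<dots> \<le> M' * B * \<bar>F k y - f y\<bar>"
              using M' B0 by (intro mult_left_mono abs_triangle_ineq3) auto
            finally show ?thesis using True by simp
          qed simp
        qed (use Ki Fi fi i0 in simp_all)
        moreover have "norm (LINT y|lborel. \<bar>?G (F k) y - ?G f y\<bar>) = (LINT y|lborel. \<bar>?G (F k) y - ?G f y\<bar>)"
          unfolding real_norm_def by (intro abs_of_nonneg Bochner_Integration.integral_nonneg) simp
        moreover have "(LINT y|lborel. M' * B * (indicator K y * \<bar>F k y - f y\<bar>)) =
            M' * B * (LINT y:K|lborel. \<bar>F k y - f y\<bar>)"
          by (simp add: set_lebesgue_integral_def)
        ultimately show ?thesis by linarith
      qed
      show "(\<lambda>k. LINT y|lborel. \<bar>?G (F k) y - ?G f y\<bar>) \<longlonglongrightarrow> 0"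
        by (rule Lim_null_comparison[OF always_eventually[OF allI[OF le]] tendsto_mult_right_zero[OF FL]])
      have G: "\<bar>H t * E y\<bar> \<le> M' * (\<bar>H 0\<bar> + B * \<bar>t\<bar>)" for t y
      proof -
        have "\<bar>H t * E y\<bar> \<le> (\<bar>H 0\<bar> + B * \<bar>t\<bar>) * M'"
          unfolding abs_mult using M'(2)[of y] Hb[of t] B0 by (intro mult_mono) (auto simp: E_def)
        then show ?thesis by (simp add: mult.commute)
      qed
      show "AE y in lborel. \<bar>H (F k y) * E y\<bar> \<le> ?G (F k) y" for k
      proof (rule AE_I2)
        fix y
        show "\<bar>H (F k y) * E y\<bar> \<le> ?G (F k) y"
          using G[of "F k y" y] \<psi>0(2)[of y e] by (cases "y \<in> K") (simp_all add: E_def)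
      qed
      show "AE y in lborel. \<bar>indicator V y *\<^sub>R (H (f y) * E y)\<bar> \<le> ?G f y"
      proof (rule AE_I2)
        fix y
        show "\<bar>indicator V y *\<^sub>R (H (f y) * E y)\<bar> \<le> ?G f y"
          using G[of "f y" y] \<psi>0(2)[of y e] \<psi>C(3) by (cases "y \<in> K") (auto simp: E_def)
      qed
    qed measurable
    \<comment> \<open>Here the majorants come from \<open>G\<close>: at exponent 1 the derivative of
      \<open>F k\<close> is itself bounded by the mollification of |h i|.\<close>
    have lim2: "(\<lambda>k. LINT y|lborel. H' (F k y) * D k y * \<psi> y) \<longlonglongrightarrow>
        (LINT y|lborel. indicator V y *\<^sub>R ((H' (f y) * h i y) * \<psi> y))"
    proof (rule integral_dominated_convergence_L1(2))
      show "(\<lambda>y. indicator V y *\<^sub>R ((H' (f y) * h i y) * \<psi> y)) \<in> borel_measurable lborel"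
        using s2 by (simp add: set_integrable_def)
      show "AE y in lborel. (\<lambda>k. H' (F k y) * D k y * \<psi> y) \<longlonglongrightarrow> indicator V y *\<^sub>R ((H' (f y) * h i y) * \<psi> y)"
        using Flim DFlim[of i]
      proof eventually_elim
        case (elim y)
        show ?case
        proof (cases "y \<in> K")
          case True
          have "(\<lambda>k. H' (F k y)) \<longlonglongrightarrow> H' (f y)"
            using elim True H'c by (intro continuous_on_tendsto_compose[of UNIV H']) auto
          moreover have "(\<lambda>k. D k y) \<longlonglongrightarrow> h i y"
            using elim True by (simp add: D_def e_def)
          ultimately have "(\<lambda>k. H' (F k y) * D k y * \<psi> y) \<longlonglongrightarrow> H' (f y) * h i y * \<psi> y"
            by (intro tendsto_mult tendsto_const)
          then show ?thesis using True \<psi>C(3) by auto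
        next
          case False
          then show ?thesis using \<psi>0 by simp
        qed
      qed
      let ?G = "\<lambda>g y. (B * M) * (indicator K y * g y)"
      have iG: "integrable lborel (\<lambda>y. indicator K y * G k i y)" for k
        using integrable_mult_indicator[OF _ Gi[of k i], of K] by simp
      have ih: "integrable lborel (\<lambda>y. indicator K y * \<bar>h i y\<bar>)"
        using integrable_abs[OF hi] by (simp add: abs_mult)
      show "integrable lborel (?G (G k i))" "integrable lborel (?G (\<lambda>y. \<bar>h i y\<bar>))" for k
        using iG ih by simp_all
      have "(LINT y|lborel. \<bar>?G (G k i) y - ?G (\<lambda>y. \<bar>h i y\<bar>) y\<bar>) =
          B * M * (LINT y:K|lborel. \<bar>G k i y - \<bar>h i y\<bar> powr 1\<bar>)" for k
      proof -
        have "(LINT y|lborel. \<bar>?G (G k i) y - ?G (\<lambda>y. \<bar>h i y\<bar>) y\<bar>) =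
          (LINT y|lborel. B * M * (indicator K y * \<bar>G k i y - \<bar>h i y\<bar>\<bar>))"
        proof (rule Bochner_Integration.integral_cong[OF refl])
          show "\<bar>?G (G k i) y - ?G (\<lambda>y. \<bar>h i y\<bar>) y\<bar> = B * M * (indicator K y * \<bar>G k i y - \<bar>h i y\<bar>\<bar>)" for y
            using B0 M(1) unfolding right_diff_distrib[symmetric] abs_mult by simp
        qed
        then show ?thesis by (simp add: set_lebesgue_integral_def)
      qed
      moreover have "(\<lambda>k. B * M * (LINT y:K|lborel. \<bar>G k i y - \<bar>h i y\<bar> powr 1\<bar>)) \<longlonglongrightarrow> B * M * 0"
        by (intro tendsto_mult_left GL)
      ultimately show "(\<lambda>k. LINT y|lborel. \<bar>?G (G k i) y - ?G (\<lambda>y. \<bar>h i y\<bar>) y\<bar>) \<longlonglongrightarrow> 0"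
        by simp
      have bd: "\<bar>H' t * d * \<psi> y\<bar> \<le> B * M * c" if "\<bar>d\<bar> \<le> c" for t d y c
      proof -
        have "\<bar>H' t * d * \<psi> y\<bar> \<le> B * c * M"
          unfolding abs_mult using B[of t] that M(2)[of y] B0 by (intro mult_mono) auto
        then show ?thesis by (simp add: ac_simps)
      qed
      show "AE y in lborel. \<bar>H' (F k y) * D k y * \<psi> y\<bar> \<le> ?G (G k i) y" for k
      proof (rule AE_I2)
        fix y
        show "\<bar>H' (F k y) * D k y * \<psi> y\<bar> \<le> ?G (G k i) y"
          using bd[of "D k y" "G k i y" "F k y" y] DFG[of y k i] \<psi>0(1)[of y]
          by (cases "y \<in> K") (simp_all add: D_def e_def)
      qed
      show "AE y in lborel. \<bar>indicator V y *\<^sub>R ((H' (f y) * h i y) * \<psi> y)\<bar> \<le> ?G (\<lambda>y. \<bar>h i y\<bar>) y"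
      proof (rule AE_I2)
        fix y
        show "\<bar>indicator V y *\<^sub>R ((H' (f y) * h i y) * \<psi> y)\<bar> \<le> ?G (\<lambda>y. \<bar>h i y\<bar>) y"
          using bd[of "h i y" "\<bar>h i y\<bar>" "f y" y] \<psi>0(1)[of y] \<psi>C(3) by (cases "y \<in> K") auto
      qed
    qed measurable
    have "(LINT y|lborel. H (F k y) * E y) + (LINT y|lborel. H' (F k y) * D k y * \<psi> y) = 0" for k
    proof -
      have HF: "Ck_on 1 (\<lambda>y. H (F k y)) UNIV"
        by (rule Ck_on_1_real_compose(1)[OF F1, where T = UNIV and F' = H']) (use H H'c in auto)
      have DHF: "frechet_derivative (\<lambda>y. H (F k y)) (at y) e = H' (F k y) * D k y" for y
        unfolding D_def
        by (rule Ck_on_1_real_compose(2)[OF F1, where T = UNIV]) (use H H'c in auto)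
      have "(LINT y|lborel. frechet_derivative (\<lambda>y. H (F k y) * \<psi> y) (at y) e) = 0"
        by (rule integral_derivative_zero[OF Ck_on_1_mult[OF HF \<psi>C(1)] \<psi>C(2)]) (simp add: \<psi>0)
      moreover have "frechet_derivative (\<lambda>y. H (F k y) * \<psi> y) (at y) e =
          H (F k y) * E y + H' (F k y) * D k y * \<psi> y" for y
        unfolding E_def by (simp add: frechet_derivative_mult_real[OF HF \<psi>C(1) UNIV_I] DHF)
      ultimately have "(LINT y|lborel. H (F k y) * E y + H' (F k y) * D k y * \<psi> y) = 0"
        by simp
      moreover have "integrable lborel (\<lambda>y. H (F k y) * E y)"
      proof -
        have "integrable lborel (\<lambda>y. indicator K y *\<^sub>R (H (F k y) * E y))"
          by (rule borel_integrable_compact[OF \<psi>C(2)])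
            (rule continuous_on_subset[OF continuous_on_mult[OF continuous_on_compose2[OF Hc Fc subset_UNIV]
                cs(2)[folded E_def]] subset_UNIV])
        moreover have "(\<lambda>y. indicator K y *\<^sub>R (H (F k y) * E y)) = (\<lambda>y. H (F k y) * E y)"
          using \<psi>0(2)[of _ e] by (fastforce simp: E_def indicator_def fun_eq_iff)
        ultimately show ?thesis by (rule subst[rotated])
      qed
      moreover have "integrable lborel (\<lambda>y. H' (F k y) * D k y * \<psi> y)"
      proof -
        have "integrable lborel (\<lambda>y. indicator K y *\<^sub>R (H' (F k y) * D k y * \<psi> y))"
          by (rule borel_integrable_compact[OF \<psi>C(2)])
            (rule continuous_on_subset[OF continuous_on_mult[OF continuous_on_mult[OF
                continuous_on_compose2[OF H'c Fc subset_UNIV] Dc] cs(1)] subset_UNIV])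
        moreover have "(\<lambda>y. indicator K y *\<^sub>R (H' (F k y) * D k y * \<psi> y)) = (\<lambda>y. H' (F k y) * D k y * \<psi> y)"
          using \<psi>0(1) by (fastforce simp: indicator_def fun_eq_iff)
        ultimately show ?thesis by (rule subst[rotated])
      qed
      ultimately show ?thesis by simp
    qed
    then have "(\<lambda>k. 0) \<longlonglongrightarrow> (LINT y|lborel. indicator V y *\<^sub>R (H (f y) * E y)) +
        (LINT y|lborel. indicator V y *\<^sub>R ((H' (f y) * h i y) * \<psi> y))"
      using tendsto_add[OF lim1 lim2] by simp
    then have "(LINT y|lborel. indicator V y *\<^sub>R (H (f y) * E y)) +
        (LINT y|lborel. indicator V y *\<^sub>R ((H' (f y) * h i y) * \<psi> y)) = 0"
      using LIMSEQ_unique[OF _ tendsto_const] by blast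
    then show ?thesis
      by (simp add: set_lebesgue_integral_def E_def e_def)
  qed
  with Hl H'l show ?thesis by (simp add: weak_partial_def)
qed

section \<open>Uniqueness of weak derivatives\<close>

text \<open>By Lindelof's theorem countably many of the neighbourhoods cover \<open>V\<close>, and a
  countable union of null sets is null.\<close>

lemma AE_open_local:
  fixes V :: "'a::second_countable_topology set"
  assumes "\<And>x. x \<in> V \<Longrightarrow> \<exists>N. open N \<and> x \<in> N \<and> (AE y in M. y \<in> N \<longrightarrow> P y)"
  shows "AE y in M. y \<in> V \<longrightarrow> P y"
proof -
  define \<F> where "\<F> = {N. open N \<and> (AE y in M. y \<in> N \<longrightarrow> P y)}"
  obtain \<G> where \<G>: "\<G> \<subseteq> \<F>" "countable \<G>" "\<Union>\<G> = \<Union>\<F>"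
    using Lindelof[of \<F>] by (auto simp: \<F>_def)
  have "AE y in M. \<forall>N\<in>\<G>. y \<in> N \<longrightarrow> P y"
    using \<G> by (subst AE_ball_countable) (auto simp: \<F>_def)
  then show ?thesis
  proof eventually_elim
    case (elim y)
    show ?case
    proof
      assume "y \<in> V"
      then have "y \<in> \<Union>\<F>" using assms by (auto simp: \<F>_def)
      then show "P y" using elim \<G>(3) by auto
    qed
  qed
qed

text \<open>The fundamental lemma of the calculus of variations: translated mollifiers are
  admissible tests, so all mollifications of \<open>h\<close> with small radius vanish near
  \<open>x\<close>, while they converge to \<open>h\<close> in L^1.\<close>

lemma locally_integrable_eq_0:
  fixes V :: "(real ^ 'n::finite) set"
  assumes V: "open V" and h: "locally_integrable lborel V h"
    and zero: "\<And>\<psi>. \<psi> \<in> C1_0_euclidean V \<Longrightarrow> (LINT y:V|lborel. h y * \<psi> y) = 0"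
  shows "AE y in lborel. y \<in> V \<longrightarrow> h y = 0"
proof (rule AE_open_local)
  fix x assume "x \<in> V"
  then obtain r0 where r0: "r0 > 0" "cball x r0 \<subseteq> V"
    using V open_contains_cball by blast
  \<comment> \<open>Half the radius: balls of radius at most \<open>r\<close> around points of
    \<open>cball x r\<close> remain inside \<open>cball x r0\<close>.\<close>
  define r where "r = r0 / 2"
  have r: "r > 0" using r0 by (simp add: r_def)
  define K where "K = cball x r0"
  define hb where "hb y = indicator K y * h y" for y
  have hi: "integrable lborel hb"
    using h r0(2) by (auto simp: locally_integrable_def set_integrable_def hb_def[abs_def] K_def)
  have moll0: "mollify hb s y = 0" if s: "0 < s" "s \<le> r" and y: "y \<in> cball x r" for s y
  proof -
    define \<psi> where "\<psi> z = moll s (z - y)" for z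
    have sub: "cball y s \<subseteq> K"
      using s y by (simp add: K_def r_def cball_subset_cball_iff dist_commute)
    have z0: "\<psi> z = 0" if "z \<notin> cball y s" for z
      using that by (simp add: \<psi>_def moll_eq_0[OF s(1)] dist_norm norm_minus_commute)
    have cl: "closure {z. \<psi> z \<noteq> 0} \<subseteq> cball y s"
      by (rule closure_minimal[OF _ closed_cball]) (use z0 in blast)
    have \<psi>d: "(\<psi> has_derivative moll_deriv s (z - y)) (at z)" for z
    proof -
      have "((\<lambda>z. z - y) has_derivative (\<lambda>v. v)) (at z)"
        by (auto intro!: derivative_eq_intros)
      from has_derivative_compose[OF this moll_has_derivative[OF s(1)]] show ?thesis
        by (simp add: \<psi>_def[abs_def])
    qed
    have "Ck_on 1 \<psi> UNIV"
      by (rule Ck_on_1_I[OF \<psi>d])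
        (auto intro!: continuous_on_compose2[OF continuous_on_moll_deriv[of UNIV]] continuous_intros)
    moreover have "compact (closure {z. \<psi> z \<noteq> 0})"
      using cl by (meson bounded_cball bounded_subset closed_closure compact_eq_bounded_closed)
    ultimately have "\<psi> \<in> C1_0_euclidean V"
      using cl sub r0(2) by (simp add: C1_0_euclidean_def K_def del: Ck_on.simps One_nat_def)
    then have "(LINT z:V|lborel. h z * \<psi> z) = 0"
      by (rule zero)
    moreover have "mollify hb s y = (LINT z:V|lborel. h z * \<psi> z)"
      unfolding mollify_def set_lebesgue_integral_def
    proof (rule Bochner_Integration.integral_cong[OF refl])
      fix z
      show "moll s (y - z) * hb z = indicator V z *\<^sub>R (h z * \<psi> z)"
      proof (cases "z \<in> cball y s")
        case True
        then have "z \<in> K" "z \<in> V" using sub r0(2) by (auto simp: K_def)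
        then show ?thesis using moll_uminus[OF s(1), of y z] by (simp add: \<psi>_def hb_def)
      next
        case False
        then show ?thesis using z0[OF False] moll_uminus[OF s(1), of y z] by (simp add: \<psi>_def)
      qed
    qed
    ultimately show ?thesis by simp
  qed
  define s where "s k = r / real (Suc k)" for k
  have s: "s k > 0" "s k \<le> r" for k
    using r by (auto simp: s_def divide_le_eq)
  have slim: "s \<longlonglongrightarrow> 0"
    unfolding s_def by (rule LIMSEQ_Suc[OF lim_const_over_n])
  have "(\<lambda>k. LINT y:cball x r|lborel. \<bar>0 - hb y\<bar>) \<longlonglongrightarrow> 0"
    by (rule set_L1_tendsto[OF mollify_L1_tendsto[OF hi slim s(1)] mollify_L1_contraction(1)[OF s(1) hi] hi])
      (use moll0 s in simp_all)
  then have "(LINT y:cball x r|lborel. \<bar>hb y\<bar>) = 0"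
    using LIMSEQ_unique[OF tendsto_const] by fastforce
  moreover have "integrable lborel (\<lambda>y. indicator (cball x r) y *\<^sub>R \<bar>hb y\<bar>)"
    using hi by (intro integrable_mult_indicator) auto
  ultimately have "AE y in lborel. indicator (cball x r) y *\<^sub>R \<bar>hb y\<bar> = 0"
    by (subst (asm) set_lebesgue_integral_def, subst (asm) integral_nonneg_eq_0_iff_AE) auto
  then have "AE y in lborel. y \<in> ball x r \<longrightarrow> h y = 0"
  proof eventually_elim
    case (elim y)
    show ?case
    proof
      assume "y \<in> ball x r"
      then have "y \<in> cball x r" "y \<in> K" using r by (auto simp: K_def r_def)
      then show "h y = 0" using elim by (simp add: hb_def)
    qed
  qed
  then show "\<exists>N. open N \<and> x \<in> N \<and> (AE y in lborel. y \<in> N \<longrightarrow> h y = 0)"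
    using r by (intro exI[of _ "ball x r"]) auto
qed

text \<open>Functions that agree almost everywhere have equal integrals against derivatives of
  tests, so h - h' is orthogonal to all tests. Agreement almost everywhere is the form in which
  \<rho> = d^\<alpha> is given.\<close>

lemma weak_partial_unique:
  fixes V :: "(real ^ 'n::finite) set"
  assumes V: "open V" and wp: "weak_partial V f i h" "weak_partial V f' i h'"
    and eq: "AE y in lborel. y \<in> V \<longrightarrow> f y = f' y"
  shows "AE y in lborel. y \<in> V \<longrightarrow> h y = h' y"
proof -
  have "AE y in lborel. y \<in> V \<longrightarrow> h y - h' y = 0"
  proof (rule locally_integrable_eq_0[OF V])
    show "locally_integrable lborel V (\<lambda>y. h y - h' y)"
    proof -
      have "locally_integrable lborel V h" "locally_integrable lborel V h'"
        using wp by (auto simp: weak_partial_def)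
      then show ?thesis
        unfolding locally_integrable_def by (intro allI impI set_integral_diff(1)) auto
    qed
    fix \<psi> assume \<psi>: "\<psi> \<in> C1_0_euclidean V"
    note \<psi>C = C1_0_euclideanD[OF \<psi>] and \<psi>0 = C1_0_euclidean_zero[OF \<psi>]
    have cs: "continuous_on UNIV \<psi>" "continuous_on UNIV (\<lambda>y. frechet_derivative \<psi> (at y) (axis i 1))"
      using Ck_on_1_continuous[OF \<psi>C(1)] Ck_on_1_continuous_derivative[OF \<psi>C(1)] by auto
    have li: "locally_integrable lborel V f" "locally_integrable lborel V f'"
      "locally_integrable lborel V h" "locally_integrable lborel V h'"
      using wp by (auto simp: weak_partial_def)
    note int1 = locally_integrable_mult_test[OF _ \<psi>C(2,3) cs(1) \<psi>0(1)]
      and int2 = locally_integrable_mult_test[OF _ \<psi>C(2,3) cs(2) \<psi>0(2)]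
    have "(LINT y:V|lborel. h y * \<psi> y) - (LINT y:V|lborel. h' y * \<psi> y) =
        (LINT y:V|lborel. f' y * frechet_derivative \<psi> (at y) (axis i 1)) -
        (LINT y:V|lborel. f y * frechet_derivative \<psi> (at y) (axis i 1))"
      using wp \<psi> by (simp add: weak_partial_def)
    also have "(LINT y:V|lborel. f' y * frechet_derivative \<psi> (at y) (axis i 1)) =
        (LINT y:V|lborel. f y * frechet_derivative \<psi> (at y) (axis i 1))"
      unfolding set_lebesgue_integral_def
    proof (rule integral_cong_AE)
      show "AE y in lborel. indicator V y *\<^sub>R (f' y * frechet_derivative \<psi> (at y) (axis i 1)) =
          indicator V y *\<^sub>R (f y * frechet_derivative \<psi> (at y) (axis i 1))"
        using eq by eventually_elim (simp add: indicator_def)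
    qed (use int2[OF li(1)] int2[OF li(2)] in \<open>auto simp: set_integrable_def dest: borel_measurable_integrable\<close>)
    finally have "(LINT y:V|lborel. h y * \<psi> y) - (LINT y:V|lborel. h' y * \<psi> y) = 0"
      by simp
    then show "(LINT y:V|lborel. (h y - h' y) * \<psi> y) = 0"
      using int1[OF li(3)] int1[OF li(4)] by (simp add: left_diff_distrib set_integral_diff)
  qed
  then show ?thesis by simp
qed

text \<open>The chain rule does not apply to the power itself, whose derivative may be unbounded on
  the half line. It is applied to H(f) and to Q(d), where Q(t) = H(t^\<alpha>) for t > 0 and
  \<open>H\<close> is a bump supported in [a, b] with a > 0. These compositions agree almost
  everywhere, hence so do their weak derivatives. The factor H'(f) cancels where it is nonzero, and
  countably many rational pairs (a, b) reach every positive value of \<open>f\<close>.\<close>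

lemma weak_partial_powr:
  fixes V :: "(real ^ 'n::finite) set"
  assumes V: "open V" and f: "\<And>i. weak_partial V f i (h i)" and d: "\<And>i. weak_partial V d i (k i)"
    and \<alpha>: "\<alpha> \<noteq> 0" and fd: "AE y in lborel. y \<in> V \<longrightarrow> d y \<ge> 0 \<and> f y = d y powr \<alpha>"
  shows "AE y in lborel. y \<in> V \<longrightarrow> d y > 0 \<longrightarrow> h i y = \<alpha> * d y powr (\<alpha> - 1) * k i y"
proof -
  \<comment> \<open>The derivative of \<open>psq (t - a) * psq (b - t)\<close>, the C^1 bump on
    [a, b] that is named \<open>H\<close> once \<open>a\<close> and \<open>b\<close> are
    fixed.\<close>
  define H' where "H' a b t = 2 * max 0 (t - a) * psq (b - t) - psq (t - a) * (2 * max 0 (b - t))" for a b t :: real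
  have local: "AE y in lborel. y \<in> V \<longrightarrow> d y > 0 \<longrightarrow>
      H' a b (f y) * h i y = H' a b (f y) * (\<alpha> * d y powr (\<alpha> - 1) * k i y)"
    if ab: "0 < a" "a < b" for a b
  proof -
    define H where "H t = psq (t - a) * psq (b - t)" for t
    define Q where "Q t = (if t > 0 then H (t powr \<alpha>) else 0)" for t
    define Q' where "Q' t = (if t > 0 then H' a b (t powr \<alpha>) * (\<alpha> * t powr (\<alpha> - 1)) else 0)" for t
    have H0: "H t = 0" "H' a b t = 0" if "t \<notin> {a..b}" for t
    proof -
      have "psq (t - a) = 0 \<and> max 0 (t - a) = 0 \<or> psq (b - t) = 0 \<and> max 0 (b - t) = 0"
        using that by (auto simp: psq_eq_0)
      then show "H t = 0" "H' a b t = 0" by (auto simp: H_def H'_def)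
    qed
    have HD: "(H has_real_derivative H' a b t) (at t)" for t
      unfolding H_def[abs_def] H'_def
      by (auto intro!: derivative_eq_intros DERIV_chain2[OF psq_has_derivative] simp: algebra_simps)
    have H'c: "continuous_on S (H' a b)" for S
      unfolding H'_def
      by (intro continuous_intros continuous_on_compose2[OF continuous_on_psq[of UNIV]] subset_UNIV)
    obtain B where B: "\<And>t. \<bar>H' a b t\<bar> \<le> B"
      using continuous_compact_support_bounded[OF H'c compact_Icc H0(2)] by metis
    \<comment> \<open>Together with \<open>M\<close> this bounds the positive t for which t^\<alpha>
      lies in [a, b]; minimum and maximum are taken because a negative \<alpha> reverses the order.
      Since m > 0, extending \<open>Q\<close> by zero to t \<le> 0 keeps it C^1.\<close>
    define m where "m = min (a powr (1 / \<alpha>)) (b powr (1 / \<alpha>))"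
    define M where "M = max (a powr (1 / \<alpha>)) (b powr (1 / \<alpha>))"
    have m: "m > 0" using ab by (simp add: m_def)
    have out: "t powr \<alpha> \<notin> {a..b}" if "t > 0" "t < m \<or> t > M" for t
    proof
      assume "t powr \<alpha> \<in> {a..b}"
      then have t: "a \<le> t powr \<alpha>" "t powr \<alpha> \<le> b" by auto
      have inv: "(t powr \<alpha>) powr (1 / \<alpha>) = t"
        using \<alpha> \<open>t > 0\<close> by (simp add: powr_powr)
      consider "\<alpha> > 0" | "\<alpha> < 0" using \<alpha> by linarith
      then have "m \<le> t \<and> t \<le> M"
      proof cases
        case 1
        then have "a powr (1 / \<alpha>) \<le> t" "t \<le> b powr (1 / \<alpha>)"
          using powr_mono2[of "1/\<alpha>" a "t powr \<alpha>"] powr_mono2[of "1/\<alpha>" "t powr \<alpha>" b] t ab inv by auto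
        then show ?thesis by (auto simp: m_def M_def)
      next
        case 2
        then have "t \<le> a powr (1 / \<alpha>)" "b powr (1 / \<alpha>) \<le> t"
          using powr_mono2'[of "1/\<alpha>" a "t powr \<alpha>"] powr_mono2'[of "1/\<alpha>" "t powr \<alpha>" b] t ab inv \<open>t > 0\<close> by auto
        then show ?thesis by (auto simp: m_def M_def)
      qed
      with that(2) show False by auto
    qed
    have Q0: "Q t = 0" "Q' t = 0" if "t < m \<or> t > M" for t
      using that H0 out by (auto simp: Q_def Q'_def)
    have QD: "(Q has_real_derivative Q' t) (at t)" for t
    proof (cases "t > 0")
      case True
      have "((\<lambda>t. H (t powr \<alpha>)) has_real_derivative H' a b (t powr \<alpha>) * (\<alpha> * t powr (\<alpha> - 1))) (at t)"
        by (rule DERIV_chain2[OF HD has_real_derivative_powr[OF True]])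
      then have "(Q has_real_derivative H' a b (t powr \<alpha>) * (\<alpha> * t powr (\<alpha> - 1))) (at t)"
        by (rule has_field_derivative_transform_within_open[where S = "{0<..}"]) (use True in \<open>auto simp: Q_def\<close>)
      then show ?thesis using True by (simp add: Q'_def)
    next
      case False
      have "(Q has_real_derivative 0) (at t)"
        by (rule has_field_derivative_transform_within_open[where S = "{..<m}" and f = "\<lambda>_. 0"])
          (use False m Q0 in auto)
      then show ?thesis using False by (simp add: Q'_def)
    qed
    have Q'c: "continuous_on UNIV Q'"
    proof -
      have "continuous_on {0<..} (\<lambda>t. H' a b (t powr \<alpha>) * (\<alpha> * t powr (\<alpha> - 1)))"
        by (intro continuous_intros continuous_on_compose2[OF H'c[of UNIV]]) auto
      then have 1: "continuous_on {0<..} Q'"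
        by (rule continuous_on_eq) (auto simp: Q'_def)
      have 2: "continuous_on {..<m} Q'"
        by (rule continuous_on_eq[OF continuous_on_const[of _ 0]]) (use Q0 in auto)
      have "continuous_on ({0<..} \<union> {..<m}) Q'"
        by (intro continuous_on_open_Un 1 2) auto
      moreover have "{0<..} \<union> {..<m} = UNIV" using m by auto
      ultimately show ?thesis by simp
    qed
    obtain C where C: "\<And>t. \<bar>Q' t\<bar> \<le> C"
      using continuous_compact_support_bounded[OF Q'c compact_Icc[of m M]] Q0(2)
      by (metis atLeastAtMost_iff not_le)
    have "AE y in lborel. y \<in> V \<longrightarrow> H' a b (f y) * h i y = Q' (d y) * k i y"
    proof (rule weak_partial_unique[OF V])
      show "weak_partial V (\<lambda>y. H (f y)) i (\<lambda>y. H' a b (f y) * h i y)"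
        by (rule weak_partial_chain[OF V f HD H'c B])
      show "weak_partial V (\<lambda>y. Q (d y)) i (\<lambda>y. Q' (d y) * k i y)"
        by (rule weak_partial_chain[OF V d QD Q'c C])
      show "AE y in lborel. y \<in> V \<longrightarrow> H (f y) = Q (d y)"
        using fd
      proof eventually_elim
        case (elim y)
        show ?case
        proof
          assume "y \<in> V"
          with elim have "d y \<ge> 0" "f y = d y powr \<alpha>" by auto
          then show "H (f y) = Q (d y)"
            using H0(1)[of 0] ab by (cases "d y = 0") (auto simp: Q_def)
        qed
      qed
    qed
    then show ?thesis
      using fd by eventually_elim (auto simp: Q'_def mult.assoc)
  qed
  have "countable {(a, b). a \<in> \<rat> \<and> b \<in> \<rat> \<and> 0 < a \<and> a < (b::real)}"
    by (rule countable_subset[of _ "\<rat> \<times> \<rat>"]) (auto intro: countable_rat)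
  then have "AE y in lborel. \<forall>(a, b)\<in>{(a, b). a \<in> \<rat> \<and> b \<in> \<rat> \<and> 0 < a \<and> a < (b::real)}.
      y \<in> V \<longrightarrow> d y > 0 \<longrightarrow> H' a b (f y) * h i y = H' a b (f y) * (\<alpha> * d y powr (\<alpha> - 1) * k i y)"
    using local by (subst AE_ball_countable) auto
  then show ?thesis
    using fd
  proof eventually_elim
    case (elim y)
    show ?case
    proof (intro impI)
      assume y: "y \<in> V" "d y > 0"
      define t where "t = f y"
      have t: "t > 0" using elim(2) y by (simp add: t_def)
      obtain a where a: "a \<in> \<rat>" "0 < a" "a < t" using Rats_dense_in_real[OF t] by auto
      \<comment> \<open>This choice of b places t in the left half of (a, b), where the derivative 2
        (t - a) (b - t) (a + b - 2 t) of the bump is positive.\<close>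
      obtain b where b: "b \<in> \<rat>" "2 * t - a < b" using Rats_dense_in_real[of "2 * t - a" "2 * t - a + 1"] by auto
      have "a < b" using a b by linarith
      then have eq: "H' a b t * h i y = H' a b t * (\<alpha> * d y powr (\<alpha> - 1) * k i y)"
        using elim(1) a b y by (auto simp: t_def)
      have "t < b" using a b by linarith
      then have "H' a b t = 2 * (t - a) * (b - t) * (b - 2 * t + a)"
        using a(3) by (simp add: H'_def psq_def power2_eq_square algebra_simps)
      moreover have "2 * (t - a) * (b - t) * (b - 2 * t + a) > 0"
        using a b \<open>t < b\<close> by (intro mult_pos_pos) auto
      ultimately have "H' a b t \<noteq> 0" by (metis less_irrefl)
      then show "h i y = \<alpha> * d y powr (\<alpha> - 1) * k i y"
        using eq by simp
    qed
  qed
qed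

section \<open>Charts, gradients and the metric\<close>

text \<open>The segment from the identity to \<open>M\<close> consists of positive definite, hence
  invertible, matrices. The determinant is 1 at the start and, by the intermediate value theorem,
  could not become nonpositive without a zero on the way.\<close>

lemma det_pos_if_positive_definite:
  fixes M :: "real ^ 'n ^ 'n::finite"
  assumes pos: "\<And>v. v \<noteq> 0 \<Longrightarrow> v \<bullet> (M *v v) > 0"
  shows "det M > 0"
proof (rule ccontr)
  assume "\<not> det M > 0"
  define P where "P t = (\<chi> i j. (1 - t) * (mat 1 :: real ^ 'n ^ 'n) $ i $ j + t * M $ i $ j)" for t
  have "continuous_on {0..1} (\<lambda>t. det (P t))"
    unfolding det_def P_def by (simp add: continuous_intros)
  moreover have "P 0 = mat 1" "P 1 = M"
    by (simp_all add: P_def vec_eq_iff)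
  ultimately obtain t where t: "0 \<le> t" "t \<le> 1" "det (P t) = 0"
    using IVT2'[of "\<lambda>t. det (P t)" 1 0 0] \<open>\<not> det M > 0\<close> by (auto simp: det_I)
  then have "\<not> invertible (P t)" by (simp add: invertible_det_nz)
  then obtain v where v: "v \<noteq> 0" "P t *v v = 0"
    unfolding invertible_left_inverse matrix_left_invertible_ker by auto
  have "P t = (1 - t) *\<^sub>R mat 1 + t *\<^sub>R M"
    by (simp add: P_def vec_eq_iff)
  then have "P t *v v = (1 - t) *\<^sub>R v + t *\<^sub>R (M *v v)"
    by (simp add: matrix_vector_mult_add_rdistrib scaleR_matrix_vector_assoc[symmetric])
  then have "v \<bullet> (P t *v v) = (1 - t) * (v \<bullet> v) + t * (v \<bullet> (M *v v))"
    by (simp add: inner_add_right)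
  moreover have "(1 - t) * (v \<bullet> v) + t * (v \<bullet> (M *v v)) > 0"
  proof (cases "t = 0")
    case False
    then have "t * (v \<bullet> (M *v v)) > 0" using t(1) pos[OF v(1)] by simp
    then show ?thesis using t(2) by (simp add: add_nonneg_pos)
  qed (use v in simp)
  ultimately show False using v(2) by simp
qed

lemma linear_axis_sum:
  fixes L :: "real ^ 'n::finite \<Rightarrow> real"
  assumes "linear L"
  shows "L w = (\<Sum>i\<in>UNIV. w $ i * L (axis i 1))"
proof -
  have "(\<Sum>i\<in>UNIV. w $ i * L (axis i 1)) = L (\<Sum>i\<in>UNIV. w $ i *\<^sub>R axis i 1)"
    by (simp add: linear_sum[OF assms] linear_cmul[OF assms])
  then show ?thesis
    using basis_expansion[of w] by (simp add: scalar_mult_eq_scaleR)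
qed

definition C1_manifold :: "('m, 'n::finite) chart set \<Rightarrow> ('m \<Rightarrow> real) \<Rightarrow> bool"
  where "C1_manifold A u \<longleftrightarrow> (\<forall>c\<in>A. Ck_on 1 (u \<circ> chart_inv c) (snd c ` fst c))"

text \<open>The differential of \<open>u\<close> in the coordinates of \<open>c\<close>, a covector;
  unlike \<open>gradient\<close> it does not involve the metric.\<close>

definition chart_deriv :: "('m \<Rightarrow> real) \<Rightarrow> ('m, 'n::finite) chart \<Rightarrow> 'm \<Rightarrow> real ^ 'n \<Rightarrow> real"
  where "chart_deriv u c x = frechet_derivative (u \<circ> chart_inv c) (at (snd c x))"

section \<open>Charts and coordinate differentials\<close>

context smooth_manifold
begin

lemma chart_inv_left: "c \<in> A \<Longrightarrow> x \<in> fst c \<Longrightarrow> chart_inv c (snd c x) = x"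
  using chart_homeomorphism homeomorphism_apply1 by metis

lemma chart_inv_right: "c \<in> A \<Longrightarrow> y \<in> snd c ` fst c \<Longrightarrow> snd c (chart_inv c y) = y"
  using chart_homeomorphism homeomorphism_apply2 by metis

lemma chart_inv_in: "c \<in> A \<Longrightarrow> y \<in> snd c ` fst c \<Longrightarrow> chart_inv c y \<in> fst c"
  by (metis chart_inv_left imageE)

lemma chart_continuous: "c \<in> A \<Longrightarrow> continuous_on (fst c) (snd c)"
  using chart_homeomorphism by (simp add: homeomorphism_def)

lemma chart_inv_continuous: "c \<in> A \<Longrightarrow> continuous_on (snd c ` fst c) (chart_inv c)"
  using chart_homeomorphism by (simp add: homeomorphism_def)

lemma chart_image_eq:
  assumes "c \<in> A" "N \<subseteq> fst c"
  shows "snd c ` N = (snd c ` fst c) \<inter> chart_inv c -` N"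
proof -
  have "chart_inv c (snd c x) = x" if "x \<in> fst c" for x
    by (rule chart_inv_left[OF assms(1) that])
  then show ?thesis
    using assms(2) by (auto simp: subset_iff)
qed

lemma chart_inv_image_eq:
  assumes "c \<in> A" "V \<subseteq> snd c ` fst c"
  shows "chart_inv c ` V = fst c \<inter> snd c -` V"
proof (intro set_eqI iffI)
  fix x assume "x \<in> fst c \<inter> snd c -` V"
  then show "x \<in> chart_inv c ` V"
    using chart_inv_left[OF assms(1), of x] by (auto intro!: image_eqI[of x _ "snd c x"])
next
  fix x assume "x \<in> chart_inv c ` V"
  then obtain y where "y \<in> V" "x = chart_inv c y" by auto
  then show "x \<in> fst c \<inter> snd c -` V"
    using chart_inv_in[OF assms(1), of y] chart_inv_right[OF assms(1), of y] assms(2) by auto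
qed

lemma chart_image_subset_open:
  assumes "c \<in> A" "N \<subseteq> fst c" "open N"
  shows "open (snd c ` N)"
  unfolding chart_image_eq[OF assms(1,2)]
  by (rule continuous_open_preimage[OF chart_inv_continuous chart_image_open]) (use assms in auto)

lemma chart_inv_image_open:
  assumes "c \<in> A" "V \<subseteq> snd c ` fst c" "open V"
  shows "open (chart_inv c ` V)"
  unfolding chart_inv_image_eq[OF assms(1,2)]
  by (rule continuous_open_preimage[OF chart_continuous chart_open]) (use assms in auto)

lemma chart_inv_image_compact:
  assumes "c \<in> A" "K \<subseteq> snd c ` fst c" "compact K"
  shows "compact (chart_inv c ` K)"
  by (rule compact_continuous_image[OF continuous_on_subset[OF chart_inv_continuous] assms(3)]) (use assms in auto)

lemma chart_image_compact:
  assumes "c \<in> A" "L \<subseteq> fst c" "compact L"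
  shows "compact (snd c ` L)"
  by (rule compact_continuous_image[OF continuous_on_subset[OF chart_continuous] assms(3)]) (use assms in auto)

lemma chart_image_Int_open:
  assumes "c \<in> A" "open \<Omega>"
  shows "open (snd c ` (fst c \<inter> \<Omega>))"
  by (rule chart_image_subset_open[OF assms(1) _ open_Int[OF chart_open[OF assms(1)] assms(2)]]) simp

lemma chart_at: "chart_at A x \<in> A" "x \<in> fst (chart_at A x)"
proof -
  have "\<exists>c. c \<in> A \<and> x \<in> fst c" using charts_cover by blast
  from someI_ex[OF this] show "chart_at A x \<in> A" "x \<in> fst (chart_at A x)"
    by (auto simp: chart_at_def)
qed

lemma transition_has_derivative:
  assumes "c \<in> A" "c' \<in> A" "x \<in> fst c \<inter> fst c'"
  shows "(transition c c' has_derivative dtransition c c' x) (at (snd c x))"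
proof -
  have "Ck_on 1 (transition c c') (snd c ` (fst c \<inter> fst c'))"
    using transition_smooth[OF assms(1,2)] unfolding smooth_on_def by blast
  from Ck_on_1_has_derivative[OF this] show ?thesis
    using assms(3) by (simp add: dtransition_def)
qed

lemma transition_Ck_on_1:
  assumes "c \<in> A" "c' \<in> A"
  shows "Ck_on 1 (transition c c') (snd c ` (fst c \<inter> fst c'))"
  using transition_smooth[OF assms] unfolding smooth_on_def by blast

lemma linear_dtransition:
  assumes "c \<in> A" "c' \<in> A" "x \<in> fst c \<inter> fst c'"
  shows "linear (dtransition c c' x)"
  using has_derivative_linear[OF transition_has_derivative[OF assms]] .

lemma C1_has_derivative:
  assumes "C1_manifold A u" "c \<in> A" "x \<in> fst c"
  shows "((u \<circ> chart_inv c) has_derivative chart_deriv u c x) (at (snd c x))"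
  using assms Ck_on_1_has_derivative unfolding C1_manifold_def chart_deriv_def by blast

lemma linear_chart_deriv:
  assumes "C1_manifold A u" "c \<in> A" "x \<in> fst c"
  shows "linear (chart_deriv u c x)"
  using has_derivative_linear[OF C1_has_derivative[OF assms]] .

text \<open>On the overlap of the charts one coordinate expression of \<open>u\<close> is the other
  composed with \<open>transition\<close>, so this is the chain rule: covectors pull back.\<close>

lemma chart_deriv_transition:
  assumes "C1_manifold A u" "c \<in> A" "c' \<in> A" "x \<in> fst c \<inter> fst c'"
  shows "chart_deriv u c x v = chart_deriv u c' x (dtransition c c' x v)"
proof -
  have tx: "transition c c' (snd c x) = snd c' x"
    using assms by (simp add: transition_def chart_inv_left)
  have "((\<lambda>y. (u \<circ> chart_inv c') (transition c c' y)) has_derivative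
      (\<lambda>v. chart_deriv u c' x (dtransition c c' x v))) (at (snd c x))"
    by (rule has_derivative_compose[OF transition_has_derivative[OF assms(2-4)]])
      (use assms C1_has_derivative[OF assms(1,3), of x] tx in \<open>simp add: comp_def\<close>)
  then have "((u \<circ> chart_inv c) has_derivative (\<lambda>v. chart_deriv u c' x (dtransition c c' x v))) (at (snd c x))"
  proof (rule has_derivative_transform_within_open)
    show "open (snd c ` (fst c \<inter> fst c'))"
      using chart_image_Int_open[OF assms(2) chart_open[OF assms(3)]] .
    show "snd c x \<in> snd c ` (fst c \<inter> fst c')" using assms by auto
    show "(u \<circ> chart_inv c') (transition c c' y) = (u \<circ> chart_inv c) y"
      if "y \<in> snd c ` (fst c \<inter> fst c')" for y
      using that assms by (auto simp: transition_def chart_inv_left)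
  qed
  then have "(\<lambda>v. chart_deriv u c' x (dtransition c c' x v)) = chart_deriv u c x"
    unfolding chart_deriv_def[of u c x] by (rule frechet_derivative_at)
  then show ?thesis by metis
qed

lemma C1_continuous_on:
  assumes "C1_manifold A u"
  shows "continuous_on UNIV u"
proof -
  have "continuous_on (fst c) u" if "c \<in> A" for c
  proof -
    have "continuous_on (snd c ` fst c) (u \<circ> chart_inv c)"
      by (rule Ck_on_1_continuous) (use assms that in \<open>unfold C1_manifold_def, blast\<close>)
    then have "continuous_on (fst c) (\<lambda>x. (u \<circ> chart_inv c) (snd c x))"
      by (rule continuous_on_compose2[OF _ chart_continuous[OF that]]) simp
    then show ?thesis
      by (rule continuous_on_eq) (simp add: chart_inv_left[OF that])
  qed
  then have "continuous_on (\<Union>c\<in>A. fst c) u"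
    by (intro continuous_on_open_UN) (use chart_open in auto)
  then show ?thesis using charts_cover by simp
qed

lemma C1_0D:
  assumes "u \<in> C1_0 A \<Omega>"
  shows "C1_manifold A u" "compact (closure {x. u x \<noteq> 0})" "closure {x. u x \<noteq> 0} \<subseteq> \<Omega>"
  using assms unfolding C1_0_def C1_manifold_def by auto

end

section \<open>The metric, gradients and pointwise norms\<close>

context riemannian_manifold
begin

lemma metric_linear:
  assumes "c \<in> A" "x \<in> fst c"
  shows "linear (g c x v)" "linear (\<lambda>v. g c x v w)"
  using metric_bilinear[OF assms] by (auto simp: bilinear_def)

lemma metric_nonneg:
  assumes "c \<in> A" "x \<in> fst c"
  shows "g c x v v \<ge> 0"
  using metric_positive[OF assms, of v] linear_0[OF metric_linear(1)[OF assms, of 0]]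
  by (cases "v = 0") auto

lemma metric_Cauchy_Schwarz:
  assumes "c \<in> A" "x \<in> fst c"
  shows "\<bar>g c x v w\<bar> \<le> sqrt (g c x v v) * sqrt (g c x w w)"
proof (cases "w = 0")
  case True
  then show ?thesis
    using linear_0[OF metric_linear(1)[OF assms, of v]] metric_nonneg[OF assms] by simp
next
  case False
  let ?g = "g c x"
  note lin = linear_diff[OF metric_linear(1)[OF assms]] linear_diff[OF metric_linear(2)[OF assms]]
    linear_cmul[OF metric_linear(1)[OF assms]] linear_cmul[OF metric_linear(2)[OF assms]]
  have w: "?g w w > 0" using metric_positive[OF assms False] .
  define t where "t = ?g v w / ?g w w"
  have "0 \<le> ?g (v - t *\<^sub>R w) (v - t *\<^sub>R w)"
    by (rule metric_nonneg[OF assms])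
  also have "\<dots> = ?g v v - t * ?g v w - (t * ?g w v - t * (t * ?g w w))"
    by (simp add: lin algebra_simps)
  also have "t * (t * ?g w w) = t * ?g v w"
    using w by (simp add: t_def)
  also have "?g w v = ?g v w"
    by (rule metric_symmetric[OF assms])
  finally have "t * ?g v w \<le> ?g v v"
    by simp
  then have "(?g v w)\<^sup>2 \<le> ?g v v * ?g w w"
    using w by (simp add: t_def power2_eq_square divide_le_eq)
  then have "sqrt ((?g v w)\<^sup>2) \<le> sqrt (?g v v * ?g w w)"
    by (rule real_sqrt_le_mono)
  then show ?thesis by (simp add: real_sqrt_mult)
qed

text \<open>The map from a vector to its covector components is linear and, by positive
  definiteness, injective, hence bijective in finite dimension. This makes the definite description
  in \<open>gradient\<close> meaningful.\<close>

lemma metric_riesz: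
  assumes "c \<in> A" "x \<in> fst c" "linear L"
  shows "\<exists>!v. \<forall>w. g c x v w = L w"
proof -
  define T where "T v = (\<chi> i. g c x v (axis i 1))" for v
  have lin: "linear T"
    using metric_linear(2)[OF assms(1,2)] by (intro linearI) (auto simp: T_def vec_eq_iff linear_iff)
  have "inj T"
  proof (rule linear_injective_0[OF lin, THEN iffD2], intro allI impI)
    fix v assume "T v = 0"
    then have "g c x v (axis i 1) = 0" for i by (simp add: T_def vec_eq_iff)
    then have "g c x v v = 0"
      using linear_axis_sum[OF metric_linear(1)[OF assms(1,2)], of v v] by simp
    then show "v = 0" using metric_positive[OF assms(1,2), of v] by force
  qed
  then have "surj T" using linear_injective_imp_surjective[OF lin _ refl] by blast
  then obtain v where v: "(\<chi> i. L (axis i 1)) = T v" by (metis surjD)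
  have *: "g c x v w = L w" for w
    using v linear_axis_sum[OF metric_linear(1)[OF assms(1,2)], of v w] linear_axis_sum[OF assms(3), of w]
    by (simp add: T_def vec_eq_iff)
  show ?thesis
  proof (rule ex1I[of _ v])
    fix v' assume "\<forall>w. g c x v' w = L w"
    then have "T v' = T v" using * by (simp add: T_def vec_eq_iff)
    then show "v' = v" using \<open>inj T\<close> by (simp add: injD)
  qed (use * in simp)
qed

lemma gradient_inner:
  assumes "C1_manifold A u" "c \<in> A" "x \<in> fst c"
  shows "g c x (gradient g u c x) w = chart_deriv u c x w"
  using theI'[OF metric_riesz[OF assms(2,3) linear_chart_deriv[OF assms]]]
  by (simp add: gradient_def chart_deriv_def)

lemma gradient_unique:
  assumes "C1_manifold A u" "c \<in> A" "x \<in> fst c" "\<And>w. g c x v w = chart_deriv u c x w"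
  shows "v = gradient g u c x"
  using metric_riesz[OF assms(2,3) linear_chart_deriv[OF assms(1-3)]] gradient_inner[OF assms(1-3)] assms(4)
  by blast

text \<open>The transformation law of the metric makes the differential an isometry of the inner
  products at \<open>x\<close>. Positive definiteness then gives injectivity, and the dimensions
  agree.\<close>

lemma dtransition_surj:
  assumes "c \<in> A" "c' \<in> A" "x \<in> fst c \<inter> fst c'"
  shows "surj (dtransition c c' x)"
proof (rule linear_injective_imp_surjective[OF _ _ refl])
  show "linear (dtransition c c' x)" by (rule linear_dtransition[OF assms])

  from \<open>linear (dtransition c c' x)\<close> show "inj (dtransition c c' x)"
  proof (rule linear_injective_0[THEN iffD2], intro allI impI)
    fix v assume *: "dtransition c c' x v = 0"
    have "g c x v v = g c' x 0 0"
      using metric_transform[OF assms, of v v] by (simp add: *)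
    also have "\<dots> = 0"
      using linear_0[OF metric_linear(1)[OF assms(2)]] assms(3) by simp
    finally show "v = 0" using metric_positive[OF assms(1), of x v] assms(3) by force
  qed
qed

text \<open>The transformed vector represents the differential in \<open>c'\<close>: by surjectivity
  of \<open>dtransition\<close> every direction there is an image, and on images both the metric and
  the differential are given by their transformation laws.\<close>

lemma gradient_vector_field:
  assumes "C1_manifold A u"
  shows "vector_field A S (gradient g u)"
  unfolding vector_field_def
proof (intro ballI)
  fix c c' x assume c: "c \<in> A" "c' \<in> A" and "x \<in> fst c \<inter> fst c' \<inter> S"
  then have x: "x \<in> fst c \<inter> fst c'" by simp
  have "g c' x (dtransition c c' x (gradient g u c x)) w = chart_deriv u c' x w" for w
  proof -
    obtain w0 where "w = dtransition c c' x w0"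
      using dtransition_surj[OF c x] by (metis surjD)
    then show ?thesis
      using metric_transform[OF c x, of "gradient g u c x" w0] gradient_inner[OF assms c(1), of x w0]
        chart_deriv_transition[OF assms c x, of w0] x by simp
  qed
  then show "gradient g u c' x = dtransition c c' x (gradient g u c x)"
    using gradient_unique[OF assms c(2)] x by fastforce
qed

text \<open>Replaces the arbitrary chart inside \<open>ginner\<close> by one that stays fixed on a
  neighbourhood, as continuity and measurability arguments require.\<close>

lemma ginner_chart:
  assumes "vector_field A S X" "vector_field A S Y" "x \<in> S" "c \<in> A" "x \<in> fst c"
  shows "ginner A g X Y x = g c x (X c x) (Y c x)"
proof -
  let ?c = "chart_at A x"
  have x: "x \<in> fst ?c \<inter> fst c" using chart_at assms by auto
  have "X c x = dtransition ?c c x (X ?c x)" "Y c x = dtransition ?c c x (Y ?c x)"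
    using assms x chart_at(1) unfolding vector_field_def by blast+
  then show ?thesis
    using metric_transform[OF chart_at(1) assms(4) x] by (simp add: ginner_def)
qed

lemma gnorm_nonneg: "gnorm A g X x \<ge> 0"
  by (simp add: gnorm_def ginner_def metric_nonneg chart_at)

lemma ginner_Cauchy_Schwarz: "\<bar>ginner A g X Y x\<bar> \<le> gnorm A g X x * gnorm A g Y x"
  using metric_Cauchy_Schwarz chart_at unfolding gnorm_def ginner_def by blast

lemma ginner_gradient:
  assumes "vector_field A S X" "C1_manifold A u" "x \<in> S" "c \<in> A" "x \<in> fst c"
  shows "ginner A g X (gradient g u) x = chart_deriv u c x (X c x)"
  using ginner_chart[OF assms(1) gradient_vector_field[OF assms(2)] assms(3-5)]
    metric_symmetric[OF assms(4,5)] gradient_inner[OF assms(2,4,5)] by simp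

lemma gram_mult: "c \<in> A \<Longrightarrow> x \<in> fst c \<Longrightarrow> (gram g c x *v w) $ i = g c x (axis i 1) w"
  using linear_axis_sum[OF metric_linear(1), of c x "axis i 1" w]
  by (simp add: gram_def matrix_vector_mult_def mult.commute)

lemma metric_gram:
  assumes "c \<in> A" "x \<in> fst c"
  shows "g c x v w = v \<bullet> (gram g c x *v w)"
  using linear_axis_sum[OF metric_linear(2)[OF assms, of w], of v] gram_mult[OF assms, of w]
  by (simp add: inner_vec_def)

lemma det_gram_pos:
  assumes "c \<in> A" "x \<in> fst c"
  shows "det (gram g c x) > 0"
  by (rule det_pos_if_positive_definite) (use metric_gram[OF assms] metric_positive[OF assms] in metis)

lemma gram_continuous:
  assumes "c \<in> A"
  shows "continuous_on (snd c ` fst c) (\<lambda>y. gram g c (chart_inv c y) $ i $ j)"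
proof -
  have "Ck_on 0 (\<lambda>y. g c (chart_inv c y) (axis i 1) (axis j 1)) (snd c ` fst c)"
    using metric_smooth[OF assms] unfolding smooth_on_def by blast
  then show ?thesis by (simp add: gram_def)
qed

lemma metric_continuous:
  assumes "c \<in> A" "continuous_on T (\<lambda>z. \<tau> z)" "\<tau> ` T \<subseteq> snd c ` fst c" "continuous_on T v" "continuous_on T w"
  shows "continuous_on T (\<lambda>z. g c (chart_inv c (\<tau> z)) (v z) (w z))"
proof -
  have "continuous_on T (\<lambda>z. \<Sum>i\<in>UNIV. v z $ i * (\<Sum>j\<in>UNIV. gram g c (chart_inv c (\<tau> z)) $ i $ j * w z $ j))"
    by (intro continuous_intros assms(4,5)
        continuous_on_compose2[OF gram_continuous[OF assms(1)] assms(2,3)])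
  then show ?thesis
  proof (rule continuous_on_eq)
    fix z assume "z \<in> T"
    then have "chart_inv c (\<tau> z) \<in> fst c" using assms(3) chart_inv_in[OF assms(1)] by auto
    then show "(\<Sum>i\<in>UNIV. v z $ i * (\<Sum>j\<in>UNIV. gram g c (chart_inv c (\<tau> z)) $ i $ j * w z $ j)) =
        g c (chart_inv c (\<tau> z)) (v z) (w z)"
      by (simp add: metric_gram[OF assms(1)] inner_vec_def matrix_vector_mult_def)
  qed
qed

text \<open>On the compact product of the coordinate image with the unit sphere the metric has a
  positive lower bound \<open>m\<close>, which compares the Euclidean norm with the Riemannian one.
  The second bound is the Cauchy-Schwarz inequality with a bound for the lengths of the coordinate
  vectors.\<close>

lemma metric_compact_bound:
  assumes c: "c \<in> A" and L: "compact L" "L \<subseteq> fst c"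
  obtains C where "C > 0" "\<And>x v. x \<in> L \<Longrightarrow> norm v \<le> C * sqrt (g c x v v)"
    and "\<And>x v i. x \<in> L \<Longrightarrow> \<bar>g c x v (axis i 1)\<bar> \<le> C * sqrt (g c x v v)"
proof -
  define K where "K = snd c ` L"
  have K: "compact K" "K \<subseteq> snd c ` fst c"
    using chart_image_compact[OF c L(2,1)] L(2) by (auto simp: K_def)
  have inK: "snd c x \<in> K" "chart_inv c (snd c x) = x" "x \<in> fst c" if "x \<in> L" for x
    using that L(2) chart_inv_left[OF c] by (auto simp: K_def)
  define q where "q z = g c (chart_inv c (fst z)) (snd z) (snd z)" for z :: "(real ^ 'n) \<times> (real ^ 'n)"
  have "continuous_on (K \<times> sphere 0 1) q"
    unfolding q_def using K(2) by (intro metric_continuous[OF c] continuous_intros) auto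
  then have comp: "compact (q ` (K \<times> sphere 0 1))"
    by (intro compact_continuous_image compact_Times K(1) compact_sphere)
  have qpos: "q z > 0" if "z \<in> K \<times> sphere 0 1" for z
    using that K(2) chart_inv_in[OF c] unfolding q_def by (intro metric_positive[OF c]) auto
  obtain m where m: "m > 0" "\<And>z. z \<in> K \<times> sphere 0 1 \<Longrightarrow> m \<le> q z"
  proof (cases "K \<times> sphere (0::real^'n) 1 = {}")
    case True
    then show ?thesis using that[of 1] by (metis empty_iff zero_less_one)
  next
    case False
    then obtain z0 where "z0 \<in> K \<times> sphere 0 1" "\<And>z. z \<in> K \<times> sphere 0 1 \<Longrightarrow> q z0 \<le> q z"
      using compact_attains_inf[OF comp] by auto
    then show ?thesis using that[of "q z0"] qpos by blast
  qed
  have b1: "norm v \<le> 1 / sqrt m * sqrt (g c x v v)" if "x \<in> L" for x v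
  proof (cases "v = 0")
    case True
    then show ?thesis using m(1) metric_nonneg[OF c inK(3)[OF that]] by simp
  next
    case False
    have "(snd c x, v /\<^sub>R norm v) \<in> K \<times> sphere 0 1"
      using inK[OF that] False by simp
    then have "m \<le> g c x (v /\<^sub>R norm v) (v /\<^sub>R norm v)"
      using m(2) inK(2)[OF that] by (fastforce simp: q_def)
    also have "\<dots> = g c x v v / (norm v)\<^sup>2"
      by (simp add: linear_cmul[OF metric_linear(1)[OF c inK(3)[OF that]]]
          linear_cmul[OF metric_linear(2)[OF c inK(3)[OF that]]] power2_eq_square divide_inverse)
    finally have "m * (norm v)\<^sup>2 \<le> g c x v v"
      using False by (simp add: le_divide_eq)
    then have "sqrt m * norm v \<le> sqrt (g c x v v)"
      using real_sqrt_le_mono by (fastforce simp: real_sqrt_mult)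
    then show ?thesis using m(1) by (simp add: field_simps)
  qed
  have "\<exists>B. \<forall>y\<in>K. g c (chart_inv c y) (axis i 1) (axis i 1) \<le> B" for i
  proof -
    have "continuous_on K (\<lambda>y. g c (chart_inv c y) (axis i 1) (axis i 1))"
      using K(2) by (intro metric_continuous[OF c] continuous_intros) auto
    then have "bounded ((\<lambda>y. g c (chart_inv c y) (axis i 1) (axis i 1)) ` K)"
      by (intro compact_imp_bounded compact_continuous_image K(1))
    then show ?thesis by (auto simp: bounded_iff abs_le_iff)
  qed
  then obtain B where B: "\<And>i y. y \<in> K \<Longrightarrow> g c (chart_inv c y) (axis i 1) (axis i 1) \<le> B i"
    by metis
  define C where "C = max (1 / sqrt m) (Max (range (\<lambda>i. sqrt (B i))))"
  have b2: "\<bar>g c x v (axis i 1)\<bar> \<le> C * sqrt (g c x v v)" if "x \<in> L" for x v i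
  proof -
    have "\<bar>g c x v (axis i 1)\<bar> \<le> sqrt (g c x v v) * sqrt (g c x (axis i 1) (axis i 1))"
      by (rule metric_Cauchy_Schwarz[OF c inK(3)[OF that]])
    also have "\<dots> \<le> sqrt (g c x v v) * C"
    proof (rule mult_left_mono)
      have "sqrt (g c x (axis i 1) (axis i 1)) \<le> sqrt (B i)"
        using B[OF inK(1)[OF that], of i] by (simp add: inK(2)[OF that])
      also have "\<dots> \<le> Max (range (\<lambda>i. sqrt (B i)))"
        by (rule Max_ge) auto
      finally show "sqrt (g c x (axis i 1) (axis i 1)) \<le> C" by (simp add: C_def)
    qed (simp add: metric_nonneg[OF c inK(3)[OF that]])
    finally show ?thesis by (simp add: mult.commute)
  qed
  show ?thesis
  proof (rule that[of C])
    show "C > 0" using m(1) by (simp add: C_def less_max_iff_disj)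
    show "norm v \<le> C * sqrt (g c x v v)" if "x \<in> L" for x v
      using b1[OF that, of v] mult_right_mono[of "1 / sqrt m" C "sqrt (g c x v v)"]
        metric_nonneg[OF c inK(3)[OF that], of v] by (simp add: C_def)
  qed (rule b2)
qed

end

section \<open>The volume measure in charts\<close>

lemma set_borel_measurable_restrict:
  fixes f :: "'a \<Rightarrow> real"
  assumes "S \<inter> space M \<in> sets M"
  shows "set_borel_measurable M S f \<longleftrightarrow> f \<in> borel_measurable (restrict_space M S)"
  unfolding set_borel_measurable_def borel_measurable_restrict_space_iff[OF assms] ..

locale riemannian_volume_manifold = riemannian_manifold A g
  for A :: "('m::{second_countable_topology, t2_space}, 'n::finite) chart set" and g +
  fixes vol :: "'m measure"
  assumes volume: "riemannian_volume A g vol"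
begin

lemma sets_vol [measurable_cong, simp]: "sets vol = sets borel"
  using volume by (simp add: riemannian_volume_def)

lemma space_vol [simp]: "space vol = UNIV"
  using sets_eq_imp_space_eq[OF sets_vol] by simp

lemma borel_measurable_vol [simp]: "borel_measurable vol = borel_measurable borel"
  by (rule measurable_cong_sets) simp_all

definition dens :: "('m, 'n) chart \<Rightarrow> real ^ 'n \<Rightarrow> real"
  where "dens c y = sqrt (det (gram g c (chart_inv c y)))"

lemma emeasure_vol_chart:
  assumes "c \<in> A" "B \<in> sets borel" "B \<subseteq> fst c"
  shows "emeasure vol B = (\<integral>\<^sup>+y. ennreal (dens c y) * indicator (snd c ` B) y \<partial>lborel)"
  using volume assms by (simp add: riemannian_volume_def dens_def)

lemma dens_pos: "c \<in> A \<Longrightarrow> y \<in> snd c ` fst c \<Longrightarrow> dens c y > 0"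
  unfolding dens_def using det_gram_pos chart_inv_in by simp

lemma dens_continuous:
  assumes "c \<in> A"
  shows "continuous_on (snd c ` fst c) (dens c)"
  unfolding dens_def det_def by (intro continuous_intros gram_continuous[OF assms])

lemma chart_borel [measurable]: "c \<in> A \<Longrightarrow> fst c \<in> sets borel"
  and chart_image_borel [measurable]: "c \<in> A \<Longrightarrow> snd c ` fst c \<in> sets borel"
  using chart_open chart_image_open by auto

lemma chart_inv_measurable:
  assumes "c \<in> A"
  shows "chart_inv c \<in> measurable (restrict_space lborel (snd c ` fst c)) (restrict_space borel (fst c))"
proof (rule measurable_restrict_space2)
  show "chart_inv c \<in> space (restrict_space lborel (snd c ` fst c)) \<rightarrow> fst c"
    using chart_inv_in[OF assms] by (auto simp: space_restrict_space)
  have "chart_inv c \<in> borel_measurable (restrict_space borel (snd c ` fst c))"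
    by (rule borel_measurable_continuous_on_restrict[OF chart_inv_continuous[OF assms]])
  then show "chart_inv c \<in> borel_measurable (restrict_space lborel (snd c ` fst c))"
    by (simp cong: measurable_cong_sets sets_restrict_space_cong)
qed

lemma dens_measurable:
  assumes "c \<in> A"
  shows "dens c \<in> borel_measurable (restrict_space lborel (snd c ` fst c))"
  using borel_measurable_continuous_on_restrict[OF dens_continuous[OF assms]]
  by (simp cong: measurable_cong_sets sets_restrict_space_cong)

text \<open>Both measures agree on Borel subsets of the chart by the definition of the volume.
  Stated as an equality of measures, this yields the change of variables formula for all integrands
  instead of indicators alone.\<close>

lemma restrict_vol_chart:
  assumes c: "c \<in> A"
  shows "restrict_space vol (fst c) =
    distr (density (restrict_space lborel (snd c ` fst c)) (\<lambda>y. ennreal (dens c y)))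
      (restrict_space borel (fst c)) (chart_inv c)"
proof (rule measure_eqI)
  show "sets (restrict_space vol (fst c)) = sets (distr (density (restrict_space lborel (snd c ` fst c))
      (\<lambda>y. ennreal (dens c y))) (restrict_space borel (fst c)) (chart_inv c))"
    by (simp cong: sets_restrict_space_cong)
  fix B assume "B \<in> sets (restrict_space vol (fst c))"
  then have B: "B \<in> sets borel" "B \<subseteq> fst c"
    using c by (auto simp: sets_restrict_space_iff)
  let ?W = "snd c ` fst c"
  have pre: "chart_inv c -` B \<inter> ?W = snd c ` B"
    using chart_image_eq[OF c B(2)] by auto
  have B': "B \<in> sets (restrict_space borel (fst c))"
    using B c by (auto simp: sets_restrict_space_iff)
  have "emeasure (distr (density (restrict_space lborel ?W) (\<lambda>y. ennreal (dens c y)))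
      (restrict_space borel (fst c)) (chart_inv c)) B =
      emeasure (density (restrict_space lborel ?W) (\<lambda>y. ennreal (dens c y))) (snd c ` B)"
    using chart_inv_measurable[OF c] B' pre
    by (subst emeasure_distr) (auto simp: space_restrict_space)
  also have "\<dots> = (\<integral>\<^sup>+y. ennreal (dens c y) * indicator (snd c ` B) y \<partial>restrict_space lborel ?W)"
    using measurable_sets[OF chart_inv_measurable[OF c] B'] dens_measurable[OF c] pre
    by (subst emeasure_density) (auto simp: space_restrict_space)
  also have "\<dots> = (\<integral>\<^sup>+y. ennreal (dens c y) * indicator (snd c ` B) y * indicator ?W y \<partial>lborel)"
    using c by (subst nn_integral_restrict_space) auto
  also have "\<dots> = (\<integral>\<^sup>+y. ennreal (dens c y) * indicator (snd c ` B) y \<partial>lborel)"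
    using B(2) by (intro nn_integral_cong) (auto simp: indicator_def)
  also have "\<dots> = emeasure vol B"
    using emeasure_vol_chart[OF c B] by simp
  also have "\<dots> = emeasure (restrict_space vol (fst c)) B"
    using B c by (subst emeasure_restrict_space) auto
  finally show "emeasure (restrict_space vol (fst c)) B = emeasure (distr (density (restrict_space lborel ?W)
      (\<lambda>y. ennreal (dens c y))) (restrict_space borel (fst c)) (chart_inv c)) B" ..
qed

lemma nn_integral_chart:
  assumes c: "c \<in> A" and f: "f \<in> borel_measurable borel"
  shows "(\<integral>\<^sup>+x. f x * indicator (fst c) x \<partial>vol) =
    (\<integral>\<^sup>+y. ennreal (dens c y) * f (chart_inv c y) * indicator (snd c ` fst c) y \<partial>lborel)"
proof -
  let ?W = "snd c ` fst c"
  have f': "f \<in> borel_measurable (restrict_space borel (fst c))"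
    using f by (rule measurable_restrict_space1)
  have "(\<integral>\<^sup>+x. f x * indicator (fst c) x \<partial>vol) = (\<integral>\<^sup>+x. f x \<partial>restrict_space vol (fst c))"
    using c by (subst nn_integral_restrict_space) auto
  also have "\<dots> = (\<integral>\<^sup>+y. f (chart_inv c y) \<partial>density (restrict_space lborel ?W) (\<lambda>y. ennreal (dens c y)))"
    unfolding restrict_vol_chart[OF c]
    using chart_inv_measurable[OF c] f' by (subst nn_integral_distr) auto
  also have "\<dots> = (\<integral>\<^sup>+y. ennreal (dens c y) * f (chart_inv c y) \<partial>restrict_space lborel ?W)"
    using measurable_compose[OF chart_inv_measurable[OF c] f'] dens_measurable[OF c]
    by (subst nn_integral_density) auto
  also have "\<dots> = (\<integral>\<^sup>+y. ennreal (dens c y) * f (chart_inv c y) * indicator ?W y \<partial>lborel)"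
    using c by (subst nn_integral_restrict_space) auto
  finally show ?thesis .
qed

lemma AE_vol_chart:
  assumes c: "c \<in> A" and P: "AE y in lborel. y \<in> snd c ` fst c \<longrightarrow> P y"
  shows "AE x in vol. x \<in> fst c \<longrightarrow> P (snd c x)"
proof -
  obtain N where N: "N \<in> null_sets lborel" "{y \<in> space lborel. \<not> (y \<in> snd c ` fst c \<longrightarrow> P y)} \<subseteq> N"
    using P by (auto simp: eventually_ae_filter)
  define M where "M = fst c \<inter> snd c -` N"
  have Nb: "N \<in> sets borel" using N(1) by auto
  have "snd c \<in> borel_measurable (restrict_space borel (fst c))"
    by (rule borel_measurable_continuous_on_restrict[OF chart_continuous[OF c]])
  from measurable_sets[OF this Nb] have Mb: "M \<in> sets borel"
    using c by (auto simp: M_def space_restrict_space sets_restrict_space_iff Int_commute)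
  have "emeasure vol M = (\<integral>\<^sup>+y. ennreal (dens c y) * indicator (snd c ` M) y \<partial>lborel)"
    by (rule emeasure_vol_chart[OF c Mb]) (auto simp: M_def)
  also have "\<dots> = (\<integral>\<^sup>+(y::real^'n). 0 \<partial>lborel)"
  proof (rule nn_integral_cong_AE)
    show "AE y in lborel. ennreal (dens c y) * indicator (snd c ` M) y = 0"
      using AE_not_in[OF N(1)] by eventually_elim (auto simp: M_def indicator_def)
  qed
  finally have "M \<in> null_sets vol" using Mb by (auto simp: null_sets_def)
  from AE_not_in[OF this] show ?thesis
    by eventually_elim (use N(2) in \<open>auto simp: M_def\<close>)
qed

text \<open>The density is strictly positive, so a subset of the chart of volume zero has a Lebesgue
  null coordinate image.\<close>

lemma AE_lborel_chart:
  assumes c: "c \<in> A" and P: "AE x in vol. x \<in> fst c \<longrightarrow> P x"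
  shows "AE y in lborel. y \<in> snd c ` fst c \<longrightarrow> P (chart_inv c y)"
proof -
  obtain N where N: "N \<in> null_sets vol" "{x \<in> space vol. \<not> (x \<in> fst c \<longrightarrow> P x)} \<subseteq> N"
    using P by (auto simp: eventually_ae_filter)
  define M where "M = N \<inter> fst c"
  have Nb: "N \<in> sets borel" using N(1) by auto
  have Mb: "M \<in> sets borel" "M \<subseteq> fst c" using Nb c by (auto simp: M_def)
  have "emeasure vol M = 0"
    using N(1) Mb emeasure_mono[of M N vol] Nb by (auto simp: M_def)
  then have 0: "(\<integral>\<^sup>+y. ennreal (dens c y) * indicator (snd c ` M) y \<partial>lborel) = 0"
    using emeasure_vol_chart[OF c Mb] by simp
  have im: "snd c ` M = chart_inv c -` M \<inter> snd c ` fst c"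
    using chart_image_eq[OF c Mb(2)] by auto
  have "M \<in> sets (restrict_space borel (fst c))"
    using Mb c by (auto simp: sets_restrict_space_iff)
  from measurable_sets[OF chart_inv_measurable[OF c] this]
  have Ib: "snd c ` M \<in> sets borel"
    using c im by (auto simp: space_restrict_space sets_restrict_space_iff)
  have "(\<lambda>y. indicator (snd c ` fst c) y *\<^sub>R dens c y) \<in> borel_measurable lborel"
    using dens_measurable[OF c] c by (subst (asm) borel_measurable_restrict_space_iff) auto
  then have "(\<lambda>y. ennreal (indicator (snd c ` fst c) y *\<^sub>R dens c y) * indicator (snd c ` M) y) \<in> borel_measurable lborel"
    using Ib by measurable
  moreover have "ennreal (indicator (snd c ` fst c) y *\<^sub>R dens c y) * indicator (snd c ` M) y =
      ennreal (dens c y) * indicator (snd c ` M) y" for y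
    using im by (auto simp: indicator_def)
  ultimately have "AE y in lborel. ennreal (dens c y) * indicator (snd c ` M) y = 0"
    using 0 by (subst (asm) nn_integral_0_iff_AE) auto
  then show ?thesis
  proof eventually_elim
    case (elim y)
    show ?case
    proof (rule impI, rule ccontr)
      assume y: "y \<in> snd c ` fst c" "\<not> P (chart_inv c y)"
      then have "chart_inv c y \<in> M"
        using N(2) chart_inv_in[OF c] by (auto simp: M_def)
      then have "y \<in> snd c ` M" using im y by auto
      then show False using elim dens_pos[OF c y(1)] by simp
    qed
  qed
qed

section \<open>Transfer of measurability and integrability through charts\<close>

lemma chart_measurable_vol:
  fixes \<Theta> :: "real ^ 'n \<Rightarrow> real"
  assumes c: "c \<in> A" and L: "L \<in> sets borel" "L \<subseteq> fst c" and m: "set_borel_measurable borel K \<Theta>"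
    and K: "snd c ` L \<subseteq> K"
  shows "set_borel_measurable vol L (\<lambda>x. \<Theta> (snd c x))"
proof -
  have "snd c \<in> borel_measurable (restrict_space borel L)"
    by (rule borel_measurable_continuous_on_restrict[OF continuous_on_subset[OF chart_continuous[OF c] L(2)]])
  then have "(\<lambda>x. indicator K (snd c x) *\<^sub>R \<Theta> (snd c x)) \<in> borel_measurable (restrict_space borel L)"
    using m unfolding set_borel_measurable_def by (rule measurable_compose)
  moreover have "(\<lambda>x. indicator K (snd c x) *\<^sub>R \<Theta> (snd c x)) \<in> borel_measurable (restrict_space borel L)
      \<longleftrightarrow> (\<lambda>x. \<Theta> (snd c x)) \<in> borel_measurable (restrict_space borel L)"
    by (rule measurable_cong) (use K in \<open>auto simp: space_restrict_space\<close>)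
  ultimately show ?thesis
    using L(1) by (subst set_borel_measurable_restrict) (simp_all cong: measurable_cong_sets sets_restrict_space_cong)
qed

lemma chart_measurable_lborel:
  fixes \<Theta> :: "'m \<Rightarrow> real"
  assumes c: "c \<in> A" and K: "K \<in> sets borel" "K \<subseteq> snd c ` fst c" and m: "set_borel_measurable vol L \<Theta>"
    and L: "chart_inv c ` K \<subseteq> L"
  shows "set_borel_measurable lborel K (\<lambda>y. \<Theta> (chart_inv c y))"
proof -
  have "chart_inv c \<in> borel_measurable (restrict_space borel K)"
    by (rule borel_measurable_continuous_on_restrict[OF continuous_on_subset[OF chart_inv_continuous[OF c] K(2)]])
  then have "(\<lambda>y. indicator L (chart_inv c y) *\<^sub>R \<Theta> (chart_inv c y)) \<in> borel_measurable (restrict_space borel K)"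
    using m unfolding set_borel_measurable_def borel_measurable_vol by (rule measurable_compose)
  moreover have "(\<lambda>y. indicator L (chart_inv c y) *\<^sub>R \<Theta> (chart_inv c y)) \<in> borel_measurable (restrict_space borel K)
      \<longleftrightarrow> (\<lambda>y. \<Theta> (chart_inv c y)) \<in> borel_measurable (restrict_space borel K)"
    by (rule measurable_cong) (use L in \<open>auto simp: space_restrict_space\<close>)
  ultimately show ?thesis
    using K(1) by (subst set_borel_measurable_restrict) (simp_all cong: measurable_cong_sets sets_restrict_space_cong)
qed

lemma dens_compact_bounds:
  assumes c: "c \<in> A" and K: "compact K" "K \<subseteq> snd c ` fst c"
  obtains m M where "m > 0" "M > 0" "\<And>y. y \<in> K \<Longrightarrow> m \<le> dens c y" "\<And>y. y \<in> K \<Longrightarrow> dens c y \<le> M"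
proof (cases "K = {}")
  case True
  then show ?thesis using that[of 1 1] by simp
next
  case False
  have cont: "continuous_on K (dens c)"
    by (rule continuous_on_subset[OF dens_continuous[OF c] K(2)])
  obtain a where a: "a \<in> K" "\<And>y. y \<in> K \<Longrightarrow> dens c a \<le> dens c y"
    using continuous_attains_inf[OF K(1) False cont] by auto
  obtain b where b: "b \<in> K" "\<And>y. y \<in> K \<Longrightarrow> dens c y \<le> dens c b"
    using continuous_attains_sup[OF K(1) False cont] by auto
  show ?thesis
    using that[of "dens c a" "dens c b"] a b dens_pos[OF c] K(2) by blast
qed

text \<open>The constant is an upper bound for the density on the compact coordinate image. It is
  chosen before \<open>\<Theta>\<close>, so L^1 convergence in coordinates implies L^1 convergence
  on the manifold.\<close>

lemma chart_integrable_vol: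
  assumes c: "c \<in> A" and L: "compact L" "L \<subseteq> fst c"
  obtains C where "C > 0"
    and "\<And>\<Theta> :: real ^ 'n \<Rightarrow> real. set_integrable lborel (snd c ` L) \<Theta> \<Longrightarrow>
      set_integrable vol L (\<lambda>x. \<Theta> (snd c x)) \<and>
      (LINT x:L|vol. \<bar>\<Theta> (snd c x)\<bar>) \<le> C * (LINT y:snd c ` L|lborel. \<bar>\<Theta> y\<bar>)"
proof -
  define K where "K = snd c ` L"
  have K: "compact K" "K \<subseteq> snd c ` fst c"
    using chart_image_compact[OF c L(2,1)] L(2) by (auto simp: K_def)
  obtain m M where "m > 0" and M: "M > 0" and "\<And>y. y \<in> K \<Longrightarrow> m \<le> dens c y"
    and M2: "\<And>y. y \<in> K \<Longrightarrow> dens c y \<le> M"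
    using dens_compact_bounds[OF c K] by metis
  note M = M M2
  have Lb: "L \<in> sets borel" using L(1) by (simp add: compact_imp_closed)
  have "set_integrable vol L (\<lambda>x. \<Theta> (snd c x)) \<and>
      (LINT x:L|vol. \<bar>\<Theta> (snd c x)\<bar>) \<le> M * (LINT y:K|lborel. \<bar>\<Theta> y\<bar>)"
    if \<Theta>: "set_integrable lborel K \<Theta>" for \<Theta> :: "real ^ 'n \<Rightarrow> real"
  proof -
    have "set_borel_measurable borel K \<Theta>"
      using \<Theta> by (auto simp: set_borel_measurable_def set_integrable_def)
    from chart_measurable_vol[OF c Lb L(2) this]
    have meas: "(\<lambda>x. indicator L x *\<^sub>R \<Theta> (snd c x)) \<in> borel_measurable borel"
      by (simp add: K_def set_borel_measurable_def)
    have i: "integrable lborel (\<lambda>y. M * \<bar>indicator K y *\<^sub>R \<Theta> y\<bar>)"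
      using \<Theta> by (auto simp: set_integrable_def)
    have "(\<integral>\<^sup>+x. ennreal \<bar>indicator L x *\<^sub>R \<Theta> (snd c x)\<bar> \<partial>vol) =
        (\<integral>\<^sup>+x. ennreal \<bar>indicator L x *\<^sub>R \<Theta> (snd c x)\<bar> * indicator (fst c) x \<partial>vol)"
      using L(2) by (intro nn_integral_cong) (auto simp: indicator_def)
    also have "\<dots> = (\<integral>\<^sup>+y. ennreal (dens c y) * ennreal \<bar>indicator L (chart_inv c y) *\<^sub>R \<Theta> (snd c (chart_inv c y))\<bar>
        * indicator (snd c ` fst c) y \<partial>lborel)"
      by (rule nn_integral_chart[OF c measurable_compose[OF borel_measurable_abs[OF meas] measurable_ennreal]])
    also have "\<dots> \<le> (\<integral>\<^sup>+y. ennreal (M * \<bar>indicator K y *\<^sub>R \<Theta> y\<bar>) \<partial>lborel)"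
    proof (rule nn_integral_mono)
      fix y
      show "ennreal (dens c y) * ennreal \<bar>indicator L (chart_inv c y) *\<^sub>R \<Theta> (snd c (chart_inv c y))\<bar>
        * indicator (snd c ` fst c) y \<le> ennreal (M * \<bar>indicator K y *\<^sub>R \<Theta> y\<bar>)"
      proof (cases "y \<in> snd c ` fst c \<and> chart_inv c y \<in> L")
        case True
        then have y2: "snd c (chart_inv c y) = y"
          using chart_inv_right[OF c] by blast
        moreover have "snd c (chart_inv c y) \<in> K"
          unfolding K_def using True by blast
        ultimately have y: "y \<in> K" "snd c (chart_inv c y) = y" by simp_all
        have "ennreal (dens c y) * ennreal \<bar>\<Theta> y\<bar> \<le> ennreal M * ennreal \<bar>\<Theta> y\<bar>"
          by (intro mult_right_mono ennreal_leI M(2) y(1)) simp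
        then show ?thesis
          using True y M(1) by (simp add: ennreal_mult)
      qed (auto simp: indicator_def)
    qed
    also have "\<dots> = ennreal (LINT y|lborel. M * \<bar>indicator K y *\<^sub>R \<Theta> y\<bar>)"
      using i M(1) by (intro nn_integral_eq_integral) auto
    finally have le: "(\<integral>\<^sup>+x. ennreal \<bar>indicator L x *\<^sub>R \<Theta> (snd c x)\<bar> \<partial>vol)
        \<le> ennreal (LINT y|lborel. M * \<bar>indicator K y *\<^sub>R \<Theta> y\<bar>)" .
    have int: "integrable vol (\<lambda>x. indicator L x *\<^sub>R \<Theta> (snd c x))"
    proof (rule integrableI_bounded)
      show "(\<integral>\<^sup>+x. ennreal (norm (indicator L x *\<^sub>R \<Theta> (snd c x))) \<partial>vol) < \<infinity>"
        using le_less_trans[OF le] by simp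
    qed (use meas in simp)
    have "ennreal (LINT x|vol. \<bar>indicator L x *\<^sub>R \<Theta> (snd c x)\<bar>) =
        (\<integral>\<^sup>+x. ennreal \<bar>indicator L x *\<^sub>R \<Theta> (snd c x)\<bar> \<partial>vol)"
      using int by (intro nn_integral_eq_integral[symmetric]) auto
    with le have "(LINT x|vol. \<bar>indicator L x *\<^sub>R \<Theta> (snd c x)\<bar>) \<le> (LINT y|lborel. M * \<bar>indicator K y *\<^sub>R \<Theta> y\<bar>)"
    proof -
      have "0 \<le> (LINT y|lborel. M * \<bar>indicator K y *\<^sub>R \<Theta> y\<bar>)"
        using M(1) by (intro Bochner_Integration.integral_nonneg) simp
      with le \<open>ennreal _ = _\<close> show ?thesis by (metis ennreal_le_iff)
    qed
    then have "(LINT x:L|vol. \<bar>\<Theta> (snd c x)\<bar>) \<le> M * (LINT y:K|lborel. \<bar>\<Theta> y\<bar>)"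
      by (simp add: set_lebesgue_integral_def abs_mult)
    with int show ?thesis by (simp add: set_integrable_def)
  qed
  with M(1) show ?thesis using that unfolding K_def by blast
qed

text \<open>Integrability returns to coordinates because the density has a positive lower bound on
  \<open>K\<close>.\<close>

lemma chart_integrable_lborel:
  fixes \<Theta> :: "'m \<Rightarrow> real"
  assumes c: "c \<in> A" and K: "compact K" "K \<subseteq> snd c ` fst c" and \<Theta>: "set_integrable vol (chart_inv c ` K) \<Theta>"
  shows "set_integrable lborel K (\<lambda>y. \<Theta> (chart_inv c y))"
proof -
  define L where "L = chart_inv c ` K"
  have L: "compact L" "L \<subseteq> fst c"
    using chart_inv_image_compact[OF c K(2,1)] K(2) chart_inv_in[OF c] by (auto simp: L_def)
  obtain m M where m: "m > 0" "\<And>y. y \<in> K \<Longrightarrow> m \<le> dens c y"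
    using dens_compact_bounds[OF c K] by metis
  have Kb: "K \<in> sets borel" using K(1) by (simp add: compact_imp_closed)
  have mL: "(\<lambda>x. indicator L x *\<^sub>R \<Theta> x) \<in> borel_measurable borel"
    using \<Theta> by (auto simp: set_integrable_def L_def dest: borel_measurable_integrable)
  then have meas: "(\<lambda>y. indicator K y *\<^sub>R \<Theta> (chart_inv c y)) \<in> borel_measurable lborel"
    using chart_measurable_lborel[OF c Kb K(2), of L \<Theta>] by (simp add: L_def set_borel_measurable_def)
  have "(\<integral>\<^sup>+y. ennreal \<bar>m * (indicator K y *\<^sub>R \<Theta> (chart_inv c y))\<bar> \<partial>lborel) \<le>
      (\<integral>\<^sup>+y. ennreal (dens c y) * ennreal \<bar>indicator L (chart_inv c y) *\<^sub>R \<Theta> (chart_inv c y)\<bar>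
        * indicator (snd c ` fst c) y \<partial>lborel)"
  proof (rule nn_integral_mono)
    fix y
    show "ennreal \<bar>m * (indicator K y *\<^sub>R \<Theta> (chart_inv c y))\<bar> \<le>
      ennreal (dens c y) * ennreal \<bar>indicator L (chart_inv c y) *\<^sub>R \<Theta> (chart_inv c y)\<bar> * indicator (snd c ` fst c) y"
    proof (cases "y \<in> K")
      case True
      then have "y \<in> snd c ` fst c" "chart_inv c y \<in> L" using K(2) by (auto simp: L_def)
      moreover have "ennreal m * ennreal \<bar>\<Theta> (chart_inv c y)\<bar> \<le> ennreal (dens c y) * ennreal \<bar>\<Theta> (chart_inv c y)\<bar>"
        by (intro mult_right_mono ennreal_leI m(2) True) simp
      ultimately show ?thesis using True m(1) by (simp add: abs_mult ennreal_mult)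
    qed simp
  qed
  also have "\<dots> = (\<integral>\<^sup>+x. ennreal \<bar>indicator L x *\<^sub>R \<Theta> x\<bar> * indicator (fst c) x \<partial>vol)"
    by (rule nn_integral_chart[OF c measurable_compose[OF borel_measurable_abs[OF mL] measurable_ennreal], symmetric])
  also have "\<dots> \<le> (\<integral>\<^sup>+x. ennreal \<bar>indicator L x *\<^sub>R \<Theta> x\<bar> \<partial>vol)"
    by (intro nn_integral_mono) (auto simp: indicator_def)
  also have "\<dots> < \<infinity>"
    using \<Theta> unfolding set_integrable_def integrable_iff_bounded L_def by simp
  finally have "integrable lborel (\<lambda>y. m * (indicator K y *\<^sub>R \<Theta> (chart_inv c y)))"
    using meas by (intro integrableI_bounded) auto
  then show ?thesis
    using m(1) by (simp add: set_integrable_def)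
qed

lemma chart_nbhd:
  assumes "open \<Omega>" "x \<in> \<Omega>"
  obtains c N L where "c \<in> A" "open N" "x \<in> N" "N \<subseteq> L" "compact L" "L \<subseteq> fst c \<inter> \<Omega>"
proof -
  obtain c where c: "c \<in> A" "x \<in> fst c" using charts_cover by blast
  have "open (snd c ` (fst c \<inter> \<Omega>))" by (rule chart_image_Int_open[OF c(1) assms(1)])
  then obtain r where r: "r > 0" "cball (snd c x) r \<subseteq> snd c ` (fst c \<inter> \<Omega>)"
    using c assms(2) open_contains_cball by blast
  have sub: "cball (snd c x) r \<subseteq> snd c ` fst c" "ball (snd c x) r \<subseteq> snd c ` fst c"
    using r by (auto dest!: subsetD[OF r(2)] intro: less_imp_le simp: subset_eq)
  show ?thesis
  proof (rule that[OF c(1)])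
    show "open (chart_inv c ` ball (snd c x) r)"
      by (rule chart_inv_image_open[OF c(1) sub(2)]) simp
    show "x \<in> chart_inv c ` ball (snd c x) r"
      using r(1) chart_inv_left[OF c] by (auto intro!: image_eqI[of x _ "snd c x"])
    show "chart_inv c ` ball (snd c x) r \<subseteq> chart_inv c ` cball (snd c x) r"
      by (intro image_mono ball_subset_cball)
    show "compact (chart_inv c ` cball (snd c x) r)"
      by (rule chart_inv_image_compact[OF c(1) sub(1)]) simp
    show "chart_inv c ` cball (snd c x) r \<subseteq> fst c \<inter> \<Omega>"
    proof
      fix z assume "z \<in> chart_inv c ` cball (snd c x) r"
      then obtain w where "w \<in> fst c \<inter> \<Omega>" "z = chart_inv c (snd c w)" using r(2) by auto
      then show "z \<in> fst c \<inter> \<Omega>" using chart_inv_left[OF c(1), of w] by auto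
    qed
  qed
qed

text \<open>Every point has a neighbourhood inside a compact subset of one chart, which has finite
  volume by \<open>chart_integrable_vol\<close>; finitely many such neighbourhoods cover.\<close>

lemma emeasure_vol_compact:
  assumes "compact K"
  shows "emeasure vol K < \<infinity>"
proof -
  have "\<exists>N. open N \<and> x \<in> N \<and> emeasure vol N < \<infinity>" for x
  proof -
    obtain c N L where cNL: "c \<in> A" "open N" "x \<in> N" "N \<subseteq> L" "compact L" "L \<subseteq> fst c \<inter> UNIV"
      using chart_nbhd[OF open_UNIV UNIV_I[of x]] by metis
    have L: "L \<subseteq> fst c" "L \<in> sets borel" using cNL by (auto simp: compact_imp_closed)
    have "integrable lborel (indicator (snd c ` L) :: real ^ 'n \<Rightarrow> real)"
      using chart_image_compact[OF cNL(1) L(1) cNL(5)] emeasure_compact_finite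
      by (intro integrable_real_indicator) (auto simp: compact_imp_closed)
    then have "set_integrable lborel (snd c ` L) (\<lambda>_. 1 :: real)"
      by (simp add: set_integrable_def)
    then have 1: "set_integrable vol L (\<lambda>_. 1 :: real)"
    proof (rule_tac chart_integrable_vol[OF cNL(1,5) L(1)], goal_cases)
      case (1 C)
      from 1(3)[OF 1(1)] show ?case by simp
    qed
    have "emeasure vol L < \<infinity>"
      using 1 L(2) by (simp add: set_integrable_def integrable_indicator_iff)
    moreover have "emeasure vol N \<le> emeasure vol L"
      by (rule emeasure_mono[OF cNL(4)]) (use L(2) in simp)
    ultimately have "emeasure vol N < \<infinity>"
      by (rule le_less_trans[rotated])
    then show ?thesis using cNL by blast
  qed
  then obtain N where N: "\<And>x. open (N x)" "\<And>x. x \<in> N x" "\<And>x. emeasure vol (N x) < \<infinity>"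
    by metis
  obtain D where D: "D \<subseteq> K" "finite D" "K \<subseteq> (\<Union>x\<in>D. N x)"
    using compactE_image[OF assms, of K N] N by blast
  have "emeasure vol K \<le> emeasure vol (\<Union>x\<in>D. N x)"
    using D(3) N(1) by (intro emeasure_mono) (auto intro!: borel_open open_UN)
  also have "\<dots> \<le> (\<Sum>x\<in>D. emeasure vol (N x))"
    using D(2) N(1) by (intro emeasure_subadditive_finite) auto
  also have "\<dots> < \<infinity>"
    using D(2) by (induction D rule: finite_induct) (use N(3) in auto)
  finally show ?thesis .
qed

text \<open>Countably many of the neighbourhoods suffice by Lindelof's theorem. The complement of
  \<Omega>, where the truncated function is 0, completes them to a countable cover of the
  space.\<close>

lemma set_borel_measurable_open_local:
  fixes f :: "'m \<Rightarrow> real"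
  assumes "open \<Omega>" and loc: "\<And>x. x \<in> \<Omega> \<Longrightarrow> \<exists>N. open N \<and> x \<in> N \<and> set_borel_measurable vol N f"
  shows "set_borel_measurable vol \<Omega> f"
proof -
  define \<F> where "\<F> = {N. open N \<and> set_borel_measurable vol N f}"
  obtain \<G> where \<G>: "\<G> \<subseteq> \<F>" "countable \<G>" "\<Union>\<G> = \<Union>\<F>"
    using Lindelof[of \<F>] by (auto simp: \<F>_def)
  have cov: "\<Omega> \<subseteq> \<Union>\<G>" unfolding \<G>(3) using loc by (fastforce simp: \<F>_def)
  have "(\<lambda>x. indicator \<Omega> x *\<^sub>R f x) \<in> borel_measurable borel"
  proof (rule measurable_piecewise_restrict[of "insert (- \<Omega>) \<G>"])
    show "countable (insert (- \<Omega>) \<G>)" using \<G>(2) by simp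
    show "N \<inter> space borel \<in> sets borel" if "N \<in> insert (- \<Omega>) \<G>" for N
      using that assms(1) \<G>(1) by (auto simp: \<F>_def)
    show "space borel \<subseteq> \<Union> (insert (- \<Omega>) \<G>)" using cov by auto
    fix N assume N: "N \<in> insert (- \<Omega>) \<G>"
    show "(\<lambda>x. indicator \<Omega> x *\<^sub>R f x) \<in> borel_measurable (restrict_space borel N)"
    proof (cases "N = - \<Omega>")
      case True
      have "(\<lambda>x. indicator \<Omega> x *\<^sub>R f x) \<in> borel_measurable (restrict_space borel N)
          \<longleftrightarrow> (\<lambda>x. 0 :: real) \<in> borel_measurable (restrict_space borel N)"
        by (rule measurable_cong) (use True in \<open>auto simp: space_restrict_space\<close>)
      then show ?thesis by simp
    next
      case False
      then have "open N" "set_borel_measurable vol N f" using N \<G>(1) by (auto simp: \<F>_def)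
      then have "f \<in> borel_measurable (restrict_space vol N)"
        by (subst (asm) set_borel_measurable_restrict) auto
      then have "f \<in> borel_measurable (restrict_space borel N)"
        by (simp cong: measurable_cong_sets sets_restrict_space_cong)
      moreover have "(indicator \<Omega> :: 'm \<Rightarrow> real) \<in> borel_measurable (restrict_space borel N)"
        using assms(1) by (intro measurable_restrict_space1) auto
      ultimately show ?thesis by (rule borel_measurable_scaleR[rotated])
    qed
  qed
  then show ?thesis by (simp add: set_borel_measurable_def)
qed

lemma set_integrable_compact_support:
  fixes f :: "'m \<Rightarrow> real"
  assumes m: "set_borel_measurable vol \<Omega> f" and K: "compact K" "\<And>x. x \<in> \<Omega> \<Longrightarrow> x \<notin> K \<Longrightarrow> f x = 0"
    and B: "AE x in vol. x \<in> \<Omega> \<longrightarrow> \<bar>f x\<bar> \<le> B"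
  shows "set_integrable vol \<Omega> f"
  unfolding set_integrable_def
proof (rule Bochner_Integration.integrable_bound)
  show "integrable vol (\<lambda>x. indicator K x * B)"
    using emeasure_vol_compact[OF K(1)] K(1)
    by (intro integrable_mult_left integrable_real_indicator) (auto simp: compact_imp_closed)
  show "(\<lambda>x. indicator \<Omega> x *\<^sub>R f x) \<in> borel_measurable vol"
    using m by (simp add: set_borel_measurable_def)
  show "AE x in vol. norm (indicator \<Omega> x *\<^sub>R f x) \<le> norm (indicator K x * B)"
    using B
  proof eventually_elim
    case (elim x)
    then show ?case using K(2)[of x] by (cases "x \<in> \<Omega>"; cases "x \<in> K") auto
  qed
qed

end

section \<open>Test functions and measurability\<close>

lemma continuous_on_det:
  fixes M :: "'a::topological_space \<Rightarrow> real ^ 'n ^ 'n::finite"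
  assumes "\<And>i j. continuous_on S (\<lambda>x. M x $ i $ j)"
  shows "continuous_on S (\<lambda>x. det (M x))"
  unfolding det_def by (intro continuous_intros assms)

lemma borel_measurable_det:
  fixes M :: "'a \<Rightarrow> real ^ 'n ^ 'n::finite"
  assumes [measurable]: "\<And>i j. (\<lambda>x. M x $ i $ j) \<in> borel_measurable N"
  shows "(\<lambda>x. det (M x)) \<in> borel_measurable N"
  unfolding det_def by measurable

text \<open>The zero branch is explicit because \<open>snd c\<close> takes arbitrary values outside
  the domain of the chart.\<close>

definition lift :: "('m, 'n::finite) chart \<Rightarrow> (real ^ 'n \<Rightarrow> real) \<Rightarrow> 'm \<Rightarrow> real"
  where "lift c \<psi> x = (if x \<in> fst c then \<psi> (snd c x) else 0)"

text \<open>In another chart \<open>c'\<close> the function is a composition with the transition on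
  the overlap, and 0 off the compact set \<open>L\<close>. These two open sets cover the chart
  because \<open>L\<close> lies in the domain of \<open>c\<close>.\<close>

lemma (in smooth_manifold) lift_C1_0:
  assumes c: "c \<in> A" and \<Omega>: "open \<Omega>" and \<psi>: "\<psi> \<in> C1_0_euclidean (snd c ` (fst c \<inter> \<Omega>))"
  shows "lift c \<psi> \<in> C1_0 A \<Omega>"
    and "\<And>x. x \<notin> chart_inv c ` closure {y. \<psi> y \<noteq> 0} \<Longrightarrow> lift c \<psi> x = 0"
proof -
  define K where "K = closure {y. \<psi> y \<noteq> 0}"
  note \<psi>C = C1_0_euclideanD[OF \<psi>, folded K_def]
  have KW: "K \<subseteq> snd c ` fst c" using \<psi>C(3) by auto
  define L where "L = chart_inv c ` K"
  have L: "compact L" unfolding L_def by (rule chart_inv_image_compact[OF c KW \<psi>C(2)])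
  have LU: "L \<subseteq> fst c \<inter> \<Omega>"
  proof
    fix x assume "x \<in> L"
    then obtain z where "z \<in> fst c \<inter> \<Omega>" "x = chart_inv c (snd c z)"
      using \<psi>C(3) by (auto simp: L_def)
    then show "x \<in> fst c \<inter> \<Omega>" using chart_inv_left[OF c, of z] by auto
  qed
  show zero: "lift c \<psi> x = 0" if "x \<notin> chart_inv c ` closure {y. \<psi> y \<noteq> 0}" for x
  proof (rule ccontr)
    assume "lift c \<psi> x \<noteq> 0"
    then have "x \<in> fst c" "\<psi> (snd c x) \<noteq> 0" by (auto simp: lift_def split: if_splits)
    then have "snd c x \<in> K" using closure_subset[of "{y. \<psi> y \<noteq> 0}"] by (auto simp: K_def)
    then have "chart_inv c (snd c x) \<in> L" by (auto simp: L_def)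
    then show False using that chart_inv_left[OF c \<open>x \<in> fst c\<close>] by (simp add: L_def K_def)
  qed
  have Lcl: "closed L" using L by (rule compact_imp_closed)
  have supp: "closure {x. lift c \<psi> x \<noteq> 0} \<subseteq> L"
    by (rule closure_minimal[OF _ Lcl]) (use zero in \<open>auto simp: L_def K_def\<close>)
  have "Ck_on 1 (lift c \<psi> \<circ> chart_inv c') (snd c' ` fst c')" if c': "c' \<in> A" for c'
  proof -
    have 1: "Ck_on 1 (lift c \<psi> \<circ> chart_inv c') (snd c' ` (fst c' \<inter> fst c))"
    proof (rule Ck_on_1_cong)
      show "Ck_on 1 (\<lambda>y. \<psi> (transition c' c y)) (snd c' ` (fst c' \<inter> fst c))"
        by (rule Ck_on_1_compose[OF \<psi>C(1) transition_Ck_on_1[OF c' c]]) simp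
      show "open (snd c' ` (fst c' \<inter> fst c))"
        by (rule chart_image_Int_open[OF c' chart_open[OF c]])
      show "\<psi> (transition c' c y) = (lift c \<psi> \<circ> chart_inv c') y"
        if y: "y \<in> snd c' ` (fst c' \<inter> fst c)" for y
      proof -
        obtain z where "z \<in> fst c'" "z \<in> fst c" "y = snd c' z" using y by blast
        then show ?thesis using chart_inv_left[OF c', of z] by (simp add: transition_def lift_def)
      qed
    qed
    have 2: "Ck_on 1 (lift c \<psi> \<circ> chart_inv c') (snd c' ` (fst c' \<inter> - L))"
    proof (rule Ck_on_1_cong[OF Ck_on_1_const[of 0]])
      show "open (snd c' ` (fst c' \<inter> - L))"
        by (rule chart_image_Int_open[OF c']) (use Lcl in auto)
      show "0 = (lift c \<psi> \<circ> chart_inv c') y" if y: "y \<in> snd c' ` (fst c' \<inter> - L)" for y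
      proof -
        obtain z where "z \<in> fst c'" "z \<notin> L" "y = snd c' z" using y by blast
        then show ?thesis using chart_inv_left[OF c', of z] zero[of z] by (simp add: L_def K_def)
      qed
    qed
    have "snd c' ` (fst c' \<inter> fst c) \<union> snd c' ` (fst c' \<inter> - L) = snd c' ` fst c'"
      using LU by auto
    moreover have "Ck_on 1 (lift c \<psi> \<circ> chart_inv c') (snd c' ` (fst c' \<inter> fst c) \<union> snd c' ` (fst c' \<inter> - L))"
      by (rule Ck_on_1_Un[OF 1 2 chart_image_Int_open[OF c' chart_open[OF c]] chart_image_Int_open[OF c']])
        (use Lcl in auto)
    ultimately show ?thesis by metis
  qed
  moreover have "compact (closure {x. lift c \<psi> x \<noteq> 0})"
    using compact_Int_closed[OF L closed_closure, of "{x. lift c \<psi> x \<noteq> 0}"] supp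
    by (simp add: inf.absorb2)
  moreover have "closure {x. lift c \<psi> x \<noteq> 0} \<subseteq> \<Omega>" using supp LU by auto
  ultimately show "lift c \<psi> \<in> C1_0 A \<Omega>"
    unfolding C1_0_def by blast
qed

lemma (in smooth_manifold) lift_chart_deriv:
  assumes c: "c \<in> A" and x: "x \<in> fst c" and \<psi>: "Ck_on 1 \<psi> UNIV"
  shows "chart_deriv (lift c \<psi>) c x = frechet_derivative \<psi> (at (snd c x))"
proof -
  have "((lift c \<psi> \<circ> chart_inv c) has_derivative frechet_derivative \<psi> (at (snd c x))) (at (snd c x))"
  proof (rule has_derivative_transform_within_open[OF Ck_on_1_has_derivative[OF \<psi> UNIV_I] chart_image_open[OF c]])
    show "snd c x \<in> snd c ` fst c" using x by simp
    show "\<psi> y = (lift c \<psi> \<circ> chart_inv c) y" if "y \<in> snd c ` fst c" for y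
      using chart_inv_in[OF c that] chart_inv_right[OF c that] by (simp add: lift_def)
  qed
  then show ?thesis unfolding chart_deriv_def by (rule frechet_derivative_at[symmetric])
qed

lemma (in smooth_manifold) chart_deriv_zero_open:
  assumes c: "c \<in> A" and x: "x \<in> fst c" and N: "open N" "x \<in> N" and zero: "\<And>y. y \<in> N \<Longrightarrow> u y = 0"
  shows "chart_deriv u c x = (\<lambda>v. 0)"
  unfolding chart_deriv_def
proof (rule frechet_derivative_zero_open)
  show "open (snd c ` (fst c \<inter> N))" by (rule chart_image_Int_open[OF c N(1)])
  show "snd c x \<in> snd c ` (fst c \<inter> N)" using x N by auto
  show "(u \<circ> chart_inv c) y = 0" if y: "y \<in> snd c ` (fst c \<inter> N)" for y
  proof -
    obtain z where "z \<in> fst c" "z \<in> N" "y = snd c z" using y by blast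
    then show ?thesis using chart_inv_left[OF c, of z] zero[of z] by simp
  qed
qed

lemma (in smooth_manifold) chart_deriv_continuous:
  assumes "C1_manifold A u" "c \<in> A"
  shows "continuous_on (fst c) (\<lambda>x. chart_deriv u c x v)"
proof -
  have "Ck_on 1 (u \<circ> chart_inv c) (snd c ` fst c)"
    using assms unfolding C1_manifold_def by blast
  from Ck_on_1_continuous_derivative[OF this]
  show ?thesis
    unfolding chart_deriv_def by (rule continuous_on_compose2[OF _ chart_continuous[OF assms(2)]]) simp
qed

section \<open>Regularity of gradients and calculus of test functions\<close>

context riemannian_manifold
begin

text \<open>Cramer's rule for the Gram matrix gives the components of a vector as rational functions
  of its covector components and the metric coefficients. Continuity and measurability thus pass
  from differentials to the gradients that represent them.\<close>

lemma metric_cramer: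
  assumes "c \<in> A" "x \<in> fst c"
  shows "v $ k = det (\<chi> i j. if j = k then g c x v (axis i 1) else gram g c x $ i $ j) / det (gram g c x)"
proof -
  have "gram g c x *v v = (\<chi> i. g c x v (axis i 1))"
    using gram_mult[OF assms, of v] metric_symmetric[OF assms] by (simp add: vec_eq_iff)
  then have "v = (\<chi> k. det (\<chi> i j. if j = k then (\<chi> i. g c x v (axis i 1)) $ i else gram g c x $ i $ j) / det (gram g c x))"
    using cramer[of "gram g c x" v] det_gram_pos[OF assms] by (metis less_irrefl)
  then have "v $ k = (\<chi> k. det (\<chi> i j. if j = k then (\<chi> i. g c x v (axis i 1)) $ i else gram g c x $ i $ j) / det (gram g c x)) $ k"
    by (rule arg_cong)
  then show ?thesis by (simp cong: if_cong)
qed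

lemma gram_continuous_manifold:
  assumes "c \<in> A"
  shows "continuous_on (fst c) (\<lambda>x. gram g c x $ i $ j)"
proof -
  have "continuous_on (fst c) (\<lambda>x. gram g c (chart_inv c (snd c x)) $ i $ j)"
    by (rule continuous_on_compose2[OF gram_continuous[OF assms] chart_continuous[OF assms]]) simp
  then show ?thesis
    by (rule continuous_on_eq) (simp add: chart_inv_left[OF assms])
qed

lemma gradient_component_continuous:
  assumes u: "C1_manifold A u" and c: "c \<in> A"
  shows "continuous_on (fst c) (\<lambda>x. gradient g u c x $ k)"
proof -
  have "continuous_on (fst c) (\<lambda>x. det (\<chi> i j. if j = k then chart_deriv u c x (axis i 1) else gram g c x $ i $ j) /
      det (gram g c x))"
  proof (intro continuous_on_divide continuous_on_det ballI)
    show "continuous_on (fst c) (\<lambda>x. (\<chi> i j. if j = k then chart_deriv u c x (axis i 1) else gram g c x $ i $ j) $ i $ j)" for i j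
      using chart_deriv_continuous[OF u c] gram_continuous_manifold[OF c] by (cases "j = k") simp_all
    show "continuous_on (fst c) (\<lambda>x. gram g c x $ i $ j)" for i j
      by (rule gram_continuous_manifold[OF c])
    show "det (gram g c x) \<noteq> 0" if "x \<in> fst c" for x
      using det_gram_pos[OF c that] by simp
  qed
  then show ?thesis
  proof (rule continuous_on_eq)
    fix x assume x: "x \<in> fst c"
    show "det (\<chi> i j. if j = k then chart_deriv u c x (axis i 1) else gram g c x $ i $ j) / det (gram g c x) =
        gradient g u c x $ k"
      unfolding metric_cramer[OF c x, of "gradient g u c x" k] gradient_inner[OF u c x] ..
  qed
qed

text \<open>The chart selected by \<open>chart_at\<close> may jump from point to point. In a fixed
  chart the squared norm is the differential applied to the gradient, a finite sum of continuous
  products, and the chart domains form an open cover.\<close>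

lemma gnorm_gradient_continuous:
  assumes u: "C1_manifold A u"
  shows "continuous_on UNIV (gnorm A g (gradient g u))"
proof -
  have "continuous_on (fst c) (gnorm A g (gradient g u))" if c: "c \<in> A" for c
  proof -
    have "continuous_on (fst c) (\<lambda>x. sqrt (\<Sum>i\<in>UNIV. gradient g u c x $ i * chart_deriv u c x (axis i 1)))"
      by (intro continuous_intros gradient_component_continuous[OF u c] chart_deriv_continuous[OF u c])
    then show ?thesis
    proof (rule continuous_on_eq)
      fix x assume x: "x \<in> fst c"
      have "ginner A g (gradient g u) (gradient g u) x = chart_deriv u c x (gradient g u c x)"
        by (rule ginner_gradient[OF gradient_vector_field[OF u] u UNIV_I c x])
      also have "\<dots> = (\<Sum>i\<in>UNIV. gradient g u c x $ i * chart_deriv u c x (axis i 1))"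
        by (rule linear_axis_sum[OF linear_chart_deriv[OF u c x]])
      finally show "sqrt (\<Sum>i\<in>UNIV. gradient g u c x $ i * chart_deriv u c x (axis i 1)) = gnorm A g (gradient g u) x"
        by (simp add: gnorm_def)
    qed
  qed
  then have "continuous_on (\<Union>c\<in>A. fst c) (gnorm A g (gradient g u))"
    by (intro continuous_on_open_UN) (use chart_open in auto)
  then show ?thesis using charts_cover by simp
qed

lemma ginner_gradient_zero:
  assumes u: "C1_manifold A u" and X: "vector_field A S X" and x: "x \<in> S" "x \<notin> closure {x. u x \<noteq> 0}"
  shows "ginner A g X (gradient g u) x = 0"
proof -
  define N where "N = - closure {x. u x \<noteq> 0}"
  have N: "open N" "x \<in> N" unfolding N_def using x(2) by (auto intro: open_Compl closed_closure)
  have zero: "u y = 0" if "y \<in> N" for y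
    using that closure_subset[of "{x. u x \<noteq> 0}"] by (auto simp: N_def)
  have "chart_deriv u (chart_at A x) x = (\<lambda>v. 0)"
    by (rule chart_deriv_zero_open[OF chart_at N zero])
  then show ?thesis
    unfolding ginner_gradient[OF X u x(1) chart_at] by simp
qed

lemma gnorm_gradient_zero:
  assumes u: "C1_manifold A u" and x: "x \<notin> closure {x. u x \<noteq> 0}"
  shows "gnorm A g (gradient g u) x = 0"
  using ginner_gradient_zero[OF u gradient_vector_field[OF u, of UNIV] UNIV_I x] by (simp add: gnorm_def)

lemma C1_manifold_compose:
  assumes u: "C1_manifold A u" and F: "\<And>t. (F has_real_derivative F' t) (at t)" and F': "continuous_on UNIV F'"
  shows "C1_manifold A (\<lambda>x. F (u x))"
    and "c \<in> A \<Longrightarrow> x \<in> fst c \<Longrightarrow> chart_deriv (\<lambda>x. F (u x)) c x v = F' (u x) * chart_deriv u c x v"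
proof -
  have uc: "Ck_on 1 (u \<circ> chart_inv c) (snd c ` fst c)" if "c \<in> A" for c
    using assms that unfolding C1_manifold_def by blast
  have eq: "(\<lambda>x. F (u x)) \<circ> chart_inv c = (\<lambda>y. F ((u \<circ> chart_inv c) y))" for c
    by (simp add: comp_def)
  show "C1_manifold A (\<lambda>x. F (u x))"
    unfolding C1_manifold_def eq
    by (intro ballI Ck_on_1_real_compose(1)[OF uc F F']) auto
  show "chart_deriv (\<lambda>x. F (u x)) c x v = F' (u x) * chart_deriv u c x v" if c: "c \<in> A" "x \<in> fst c"
  proof -
    have "frechet_derivative (\<lambda>y. F ((u \<circ> chart_inv c) y)) (at (snd c x)) v =
        F' ((u \<circ> chart_inv c) (snd c x)) * frechet_derivative (u \<circ> chart_inv c) (at (snd c x)) v"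
      by (rule Ck_on_1_real_compose(2)[OF uc[OF c(1)] F F']) (use c in auto)
    then show ?thesis
      using chart_inv_left[OF c] by (simp add: chart_deriv_def eq)
  qed
qed

lemma ginner_gradient_compose:
  assumes u: "C1_manifold A u" and F: "\<And>t. (F has_real_derivative F' t) (at t)" and F': "continuous_on UNIV F'"
    and X: "vector_field A S X" "x \<in> S"
  shows "ginner A g X (gradient g (\<lambda>x. F (u x))) x = F' (u x) * ginner A g X (gradient g u) x"
  using ginner_gradient[OF X(1) C1_manifold_compose(1)[OF u F F'] X(2) chart_at]
    ginner_gradient[OF X(1) u X(2) chart_at] C1_manifold_compose(2)[OF u F F' chart_at] by simp

lemma C1_manifold_diff:
  assumes "C1_manifold A u" "C1_manifold A v"
  shows "C1_manifold A (\<lambda>x. u x - v x)"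
proof -
  have eq: "(\<lambda>x. u x - v x) \<circ> chart_inv c = (\<lambda>y. (u \<circ> chart_inv c) y - (v \<circ> chart_inv c) y)" for c
    by (simp add: comp_def)
  show ?thesis
    unfolding C1_manifold_def eq
  proof
    fix c assume "c \<in> A"
    then have "Ck_on 1 (u \<circ> chart_inv c) (snd c ` fst c)" "Ck_on 1 (v \<circ> chart_inv c) (snd c ` fst c)"
      using assms unfolding C1_manifold_def by blast+
    then show "Ck_on 1 (\<lambda>y. (u \<circ> chart_inv c) y - (v \<circ> chart_inv c) y) (snd c ` fst c)"
      by (rule Ck_on_1_diff)
  qed
qed

lemma ginner_gradient_diff:
  assumes u: "C1_manifold A u" and v: "C1_manifold A v" and X: "vector_field A S X" "x \<in> S"
  shows "ginner A g X (gradient g (\<lambda>x. u x - v x)) x =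
    ginner A g X (gradient g u) x - ginner A g X (gradient g v) x"
proof -
  let ?c = "chart_at A x"
  have "((\<lambda>x. u x - v x) \<circ> chart_inv ?c has_derivative (\<lambda>w. chart_deriv u ?c x w - chart_deriv v ?c x w)) (at (snd ?c x))"
    using has_derivative_diff[OF C1_has_derivative[OF u chart_at] C1_has_derivative[OF v chart_at]]
    by (simp add: comp_def)
  from frechet_derivative_at[OF this]
  have "chart_deriv (\<lambda>x. u x - v x) ?c x = (\<lambda>w. chart_deriv u ?c x w - chart_deriv v ?c x w)"
    by (simp add: chart_deriv_def)
  then show ?thesis
    using ginner_gradient[OF X(1) C1_manifold_diff[OF u v] X(2) chart_at]
      ginner_gradient[OF X(1) u X(2) chart_at] ginner_gradient[OF X(1) v X(2) chart_at] by simp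
qed

end

context riemannian_volume_manifold
begin

lemma continuous_set_borel_measurable:
  assumes "continuous_on UNIV f" "\<Omega> \<in> sets borel"
  shows "set_borel_measurable vol \<Omega> (f :: 'm \<Rightarrow> real)"
  using borel_measurable_continuous_onI[OF assms(1)] assms(2)
  by (subst set_borel_measurable_restrict) (auto intro!: measurable_restrict_space1)

lemma C1_0_bounded:
  assumes "u \<in> C1_0 A \<Omega>"
  obtains B where "B > 0" "\<And>x. \<bar>u x\<bar> \<le> B" "\<And>x. gnorm A g (gradient g u) x \<le> B"
proof -
  note uC = C1_0D[OF assms]
  have "u x = 0" if "x \<notin> closure {x. u x \<noteq> 0}" for x
    using that closure_subset[of "{x. u x \<noteq> 0}"] by auto
  then obtain B1 where B1: "B1 > 0" "\<And>x. \<bar>u x\<bar> \<le> B1"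
    using continuous_compact_support_bounded[OF C1_continuous_on[OF uC(1)] uC(2)] by metis
  obtain B2 where B2: "B2 > 0" "\<And>x. \<bar>gnorm A g (gradient g u) x\<bar> \<le> B2"
    using continuous_compact_support_bounded[OF gnorm_gradient_continuous[OF uC(1)] uC(2) gnorm_gradient_zero[OF uC(1)]]
    by metis
  show ?thesis
  proof (rule that[of "max B1 B2"])
    show "\<bar>u x\<bar> \<le> max B1 B2" for x using B1(2)[of x] by simp
    show "gnorm A g (gradient g u) x \<le> max B1 B2" for x using B2(2)[of x] by simp
  qed (use B1 in simp)
qed

lemma C1_0_powr_integrable:
  assumes u: "u \<in> C1_0 A \<Omega>" and a: "a > 0" and \<Omega>: "open \<Omega>"
  shows "set_integrable vol \<Omega> (\<lambda>x. \<bar>u x\<bar> powr a)"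
    and "set_integrable vol \<Omega> (\<lambda>x. gnorm A g (gradient g u) x powr a)"
proof -
  note uC = C1_0D[OF u]
  obtain B where B: "B > 0" "\<And>x. \<bar>u x\<bar> \<le> B" "\<And>x. gnorm A g (gradient g u) x \<le> B"
    using C1_0_bounded[OF u] by metis
  have \<Omega>b: "\<Omega> \<in> sets borel" using \<Omega> by simp
  have m1: "set_borel_measurable vol \<Omega> (\<lambda>x. \<bar>u x\<bar> powr a)"
    by (rule continuous_set_borel_measurable[OF _ \<Omega>b])
      (use a in \<open>intro continuous_on_powr' continuous_intros C1_continuous_on[OF uC(1)], auto\<close>)
  have m2: "set_borel_measurable vol \<Omega> (\<lambda>x. gnorm A g (gradient g u) x powr a)"
    by (rule continuous_set_borel_measurable[OF _ \<Omega>b])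
      (use a gnorm_nonneg in \<open>intro continuous_on_powr' continuous_intros gnorm_gradient_continuous[OF uC(1)], auto\<close>)
  show "set_integrable vol \<Omega> (\<lambda>x. \<bar>u x\<bar> powr a)"
  proof (rule set_integrable_compact_support[OF m1 uC(2)])
    show "\<bar>u x\<bar> powr a = 0" if "x \<notin> closure {x. u x \<noteq> 0}" for x
      using that closure_subset[of "{x. u x \<noteq> 0}"] by auto
    show "AE x in vol. x \<in> \<Omega> \<longrightarrow> \<bar>\<bar>u x\<bar> powr a\<bar> \<le> B powr a"
      using a B(2) by (auto intro!: AE_I2 powr_mono2)
  qed
  show "set_integrable vol \<Omega> (\<lambda>x. gnorm A g (gradient g u) x powr a)"
  proof (rule set_integrable_compact_support[OF m2 uC(2)])
    show "gnorm A g (gradient g u) x powr a = 0" if "x \<notin> closure {x. u x \<noteq> 0}" for x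
      using gnorm_gradient_zero[OF uC(1) that] by simp
    show "AE x in vol. x \<in> \<Omega> \<longrightarrow> \<bar>gnorm A g (gradient g u) x powr a\<bar> \<le> B powr a"
      using a B(3) gnorm_nonneg by (auto intro!: AE_I2 powr_mono2)
  qed
qed

end

section \<open>Measurability of a weakly differentiable function and of its gradient\<close>

locale weakly_differentiable = riemannian_volume_manifold A g vol
  for A :: "('m::{second_countable_topology, t2_space}, 'n::finite) chart set" and g and vol :: "'m measure" +
  fixes \<Omega> :: "'m set" and \<rho> :: "'m \<Rightarrow> real" and X :: "('m, 'n) vfield"
  assumes open_domain: "open \<Omega>" and weak_gradient: "weak_gradient A g \<Omega> \<rho> X"
begin

lemma vector_field_grad: "vector_field A \<Omega> X"
  using weak_gradient by (simp add: weak_gradient_def)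

lemma weak_partial_chart:
  "c \<in> A \<Longrightarrow> weak_partial (snd c ` (fst c \<inter> \<Omega>)) (\<rho> \<circ> chart_inv c) i
    (\<lambda>y. g c (chart_inv c y) (X c (chart_inv c y)) (axis i 1))"
  using weak_gradient unfolding weak_gradient_def by blast

text \<open>The coordinate expression of \<open>f\<close> is measurable on compact sets because it
  is integrable there, and composing it with the chart returns \<open>f\<close>. This is how the
  definition of weak partial derivatives provides measurability.\<close>

lemma chart_measurable_of_locally_integrable:
  assumes c: "c \<in> A" and L: "compact L" "L \<subseteq> fst c \<inter> \<Omega>"
    and f: "locally_integrable lborel (snd c ` (fst c \<inter> \<Omega>)) (\<lambda>y. f (chart_inv c y))"
  shows "f \<in> borel_measurable (restrict_space vol L)"
proof -
  have Lb: "L \<in> sets borel" using L(1) by (simp add: compact_imp_closed)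
  have "compact (snd c ` L)" "snd c ` L \<subseteq> snd c ` (fst c \<inter> \<Omega>)"
    using chart_image_compact[OF c _ L(1)] L(2) by auto
  then have "set_integrable lborel (snd c ` L) (\<lambda>y. f (chart_inv c y))"
    using f by (simp add: locally_integrable_def)
  then have "set_borel_measurable borel (snd c ` L) (\<lambda>y. f (chart_inv c y))"
    by (auto simp: set_integrable_def set_borel_measurable_def dest: borel_measurable_integrable)
  from chart_measurable_vol[OF c Lb _ this order_refl] L(2)
  have "set_borel_measurable vol L (\<lambda>x. f (chart_inv c (snd c x)))" by simp
  then have "(\<lambda>x. f (chart_inv c (snd c x))) \<in> borel_measurable (restrict_space vol L)"
    using Lb by (subst (asm) set_borel_measurable_restrict) auto
  moreover have "(\<lambda>x. f (chart_inv c (snd c x))) \<in> borel_measurable (restrict_space vol L) \<longleftrightarrow>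
      f \<in> borel_measurable (restrict_space vol L)"
    by (rule measurable_cong) (use L(2) chart_inv_left[OF c] in \<open>auto simp: space_restrict_space\<close>)
  ultimately show ?thesis by simp
qed

lemma rho_measurable_chart:
  assumes "c \<in> A" "compact L" "L \<subseteq> fst c \<inter> \<Omega>"
  shows "\<rho> \<in> borel_measurable (restrict_space vol L)"
  by (rule chart_measurable_of_locally_integrable[OF assms])
    (use weak_partial_chart[OF assms(1)] in \<open>simp add: weak_partial_def comp_def\<close>)

lemma covector_measurable_chart:
  assumes "c \<in> A" "compact L" "L \<subseteq> fst c \<inter> \<Omega>"
  shows "(\<lambda>x. g c x (X c x) (axis i 1)) \<in> borel_measurable (restrict_space vol L)"
  by (rule chart_measurable_of_locally_integrable[OF assms])
    (use weak_partial_chart[OF assms(1), of i] in \<open>simp add: weak_partial_def\<close>)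

lemma continuous_measurable_chart:
  assumes "continuous_on (fst c) f" "L \<subseteq> fst c" "L \<in> sets borel"
  shows "(f :: 'm \<Rightarrow> real) \<in> borel_measurable (restrict_space vol L)"
  using borel_measurable_continuous_on_restrict[OF continuous_on_subset[OF assms(1,2)]]
  by (simp cong: measurable_cong_sets sets_restrict_space_cong)

lemma grad_component_measurable_chart:
  assumes c: "c \<in> A" and L: "compact L" "L \<subseteq> fst c \<inter> \<Omega>"
  shows "(\<lambda>x. X c x $ k) \<in> borel_measurable (restrict_space vol L)"
proof -
  have Lb: "L \<in> sets borel" using L(1) by (simp add: compact_imp_closed)
  have gm: "(\<lambda>x. gram g c x $ i $ j) \<in> borel_measurable (restrict_space vol L)" for i j
    using continuous_measurable_chart[OF gram_continuous_manifold[OF c] _ Lb] L(2) by auto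
  have "(\<lambda>x. det (\<chi> i j. if j = k then g c x (X c x) (axis i 1) else gram g c x $ i $ j) / det (gram g c x))
      \<in> borel_measurable (restrict_space vol L)"
  proof (intro borel_measurable_divide borel_measurable_det)
    show "(\<lambda>x. (\<chi> i j. if j = k then g c x (X c x) (axis i 1) else gram g c x $ i $ j) $ i $ j)
        \<in> borel_measurable (restrict_space vol L)" for i j
      using gm covector_measurable_chart[OF c L] by (cases "j = k") simp_all
  qed (rule gm)
  moreover have "(\<lambda>x. det (\<chi> i j. if j = k then g c x (X c x) (axis i 1) else gram g c x $ i $ j) / det (gram g c x))
      \<in> borel_measurable (restrict_space vol L) \<longleftrightarrow> (\<lambda>x. X c x $ k) \<in> borel_measurable (restrict_space vol L)"
  proof (rule measurable_cong)
    fix x assume "x \<in> space (restrict_space vol L)"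
    then have x: "x \<in> fst c" using L(2) by (auto simp: space_restrict_space)
    show "det (\<chi> i j. if j = k then g c x (X c x) (axis i 1) else gram g c x $ i $ j) / det (gram g c x) = X c x $ k"
      by (rule metric_cramer[OF c x, symmetric])
  qed
  ultimately show ?thesis by simp
qed

lemma set_borel_measurable_domainI:
  fixes f :: "'m \<Rightarrow> real"
  assumes "\<And>c L. c \<in> A \<Longrightarrow> compact L \<Longrightarrow> L \<subseteq> fst c \<inter> \<Omega> \<Longrightarrow> f \<in> borel_measurable (restrict_space vol L)"
  shows "set_borel_measurable vol \<Omega> f"
proof (rule set_borel_measurable_open_local[OF open_domain])
  fix x assume x: "x \<in> \<Omega>"
  obtain c N L where cNL: "c \<in> A" "open N" "x \<in> N" "N \<subseteq> L" "compact L" "L \<subseteq> fst c \<inter> \<Omega>"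
    using chart_nbhd[OF open_domain x] by metis
  have "L \<in> sets vol" using cNL(5) by (simp add: compact_imp_closed)
  then have Lf: "(\<lambda>x. indicator L x *\<^sub>R f x) \<in> borel_measurable borel"
    using assms[OF cNL(1,5,6)] by (subst (asm) borel_measurable_restrict_space_iff) auto
  have "(\<lambda>x. indicator N x *\<^sub>R (indicator L x *\<^sub>R f x)) \<in> borel_measurable borel"
    by (rule borel_measurable_scaleR[OF borel_measurable_indicator[OF borel_open[OF cNL(2)]] Lf])
  moreover have "(\<lambda>x. indicator N x *\<^sub>R (indicator L x *\<^sub>R f x)) = (\<lambda>x. indicator N x *\<^sub>R f x)"
    using cNL(4) by (auto simp: indicator_def fun_eq_iff)
  ultimately have "set_borel_measurable vol N f" by (simp only: set_borel_measurable_def borel_measurable_vol)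
  then show "\<exists>N. open N \<and> x \<in> N \<and> set_borel_measurable vol N f"
    using cNL by blast
qed

lemma rho_measurable: "set_borel_measurable vol \<Omega> \<rho>"
  by (rule set_borel_measurable_domainI[OF rho_measurable_chart])

lemma ginner_gradient_measurable_chart:
  assumes u: "C1_manifold A u" and c: "c \<in> A" and L: "compact L" "L \<subseteq> fst c \<inter> \<Omega>"
  shows "ginner A g X (gradient g u) \<in> borel_measurable (restrict_space vol L)"
proof -
  have Lb: "L \<in> sets borel" using L(1) by (simp add: compact_imp_closed)
  have [measurable]: "(\<lambda>x. chart_deriv u c x (axis i 1)) \<in> borel_measurable (restrict_space vol L)" for i
    using continuous_measurable_chart[OF chart_deriv_continuous[OF u c] _ Lb] L(2) by auto
  note [measurable] = grad_component_measurable_chart[OF c L]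
  have "(\<lambda>x. \<Sum>i\<in>UNIV. X c x $ i * chart_deriv u c x (axis i 1)) \<in> borel_measurable (restrict_space vol L)"
    by measurable
  moreover have "(\<lambda>x. \<Sum>i\<in>UNIV. X c x $ i * chart_deriv u c x (axis i 1)) \<in> borel_measurable (restrict_space vol L) \<longleftrightarrow>
      ginner A g X (gradient g u) \<in> borel_measurable (restrict_space vol L)"
  proof (rule measurable_cong)
    fix x assume "x \<in> space (restrict_space vol L)"
    then have x: "x \<in> fst c" "x \<in> \<Omega>" using L(2) by (auto simp: space_restrict_space)
    show "(\<Sum>i\<in>UNIV. X c x $ i * chart_deriv u c x (axis i 1)) = ginner A g X (gradient g u) x"
      using ginner_gradient[OF vector_field_grad u x(2) c x(1)]
        linear_axis_sum[OF linear_chart_deriv[OF u c x(1)], of "X c x"] by simp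
  qed
  ultimately show ?thesis by simp
qed

lemma ginner_gradient_measurable:
  "C1_manifold A u \<Longrightarrow> set_borel_measurable vol \<Omega> (ginner A g X (gradient g u))"
  by (rule set_borel_measurable_domainI[OF ginner_gradient_measurable_chart])

lemma gnorm_chart:
  assumes "c \<in> A" "x \<in> fst c" "x \<in> \<Omega>"
  shows "gnorm A g X x = sqrt (g c x (X c x) (X c x))"
  using ginner_chart[OF vector_field_grad vector_field_grad assms(3,1,2)] by (simp add: gnorm_def)

lemma gnorm_measurable_chart:
  assumes c: "c \<in> A" and L: "compact L" "L \<subseteq> fst c \<inter> \<Omega>"
  shows "gnorm A g X \<in> borel_measurable (restrict_space vol L)"
proof -
  note [measurable] = grad_component_measurable_chart[OF c L] covector_measurable_chart[OF c L]
  have "(\<lambda>x. sqrt (\<Sum>i\<in>UNIV. X c x $ i * g c x (X c x) (axis i 1))) \<in> borel_measurable (restrict_space vol L)"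
    by measurable
  moreover have "(\<lambda>x. sqrt (\<Sum>i\<in>UNIV. X c x $ i * g c x (X c x) (axis i 1))) \<in> borel_measurable (restrict_space vol L) \<longleftrightarrow>
      gnorm A g X \<in> borel_measurable (restrict_space vol L)"
  proof (rule measurable_cong)
    fix x assume "x \<in> space (restrict_space vol L)"
    then have x: "x \<in> fst c" "x \<in> \<Omega>" using L(2) by (auto simp: space_restrict_space)
    show "sqrt (\<Sum>i\<in>UNIV. X c x $ i * g c x (X c x) (axis i 1)) = gnorm A g X x"
      using gnorm_chart[OF c x] linear_axis_sum[OF metric_linear(1)[OF c x(1)], of "X c x" "X c x"] by simp
  qed
  ultimately show ?thesis by simp
qed

lemma gnorm_measurable: "set_borel_measurable vol \<Omega> (gnorm A g X)"
  by (rule set_borel_measurable_domainI[OF gnorm_measurable_chart])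

end

section \<open>Composite test functions\<close>

lemma powr_diff_1_le:
  fixes a p :: real
  assumes "a \<ge> 0" "p > 1"
  shows "a powr (p - 1) \<le> 1 + a powr p"
proof (cases "a \<le> 1")
  case True
  then have "a powr (p - 1) \<le> 1 powr (p - 1)" using assms by (intro powr_mono2) auto
  then show ?thesis by (simp add: add_increasing2)
next
  case False
  then have "a powr (p - 1) \<le> a powr p" by (intro powr_mono) auto
  then show ?thesis by simp
qed

text \<open>The identities include \<open>a = 0\<close> because \<open>0 powr x = 0\<close>. The
  same convention makes the flux |grad \<rho>|^(p-2) grad \<rho> vanish where the gradient does,
  also for p < 2.\<close>

lemma powr_diff_2_mult:
  fixes a p :: real
  assumes "a \<ge> 0"
  shows "a powr (p - 2) * a = a powr (p - 1)" "a powr (p - 1) * a = a powr p"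
    and "a powr (p - 2) * a\<^sup>2 = a powr p"
proof -
  show 1: "a powr (p - 2) * a = a powr (p - 1)" and 2: "a powr (p - 1) * a = a powr p"
    using assms powr_add[of a "p - 2" 1] powr_add[of a "p - 1" 1] by (cases "a = 0"; simp)+
  have "a powr (p - 2) * a\<^sup>2 = (a powr (p - 2) * a) * a" by (simp add: power2_eq_square)
  also have "\<dots> = a powr p" by (simp only: 1 2)
  finally show "a powr (p - 2) * a\<^sup>2 = a powr p" .
qed

text \<open>A crude Young inequality with constants 1: the p-th power of the larger of the two
  numbers dominates the product.\<close>

lemma powr_diff_1_mult_le:
  fixes a b p :: real
  assumes "a \<ge> 0" "b \<ge> 0" "p > 1"
  shows "a powr (p - 1) * b \<le> a powr p + b powr p"
proof (cases "b \<le> a")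
  case True
  then have "a powr (p - 1) * b \<le> a powr (p - 1) * a" by (intro mult_left_mono) auto
  also have "\<dots> = a powr p" by (rule powr_diff_2_mult(2)[OF assms(1)])
  finally show ?thesis by (simp add: add_increasing2)
next
  case False
  then have "a powr (p - 1) * b \<le> b powr (p - 1) * b"
    using assms by (intro mult_right_mono powr_mono2) auto
  also have "\<dots> = b powr p" by (rule powr_diff_2_mult(2)[OF assms(2)])
  finally show ?thesis by (simp add: add_increasing)
qed

lemma (in smooth_manifold) chart_inv_image_subset:
  assumes "c \<in> A" "K \<subseteq> snd c ` (fst c \<inter> \<Omega>)"
  shows "chart_inv c ` K \<subseteq> fst c \<inter> \<Omega>" "snd c ` chart_inv c ` K = K"
proof -
  have *: "chart_inv c y \<in> fst c \<inter> \<Omega> \<and> snd c (chart_inv c y) = y" if y: "y \<in> K" for y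
  proof -
    obtain z where "z \<in> fst c" "z \<in> \<Omega>" "y = snd c z" using assms(2) y by blast
    then show ?thesis using chart_inv_left[OF assms(1), of z] by simp
  qed
  show "chart_inv c ` K \<subseteq> fst c \<inter> \<Omega>" using * by blast
  show "snd c ` chart_inv c ` K = K" using * by force
qed

text \<open>The weak gradient is a parameter \<open>X\<close> instead of the choice
  \<open>weak_grad\<close>, so the arguments refer to its defining properties.\<close>

locale superharmonic = weakly_differentiable A g vol \<Omega> \<rho> X
  for A :: "('m::{second_countable_topology, t2_space}, 'n::finite) chart set" and g
    and vol :: "'m measure" and \<Omega> \<rho> X +
  fixes p :: real
  assumes p_gt_1: "p > 1"
    and rho_nonneg: "AE x in vol. x \<in> \<Omega> \<longrightarrow> \<rho> x \<ge> 0"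
    and grad_Lp: "locally_integrable vol \<Omega> (\<lambda>x. gnorm A g X x powr p)"
    and superharmonic: "\<And>\<phi>. \<phi> \<in> C1_0 A \<Omega> \<Longrightarrow> (\<And>x. \<phi> x \<ge> 0) \<Longrightarrow>
      (LINT x:\<Omega>|vol. gnorm A g X x powr (p - 2) * ginner A g X (gradient g \<phi>) x) \<ge> 0"
begin

text \<open>On compact subsets of a chart the covector components are bounded by a multiple of the
  Riemannian norm. This supplies, in coordinates, the p-th power integrability that
  \<open>weak_partial_approx\<close> asks for.\<close>

lemma covector_powr_locally_integrable:
  assumes c: "c \<in> A"
  shows "locally_integrable lborel (snd c ` (fst c \<inter> \<Omega>))
    (\<lambda>y. \<bar>g c (chart_inv c y) (X c (chart_inv c y)) (axis i 1)\<bar> powr p)"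
  unfolding locally_integrable_def
proof (intro allI impI, elim conjE)
  fix K assume K: "compact K" "K \<subseteq> snd c ` (fst c \<inter> \<Omega>)"
  define h where "h y = g c (chart_inv c y) (X c (chart_inv c y)) (axis i 1)" for y
  have KW: "K \<subseteq> snd c ` fst c" using K(2) by auto
  define L where "L = chart_inv c ` K"
  have L: "compact L" "L \<subseteq> fst c \<inter> \<Omega>"
    using chart_inv_image_compact[OF c KW K(1)] chart_inv_image_subset(1)[OF c K(2)] by (auto simp: L_def)
  have LU: "L \<subseteq> fst c" using L(2) by auto
  obtain C where C: "C > 0" "\<And>x v i. x \<in> L \<Longrightarrow> \<bar>g c x v (axis i 1)\<bar> \<le> C * sqrt (g c x v v)"
    using metric_compact_bound[OF c L(1) LU] by metis
  have "set_integrable vol L (\<lambda>x. gnorm A g X x powr p)"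
    using grad_Lp L by (simp add: locally_integrable_def)
  from chart_integrable_lborel[OF c K(1) KW this[unfolded L_def]]
  have i: "integrable lborel (\<lambda>y. C powr p * (indicator K y *\<^sub>R gnorm A g X (chart_inv c y) powr p))"
    by (simp add: set_integrable_def)
  have "locally_integrable lborel (snd c ` (fst c \<inter> \<Omega>)) h"
    using weak_partial_chart[OF c, of i] by (simp add: weak_partial_def h_def[abs_def])
  then have hm: "(\<lambda>y. indicator K y *\<^sub>R h y) \<in> borel_measurable lborel"
    using K by (auto simp: locally_integrable_def set_integrable_def dest: borel_measurable_integrable)
  show "set_integrable lborel K (\<lambda>y. \<bar>h y\<bar> powr p)"
    unfolding set_integrable_def
  proof (rule Bochner_Integration.integrable_bound[OF i])
    have "(\<lambda>y. \<bar>indicator K y *\<^sub>R h y\<bar> powr p) \<in> borel_measurable lborel"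
      using hm by measurable
    moreover have "\<bar>indicator K y *\<^sub>R h y\<bar> powr p = indicator K y *\<^sub>R \<bar>h y\<bar> powr p" for y
      by (simp add: indicator_def)
    ultimately show "(\<lambda>y. indicator K y *\<^sub>R \<bar>h y\<bar> powr p) \<in> borel_measurable lborel"
      by simp
    show "AE y in lborel. norm (indicator K y *\<^sub>R \<bar>h y\<bar> powr p)
        \<le> norm (C powr p * (indicator K y *\<^sub>R gnorm A g X (chart_inv c y) powr p))"
    proof (rule AE_I2)
      fix y
      show "norm (indicator K y *\<^sub>R \<bar>h y\<bar> powr p)
        \<le> norm (C powr p * (indicator K y *\<^sub>R gnorm A g X (chart_inv c y) powr p))"
      proof (cases "y \<in> K")
        case True
        then have x: "chart_inv c y \<in> L" "chart_inv c y \<in> fst c" "chart_inv c y \<in> \<Omega>"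
          using L(2) by (auto simp: L_def)
        have "\<bar>h y\<bar> \<le> C * gnorm A g X (chart_inv c y)"
          unfolding h_def gnorm_chart[OF c x(2,3)] by (rule C(2)[OF x(1)])
        then have "\<bar>h y\<bar> powr p \<le> (C * gnorm A g X (chart_inv c y)) powr p"
          using p_gt_1 by (intro powr_mono2) auto
        then show ?thesis
          using True C(1) by (simp add: powr_mult gnorm_nonneg)
      qed simp
    qed
  qed
qed

end

text \<open>Collects the properties of the regularized weight. Bounds for \<open>F\<close> and
  \<open>F'\<close> are asked on nonnegative arguments, the values taken by the mollifications and
  almost everywhere by \<rho>. Differentiability is asked on the open set t > - e, since two-sided
  derivatives are taken at t = 0 as well.\<close>

locale superharmonic_weight = superharmonic A g vol \<Omega> \<rho> X p
  for A :: "('m::{second_countable_topology, t2_space}, 'n::finite) chart set" and g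
    and vol :: "'m measure" and \<Omega> \<rho> X p +
  fixes F F' :: "real \<Rightarrow> real" and M e :: real
  assumes e_pos: "e > 0"
    and F_deriv: "\<And>t. t \<in> {- e<..} \<Longrightarrow> (F has_real_derivative F' t) (at t)"
    and F'_cont: "continuous_on {- e<..} F'"
    and F_nonneg: "\<And>t. t \<ge> 0 \<Longrightarrow> F t \<ge> 0"
    and F_le: "\<And>t. t \<ge> 0 \<Longrightarrow> F t \<le> M"
    and F'_le: "\<And>t. t \<ge> 0 \<Longrightarrow> \<bar>F' t\<bar> \<le> M"
    and F_measurable: "F \<in> borel_measurable borel" "F' \<in> borel_measurable borel"
begin

text \<open>The integrand obtained by formally testing with the product of \<open>w\<close> and
  F(\<rho>). The product and chain rules give the two terms; in the second, |grad \<rho>|^(p-2)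
  times |grad \<rho>|^2 is written as a p-th power. That product need not be C^1, so nonnegativity
  of the integral has to be reached by approximation.\<close>

definition Tint :: "('m \<Rightarrow> real) \<Rightarrow> 'm \<Rightarrow> real"
  where "Tint w x = F (\<rho> x) * (gnorm A g X x powr (p - 2) * ginner A g X (gradient g w) x) +
    w x * F' (\<rho> x) * gnorm A g X x powr p"

lemma M_nonneg: "M \<ge> 0"
  using F_nonneg[of 0] F_le[of 0] by simp

lemma F_cont: "continuous_on {- e<..} F"
  by (rule DERIV_continuous_on[OF has_field_derivative_at_within[OF F_deriv]])

lemma Tint_integrable:
  assumes w: "w \<in> C1_0 A \<Omega>"
  shows "set_integrable vol \<Omega> (Tint w)"
proof -
  note wC = C1_0D[OF w]
  define K where "K = closure {x. w x \<noteq> 0}"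
  obtain B where B: "B > 0" "\<And>x. \<bar>w x\<bar> \<le> B" "\<And>x. gnorm A g (gradient g w) x \<le> B"
    using C1_0_bounded[OF w] by metis
  have K: "compact K" "K \<subseteq> \<Omega>" using wC by (auto simp: K_def)
  have Kb: "K \<in> sets borel" using K(1) by (simp add: compact_imp_closed)
  have \<Omega>b: "\<Omega> \<in> sets borel" using open_domain by simp
  have rS: "set_borel_measurable vol \<Omega> f \<longleftrightarrow> f \<in> borel_measurable (restrict_space vol \<Omega>)" for f :: "'m \<Rightarrow> real"
    by (rule set_borel_measurable_restrict) (use \<Omega>b in simp)
  note [measurable] = rho_measurable[unfolded rS] gnorm_measurable[unfolded rS]
    ginner_gradient_measurable[OF wC(1), unfolded rS]
    continuous_set_borel_measurable[OF C1_continuous_on[OF wC(1)] \<Omega>b, unfolded rS] F_measurable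
  have meas: "(\<lambda>x. indicator \<Omega> x *\<^sub>R Tint w x) \<in> borel_measurable vol"
    unfolding set_borel_measurable_def[symmetric] rS Tint_def by measurable
  have "integrable vol (\<lambda>x. indicator K x *\<^sub>R gnorm A g X x powr p)"
    using grad_Lp K by (simp add: locally_integrable_def set_integrable_def)
  moreover have "integrable vol (\<lambda>x. indicator K x :: real)"
    using emeasure_vol_compact[OF K(1)] Kb by (intro integrable_real_indicator) auto
  \<comment> \<open>The majorant uses the bound \<open>M\<close> for the weight and \<open>B\<close>
    for \<open>w\<close> and its gradient. The indicator without a power comes from a^(p-1) \<le> 1
    + a^p, the factor 2 from the p-th powers in both terms of \<open>Tint\<close>.\<close>
  ultimately have i: "integrable vol (\<lambda>x. (M * B) * (indicator K x + 2 * (indicator K x *\<^sub>R gnorm A g X x powr p)))"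
    by simp
  show ?thesis
    unfolding set_integrable_def
  proof (rule Bochner_Integration.integrable_bound[OF i meas])
    show "AE x in vol. norm (indicator \<Omega> x *\<^sub>R Tint w x) \<le>
        norm ((M * B) * (indicator K x + 2 * (indicator K x *\<^sub>R gnorm A g X x powr p)))"
      using rho_nonneg
    proof eventually_elim
      case (elim x)
      show ?case
      proof (cases "x \<in> K")
        case True
        then have x: "x \<in> \<Omega>" "\<rho> x \<ge> 0" using K(2) elim by auto
        let ?a = "gnorm A g X x"
        have a: "?a \<ge> 0" by (rule gnorm_nonneg)
        have "\<bar>?a powr (p - 2) * ginner A g X (gradient g w) x\<bar> \<le> ?a powr (p - 2) * (?a * B)"
          unfolding abs_mult
          using order_trans[OF ginner_Cauchy_Schwarz[of X "gradient g w" x] mult_left_mono[OF B(3) a]]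
          by (simp add: mult_left_mono)
        also have "\<dots> = B * ?a powr (p - 1)"
          using powr_diff_2_mult(1)[OF a, of p] by (simp add: ac_simps)
        also have "\<dots> \<le> B * (1 + ?a powr p)"
          using B(1) powr_diff_1_le[OF a p_gt_1] by (intro mult_left_mono) auto
        finally have 1: "\<bar>F (\<rho> x) * (?a powr (p - 2) * ginner A g X (gradient g w) x)\<bar> \<le> M * (B * (1 + ?a powr p))"
          unfolding abs_mult[of "F (\<rho> x)"]
          using F_nonneg[OF x(2)] F_le[OF x(2)] M_nonneg by (intro mult_mono) auto
        have "\<bar>w x * F' (\<rho> x) * ?a powr p\<bar> \<le> B * M * ?a powr p"
          unfolding abs_mult using B(1,2) F'_le[OF x(2)] by (intro mult_mono) auto
        with 1 have "\<bar>Tint w x\<bar> \<le> M * (B * (1 + ?a powr p)) + B * M * ?a powr p"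
          unfolding Tint_def by (intro order_trans[OF abs_triangle_ineq] add_mono)
        also have "\<dots> = (M * B) * (1 + 2 * ?a powr p)" by (simp add: algebra_simps)
        finally show ?thesis
          using True x M_nonneg B(1) by (simp add: abs_mult)
      next
        case False
        have "x \<in> \<Omega> \<Longrightarrow> Tint w x = 0"
          using ginner_gradient_zero[OF wC(1) vector_field_grad, of x] False
            closure_subset[of "{x. w x \<noteq> 0}"] by (auto simp: Tint_def K_def)
        then show ?thesis using False by (auto simp: indicator_def)
      qed
    qed
  qed
qed

text \<open>For a test supported in one chart, the copy of \<rho> inside the weight is replaced by
  C^1 approximations \<open>R k\<close>. The product of \<psi> and F(R k) is admissible, and its
  inequality passes to the limit; the field \<open>X\<close> in the flux stays as it is.\<close>

lemma Tint_lift_nonneg: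
  assumes c: "c \<in> A" and \<psi>: "\<psi> \<in> C1_0_euclidean (snd c ` (fst c \<inter> \<Omega>))" and pos: "\<And>y. \<psi> y \<ge> 0"
  shows "(LINT x:\<Omega>|vol. Tint (lift c \<psi>) x) \<ge> 0"
proof -
  define V where "V = snd c ` (fst c \<inter> \<Omega>)"
  define K where "K = closure {y. \<psi> y \<noteq> 0}"
  define L where "L = chart_inv c ` K"
  define h where "h i y = g c (chart_inv c y) (X c (chart_inv c y)) (axis i 1)" for i y
  define a where "a x = gnorm A g X x" for x
  have a0: "a x \<ge> 0" for x by (simp add: a_def gnorm_nonneg)
  note \<psi>C = C1_0_euclideanD[OF \<psi>, folded K_def V_def]
  have V: "open V" unfolding V_def by (rule chart_image_Int_open[OF c open_domain])
  have KW: "K \<subseteq> snd c ` fst c" using \<psi>C(3) by (auto simp: V_def)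
  have L: "compact L" unfolding L_def by (rule chart_inv_image_compact[OF c KW \<psi>C(2)])
  have LU: "L \<subseteq> fst c \<inter> \<Omega>" and LK: "snd c ` L = K"
    using chart_inv_image_subset[OF c \<psi>C(3)[unfolded V_def]] by (simp_all add: L_def)
  have LU1: "L \<subseteq> fst c" using LU by auto
  have Lcl: "closed L" using L by (rule compact_imp_closed)
  have Lb: "L \<in> sets borel" using Lcl by simp
  have inL: "x \<in> fst c" "x \<in> \<Omega>" "snd c x \<in> K" "chart_inv c (snd c x) = x" if "x \<in> L" for x
    using that LU LK chart_inv_left[OF c] by auto
  obtain C where C: "C > 0" "\<And>x v. x \<in> L \<Longrightarrow> norm v \<le> C * sqrt (g c x v v)"
    "\<And>x v i. x \<in> L \<Longrightarrow> \<bar>g c x v (axis i 1)\<bar> \<le> C * sqrt (g c x v v)"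
    using metric_compact_bound[OF c L LU1] by metis
  have Xb: "\<bar>X c x $ j\<bar> \<le> C * a x" if "x \<in> L" for x j
    using order_trans[OF component_le_norm_cart C(2)[OF that, of "X c x"]] gnorm_chart[OF c inL(1,2)[OF that]]
    by (simp add: a_def)
  have wp: "weak_partial V (\<rho> \<circ> chart_inv c) i (h i)" for i
    using weak_partial_chart[OF c, of i] by (simp add: V_def h_def[abs_def])
  have Lp: "locally_integrable lborel V (\<lambda>y. \<bar>h i y\<bar> powr p)" for i
    using covector_powr_locally_integrable[OF c, of i] by (simp add: V_def h_def[abs_def])
  obtain R :: "nat \<Rightarrow> real ^ 'n \<Rightarrow> real" and G :: "nat \<Rightarrow> 'n \<Rightarrow> real ^ 'n \<Rightarrow> real"
    where R1: "\<And>k. Ck_on 1 (R k) UNIV"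
    and R0': "\<And>k y. (AE z in lborel. z \<in> V \<longrightarrow> (\<rho> \<circ> chart_inv c) z \<ge> 0) \<Longrightarrow> R k y \<ge> 0"
    and Rlim: "AE y in lborel. y \<in> K \<longrightarrow> (\<lambda>k. R k y) \<longlonglongrightarrow> (\<rho> \<circ> chart_inv c) y"
    and DRlim: "\<And>i. AE y in lborel. y \<in> K \<longrightarrow>
        (\<lambda>k. frechet_derivative (R k) (at y) (axis i 1)) \<longlonglongrightarrow> h i y"
    and "(\<lambda>k. LINT y:K|lborel. \<bar>R k y - (\<rho> \<circ> chart_inv c) y\<bar>) \<longlonglongrightarrow> 0"
    and Gi: "\<And>k i. integrable lborel (G k i)"
    and DRG: "\<And>k i y. y \<in> K \<Longrightarrow> \<bar>frechet_derivative (R k) (at y) (axis i 1)\<bar> powr p \<le> G k i y"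
    and GL: "\<And>i. (\<lambda>k. LINT y:K|lborel. \<bar>G k i y - \<bar>h i y\<bar> powr p\<bar>) \<longlonglongrightarrow> 0"
  proof (rule weak_partial_approx[OF V \<psi>C(2,3) less_imp_le[OF p_gt_1] wp Lp], goal_cases)
    case (1 R G)
    from 1(2-9) show ?case by (rule 1(1))
  qed
  have R0: "R k y \<ge> 0" for k y
  proof (rule R0')
    have "AE y in lborel. y \<in> snd c ` fst c \<longrightarrow> (chart_inv c y \<in> \<Omega> \<longrightarrow> \<rho> (chart_inv c y) \<ge> 0)"
      by (rule AE_lborel_chart[OF c]) (use rho_nonneg in eventually_elim, simp)
    then show "AE z in lborel. z \<in> V \<longrightarrow> (\<rho> \<circ> chart_inv c) z \<ge> 0"
    proof eventually_elim
      case (elim z)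
      then show ?case using chart_inv_left[OF c] by (auto simp: V_def)
    qed
  qed
  define D\<psi> where "D\<psi> x j = frechet_derivative \<psi> (at (snd c x)) (axis j 1)" for x j
  define DR where "DR k x j = frechet_derivative (R k) (at (snd c x)) (axis j 1)" for k x j
  define S where "S x = (\<Sum>j\<in>UNIV. X c x $ j * D\<psi> x j)" for x
  \<comment> \<open>The integrand at \<open>x\<close> as a function of the value \<open>t\<close>
    and the partial derivatives \<open>d\<close> put in place of \<rho> and its covector.
    \<open>I k\<close> inserts the approximation, \<open>I'\<close> inserts \<rho> itself.\<close>
  define J where "J x t d = a x powr (p - 2) * (F t * S x + \<psi> (snd c x) * F' t * (\<Sum>j\<in>UNIV. X c x $ j * d j))" for x t d
  define I where "I k x = J x (R k (snd c x)) (DR k x)" for k x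
  define I' where "I' x = J x (\<rho> x) (\<lambda>j. h j (snd c x))" for x

  have step1: "(LINT x|vol. indicator L x * I k x) \<ge> 0" for k
  proof -
    define \<theta> where "\<theta> y = \<psi> y * F (R k y)" for y
    have im: "R k ` UNIV \<subseteq> {- e<..}"
    proof
      fix t assume "t \<in> R k ` UNIV"
      then obtain y where "t = R k y" by auto
      then show "t \<in> {- e<..}" using R0[of k y] e_pos by simp
    qed
    have FR: "Ck_on 1 (\<lambda>y. F (R k y)) UNIV"
      by (rule Ck_on_1_real_compose(1)[OF R1 F_deriv F'_cont im])
    have DFR: "frechet_derivative (\<lambda>y. F (R k y)) (at y) v = F' (R k y) * frechet_derivative (R k) (at y) v" for y v
      by (rule Ck_on_1_real_compose(2)[OF R1 F_deriv F'_cont im]) simp_all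
    have \<theta>1: "Ck_on 1 \<theta> UNIV"
      unfolding \<theta>_def[abs_def] by (rule Ck_on_1_mult[OF \<psi>C(1) FR])
    have sub: "closure {y. \<theta> y \<noteq> 0} \<subseteq> K"
      unfolding K_def by (rule closure_mono) (auto simp: \<theta>_def)
    have "compact (closure {y. \<theta> y \<noteq> 0})"
      using compact_Int_closed[OF \<psi>C(2) closed_closure, of "{y. \<theta> y \<noteq> 0}"] sub by (simp add: inf.absorb2)
    then have \<theta>C: "\<theta> \<in> C1_0_euclidean (snd c ` (fst c \<inter> \<Omega>))"
      using \<theta>1 sub \<psi>C(3) unfolding C1_0_euclidean_def V_def by blast
    note \<Phi> = lift_C1_0[OF c open_domain \<theta>C]
    have \<Phi>0: "lift c \<theta> x \<ge> 0" for x
      using pos F_nonneg[OF R0] by (simp add: lift_def \<theta>_def)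
    have supp: "closure {x. lift c \<theta> x \<noteq> 0} \<subseteq> L"
      by (rule closure_minimal[OF _ Lcl]) (use \<Phi>(2) sub in \<open>auto simp: L_def\<close>)
    have eq: "indicator \<Omega> x *\<^sub>R (a x powr (p - 2) * ginner A g X (gradient g (lift c \<theta>)) x) = indicator L x * I k x" for x
    proof (cases "x \<in> L")
      case True
      note x = inL[OF True]
      have "ginner A g X (gradient g (lift c \<theta>)) x = frechet_derivative \<theta> (at (snd c x)) (X c x)"
        using ginner_gradient[OF vector_field_grad C1_0D(1)[OF \<Phi>(1)] x(2) c x(1)]
          lift_chart_deriv[OF c x(1) \<theta>1] by simp
      also have "\<dots> = (\<Sum>j\<in>UNIV. X c x $ j * frechet_derivative \<theta> (at (snd c x)) (axis j 1))"
        by (rule linear_axis_sum[OF Ck_on_1_linear[OF \<theta>1 UNIV_I]])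
      also have "\<dots> = (\<Sum>j\<in>UNIV. F (R k (snd c x)) * (X c x $ j * D\<psi> x j) +
          \<psi> (snd c x) * F' (R k (snd c x)) * (X c x $ j * DR k x j))"
        unfolding \<theta>_def[abs_def] frechet_derivative_mult_real[OF \<psi>C(1) FR UNIV_I] DFR
        by (intro sum.cong) (simp_all add: D\<psi>_def DR_def algebra_simps)
      also have "\<dots> = F (R k (snd c x)) * S x + \<psi> (snd c x) * F' (R k (snd c x)) * (\<Sum>j\<in>UNIV. X c x $ j * DR k x j)"
        by (simp add: sum.distrib sum_distrib_left S_def)
      finally show ?thesis using True x by (simp add: I_def J_def)
    next
      case False
      then have "x \<in> \<Omega> \<Longrightarrow> ginner A g X (gradient g (lift c \<theta>)) x = 0"
        using ginner_gradient_zero[OF C1_0D(1)[OF \<Phi>(1)] vector_field_grad] supp by blast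
      then show ?thesis using False by (auto simp: indicator_def)
    qed
    show ?thesis
      using superharmonic[OF \<Phi>(1) \<Phi>0] unfolding set_lebesgue_integral_def a_def[symmetric] eq .
  qed

  \<comment> \<open>Contracting \<open>X\<close> with its own covector gives the squared norm; this
    turns the second term of \<open>I'\<close> into the p-th power in \<open>Tint\<close>.\<close>
  have hsum: "(\<Sum>j\<in>UNIV. X c x $ j * h j (snd c x)) = (a x)\<^sup>2" if "x \<in> L" for x
  proof -
    note x = inL[OF that]
    have "(a x)\<^sup>2 = g c x (X c x) (X c x)"
      using gnorm_chart[OF c x(1,2)] metric_nonneg[OF c x(1)] by (simp add: a_def)
    then show ?thesis
      using linear_axis_sum[OF metric_linear(1)[OF c x(1)], of "X c x" "X c x"] x(4) by (simp add: h_def)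
  qed

  have step2: "(LINT x|vol. indicator L x * I' x) = (LINT x:\<Omega>|vol. Tint (lift c \<psi>) x)"
    unfolding set_lebesgue_integral_def
  proof (rule Bochner_Integration.integral_cong[OF refl])
    note w = lift_C1_0[OF c open_domain \<psi>, folded K_def L_def]
    fix x
    show "indicator L x * I' x = indicator \<Omega> x *\<^sub>R Tint (lift c \<psi>) x"
    proof (cases "x \<in> L")
      case True
      note x = inL[OF True]
      have "ginner A g X (gradient g (lift c \<psi>)) x = S x"
        using ginner_gradient[OF vector_field_grad C1_0D(1)[OF w(1)] x(2) c x(1)]
          lift_chart_deriv[OF c x(1) \<psi>C(1)] linear_axis_sum[OF Ck_on_1_linear[OF \<psi>C(1) UNIV_I], of "snd c x" "X c x"]
        by (simp add: S_def D\<psi>_def)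
      moreover have "I' x = F (\<rho> x) * (a x powr (p - 2) * S x) + \<psi> (snd c x) * F' (\<rho> x) * (a x powr (p - 2) * (a x)\<^sup>2)"
        unfolding I'_def J_def hsum[OF True] by (simp add: algebra_simps)
      moreover have "a x powr (p - 2) * (a x)\<^sup>2 = a x powr p"
        by (rule powr_diff_2_mult(3)[OF a0])
      ultimately show ?thesis
        using True x by (simp add: Tint_def lift_def a_def)
    next
      case False
      have "closure {x. lift c \<psi> x \<noteq> 0} \<subseteq> L"
        by (rule closure_minimal[OF _ Lcl]) (use w(2) in auto)
      then have "x \<in> \<Omega> \<Longrightarrow> ginner A g X (gradient g (lift c \<psi>)) x = 0"
        using ginner_gradient_zero[OF C1_0D(1)[OF w(1)] vector_field_grad] False by blast
      then show ?thesis using False w(2)[OF False] by (auto simp: indicator_def Tint_def)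
    qed
  qed

  have step3: "(\<lambda>k. LINT x|vol. indicator L x * I k x) \<longlonglongrightarrow> (LINT x|vol. indicator L x * I' x)"
  proof -
    have c\<psi>: "continuous_on UNIV \<psi>" "continuous_on UNIV (\<lambda>y. frechet_derivative \<psi> (at y) v)" for v
      using Ck_on_1_continuous[OF \<psi>C(1)] Ck_on_1_continuous_derivative[OF \<psi>C(1)] by auto
    have z\<psi>: "\<psi> y = 0" "frechet_derivative \<psi> (at y) v = 0" if "y \<notin> K" for y v
      by (rule C1_0_euclidean_zero[OF \<psi>, folded K_def, OF that])+
    obtain B0 where B0: "B0 > 0" "\<And>y. \<bar>\<psi> y\<bar> \<le> B0"
      using continuous_compact_support_bounded[OF c\<psi>(1) \<psi>C(2) z\<psi>(1)] by metis
    have "\<exists>B>0. \<forall>y. \<bar>frechet_derivative \<psi> (at y) (axis j 1)\<bar> \<le> B" for j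
      using continuous_compact_support_bounded[OF c\<psi>(2) \<psi>C(2) z\<psi>(2)] by metis
    then obtain B where B: "\<And>j. B j > 0" "\<And>j y. \<bar>frechet_derivative \<psi> (at y) (axis j 1)\<bar> \<le> B j"
      by metis
    define B1 where "B1 = (\<Sum>j\<in>UNIV. B j)"
    define C1 where "C1 = M * (C * B1)"
    define C2 where "C2 = B0 * M * C"
    have B1: "B1 \<ge> 0" unfolding B1_def using B(1) by (intro sum_nonneg less_imp_le)
    have C12: "C1 \<ge> 0" "C2 \<ge> 0" using C(1) B0(1) M_nonneg B1 by (auto simp: C1_def C2_def)
    \<comment> \<open>The bound depends on \<open>d\<close> through majorants \<gamma> of its p-th
      powers alone, by a^(p-1) |d| \<le> a^p + |d|^p. It is used with \<open>G k\<close> for the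
      approximations and with |h|^p for the limit.\<close>
    have Jb: "\<bar>J x t d\<bar> \<le> C1 * (1 + a x powr p) + C2 * (\<Sum>j\<in>UNIV. a x powr p + \<gamma> j)"
      if x: "x \<in> L" and t: "t \<ge> 0" and d: "\<And>j. \<bar>d j\<bar> powr p \<le> \<gamma> j" for x t d \<gamma>
    proof -
      have "\<bar>S x\<bar> \<le> (\<Sum>j\<in>UNIV. C * a x * B j)"
        unfolding S_def
        by (rule order_trans[OF sum_abs sum_mono])
          (use Xb[OF x] B(2) C(1) a0 in \<open>auto simp: abs_mult D\<psi>_def intro!: mult_mono\<close>)
      also have "\<dots> = C * a x * B1" by (simp add: B1_def sum_distrib_left)
      finally have "\<bar>F t\<bar> * \<bar>S x\<bar> \<le> M * (C * a x * B1)"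
        using F_nonneg[OF t] F_le[OF t] M_nonneg by (intro mult_mono) auto
      then have "a x powr (p - 2) * (\<bar>F t\<bar> * \<bar>S x\<bar>) \<le> a x powr (p - 2) * (M * (C * a x * B1))"
        by (rule mult_left_mono) simp
      also have "\<dots> = C1 * a x powr (p - 1)"
        using powr_diff_2_mult(1)[OF a0, of x p] by (simp add: C1_def ac_simps)
      also have "\<dots> \<le> C1 * (1 + a x powr p)"
        by (rule mult_left_mono[OF powr_diff_1_le[OF a0 p_gt_1] C12(1)])
      finally have 1: "a x powr (p - 2) * (\<bar>F t\<bar> * \<bar>S x\<bar>) \<le> C1 * (1 + a x powr p)" .
      have "\<bar>\<Sum>j\<in>UNIV. X c x $ j * d j\<bar> \<le> (\<Sum>j\<in>UNIV. C * a x * \<bar>d j\<bar>)"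
        by (rule order_trans[OF sum_abs sum_mono])
          (use Xb[OF x] in \<open>auto simp: abs_mult intro!: mult_right_mono\<close>)
      then have "(\<bar>\<psi> (snd c x)\<bar> * \<bar>F' t\<bar>) * \<bar>\<Sum>j\<in>UNIV. X c x $ j * d j\<bar> \<le> (B0 * M) * (\<Sum>j\<in>UNIV. C * a x * \<bar>d j\<bar>)"
        using B0 F'_le[OF t] M_nonneg by (intro mult_mono) auto
      then have "a x powr (p - 2) * ((\<bar>\<psi> (snd c x)\<bar> * \<bar>F' t\<bar>) * \<bar>\<Sum>j\<in>UNIV. X c x $ j * d j\<bar>)
          \<le> a x powr (p - 2) * ((B0 * M) * (\<Sum>j\<in>UNIV. C * a x * \<bar>d j\<bar>))"
        by (rule mult_left_mono) simp
      also have "\<dots> = C2 * (\<Sum>j\<in>UNIV. (a x powr (p - 2) * a x) * \<bar>d j\<bar>)"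
        by (simp add: C2_def sum_distrib_left ac_simps)
      also have "\<dots> \<le> C2 * (\<Sum>j\<in>UNIV. a x powr p + \<gamma> j)"
      proof (intro mult_left_mono[OF _ C12(2)] sum_mono)
        fix j
        have "a x powr (p - 1) * \<bar>d j\<bar> \<le> a x powr p + \<bar>d j\<bar> powr p"
          by (rule powr_diff_1_mult_le[OF a0 _ p_gt_1]) simp
        then show "(a x powr (p - 2) * a x) * \<bar>d j\<bar> \<le> a x powr p + \<gamma> j"
          using d[of j] powr_diff_2_mult(1)[OF a0, of x p] by simp
      qed
      finally have 2: "a x powr (p - 2) * ((\<bar>\<psi> (snd c x)\<bar> * \<bar>F' t\<bar>) * \<bar>\<Sum>j\<in>UNIV. X c x $ j * d j\<bar>)
          \<le> C2 * (\<Sum>j\<in>UNIV. a x powr p + \<gamma> j)" .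
      have "\<bar>J x t d\<bar> = a x powr (p - 2) * \<bar>F t * S x + \<psi> (snd c x) * F' t * (\<Sum>j\<in>UNIV. X c x $ j * d j)\<bar>"
        by (simp add: J_def abs_mult)
      also have "\<dots> \<le> a x powr (p - 2) * (\<bar>F t * S x\<bar> + \<bar>\<psi> (snd c x) * F' t * (\<Sum>j\<in>UNIV. X c x $ j * d j)\<bar>)"
        by (intro mult_left_mono abs_triangle_ineq) simp
      also have "\<dots> = a x powr (p - 2) * (\<bar>F t\<bar> * \<bar>S x\<bar>)
          + a x powr (p - 2) * ((\<bar>\<psi> (snd c x)\<bar> * \<bar>F' t\<bar>) * \<bar>\<Sum>j\<in>UNIV. X c x $ j * d j\<bar>)"
        by (simp add: abs_mult distrib_left)
      also note add_mono[OF 1 2]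
      finally show ?thesis .
    qed
    \<comment> \<open>Only the summands \<gamma> vary with the approximation, so L^1 convergence of
      these majorants reduces to that of \<open>G k\<close>, transported from the chart to the
      manifold.\<close>
    define \<Gamma> where "\<Gamma> \<gamma> x = indicator L x * (C1 * (1 + a x powr p) + C2 * (\<Sum>j\<in>UNIV. a x powr p + \<gamma> j (snd c x)))"
      for \<gamma> :: "'n \<Rightarrow> real ^ 'n \<Rightarrow> real" and x
    define H where "H j y = \<bar>h j y\<bar> powr p" for j y
    have Ki: "set_integrable lborel K (G k j)" for k j
      unfolding set_integrable_def
      by (rule integrable_mult_indicator[OF _ Gi]) (use \<psi>C(2) in \<open>simp add: compact_imp_closed\<close>)
    have KH: "set_integrable lborel K (H j)" for j
      using Lp[of j] \<psi>C(2,3) by (simp add: locally_integrable_def H_def[abs_def])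
    obtain C3 where C3: "C3 > 0" "\<And>\<Theta> :: real ^ 'n \<Rightarrow> real. set_integrable lborel K \<Theta> \<Longrightarrow>
      set_integrable vol L (\<lambda>x. \<Theta> (snd c x)) \<and>
      (LINT x:L|vol. \<bar>\<Theta> (snd c x)\<bar>) \<le> C3 * (LINT y:K|lborel. \<bar>\<Theta> y\<bar>)"
    proof (rule chart_integrable_vol[OF c L LU1, unfolded LK], goal_cases)
      case (1 C3)
      from 1(2,3) show ?case by (rule 1(1))
    qed
    have ai: "integrable vol (\<lambda>x. indicator L x * a x powr p)"
      using grad_Lp L LU by (simp add: locally_integrable_def set_integrable_def a_def)
    have Li: "integrable vol (\<lambda>x. indicator L x :: real)"
      using emeasure_vol_compact[OF L] Lb by (intro integrable_real_indicator) auto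
    have \<Gamma>i: "integrable vol (\<Gamma> \<gamma>)" if "\<And>j. set_integrable lborel K (\<gamma> j)" for \<gamma>
    proof -
      have "integrable vol (\<lambda>x. indicator L x * \<gamma> j (snd c x))" for j
        using C3(2)[OF that[of j]] by (simp add: set_integrable_def)
      then have "integrable vol (\<lambda>x. C1 * (indicator L x + indicator L x * a x powr p) +
          C2 * (\<Sum>j\<in>UNIV. indicator L x * a x powr p + indicator L x * \<gamma> j (snd c x)))"
        using ai Li by (intro Bochner_Integration.integrable_add integrable_mult_right Bochner_Integration.integrable_sum) auto
      moreover have "(\<lambda>x. C1 * (indicator L x + indicator L x * a x powr p) +
          C2 * (\<Sum>j\<in>UNIV. indicator L x * a x powr p + indicator L x * \<gamma> j (snd c x))) = \<Gamma> \<gamma>"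
        by (auto simp: \<Gamma>_def fun_eq_iff indicator_def)
      ultimately show ?thesis by simp
    qed
    have Rl: "(\<lambda>x. \<theta> (snd c x)) \<in> borel_measurable (restrict_space vol L)"
      if "continuous_on UNIV \<theta>" for \<theta> :: "real ^ 'n \<Rightarrow> real"
      by (rule continuous_measurable_chart[OF continuous_on_compose2[OF that chart_continuous[OF c]] LU1 Lb]) simp
    note [measurable] = rho_measurable_chart[OF c L LU] gnorm_measurable_chart[OF c L LU, folded a_def]
      grad_component_measurable_chart[OF c L LU] covector_measurable_chart[OF c L LU]
      Rl[OF c\<psi>(1)] Rl[OF c\<psi>(2)] Rl[OF Ck_on_1_continuous[OF R1]] Rl[OF Ck_on_1_continuous_derivative[OF R1]]
      F_measurable
    have am [measurable]: "a \<in> borel_measurable (restrict_space vol L)"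
      unfolding a_def[abs_def] by measurable
    have toL: "(\<lambda>x. indicator L x * f x) \<in> borel_measurable vol" if "f \<in> borel_measurable (restrict_space vol L)" for f :: "'m \<Rightarrow> real"
      using that Lb by (subst (asm) borel_measurable_restrict_space_iff) auto
    have hm: "(\<lambda>x. h j (snd c x)) \<in> borel_measurable (restrict_space vol L)" for j
    proof -
      have "(\<lambda>x. h j (snd c x)) \<in> borel_measurable (restrict_space vol L) \<longleftrightarrow>
          (\<lambda>x. g c x (X c x) (axis j 1)) \<in> borel_measurable (restrict_space vol L)"
        by (rule measurable_cong) (use inL(4) in \<open>auto simp: h_def space_restrict_space\<close>)
      then show ?thesis using covector_measurable_chart[OF c L LU] by simp
    qed
    note [measurable] = hm
    have Im: "I k \<in> borel_measurable (restrict_space vol L)" for k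
      unfolding I_def[abs_def] J_def S_def D\<psi>_def DR_def by measurable
    have I'm: "I' \<in> borel_measurable (restrict_space vol L)"
      unfolding I'_def[abs_def] J_def S_def D\<psi>_def by measurable
    have ae1: "AE x in vol. x \<in> fst c \<longrightarrow> (snd c x \<in> K \<longrightarrow> (\<lambda>k. R k (snd c x)) \<longlonglongrightarrow> (\<rho> \<circ> chart_inv c) (snd c x))"
      by (rule AE_vol_chart[OF c]) (use Rlim in eventually_elim, simp)
    have ae2: "AE x in vol. \<forall>j\<in>UNIV. x \<in> fst c \<longrightarrow> (snd c x \<in> K \<longrightarrow> (\<lambda>k. DR k x j) \<longlonglongrightarrow> h j (snd c x))"
    proof (rule AE_finite_allI)
      fix j :: 'n
      show "AE x in vol. x \<in> fst c \<longrightarrow> (snd c x \<in> K \<longrightarrow> (\<lambda>k. DR k x j) \<longlonglongrightarrow> h j (snd c x))"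
        unfolding DR_def by (rule AE_vol_chart[OF c]) (use DRlim[of j] in eventually_elim, simp)
    qed simp
    show ?thesis
    proof (rule integral_dominated_convergence_L1(2))
      show "(\<lambda>x. indicator L x * I k x) \<in> borel_measurable vol" for k
        by (rule toL[OF Im])
      show "(\<lambda>x. indicator L x * I' x) \<in> borel_measurable vol"
        by (rule toL[OF I'm])
      show "integrable vol (\<Gamma> (G k))" for k by (rule \<Gamma>i[OF Ki])
      show "integrable vol (\<Gamma> H)" by (rule \<Gamma>i[OF KH])
      show "AE x in vol. (\<lambda>k. indicator L x * I k x) \<longlonglongrightarrow> indicator L x * I' x"
        using ae1 ae2 rho_nonneg
      proof eventually_elim
        case (elim x)
        show ?case
        proof (cases "x \<in> L")
          case True
          note x = inL[OF True]
          have r: "(\<lambda>k. R k (snd c x)) \<longlonglongrightarrow> \<rho> x" using elim(1) x by simp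
          have d: "(\<lambda>k. DR k x j) \<longlonglongrightarrow> h j (snd c x)" for j using elim(2) x by simp
          \<comment> \<open>Continuity of the weight is used on t > - e: the approximations are
            nonnegative everywhere, and \<rho> is nonnegative at the points considered.\<close>
          have "R k (snd c x) \<in> {- e<..}" for k
            using e_pos R0[of k "snd c x"] by simp
          then have ev: "\<forall>\<^sub>F k in sequentially. R k (snd c x) \<in> {- e<..}"
            by (intro always_eventually allI)
          have "\<rho> x \<in> {- e<..}"
            using elim(3) x e_pos by simp
          note in_dom = this ev
          have "(\<lambda>k. F (R k (snd c x))) \<longlonglongrightarrow> F (\<rho> x)" "(\<lambda>k. F' (R k (snd c x))) \<longlonglongrightarrow> F' (\<rho> x)"
            by (rule continuous_on_tendsto_compose[OF F_cont r in_dom] continuous_on_tendsto_compose[OF F'_cont r in_dom])+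
          then have "(\<lambda>k. I k x) \<longlonglongrightarrow> I' x"
            unfolding I_def I'_def J_def by (intro tendsto_intros d)
          then show ?thesis by (rule tendsto_mult_left)
        qed simp
      qed
      show "AE x in vol. \<bar>indicator L x * I k x\<bar> \<le> \<Gamma> (G k) x" for k
      proof (rule AE_I2)
        fix x
        show "\<bar>indicator L x * I k x\<bar> \<le> \<Gamma> (G k) x"
        proof (cases "x \<in> L")
          case True
          have "\<bar>I k x\<bar> \<le> C1 * (1 + a x powr p) + C2 * (\<Sum>j\<in>UNIV. a x powr p + G k j (snd c x))"
            unfolding I_def by (rule Jb[OF True R0]) (use DRG[OF inL(3)[OF True]] in \<open>simp add: DR_def\<close>)
          then show ?thesis using True by (simp add: \<Gamma>_def)
        qed (simp add: \<Gamma>_def)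
      qed
      show "AE x in vol. \<bar>indicator L x * I' x\<bar> \<le> \<Gamma> H x"
        using rho_nonneg
      proof eventually_elim
        case (elim x)
        show ?case
        proof (cases "x \<in> L")
          case True
          have "\<bar>I' x\<bar> \<le> C1 * (1 + a x powr p) + C2 * (\<Sum>j\<in>UNIV. a x powr p + H j (snd c x))"
            unfolding I'_def by (rule Jb[OF True]) (use elim inL(2)[OF True] in \<open>auto simp: H_def\<close>)
          then show ?thesis using True by (simp add: \<Gamma>_def)
        qed (simp add: \<Gamma>_def)
      qed
      show "(\<lambda>k. LINT x|vol. \<bar>\<Gamma> (G k) x - \<Gamma> H x\<bar>) \<longlonglongrightarrow> 0"
      proof (rule Lim_null_comparison)
        have "(LINT x|vol. \<bar>\<Gamma> (G k) x - \<Gamma> H x\<bar>) \<le> (\<Sum>j\<in>UNIV. C2 * (C3 * (LINT y:K|lborel. \<bar>G k j y - H j y\<bar>)))" for k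
        proof -
          have GH: "set_integrable lborel K (\<lambda>y. G k j y - H j y)" for j
            using Ki KH by (rule set_integral_diff(1))
          have int: "integrable vol (\<lambda>x. indicator L x * \<bar>G k j (snd c x) - H j (snd c x)\<bar>)" for j
            using integrable_abs[of vol "\<lambda>x. indicator L x * (G k j (snd c x) - H j (snd c x))"] C3(2)[OF GH[of j]]
            by (simp add: set_integrable_def abs_mult)
          have "(LINT x|vol. \<bar>\<Gamma> (G k) x - \<Gamma> H x\<bar>) \<le>
              (LINT x|vol. (\<Sum>j\<in>UNIV. C2 * (indicator L x * \<bar>G k j (snd c x) - H j (snd c x)\<bar>)))"
          proof (rule integral_mono)
            show "integrable vol (\<lambda>x. \<bar>\<Gamma> (G k) x - \<Gamma> H x\<bar>)"
              using \<Gamma>i[OF Ki] \<Gamma>i[OF KH] by simp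
            show "integrable vol (\<lambda>x. \<Sum>j\<in>UNIV. C2 * (indicator L x * \<bar>G k j (snd c x) - H j (snd c x)\<bar>))"
              using int by simp
            fix x
            have "\<Gamma> (G k) x - \<Gamma> H x = indicator L x * (C2 * (\<Sum>j\<in>UNIV. G k j (snd c x) - H j (snd c x)))"
              by (simp add: \<Gamma>_def sum.distrib sum_subtractf algebra_simps)
            also have "\<bar>\<dots>\<bar> \<le> indicator L x * (C2 * (\<Sum>j\<in>UNIV. \<bar>G k j (snd c x) - H j (snd c x)\<bar>))"
              using C12(2) by (simp add: abs_mult mult_left_mono sum_abs)
            finally show "\<bar>\<Gamma> (G k) x - \<Gamma> H x\<bar> \<le> (\<Sum>j\<in>UNIV. C2 * (indicator L x * \<bar>G k j (snd c x) - H j (snd c x)\<bar>))"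
              by (simp add: sum_distrib_left ac_simps)
          qed
          also have "\<dots> = (\<Sum>j\<in>UNIV. C2 * (LINT x:L|vol. \<bar>G k j (snd c x) - H j (snd c x)\<bar>))"
            using int by (simp add: set_lebesgue_integral_def)
          also have "\<dots> \<le> (\<Sum>j\<in>UNIV. C2 * (C3 * (LINT y:K|lborel. \<bar>G k j y - H j y\<bar>)))"
            by (intro sum_mono mult_left_mono[OF _ C12(2)] conjunct2[OF C3(2)[OF GH]])
          finally show ?thesis .
        qed
        then show "\<forall>\<^sub>F k in sequentially. norm (LINT x|vol. \<bar>\<Gamma> (G k) x - \<Gamma> H x\<bar>)
            \<le> (\<Sum>j\<in>UNIV. C2 * (C3 * (LINT y:K|lborel. \<bar>G k j y - H j y\<bar>)))"
          by (intro always_eventually allI) (simp add: Bochner_Integration.integral_nonneg)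
        have "(\<lambda>k. \<Sum>j\<in>(UNIV :: 'n set). C2 * (C3 * (LINT y:K|lborel. \<bar>G k j y - H j y\<bar>))) \<longlonglongrightarrow> (\<Sum>j\<in>(UNIV :: 'n set). C2 * (C3 * 0))"
          unfolding H_def by (intro tendsto_sum tendsto_mult_left GL)
        then show "(\<lambda>k. \<Sum>j\<in>UNIV. C2 * (C3 * (LINT y:K|lborel. \<bar>G k j y - H j y\<bar>))) \<longlonglongrightarrow> 0"
          by simp
      qed
    qed
  qed
  show ?thesis
    unfolding step2[symmetric] by (rule LIMSEQ_le_const[OF step3]) (use step1 in blast)
qed

end

section \<open>Hardy's inequality\<close>

text \<open>A C^1 plateau: by the factor 4 the function equals 1 wherever \<open>bump\<close>
  exceeds 1/4, hence near the centre for r > 0, and it still vanishes where \<open>bump\<close>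
  does.\<close>

definition flat_bump :: "real \<Rightarrow> 'a::euclidean_space \<Rightarrow> real"
  where "flat_bump r y = 1 - psq (1 - 4 * bump r y)"

lemma flat_bump_range: "0 \<le> flat_bump r y" "flat_bump r y \<le> 1"
  using psq_le_1[of "1 - 4 * bump r y"] psq_nonneg[of "1 - 4 * bump r y"] bump_nonneg[of r y]
  by (auto simp: flat_bump_def)

lemma flat_bump_eq_0: "r > 0 \<Longrightarrow> r \<le> norm y \<Longrightarrow> flat_bump r y = 0"
  by (simp add: flat_bump_def bump_eq_0_iff[THEN iffD2] psq_def)

lemma flat_bump_eq_1: "1 / 4 < bump r y \<Longrightarrow> flat_bump r y = 1"
  by (simp add: flat_bump_def psq_eq_0)

lemma Ck_on_1_flat_bump:
  assumes "r > 0"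
  shows "Ck_on 1 (\<lambda>y. flat_bump r (y - z :: 'a::euclidean_space)) UNIV"
proof -
  have "((\<lambda>t. 1 - psq (1 - 4 * t)) has_real_derivative 8 * max 0 (1 - 4 * t)) (at t)" for t
    by (auto intro!: derivative_eq_intros DERIV_chain2[OF psq_has_derivative])
  moreover have "continuous_on UNIV (\<lambda>t::real. 8 * max 0 (1 - 4 * t))"
    by (intro continuous_intros)
  ultimately have "Ck_on 1 (\<lambda>y. 1 - psq (1 - 4 * bump r y)) (UNIV :: 'a set)"
    by (intro Ck_on_1_real_compose(1)[OF Ck_on_1_bump[OF assms], where T = UNIV]) auto
  then have "Ck_on 1 (flat_bump r) (UNIV :: 'a set)"
    unfolding flat_bump_def[abs_def] .
  moreover have "Ck_on 1 (\<lambda>y. y - z) (UNIV :: 'a set)"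
    by (rule Ck_on_1_I[where D = "\<lambda>x v. v"]) (auto intro!: derivative_eq_intros)
  ultimately show ?thesis by (rule Ck_on_1_compose) simp
qed

text \<open>Writing the derivative with positive parts instead of a sign function makes its
  continuity at 0 visible. At 0 the difference quotient has absolute value |h|^(p-1), which tends to
  0 because p > 1.\<close>

lemma abs_powr_has_derivative:
  fixes p t :: real
  assumes p: "p > 1"
  shows "((\<lambda>t. \<bar>t\<bar> powr p) has_real_derivative p * (max 0 t powr (p - 1) - max 0 (- t) powr (p - 1))) (at t)"
proof -
  consider "t > 0" | "t < 0" | "t = 0" by linarith
  then show ?thesis
  proof cases
    case 1
    have "((\<lambda>t. t powr p) has_real_derivative p * t powr (p - 1)) (at t)"
      by (rule has_real_derivative_powr[OF 1])
    then have "((\<lambda>t. \<bar>t\<bar> powr p) has_real_derivative p * t powr (p - 1)) (at t)"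
      by (rule has_field_derivative_transform_within_open[where S = "{0<..}"]) (use 1 in auto)
    then show ?thesis using 1 by (simp add: max_def)
  next
    case 2
    have "((\<lambda>t. (- t) powr p) has_real_derivative (p * (- t) powr (p - 1)) * (- 1)) (at t)"
      by (rule DERIV_chain2[OF has_real_derivative_powr]) (use 2 in \<open>auto intro!: derivative_eq_intros\<close>)
    then have "((\<lambda>t. \<bar>t\<bar> powr p) has_real_derivative (p * (- t) powr (p - 1)) * (- 1)) (at t)"
      by (rule has_field_derivative_transform_within_open[where S = "{..<0}"]) (use 2 in auto)
    then show ?thesis using 2 by (simp add: max_def)
  next
    case 3
    have cont: "continuous_on UNIV (\<lambda>h::real. \<bar>h\<bar> powr (p - 1))"
      by (rule continuous_on_powr') (use p in \<open>auto intro!: continuous_intros\<close>)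
    then have "(\<lambda>h::real. \<bar>h\<bar> powr (p - 1)) \<midarrow>0\<rightarrow> \<bar>0\<bar> powr (p - 1)"
      unfolding continuous_on_def by blast
    then have lim: "(\<lambda>h::real. \<bar>h\<bar> powr (p - 1)) \<midarrow>0\<rightarrow> 0" by simp
    have "norm (\<bar>h\<bar> powr p / h) = \<bar>h\<bar> powr (p - 1)" if "h \<noteq> 0" for h :: real
      using that by (simp add: powr_diff)
    then have "\<forall>\<^sub>F h in at 0. norm (\<bar>h\<bar> powr p / h) \<le> \<bar>h\<bar> powr (p - 1)"
      by (simp add: eventually_at_filter)
    from Lim_null_comparison[OF this lim] show ?thesis
      using 3 by (simp add: DERIV_def)
  qed
qed

section \<open>From one chart to the whole domain\<close>

context superharmonic_weight
begin

lemma C1_0_diff: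
  assumes w: "w \<in> C1_0 A \<Omega>" and v: "v \<in> C1_0 A \<Omega>" and sub: "\<And>x. w x = 0 \<Longrightarrow> v x = 0"
  shows "(\<lambda>x. w x - v x) \<in> C1_0 A \<Omega>"
proof -
  have cl: "closure {x. w x - v x \<noteq> 0} \<subseteq> closure {x. w x \<noteq> 0}"
    by (rule closure_mono) (use sub in auto)
  have "compact (closure {x. w x - v x \<noteq> 0})"
    using compact_Int_closed[OF C1_0D(2)[OF w] closed_closure, of "{x. w x - v x \<noteq> 0}"] cl
    by (simp add: inf.absorb2)
  moreover have "C1_manifold A (\<lambda>x. w x - v x)"
    by (rule C1_manifold_diff[OF C1_0D(1)[OF w] C1_0D(1)[OF v]])
  ultimately show ?thesis
    using cl C1_0D(3)[OF w] unfolding C1_0_def C1_manifold_def by blast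
qed

lemma Tint_integral_diff:
  assumes w: "w \<in> C1_0 A \<Omega>" and v: "v \<in> C1_0 A \<Omega>"
  shows "(LINT x:\<Omega>|vol. Tint (\<lambda>x. w x - v x) x) = (LINT x:\<Omega>|vol. Tint w x) - (LINT x:\<Omega>|vol. Tint v x)"
proof -
  have "(LINT x:\<Omega>|vol. Tint (\<lambda>x. w x - v x) x) = (LINT x:\<Omega>|vol. Tint w x - Tint v x)"
  proof (rule set_lebesgue_integral_cong)
    show "\<forall>x. x \<in> \<Omega> \<longrightarrow> Tint (\<lambda>x. w x - v x) x = Tint w x - Tint v x"
    proof (intro allI impI)
      fix x assume x: "x \<in> \<Omega>"
      show "Tint (\<lambda>x. w x - v x) x = Tint w x - Tint v x"
        unfolding Tint_def ginner_gradient_diff[OF C1_0D(1)[OF w] C1_0D(1)[OF v] vector_field_grad x]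
        by (simp add: algebra_simps)
    qed
  qed (use open_domain in simp)
  then show ?thesis
    using set_integral_diff(2)[OF Tint_integrable[OF w] Tint_integrable[OF v]] by simp
qed

lemma lift_mult_C1_0:
  assumes c: "c \<in> A" and \<eta>: "\<eta> \<in> C1_0_euclidean (snd c ` (fst c \<inter> \<Omega>))" and w: "w \<in> C1_0 A \<Omega>"
  shows "(\<lambda>y. \<eta> y * w (chart_inv c y)) \<in> C1_0_euclidean (snd c ` (fst c \<inter> \<Omega>))"
    and "lift c (\<lambda>y. \<eta> y * w (chart_inv c y)) x = lift c \<eta> x * w x"
proof -
  define K where "K = closure {y. \<eta> y \<noteq> 0}"
  note \<eta>C = C1_0_euclideanD[OF \<eta>, folded K_def]
  have z: "\<eta> y = 0" if "y \<notin> K" for y by (rule C1_0_euclidean_zero(1)[OF \<eta>, folded K_def, OF that])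
  have wc: "Ck_on 1 (\<lambda>y. w (chart_inv c y)) (snd c ` fst c)"
    using C1_0D(1)[OF w] c unfolding C1_manifold_def comp_def by blast
  have "Ck_on 1 (\<lambda>y. \<eta> y * w (chart_inv c y)) (snd c ` fst c)"
    by (rule Ck_on_1_mult[OF Ck_on_1_subset[OF \<eta>C(1) subset_UNIV] wc])
  then have 1: "Ck_on 1 (\<lambda>y. \<eta> y * w (chart_inv c y)) UNIV"
    by (rule Ck_on_1_zero_outside[OF _ chart_image_open[OF c] compact_imp_closed[OF \<eta>C(2)]])
      (use \<eta>C(3) z in auto)
  have sub: "closure {y. \<eta> y * w (chart_inv c y) \<noteq> 0} \<subseteq> K"
    unfolding K_def by (rule closure_mono) auto
  have "compact (closure {y. \<eta> y * w (chart_inv c y) \<noteq> 0})"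
    using compact_Int_closed[OF \<eta>C(2) closed_closure, of "{y. \<eta> y * w (chart_inv c y) \<noteq> 0}"] sub
    by (simp add: inf.absorb2)
  then show "(\<lambda>y. \<eta> y * w (chart_inv c y)) \<in> C1_0_euclidean (snd c ` (fst c \<inter> \<Omega>))"
    using 1 sub \<eta>C(3) unfolding C1_0_euclidean_def by blast
  show "lift c (\<lambda>y. \<eta> y * w (chart_inv c y)) x = lift c \<eta> x * w x"
    using chart_inv_left[OF c, of x] by (simp add: lift_def)
qed

text \<open>Each step subtracts the product of the current function with one cutoff. This product
  lives in a single chart, so \<open>Tint_lift_nonneg\<close> applies to it and the integral does
  not increase. The remaining factor \<open>1 - lift c \<eta>\<close> vanishes where that cutoff is
  1, and earlier zeros persist.\<close>

lemma Tint_cutoff: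
  assumes "finite D"
    and "\<And>d. d \<in> D \<Longrightarrow> fst d \<in> A \<and> snd d \<in> C1_0_euclidean (snd (fst d) ` (fst (fst d) \<inter> \<Omega>)) \<and>
      (\<forall>y. 0 \<le> snd d y \<and> snd d y \<le> 1)"
    and "w \<in> C1_0 A \<Omega>" "\<And>x. w x \<ge> 0"
  shows "\<exists>w'\<in>C1_0 A \<Omega>. (\<forall>x. w' x \<ge> 0) \<and> (LINT x:\<Omega>|vol. Tint w' x) \<le> (LINT x:\<Omega>|vol. Tint w x) \<and>
    (\<forall>x. w' x \<noteq> 0 \<longrightarrow> w x \<noteq> 0 \<and> (\<forall>d\<in>D. lift (fst d) (snd d) x \<noteq> 1))"
  using assms
proof (induction D rule: finite_induct)
  case empty
  then show ?case by auto
next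
  case (insert d D)
  have "\<exists>w'\<in>C1_0 A \<Omega>. (\<forall>x. w' x \<ge> 0) \<and> (LINT x:\<Omega>|vol. Tint w' x) \<le> (LINT x:\<Omega>|vol. Tint w x) \<and>
    (\<forall>x. w' x \<noteq> 0 \<longrightarrow> w x \<noteq> 0 \<and> (\<forall>d\<in>D. lift (fst d) (snd d) x \<noteq> 1))"
    by (rule insert.IH[OF insert.prems(1)[OF insertI2] insert.prems(2,3)])
  then obtain w1 where w1: "w1 \<in> C1_0 A \<Omega>" "\<And>x. w1 x \<ge> 0"
    "(LINT x:\<Omega>|vol. Tint w1 x) \<le> (LINT x:\<Omega>|vol. Tint w x)"
    "\<And>x. w1 x \<noteq> 0 \<Longrightarrow> w x \<noteq> 0 \<and> (\<forall>d\<in>D. lift (fst d) (snd d) x \<noteq> 1)"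
    by blast
  obtain c \<eta> where d: "d = (c, \<eta>)" by (cases d)
  have c: "c \<in> A" and \<eta>: "\<eta> \<in> C1_0_euclidean (snd c ` (fst c \<inter> \<Omega>))" "\<And>y. 0 \<le> \<eta> y" "\<And>y. \<eta> y \<le> 1"
    using insert.prems(1)[of d] by (auto simp: d)
  define \<theta> where "\<theta> y = \<eta> y * w1 (chart_inv c y)" for y
  have \<theta>: "\<theta> \<in> C1_0_euclidean (snd c ` (fst c \<inter> \<Omega>))" "\<And>x. lift c \<theta> x = lift c \<eta> x * w1 x"
    unfolding \<theta>_def[abs_def] by (rule lift_mult_C1_0[OF c \<eta>(1) w1(1)])+
  have v: "lift c \<theta> \<in> C1_0 A \<Omega>" by (rule lift_C1_0(1)[OF c open_domain \<theta>(1)])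
  have Tv: "(LINT x:\<Omega>|vol. Tint (lift c \<theta>) x) \<ge> 0"
    by (rule Tint_lift_nonneg[OF c \<theta>(1)]) (simp add: \<theta>_def \<eta> w1)
  have l: "0 \<le> lift c \<eta> x" "lift c \<eta> x \<le> 1" for x
    using \<eta> by (auto simp: lift_def)
  define w2 where "w2 x = w1 x - lift c \<theta> x" for x
  have w2: "w2 x = (1 - lift c \<eta> x) * w1 x" for x
    by (simp add: w2_def \<theta> left_diff_distrib)
  show ?case
  proof (intro bexI[of _ w2] conjI allI impI)
    show "w2 \<in> C1_0 A \<Omega>"
      unfolding w2_def[abs_def] by (rule C1_0_diff[OF w1(1) v]) (simp add: \<theta>)
    show "w2 x \<ge> 0" for x using l[of x] w1(2)[of x] by (simp add: w2)
    show "(LINT x:\<Omega>|vol. Tint w2 x) \<le> (LINT x:\<Omega>|vol. Tint w x)"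
      using Tint_integral_diff[OF w1(1) v] Tv w1(3) by (simp add: w2_def[abs_def])
    fix x assume "w2 x \<noteq> 0"
    then have "w1 x \<noteq> 0" "lift c \<eta> x \<noteq> 1" by (auto simp: w2)
    then show "w x \<noteq> 0" "\<forall>d\<in>insert d D. lift (fst d) (snd d) x \<noteq> 1"
      using w1(4)[of x] by (auto simp: d)
  qed
qed

text \<open>A partition of unity argument: multiplying by \<open>1 - \<chi>\<close> for finitely many cutoff functions
  \<open>\<chi>\<close> that equal \<open>1\<close> on a cover of the support decreases the integral and ends with \<open>0\<close>.\<close>

lemma Tint_nonneg:
  assumes w: "w \<in> C1_0 A \<Omega>" and pos: "\<And>x. w x \<ge> 0"
  shows "(LINT x:\<Omega>|vol. Tint w x) \<ge> 0"
proof -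
  define K where "K = closure {x. w x \<noteq> 0}"
  have K: "compact K" "K \<subseteq> \<Omega>" using C1_0D[OF w] by (auto simp: K_def)
  define valid where "valid d \<longleftrightarrow> fst d \<in> A \<and> snd d \<in> C1_0_euclidean (snd (fst d) ` (fst (fst d) \<inter> \<Omega>)) \<and>
      (\<forall>y. 0 \<le> snd d y \<and> snd d y \<le> 1)" for d :: "('m, 'n) chart \<times> (real ^ 'n \<Rightarrow> real)"
  have "\<exists>N d. open N \<and> x \<in> N \<and> valid d \<and> (\<forall>z\<in>N. lift (fst d) (snd d) z = 1)" if "x \<in> K" for x
  proof -
    have x\<Omega>: "x \<in> \<Omega>" using that K(2) by auto
    obtain c where c: "c \<in> A" "x \<in> fst c" using charts_cover by blast
    have "open (snd c ` (fst c \<inter> \<Omega>))" by (rule chart_image_Int_open[OF c(1) open_domain])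
    then obtain r where r: "r > 0" "cball (snd c x) r \<subseteq> snd c ` (fst c \<inter> \<Omega>)"
      using c x\<Omega> open_contains_cball by blast
    define \<eta> where "\<eta> y = flat_bump r (y - snd c x)" for y
    have cl: "closure {y. \<eta> y \<noteq> 0} \<subseteq> cball (snd c x) r"
    proof (rule closure_minimal[OF _ closed_cball], rule subsetI, rule ccontr)
      fix y assume "y \<in> {y. \<eta> y \<noteq> 0}" "y \<notin> cball (snd c x) r"
      then show False using flat_bump_eq_0[OF r(1), of "y - snd c x"]
        by (simp add: \<eta>_def dist_norm norm_minus_commute)
    qed
    have "compact (closure {y. \<eta> y \<noteq> 0})"
      using compact_Int_closed[OF compact_cball closed_closure, of "snd c x" r "{y. \<eta> y \<noteq> 0}"] cl
      by (simp add: inf.absorb2)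
    moreover have "Ck_on 1 \<eta> UNIV"
      unfolding \<eta>_def[abs_def] by (rule Ck_on_1_flat_bump[OF r(1)])
    ultimately have "\<eta> \<in> C1_0_euclidean (snd c ` (fst c \<inter> \<Omega>))"
      using cl r(2) unfolding C1_0_euclidean_def by blast
    then have v: "valid (c, \<eta>)"
      using c(1) by (simp add: valid_def \<eta>_def flat_bump_range)
    \<comment> \<open>On this open set the bump exceeds the threshold 1/4 of
      \<open>flat_bump\<close>, so the cutoff is 1 there.\<close>
    define B where "B = {y. 1 / 4 < bump r (y - snd c x)} \<inter> snd c ` fst c"
    have "open {y. 1 / 4 < bump r (y - snd c x)}"
      by (intro open_Collect_less continuous_intros continuous_on_compose2[OF continuous_on_bump[of UNIV]]) auto
    then have Bo: "open B" using chart_image_open[OF c(1)] by (auto simp: B_def)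
    have BW: "B \<subseteq> snd c ` fst c" by (auto simp: B_def)
    show ?thesis
    proof (intro exI[of _ "chart_inv c ` B"] exI[of _ "(c, \<eta>)"] conjI ballI v)
      show "open (chart_inv c ` B)" by (rule chart_inv_image_open[OF c(1) BW Bo])
      have "snd c x \<in> B" using c by (simp add: B_def bump_def psq_def)
      then show "x \<in> chart_inv c ` B"
        using chart_inv_left[OF c] by (metis imageI)
      fix z assume "z \<in> chart_inv c ` B"
      then obtain y where y: "y \<in> B" "z = chart_inv c y" by auto
      have yW: "y \<in> snd c ` fst c" using y BW by auto
      have "lift c \<eta> z = \<eta> y"
        unfolding lift_def y(2) using chart_inv_in[OF c(1) yW] chart_inv_right[OF c(1) yW] by simp
      also have "\<dots> = 1" unfolding \<eta>_def by (rule flat_bump_eq_1) (use y(1) in \<open>simp add: B_def\<close>)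
      finally show "lift (fst (c, \<eta>)) (snd (c, \<eta>)) z = 1" by simp
    qed
  qed
  then obtain N d where Nd: "\<And>x. x \<in> K \<Longrightarrow> open (N x) \<and> x \<in> N x \<and> valid (d x) \<and>
      (\<forall>z\<in>N x. lift (fst (d x)) (snd (d x)) z = 1)"
    by metis
  obtain D where D: "D \<subseteq> K" "finite D" "K \<subseteq> (\<Union>x\<in>D. N x)"
    using compactE_image[OF K(1), of K N] Nd by blast
  have val: "d' \<in> d ` D \<Longrightarrow> fst d' \<in> A \<and> snd d' \<in> C1_0_euclidean (snd (fst d') ` (fst (fst d') \<inter> \<Omega>)) \<and>
      (\<forall>y. 0 \<le> snd d' y \<and> snd d' y \<le> 1)" for d'
    using Nd D(1) unfolding valid_def by blast
  obtain w' where w': "w' \<in> C1_0 A \<Omega>" "(LINT x:\<Omega>|vol. Tint w' x) \<le> (LINT x:\<Omega>|vol. Tint w x)"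
    "\<And>x. w' x \<noteq> 0 \<Longrightarrow> w x \<noteq> 0 \<and> (\<forall>d\<in>d ` D. lift (fst d) (snd d) x \<noteq> 1)"
    using Tint_cutoff[OF finite_imageI[OF D(2)] val w pos] by blast
  \<comment> \<open>Every point of the support lies where some cutoff is 1, which the last property
    of \<open>w'\<close> excludes.\<close>
  have zero: "w' x = 0" for x
  proof (rule ccontr)
    assume *: "w' x \<noteq> 0"
    then have "x \<in> K" using w'(3)[OF *] closure_subset[of "{x. w x \<noteq> 0}"] by (auto simp: K_def)
    then obtain z where "z \<in> D" "x \<in> N z" using D(3) by auto
    then have "lift (fst (d z)) (snd (d z)) x = 1" using Nd D(1) by blast
    then show False using w'(3)[OF *] \<open>z \<in> D\<close> by blast
  qed
  have "(LINT x:\<Omega>|vol. Tint w' x) = (LINT x:\<Omega>|vol. 0)"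
  proof (rule set_lebesgue_integral_cong)
    show "\<forall>x. x \<in> \<Omega> \<longrightarrow> Tint w' x = 0"
      using ginner_gradient_zero[OF C1_0D(1)[OF w'(1)] vector_field_grad] by (simp add: Tint_def zero)
  qed (use open_domain in simp)
  then show ?thesis using w'(2) by simp
qed

end

text \<open>Young's inequality with exponents p/(p-1) and p, applied to z^(p-1) and k y with k =
  p/(p-1). This scaling turns the left side into (p-1) times the product minus (p-1) z^p, and the
  terms in z combine to - (p-1)/p z^p. The factor (p-1)/p is shared by the term in y, which leaves
  the constant k^p. Later z is |u| |grad \<rho>| / (\<rho> + \<epsilon>) and y is |grad u|.\<close>

lemma Young_Hardy:
  fixes p y z :: real
  assumes p: "p > 1" and y: "y \<ge> 0" and z: "z \<ge> 0"
  shows "p * z powr (p - 1) * y - (p - 1) * z powr p \<le> (p - 1) / p * ((p / (p - 1)) powr p * y powr p - z powr p)"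
proof -
  define k where "k = p / (p - 1)"
  have k: "k > 1" using p by (simp add: k_def)
  have "z powr (p - 1) * (k * y) \<le> (z powr (p - 1)) powr k / k + (k * y) powr p / p"
    by (rule Youngs_inequality) (use p y k in \<open>auto simp: k_def field_simps\<close>)
  also have "(z powr (p - 1)) powr k = z powr p"
    using p by (simp add: powr_powr k_def)
  also have "(k * y) powr p = k powr p * y powr p"
    using k y by (simp add: powr_mult)
  finally have "(p - 1) * (z powr (p - 1) * (k * y)) \<le> (p - 1) * (z powr p / k + k powr p * y powr p / p)"
    using p by (intro mult_left_mono) auto
  moreover have "(p - 1) * (z powr (p - 1) * (k * y)) = p * z powr (p - 1) * y"
    using p by (simp add: k_def)
  moreover have "(p - 1) * (z powr p / k + k powr p * y powr p / p) - (p - 1) * z powr p =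
      (p - 1) / p * (k powr p * y powr p - z powr p)"
    using p by (simp add: k_def field_simps)
  ultimately show ?thesis unfolding k_def[symmetric] by linarith
qed

section \<open>The regularized inequality and its limit\<close>

context superharmonic
begin

text \<open>With the weight (t + \<epsilon>)^(1-p) and the test |u|^p, the powers of \<rho> +
  \<epsilon> in the two terms of \<open>Tint\<close> match those of the quotient \<open>Z\<close>.
  The integrand is at most p Z^(p-1) |grad u| - (p-1) Z^p, to which \<open>Young_Hardy\<close>
  applies.\<close>

lemma Hardy_regularized:
  assumes u: "u \<in> C1_0 A \<Omega>" and \<epsilon>: "\<epsilon> > 0"
  shows "set_integrable vol \<Omega> (\<lambda>x. (\<bar>u x\<bar> * gnorm A g X x / (\<rho> x + \<epsilon>)) powr p)"
    and "(LINT x:\<Omega>|vol. (\<bar>u x\<bar> * gnorm A g X x / (\<rho> x + \<epsilon>)) powr p) \<le>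
      (p / (p - 1)) powr p * (LINT x:\<Omega>|vol. gnorm A g (gradient g u) x powr p)"
proof -
  define F where "F t = (t + \<epsilon>) powr (1 - p)" for t
  define F' where "F' t = (1 - p) * (t + \<epsilon>) powr (- p)" for t
  \<comment> \<open>The weight and the absolute value of its derivative decrease on nonnegative
    arguments, so their values at 0 are bounds.\<close>
  define M where "M = max (\<epsilon> powr (1 - p)) ((p - 1) * \<epsilon> powr (- p))"
  interpret superharmonic_weight A g vol \<Omega> \<rho> X p F F' M \<epsilon>
  proof unfold_locales
    show "(F has_real_derivative F' t) (at t)" if "t \<in> {- \<epsilon><..}" for t
    proof -
      have "((\<lambda>t. (t + \<epsilon>) powr (1 - p)) has_real_derivative ((1 - p) * (t + \<epsilon>) powr (1 - p - 1)) * 1) (at t)"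
        by (rule DERIV_chain2[OF has_real_derivative_powr]) (use that in \<open>auto intro!: derivative_eq_intros\<close>)
      then show ?thesis by (simp add: F_def[abs_def] F'_def)
    qed
    show "continuous_on {- \<epsilon><..} F'"
      unfolding F'_def by (intro continuous_intros) auto
    show "F t \<ge> 0" for t by (simp add: F_def)
    show "F t \<le> M" if "t \<ge> 0" for t
      using that \<epsilon> p_gt_1 powr_mono2'[of "1 - p" \<epsilon> "t + \<epsilon>"] by (simp add: F_def M_def)
    show "\<bar>F' t\<bar> \<le> M" if "t \<ge> 0" for t
    proof -
      have "(p - 1) * (t + \<epsilon>) powr (- p) \<le> (p - 1) * \<epsilon> powr (- p)"
        using that \<epsilon> p_gt_1 by (intro mult_left_mono powr_mono2') auto
      moreover have "\<bar>F' t\<bar> = (p - 1) * (t + \<epsilon>) powr (- p)"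
        using p_gt_1 by (simp add: F'_def abs_mult)
      moreover have "(p - 1) * \<epsilon> powr (- p) \<le> M" by (simp add: M_def)
      ultimately show ?thesis by linarith
    qed
    show "F \<in> borel_measurable borel" "F' \<in> borel_measurable borel"
      unfolding F_def[abs_def] F'_def[abs_def] by measurable
  qed (rule \<epsilon>)
  note uC = C1_0D[OF u]
  define a where "a x = gnorm A g X x" for x
  define Z where "Z x = \<bar>u x\<bar> * a x / (\<rho> x + \<epsilon>)" for x
  have a0: "a x \<ge> 0" for x by (simp add: a_def gnorm_nonneg)
  obtain B where B: "B > 0" "\<And>x. \<bar>u x\<bar> \<le> B"
    using C1_0_bounded[OF u] by metis
  define K where "K = closure {x. u x \<noteq> 0}"
  have K: "compact K" "K \<subseteq> \<Omega>" using uC by (auto simp: K_def)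
  have u0: "u x = 0" if "x \<notin> K" for x
    using that closure_subset[of "{x. u x \<noteq> 0}"] by (auto simp: K_def)
  have \<Omega>b: "\<Omega> \<in> sets borel" using open_domain by simp
  have rS: "set_borel_measurable vol \<Omega> f \<longleftrightarrow> f \<in> borel_measurable (restrict_space vol \<Omega>)" for f :: "'m \<Rightarrow> real"
    by (rule set_borel_measurable_restrict) (use \<Omega>b in simp)
  note [measurable] = rho_measurable[unfolded rS] gnorm_measurable[unfolded rS]
    continuous_set_borel_measurable[OF C1_continuous_on[OF uC(1)] \<Omega>b, unfolded rS]
  have meas: "(\<lambda>x. indicator \<Omega> x *\<^sub>R Z x powr p) \<in> borel_measurable vol"
    unfolding set_borel_measurable_def[symmetric] rS Z_def a_def by measurable
  have ai: "integrable vol (\<lambda>x. (B / \<epsilon>) powr p * (indicator K x *\<^sub>R a x powr p))"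
    using grad_Lp K by (simp add: locally_integrable_def set_integrable_def a_def)
  \<comment> \<open>Integrability comes before the inequality because this integral is going to be
    subtracted. Positivity of \<epsilon> bounds the integrand by a multiple of |grad \<rho>|^p on
    the support of \<open>u\<close>.\<close>
  have Zi: "set_integrable vol \<Omega> (\<lambda>x. Z x powr p)"
    unfolding set_integrable_def
  proof (rule Bochner_Integration.integrable_bound[OF ai meas])
    show "AE x in vol. norm (indicator \<Omega> x *\<^sub>R Z x powr p) \<le> norm ((B / \<epsilon>) powr p * (indicator K x *\<^sub>R a x powr p))"
      using rho_nonneg
    proof eventually_elim
      case (elim x)
      show ?case
      proof (cases "x \<in> K")
        case True
        then have x: "x \<in> \<Omega>" "\<rho> x \<ge> 0" using K(2) elim by auto
        have "Z x \<le> B * a x / \<epsilon>"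
          unfolding Z_def using B a0[of x] x(2) \<epsilon> by (intro frac_le mult_right_mono) auto
        moreover have "Z x \<ge> 0" using a0[of x] x(2) \<epsilon> by (simp add: Z_def)
        ultimately have "Z x powr p \<le> (B / \<epsilon> * a x) powr p"
          using p_gt_1 by (intro powr_mono2) auto
        also have "\<dots> = (B / \<epsilon>) powr p * a x powr p"
          by (rule powr_mult)
        finally show ?thesis using True x by simp
      next
        case False
        then show ?thesis using u0[OF False] by (simp add: Z_def)
      qed
    qed
  qed
  then show "set_integrable vol \<Omega> (\<lambda>x. (\<bar>u x\<bar> * gnorm A g X x / (\<rho> x + \<epsilon>)) powr p)"
    by (simp add: Z_def a_def)
  define G' where "G' t = p * (max 0 t powr (p - 1) - max 0 (- t) powr (p - 1))" for t
  have GD: "((\<lambda>t. \<bar>t\<bar> powr p) has_real_derivative G' t) (at t)" for t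
    unfolding G'_def by (rule abs_powr_has_derivative[OF p_gt_1])
  have G'c: "continuous_on UNIV G'"
    unfolding G'_def
    by (intro continuous_intros continuous_on_powr') (use p_gt_1 in auto)
  have G'abs: "\<bar>G' t\<bar> = p * \<bar>t\<bar> powr (p - 1)" for t
    using p_gt_1 by (cases "t \<ge> 0") (auto simp: G'_def max_def abs_mult)
  define w where "w x = \<bar>u x\<bar> powr p" for x
  have wC: "w \<in> C1_0 A \<Omega>"
  proof -
    have "{x. w x \<noteq> 0} = {x. u x \<noteq> 0}" by (simp add: w_def)
    moreover have "C1_manifold A w"
      unfolding w_def[abs_def] by (rule C1_manifold_compose(1)[OF uC(1) GD G'c])
    ultimately show ?thesis
      using uC(2,3) unfolding C1_0_def C1_manifold_def by simp
  qed
  have Ti: "(LINT x:\<Omega>|vol. Tint w x) \<ge> 0"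
    by (rule Tint_nonneg[OF wC]) (simp add: w_def)
  define b where "b x = gnorm A g (gradient g u) x" for x
  have b0: "b x \<ge> 0" for x by (simp add: b_def gnorm_nonneg)
  define k where "k = (p / (p - 1)) powr p"
  have bi: "set_integrable vol \<Omega> (\<lambda>x. b x powr p)"
    unfolding b_def by (rule C1_0_powr_integrable(2)[OF u _ open_domain]) (use p_gt_1 in simp)
  have "(LINT x:\<Omega>|vol. Tint w x) \<le> (LINT x:\<Omega>|vol. (p - 1) / p * (k * b x powr p - Z x powr p))"
  proof (rule set_integral_mono_AE[OF Tint_integrable[OF wC]])
    show "set_integrable vol \<Omega> (\<lambda>x. (p - 1) / p * (k * b x powr p - Z x powr p))"
      by (intro set_integrable_mult_right impI set_integral_diff(1) bi Zi)
    show "AE x\<in>\<Omega> in vol. Tint w x \<le> (p - 1) / p * (k * b x powr p - Z x powr p)"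
      using rho_nonneg
    proof eventually_elim
      case (elim x)
      show ?case
      proof
        assume x: "x \<in> \<Omega>"
        define r where "r = \<rho> x + \<epsilon>"
        have r: "r > 0" using elim x \<epsilon> by (simp add: r_def)
        have Zx: "Z x \<ge> 0" using a0[of x] r by (simp add: Z_def r_def)
        have Zp1: "Z x powr (p - 1) = \<bar>u x\<bar> powr (p - 1) * a x powr (p - 1) * r powr (1 - p)"
        proof -
          have "r powr (1 - p) = 1 / r powr (p - 1)"
            using powr_minus_divide[of r "p - 1"] by simp
          then show ?thesis
            using a0[of x] r by (simp add: Z_def r_def[symmetric] powr_mult powr_divide)
        qed
        have Zp: "Z x powr p = \<bar>u x\<bar> powr p * a x powr p * r powr (- p)"
          using a0[of x] r by (simp add: Z_def r_def powr_mult powr_divide powr_minus_divide)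
        have gw: "ginner A g X (gradient g w) x = G' (u x) * ginner A g X (gradient g u) x"
          unfolding w_def[abs_def] by (rule ginner_gradient_compose[OF uC(1) GD G'c vector_field_grad x])
        have "r powr (1 - p) * (a x powr (p - 2) * ginner A g X (gradient g w) x) \<le>
            r powr (1 - p) * (a x powr (p - 2) * (p * \<bar>u x\<bar> powr (p - 1) * (a x * b x)))"
        proof (intro mult_left_mono)
          have "ginner A g X (gradient g w) x \<le> \<bar>G' (u x)\<bar> * \<bar>ginner A g X (gradient g u) x\<bar>"
            unfolding gw abs_mult[symmetric] by simp
          also have "\<dots> \<le> (p * \<bar>u x\<bar> powr (p - 1)) * (a x * b x)"
            unfolding G'abs using p_gt_1 ginner_Cauchy_Schwarz[of X "gradient g u" x]
            by (intro mult_left_mono) (auto simp: a_def b_def)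
          finally show "ginner A g X (gradient g w) x \<le> p * \<bar>u x\<bar> powr (p - 1) * (a x * b x)" .
        qed auto
        also have "\<dots> = p * (\<bar>u x\<bar> powr (p - 1) * (a x powr (p - 2) * a x) * r powr (1 - p)) * b x"
          by (simp add: ac_simps)
        also have "\<dots> = p * Z x powr (p - 1) * b x"
          unfolding Zp1 powr_diff_2_mult(1)[OF a0] by simp
        finally have "Tint w x \<le> p * Z x powr (p - 1) * b x + w x * F' (\<rho> x) * a x powr p"
          by (simp add: Tint_def F_def r_def a_def)
        \<comment> \<open>The decreasing weight contributes a negative p-th power, the source of the
          left side of Hardy's inequality.\<close>
        also have "w x * F' (\<rho> x) * a x powr p = - ((p - 1) * Z x powr p)"
          unfolding Zp by (simp add: w_def F'_def r_def algebra_simps)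
        finally have "Tint w x \<le> p * Z x powr (p - 1) * b x - (p - 1) * Z x powr p" by simp
        also have "\<dots> \<le> (p - 1) / p * (k * b x powr p - Z x powr p)"
          unfolding k_def by (rule Young_Hardy[OF p_gt_1 b0 Zx])
        finally show "Tint w x \<le> (p - 1) / p * (k * b x powr p - Z x powr p)" .
      qed
    qed
  qed
  also have "\<dots> = (p - 1) / p * (k * (LINT x:\<Omega>|vol. b x powr p) - (LINT x:\<Omega>|vol. Z x powr p))"
    using bi Zi by (subst set_integral_mult_right, subst set_integral_diff(2)) auto
  finally have "0 \<le> (p - 1) / p * (k * (LINT x:\<Omega>|vol. b x powr p) - (LINT x:\<Omega>|vol. Z x powr p))"
    using Ti by linarith
  moreover have "(p - 1) / p > 0" using p_gt_1 by simp
  ultimately have "0 \<le> k * (LINT x:\<Omega>|vol. b x powr p) - (LINT x:\<Omega>|vol. Z x powr p)"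
    by (simp only: zero_le_mult_iff) linarith
  then show "(LINT x:\<Omega>|vol. (\<bar>u x\<bar> * gnorm A g X x / (\<rho> x + \<epsilon>)) powr p) \<le>
      (p / (p - 1)) powr p * (LINT x:\<Omega>|vol. gnorm A g (gradient g u) x powr p)"
    by (simp add: k_def b_def Z_def a_def)
qed

lemma Hardy:
  assumes u: "u \<in> C1_0 A \<Omega>"
  shows "set_integrable vol \<Omega> (\<lambda>x. (\<bar>u x\<bar> * gnorm A g X x / \<rho> x) powr p)"
    and "(LINT x:\<Omega>|vol. (\<bar>u x\<bar> * gnorm A g X x / \<rho> x) powr p) \<le>
      (p / (p - 1)) powr p * (LINT x:\<Omega>|vol. gnorm A g (gradient g u) x powr p)"
proof -
  define \<epsilon> where "\<epsilon> k = 1 / real (Suc k)" for k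
  have \<epsilon>: "\<epsilon> k > 0" for k by (simp add: \<epsilon>_def)
  have \<epsilon>lim: "\<epsilon> \<longlonglongrightarrow> 0"
    unfolding \<epsilon>_def by (rule LIMSEQ_Suc[OF lim_const_over_n])
  define c where "c = (p / (p - 1)) powr p * (LINT x:\<Omega>|vol. gnorm A g (gradient g u) x powr p)"
  have c0: "c \<ge> 0"
    unfolding c_def set_lebesgue_integral_def by (intro mult_nonneg_nonneg Bochner_Integration.integral_nonneg) auto
  define f where "f k x = indicator \<Omega> x *\<^sub>R (\<bar>u x\<bar> * gnorm A g X x / (\<rho> x + \<epsilon> k)) powr p" for k x
  define f0 where "f0 x = indicator \<Omega> x *\<^sub>R (\<bar>u x\<bar> * gnorm A g X x / \<rho> x) powr p" for x
  have fi: "integrable vol (f k)" for k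
    using Hardy_regularized(1)[OF u \<epsilon>] by (simp add: f_def[abs_def] set_integrable_def)
  have fle: "(LINT x|vol. f k x) \<le> c" for k
    using Hardy_regularized(2)[OF u \<epsilon>] by (simp add: f_def[abs_def] set_lebesgue_integral_def c_def)
  have f0': "f k x \<ge> 0" "f0 x \<ge> 0" for k x by (simp_all add: f_def f0_def)
  have \<Omega>b: "\<Omega> \<in> sets borel" using open_domain by simp
  have rS: "set_borel_measurable vol \<Omega> f \<longleftrightarrow> f \<in> borel_measurable (restrict_space vol \<Omega>)" for f :: "'m \<Rightarrow> real"
    by (rule set_borel_measurable_restrict) (use \<Omega>b in simp)
  note [measurable] = rho_measurable[unfolded rS] gnorm_measurable[unfolded rS]
    continuous_set_borel_measurable[OF C1_continuous_on[OF C1_0D(1)[OF u]] \<Omega>b, unfolded rS]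
  have meas: "f0 \<in> borel_measurable vol"
    unfolding f0_def[abs_def] set_borel_measurable_def[symmetric] rS by measurable
  have "(\<integral>\<^sup>+x. ennreal (f0 x) \<partial>vol) \<le> (\<integral>\<^sup>+x. liminf (\<lambda>k. ennreal (f k x)) \<partial>vol)"
  proof (rule nn_integral_mono_AE)
    show "AE x in vol. ennreal (f0 x) \<le> liminf (\<lambda>k. ennreal (f k x))"
      using rho_nonneg
    proof eventually_elim
      case (elim x)
      show ?case
      \<comment> \<open>Where \<rho> = 0 the limit integrand is 0, since division by zero yields 0;
        convergence is required only where \<rho> > 0.\<close>
      proof (cases "x \<in> \<Omega> \<and> \<rho> x \<noteq> 0")
        case True
        then have r: "\<rho> x > 0" using elim by auto
        have "(\<lambda>k. \<rho> x + \<epsilon> k) \<longlonglongrightarrow> \<rho> x + 0" by (intro tendsto_intros \<epsilon>lim)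
        then have "(\<lambda>k. \<bar>u x\<bar> * gnorm A g X x / (\<rho> x + \<epsilon> k)) \<longlonglongrightarrow> \<bar>u x\<bar> * gnorm A g X x / \<rho> x"
          using r by (intro tendsto_divide tendsto_const) auto
        then have "(\<lambda>k. (\<bar>u x\<bar> * gnorm A g X x / (\<rho> x + \<epsilon> k)) powr p) \<longlonglongrightarrow> (\<bar>u x\<bar> * gnorm A g X x / \<rho> x) powr p"
          by (rule tendsto_powr'[OF _ tendsto_const]) (use p_gt_1 r \<epsilon> gnorm_nonneg in \<open>auto intro!: always_eventually divide_nonneg_pos add_pos_pos simp: less_imp_le\<close>)
        then have "(\<lambda>k. f k x) \<longlonglongrightarrow> f0 x"
          unfolding f_def f0_def by (intro tendsto_scaleR tendsto_const)
        then have "(\<lambda>k. ennreal (f k x)) \<longlonglongrightarrow> ennreal (f0 x)"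
          by (rule tendsto_ennrealI)
        from lim_imp_Liminf[OF _ this] show ?thesis by simp
      next
        case False
        then show ?thesis by (auto simp: f0_def)
      qed
    qed
  qed
  also have "\<dots> \<le> liminf (\<lambda>k. \<integral>\<^sup>+x. ennreal (f k x) \<partial>vol)"
    using fi by (intro nn_integral_liminf) auto
  also have "\<dots> \<le> liminf (\<lambda>k. ennreal c)"
  proof (rule Liminf_mono[OF always_eventually[OF allI]])
    fix k
    have "(\<integral>\<^sup>+x. ennreal (f k x) \<partial>vol) = ennreal (LINT x|vol. f k x)"
      using fi f0' by (intro nn_integral_eq_integral) auto
    also have "\<dots> \<le> ennreal c" by (rule ennreal_leI[OF fle])
    finally show "(\<integral>\<^sup>+x. ennreal (f k x) \<partial>vol) \<le> ennreal c" .
  qed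
  also have "\<dots> = ennreal c" by (rule Liminf_const) simp
  finally have le: "(\<integral>\<^sup>+x. ennreal (f0 x) \<partial>vol) \<le> ennreal c" .
  have i0: "integrable vol f0"
    by (rule integrableI_bounded[OF meas]) (use le_less_trans[OF le] f0' in simp)
  then show "set_integrable vol \<Omega> (\<lambda>x. (\<bar>u x\<bar> * gnorm A g X x / \<rho> x) powr p)"
    by (simp add: set_integrable_def f0_def[abs_def])
  have "ennreal (LINT x|vol. f0 x) = (\<integral>\<^sup>+x. ennreal (f0 x) \<partial>vol)"
    using i0 f0' by (intro nn_integral_eq_integral[symmetric]) auto
  with le have "ennreal (LINT x|vol. f0 x) \<le> ennreal c" by simp
  then have "(LINT x|vol. f0 x) \<le> c" using ennreal_le_iff[OF c0] by blast
  then show "(LINT x:\<Omega>|vol. (\<bar>u x\<bar> * gnorm A g X x / \<rho> x) powr p) \<le>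
      (p / (p - 1)) powr p * (LINT x:\<Omega>|vol. gnorm A g (gradient g u) x powr p)"
    by (simp add: c_def f0_def[abs_def] set_lebesgue_integral_def)
qed

end

section \<open>Interpolation\<close>

text \<open>After both integrals are normalized to 1, the pointwise inequality a^\<theta>
  b^(1-\<theta>) \<le> \<theta> a + (1-\<theta>) b integrates to the claim. If an integral is 0,
  normalization is impossible, but then one factor, hence the product, vanishes almost
  everywhere.\<close>

lemma Holder_interpolation:
  fixes f h :: "'a \<Rightarrow> real"
  assumes f: "integrable M f" "\<And>x. f x \<ge> 0" and h: "integrable M h" "\<And>x. h x \<ge> 0" and \<theta>: "0 < \<theta>" "\<theta> < 1"
  shows "integrable M (\<lambda>x. f x powr \<theta> * h x powr (1 - \<theta>))"
    and "(LINT x|M. f x powr \<theta> * h x powr (1 - \<theta>)) \<le> (LINT x|M. f x) powr \<theta> * (LINT x|M. h x) powr (1 - \<theta>)"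
proof -
  have Y: "a powr \<theta> * b powr (1 - \<theta>) \<le> \<theta> * a + (1 - \<theta>) * b" if "a \<ge> 0" "b \<ge> 0" for a b :: real
  proof (cases "a = 0 \<or> b = 0")
    case True
    then show ?thesis using that \<theta> by auto
  next
    case False
    then show ?thesis using Youngs_inequality_0[of \<theta> "1 - \<theta>" a b] that \<theta> by simp
  qed
  have m: "(\<lambda>x. f x powr \<theta> * h x powr (1 - \<theta>)) \<in> borel_measurable M"
    using f(1) h(1) by measurable
  show int: "integrable M (\<lambda>x. f x powr \<theta> * h x powr (1 - \<theta>))"
  proof (rule Bochner_Integration.integrable_bound[OF _ m])
    show "integrable M (\<lambda>x. \<theta> * f x + (1 - \<theta>) * h x)" using f(1) h(1) by simp
    show "AE x in M. norm (f x powr \<theta> * h x powr (1 - \<theta>)) \<le> norm (\<theta> * f x + (1 - \<theta>) * h x)"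
    proof (rule AE_I2)
      fix x
      show "norm (f x powr \<theta> * h x powr (1 - \<theta>)) \<le> norm (\<theta> * f x + (1 - \<theta>) * h x)"
        using Y[OF f(2) h(2), of x x] f(2)[of x] h(2)[of x] \<theta> by simp
    qed
  qed
  define a b where "a = (LINT x|M. f x)" and "b = (LINT x|M. h x)"
  have ab: "a \<ge> 0" "b \<ge> 0"
    using f(2) h(2) by (auto simp: a_def b_def intro!: Bochner_Integration.integral_nonneg)
  show "(LINT x|M. f x powr \<theta> * h x powr (1 - \<theta>)) \<le> (LINT x|M. f x) powr \<theta> * (LINT x|M. h x) powr (1 - \<theta>)"
  proof (cases "a = 0 \<or> b = 0")
    case True
    then have "(AE x in M. f x = 0) \<or> (AE x in M. h x = 0)"
      using integral_nonneg_eq_0_iff_AE[OF f(1)] integral_nonneg_eq_0_iff_AE[OF h(1)] f(2) h(2)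
      by (auto simp: a_def b_def)
    then have "AE x in M. f x powr \<theta> * h x powr (1 - \<theta>) = 0"
    proof
      assume "AE x in M. f x = 0" then show ?thesis by eventually_elim simp
    next
      assume "AE x in M. h x = 0" then show ?thesis by eventually_elim simp
    qed
    then have "(LINT x|M. f x powr \<theta> * h x powr (1 - \<theta>)) = 0"
      by (rule integral_eq_zero_AE)
    then show ?thesis by simp
  next
    case False
    then have p: "a > 0" "b > 0" using ab by auto
    define k where "k = a powr \<theta> * b powr (1 - \<theta>)"
    have "(LINT x|M. f x powr \<theta> * h x powr (1 - \<theta>)) \<le> (LINT x|M. k * (\<theta> * (f x / a) + (1 - \<theta>) * (h x / b)))"
    proof (rule integral_mono[OF int])
      show "integrable M (\<lambda>x. k * (\<theta> * (f x / a) + (1 - \<theta>) * (h x / b)))"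
        using f(1) h(1) by simp
      fix x
      have "f x powr \<theta> * h x powr (1 - \<theta>) = k * ((f x / a) powr \<theta> * (h x / b) powr (1 - \<theta>))"
        using p f(2)[of x] h(2)[of x] by (simp add: k_def powr_divide)
      also have "\<dots> \<le> k * (\<theta> * (f x / a) + (1 - \<theta>) * (h x / b))"
        by (intro mult_left_mono Y) (use p f(2)[of x] h(2)[of x] in \<open>auto simp: k_def\<close>)
      finally show "f x powr \<theta> * h x powr (1 - \<theta>) \<le> k * (\<theta> * (f x / a) + (1 - \<theta>) * (h x / b))" .
    qed
    also have "\<dots> = k * (\<theta> * (a / a) + (1 - \<theta>) * (b / b))"
      using f(1) h(1) by (simp add: a_def b_def)
    also have "\<dots> = k" using p by simp
    finally show ?thesis by (simp add: k_def a_def b_def)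
  qed
qed

lemma set_integral_cong_AE':
  fixes f h :: "'a \<Rightarrow> real"
  assumes f: "set_integrable M S f" and h: "set_borel_measurable M S h" and eq: "AE x in M. x \<in> S \<longrightarrow> h x = f x"
  shows "set_integrable M S h" "(LINT x:S|M. h x) = (LINT x:S|M. f x)"
proof -
  have m: "(\<lambda>x. indicator S x *\<^sub>R f x) \<in> borel_measurable M" "(\<lambda>x. indicator S x *\<^sub>R h x) \<in> borel_measurable M"
    using f h by (auto simp: set_integrable_def set_borel_measurable_def)
  have ae: "AE x in M. indicator S x *\<^sub>R h x = indicator S x *\<^sub>R f x"
    using eq by eventually_elim (simp add: indicator_def)
  show "set_integrable M S h"
    using f integrable_cong_AE[OF m(2,1) ae] by (simp add: set_integrable_def)
  show "(LINT x:S|M. h x) = (LINT x:S|M. f x)"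
    unfolding set_lebesgue_integral_def by (rule integral_cong_AE[OF m(2,1) ae])
qed

context superharmonic
begin

lemma weight_measurable:
  assumes u: "u \<in> C1_0 A \<Omega>"
  shows "set_borel_measurable vol \<Omega> (\<lambda>x. \<bar>u x\<bar> powr s * (gnorm A g X x powr t / \<rho> x powr t))"
proof -
  have \<Omega>b: "\<Omega> \<in> sets borel" using open_domain by simp
  have rS: "set_borel_measurable vol \<Omega> f \<longleftrightarrow> f \<in> borel_measurable (restrict_space vol \<Omega>)" for f :: "'m \<Rightarrow> real"
    by (rule set_borel_measurable_restrict) (use \<Omega>b in simp)
  note [measurable] = rho_measurable[unfolded rS] gnorm_measurable[unfolded rS]
    continuous_set_borel_measurable[OF C1_continuous_on[OF C1_0D(1)[OF u]] \<Omega>b, unfolded rS]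
  show ?thesis unfolding rS by measurable
qed

lemma Hardy_quotient:
  assumes u: "u \<in> C1_0 A \<Omega>"
  shows "set_integrable vol \<Omega> (\<lambda>x. \<bar>u x\<bar> powr p * (gnorm A g X x powr p / \<rho> x powr p))"
    and "(LINT x:\<Omega>|vol. \<bar>u x\<bar> powr p * (gnorm A g X x powr p / \<rho> x powr p)) \<le>
      (p / (p - 1)) powr p * (LINT x:\<Omega>|vol. gnorm A g (gradient g u) x powr p)"
proof -
  have "AE x in vol. x \<in> \<Omega> \<longrightarrow> \<bar>u x\<bar> powr p * (gnorm A g X x powr p / \<rho> x powr p) =
      (\<bar>u x\<bar> * gnorm A g X x / \<rho> x) powr p"
    using rho_nonneg by eventually_elim (simp add: powr_mult powr_divide gnorm_nonneg)
  note cong = set_integral_cong_AE'[OF Hardy(1)[OF u] weight_measurable[OF u] this]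
  show "set_integrable vol \<Omega> (\<lambda>x. \<bar>u x\<bar> powr p * (gnorm A g X x powr p / \<rho> x powr p))"
    by (rule cong(1))
  show "(LINT x:\<Omega>|vol. \<bar>u x\<bar> powr p * (gnorm A g X x powr p / \<rho> x powr p)) \<le>
      (p / (p - 1)) powr p * (LINT x:\<Omega>|vol. gnorm A g (gradient g u) x powr p)"
    unfolding cong(2) by (rule Hardy(2)[OF u])
qed

text \<open>The Hardy integrand gets the Hoelder weight \<theta> and |u|^\<delta> the weight
  1-\<theta>. The powers of |u| then add up to \<open>s\<close>, while the quotient |grad \<rho>| /
  \<rho> receives the exponent p\<theta>.\<close>

lemma Hardy_interpolation:
  assumes u: "u \<in> C1_0 A \<Omega>" and \<delta>: "\<delta> > 0" and \<theta>: "0 < \<theta>" "\<theta> < 1" and s: "s = p * \<theta> + \<delta> * (1 - \<theta>)"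
  shows "set_integrable vol \<Omega> (\<lambda>x. \<bar>u x\<bar> powr s * (gnorm A g X x powr (p * \<theta>) / \<rho> x powr (p * \<theta>)))"
    and "(LINT x:\<Omega>|vol. \<bar>u x\<bar> powr s * (gnorm A g X x powr (p * \<theta>) / \<rho> x powr (p * \<theta>))) \<le>
      ((p / (p - 1)) powr p * (LINT x:\<Omega>|vol. gnorm A g (gradient g u) x powr p)) powr \<theta> *
      (LINT x:\<Omega>|vol. \<bar>u x\<bar> powr \<delta>) powr (1 - \<theta>)"
proof -
  define f where "f x = indicator \<Omega> x *\<^sub>R (\<bar>u x\<bar> * gnorm A g X x / \<rho> x) powr p" for x
  define h where "h x = indicator \<Omega> x *\<^sub>R \<bar>u x\<bar> powr \<delta>" for x
  have f: "integrable vol f" "\<And>x. f x \<ge> 0"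
    using Hardy(1)[OF u] by (simp_all add: f_def[abs_def] set_integrable_def)
  have h: "integrable vol h" "\<And>x. h x \<ge> 0"
    using C1_0_powr_integrable(1)[OF u \<delta> open_domain] by (simp_all add: h_def[abs_def] set_integrable_def)
  note H = Holder_interpolation[OF f h \<theta>]
  have fh: "f x powr \<theta> * h x powr (1 - \<theta>) =
      indicator \<Omega> x *\<^sub>R ((\<bar>u x\<bar> * gnorm A g X x / \<rho> x) powr (p * \<theta>) * \<bar>u x\<bar> powr (\<delta> * (1 - \<theta>)))" for x
    by (simp add: f_def h_def indicator_def powr_powr)
  have i: "set_integrable vol \<Omega> (\<lambda>x. (\<bar>u x\<bar> * gnorm A g X x / \<rho> x) powr (p * \<theta>) * \<bar>u x\<bar> powr (\<delta> * (1 - \<theta>)))"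
    using H(1) unfolding fh set_integrable_def .
  have "AE x in vol. x \<in> \<Omega> \<longrightarrow> \<bar>u x\<bar> powr s * (gnorm A g X x powr (p * \<theta>) / \<rho> x powr (p * \<theta>)) =
      (\<bar>u x\<bar> * gnorm A g X x / \<rho> x) powr (p * \<theta>) * \<bar>u x\<bar> powr (\<delta> * (1 - \<theta>))"
    using rho_nonneg by eventually_elim (simp add: s powr_add powr_mult powr_divide gnorm_nonneg)
  note cong = set_integral_cong_AE'[OF i weight_measurable[OF u] this]
  show "set_integrable vol \<Omega> (\<lambda>x. \<bar>u x\<bar> powr s * (gnorm A g X x powr (p * \<theta>) / \<rho> x powr (p * \<theta>)))"
    by (rule cong(1))
  have "(LINT x:\<Omega>|vol. \<bar>u x\<bar> powr s * (gnorm A g X x powr (p * \<theta>) / \<rho> x powr (p * \<theta>))) =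
      (LINT x|vol. f x powr \<theta> * h x powr (1 - \<theta>))"
    using cong(2) unfolding fh set_lebesgue_integral_def .
  also have "\<dots> \<le> (LINT x|vol. f x) powr \<theta> * (LINT x|vol. h x) powr (1 - \<theta>)"
    by (rule H(2))
  also have "\<dots> \<le> ((p / (p - 1)) powr p * (LINT x:\<Omega>|vol. gnorm A g (gradient g u) x powr p)) powr \<theta> *
      (LINT x|vol. h x) powr (1 - \<theta>)"
  proof (intro mult_right_mono powr_mono2)
    show "(LINT x|vol. f x) \<le> (p / (p - 1)) powr p * (LINT x:\<Omega>|vol. gnorm A g (gradient g u) x powr p)"
      using Hardy(2)[OF u] by (simp add: f_def[abs_def] set_lebesgue_integral_def)
    show "0 \<le> (LINT x|vol. f x)" using f(2) by (intro Bochner_Integration.integral_nonneg)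
  qed (use \<theta> in auto)
  finally show "(LINT x:\<Omega>|vol. \<bar>u x\<bar> powr s * (gnorm A g X x powr (p * \<theta>) / \<rho> x powr (p * \<theta>))) \<le>
      ((p / (p - 1)) powr p * (LINT x:\<Omega>|vol. gnorm A g (gradient g u) x powr p)) powr \<theta> *
      (LINT x:\<Omega>|vol. \<bar>u x\<bar> powr \<delta>) powr (1 - \<theta>)"
    by (simp add: h_def[abs_def] set_lebesgue_integral_def)
qed

lemma set_integral_powr_nonneg: "(LINT x:\<Omega>|vol. f x powr r) \<ge> (0 :: real)"
  unfolding set_lebesgue_integral_def by (intro Bochner_Integration.integral_nonneg) simp

text \<open>The Hoelder weight is \<theta> = b s / p. The endpoints b = 0 and b = 1 correspond to
  \<theta> = 0 and \<theta> = 1; they are treated apart because interpolation takes 0 < \<theta> < 1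
  and because \<open>rpow\<close> with exponent 0 is the constant 1.\<close>

lemma weighted_interpolation:
  assumes u: "u \<in> C1_0 A \<Omega>" and \<delta>: "\<delta> > 0" and b: "0 \<le> b" "b \<le> 1" and s: "1 / s = b / p + (1 - b) / \<delta>"
    and q: "if b = 0 then q = 0 else 1 / (q * (p - 1)) = 1 / p + (1 - b) / (b * \<delta>)"
  shows "set_integrable vol \<Omega> (\<lambda>x. \<bar>u x\<bar> powr s *
      (rpow (gnorm A g X x) (q * (p - 1)) / rpow (\<rho> x) (q * (p - 1))))"
    and "(LINT x:\<Omega>|vol. \<bar>u x\<bar> powr s * (rpow (gnorm A g X x) (q * (p - 1)) / rpow (\<rho> x) (q * (p - 1)))) powr (1 / s)
      \<le> (p / (p - 1)) powr (q * (p - 1) / s) *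
        rpow (LINT x:\<Omega>|vol. gnorm A g (gradient g u) x powr p) (b / p) *
        rpow (LINT x:\<Omega>|vol. \<bar>u x\<bar> powr \<delta>) ((1 - b) / \<delta>)"
    (is "?L powr (1 / s) \<le> ?R")
proof -
  define a where "a = (LINT x:\<Omega>|vol. gnorm A g (gradient g u) x powr p)"
  define c where "c = (LINT x:\<Omega>|vol. \<bar>u x\<bar> powr \<delta>)"
  have ac: "a \<ge> 0" "c \<ge> 0" by (simp_all add: a_def c_def set_integral_powr_nonneg)
  define k where "k = p / (p - 1)"
  have k: "k > 0" using p_gt_1 by (simp add: k_def)
  have "1 / s > 0"
  proof (cases "b = 0")
    case False
    then have "b / p > 0" using b p_gt_1 by simp
    moreover have "(1 - b) / \<delta> \<ge> 0" using b \<delta> by simp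
    ultimately show ?thesis using s by linarith
  qed (use s \<delta> in simp)
  then have s0: "s > 0" by simp
  have "set_integrable vol \<Omega> (\<lambda>x. \<bar>u x\<bar> powr s * (rpow (gnorm A g X x) (q * (p - 1)) / rpow (\<rho> x) (q * (p - 1))))
      \<and> ?L powr (1 / s) \<le> ?R"
  proof (cases "b = 0")
    \<comment> \<open>For b = 0 the weight is constantly 1, and both sides reduce to the same power
      of the integral of |u|^\<delta>.\<close>
    case True
    then have "s = \<delta>" "q = 0" using s q by auto
    then show ?thesis
      using True C1_0_powr_integrable(1)[OF u \<delta> open_domain] \<delta> k p_gt_1 by (simp add: rpow_def k_def)
  next
    case False
    then have b0: "b > 0" using b by simp
    define t where "t = q * (p - 1)"
    have "1 / t = 1 / p + (1 - b) / (b * \<delta>)" using q False by (simp add: t_def)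
    \<comment> \<open>The sum is the relation for 1/s divided by \<open>b\<close>.\<close>
    also have "\<dots> = (1 / s) / b" using s b0 \<delta> by (simp add: add_divide_distrib)
    finally have "t = b * s" using b0 s0 by (simp add: field_simps)
    have t0: "t > 0" using \<open>t = b * s\<close> b0 s0 by simp
    show ?thesis
    proof (cases "b = 1")
      \<comment> \<open>Here s = p, the last factor is 1 as a \<open>rpow\<close> with exponent 0,
        and the claim is the p-th root of Hardy's inequality.\<close>
      case True
      then have sp: "s = p" "t = p" using s \<open>t = b * s\<close> by auto
      have int: "(LINT x:\<Omega>|vol. \<bar>u x\<bar> powr p * (gnorm A g X x powr p / \<rho> x powr p)) \<le> k powr p * a"
        using Hardy_quotient(2)[OF u] by (simp add: k_def a_def)
      have "(LINT x:\<Omega>|vol. \<bar>u x\<bar> powr p * (gnorm A g X x powr p / \<rho> x powr p)) powr (1 / p) \<le> (k powr p * a) powr (1 / p)"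
        using int p_gt_1
        by (intro powr_mono2) (auto simp: set_lebesgue_integral_def intro!: Bochner_Integration.integral_nonneg)
      also have "\<dots> = k * a powr (1 / p)"
        using k ac p_gt_1 by (simp add: powr_mult powr_powr)
      finally show ?thesis
        using Hardy_quotient(1)[OF u] p_gt_1 k True unfolding t_def[symmetric] k_def[symmetric] sp
        by (simp add: rpow_def a_def)
    next
      case False
      then have b1: "b < 1" using b by simp
      define \<theta> where "\<theta> = b * s / p"
      have p\<theta>: "p * \<theta> = t" using p_gt_1 \<open>t = b * s\<close> by (simp add: \<theta>_def)
      \<comment> \<open>Multiplying the relation for 1/s by \<open>s\<close> gives \<theta> + s
        (1-b) / \<delta> = 1; this yields both \<theta> < 1 and the exponent of the last
        factor.\<close>
      have "s * (1 / s) = s * (b / p + (1 - b) / \<delta>)" using s by simp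
      then have one: "1 = \<theta> + s * (1 - b) / \<delta>" using s0 by (simp add: \<theta>_def algebra_simps)
      then have th1: "1 - \<theta> = s * (1 - b) / \<delta>" by linarith
      have "s * (1 - b) / \<delta> > 0" using s0 b1 \<delta> by simp
      then have "\<theta> < 1" using one by linarith
      moreover have "0 < \<theta>" using b0 s0 p_gt_1 by (simp add: \<theta>_def)
      ultimately have \<theta>: "0 < \<theta>" "\<theta> < 1" by simp_all
      have "\<delta> * (1 - \<theta>) = s * (1 - b)" using th1 \<delta> by simp
      then have s\<theta>: "s = p * \<theta> + \<delta> * (1 - \<theta>)"
        unfolding p\<theta> \<open>t = b * s\<close> by (simp add: algebra_simps)
      note H = Hardy_interpolation[OF u \<delta> \<theta> s\<theta>, unfolded p\<theta>, folded k_def a_def c_def]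
      have "(LINT x:\<Omega>|vol. \<bar>u x\<bar> powr s * (gnorm A g X x powr t / \<rho> x powr t)) powr (1 / s) \<le>
          ((k powr p * a) powr \<theta> * c powr (1 - \<theta>)) powr (1 / s)"
        using H(2) s0
        by (intro powr_mono2) (auto simp: set_lebesgue_integral_def intro!: Bochner_Integration.integral_nonneg)
      also have "\<dots> = k powr (p * \<theta> / s) * a powr (\<theta> / s) * c powr ((1 - \<theta>) / s)"
        using k ac by (simp add: powr_mult powr_powr)
      also have "p * \<theta> / s = t / s" by (simp add: p\<theta>)
      also have "\<theta> / s = b / p" using s0 by (simp add: \<theta>_def)
      also have "(1 - \<theta>) / s = (1 - b) / \<delta>" using s0 by (simp add: th1)
      finally show ?thesis
        using H(1) t0 b0 b1 p_gt_1 \<delta> unfolding t_def[symmetric] k_def[symmetric] a_def[symmetric] c_def[symmetric]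
        by (simp add: rpow_def)
    qed
  qed
  then show "set_integrable vol \<Omega> (\<lambda>x. \<bar>u x\<bar> powr s *
      (rpow (gnorm A g X x) (q * (p - 1)) / rpow (\<rho> x) (q * (p - 1))))" "?L powr (1 / s) \<le> ?R"
    by blast+
qed

text \<open>In each chart \<open>weak_partial_powr\<close> makes the covector of \<rho> the multiple
  \<alpha> d^(\<alpha>-1) of that of \<open>d\<close>. A vector is determined by its covector, so
  the gradients are proportional with the same factor, and the norm takes its absolute
  value.\<close>

lemma gnorm_powr_chain:
  assumes d: "weak_gradient A g \<Omega> d Y" and d0: "AE x in vol. x \<in> \<Omega> \<longrightarrow> d x \<ge> 0"
    and \<rho>: "AE x in vol. x \<in> \<Omega> \<longrightarrow> \<rho> x = d x powr \<alpha>" and \<alpha>: "\<alpha> \<noteq> 0"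
  shows "AE x in vol. x \<in> \<Omega> \<longrightarrow> d x > 0 \<longrightarrow> gnorm A g X x = \<bar>\<alpha>\<bar> * d x powr (\<alpha> - 1) * gnorm A g Y x"
proof (rule AE_open_local)
  interpret D: weakly_differentiable A g vol \<Omega> d Y
    by unfold_locales (rule open_domain, rule d)
  fix x assume x: "x \<in> \<Omega>"
  obtain c where c: "c \<in> A" "x \<in> fst c" using charts_cover by blast
  define V where "V = snd c ` (fst c \<inter> \<Omega>)"
  have V: "open V" unfolding V_def by (rule chart_image_Int_open[OF c(1) open_domain])
  have Vin: "y \<in> snd c ` fst c" "chart_inv c y \<in> \<Omega>" if y: "y \<in> V" for y
  proof -
    obtain z where "z \<in> fst c" "z \<in> \<Omega>" "y = snd c z" using y unfolding V_def by blast
    then show "y \<in> snd c ` fst c" "chart_inv c y \<in> \<Omega>" using chart_inv_left[OF c(1), of z] by simp_all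
  qed
  have "AE y in lborel. y \<in> snd c ` fst c \<longrightarrow> (chart_inv c y \<in> \<Omega> \<longrightarrow>
      d (chart_inv c y) \<ge> 0 \<and> \<rho> (chart_inv c y) = d (chart_inv c y) powr \<alpha>)"
    by (rule AE_lborel_chart[OF c(1)]) (use d0 \<rho> in eventually_elim, simp)
  then have fd: "AE y in lborel. y \<in> V \<longrightarrow> (d \<circ> chart_inv c) y \<ge> 0 \<and> (\<rho> \<circ> chart_inv c) y = (d \<circ> chart_inv c) y powr \<alpha>"
    by eventually_elim (simp add: Vin)
  have "AE y in lborel. \<forall>i\<in>UNIV. y \<in> V \<longrightarrow> (d \<circ> chart_inv c) y > 0 \<longrightarrow>
      g c (chart_inv c y) (X c (chart_inv c y)) (axis i 1) =
      \<alpha> * (d \<circ> chart_inv c) y powr (\<alpha> - 1) * g c (chart_inv c y) (Y c (chart_inv c y)) (axis i 1)"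
    by (rule AE_finite_allI[OF finite], rule weak_partial_powr[OF V weak_partial_chart[OF c(1), folded V_def]
          D.weak_partial_chart[OF c(1), folded V_def] \<alpha> fd])
  then have "AE y in lborel. y \<in> snd c ` fst c \<longrightarrow> (\<forall>i. y \<in> V \<longrightarrow> (d \<circ> chart_inv c) y > 0 \<longrightarrow>
      g c (chart_inv c y) (X c (chart_inv c y)) (axis i 1) =
      \<alpha> * (d \<circ> chart_inv c) y powr (\<alpha> - 1) * g c (chart_inv c y) (Y c (chart_inv c y)) (axis i 1))"
    by eventually_elim simp
  from AE_vol_chart[OF c(1) this]
  have "AE z in vol. z \<in> fst c \<inter> \<Omega> \<longrightarrow> d z > 0 \<longrightarrow>
      gnorm A g X z = \<bar>\<alpha>\<bar> * d z powr (\<alpha> - 1) * gnorm A g Y z"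
  proof eventually_elim
    case (elim z)
    show ?case
    proof (intro impI)
      assume z: "z \<in> fst c \<inter> \<Omega>" "d z > 0"
      then have zc: "z \<in> fst c" "z \<in> \<Omega>" "snd c z \<in> V" by (auto simp: V_def)
      define m where "m = \<alpha> * d z powr (\<alpha> - 1)"
      have i: "g c z (X c z) (axis i 1) = g c z (m *\<^sub>R Y c z) (axis i 1)" for i
        using elim zc z(2) chart_inv_left[OF c(1) zc(1)]
        by (simp add: m_def linear_cmul[OF metric_linear(2)[OF c(1) zc(1)]])
      \<comment> \<open>By Cramer's rule, vectors with equal covector components are equal.\<close>
      have eq: "X c z = m *\<^sub>R Y c z"
      proof (rule vec_eq_iff[THEN iffD2], rule allI)
        fix k
        show "X c z $ k = (m *\<^sub>R Y c z) $ k"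
          unfolding metric_cramer[OF c(1) zc(1), of "X c z" k]
            metric_cramer[OF c(1) zc(1), of "m *\<^sub>R Y c z" k] i ..
      qed
      have "g c z (X c z) (X c z) = m * (m * g c z (Y c z) (Y c z))"
        unfolding eq by (simp add: linear_cmul[OF metric_linear(1)[OF c(1) zc(1)]]
            linear_cmul[OF metric_linear(2)[OF c(1) zc(1)]])
      then have "sqrt (g c z (X c z) (X c z)) = \<bar>m\<bar> * sqrt (g c z (Y c z) (Y c z))"
        by (simp add: real_sqrt_mult mult.assoc[symmetric] power2_eq_square[symmetric])
      then show "gnorm A g X z = \<bar>\<alpha>\<bar> * d z powr (\<alpha> - 1) * gnorm A g Y z"
        using gnorm_chart[OF c(1) zc(1,2)] D.gnorm_chart[OF c(1) zc(1,2)] by (simp add: m_def abs_mult)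
    qed
  qed
  then show "\<exists>N. open N \<and> x \<in> N \<and> (AE z in vol. z \<in> N \<longrightarrow> d z > 0 \<longrightarrow>
      gnorm A g X z = \<bar>\<alpha>\<bar> * d z powr (\<alpha> - 1) * gnorm A g Y z)"
    using c x chart_open[OF c(1)] open_domain by (intro exI[of _ "fst c \<inter> \<Omega>"]) auto
qed

text \<open>At the weight \<theta> = (p-1)/p the exponent p\<theta> is p - 1, and the factor of the
  integrand involving \<rho> is |\<alpha>|^(p-1) / d^(p-1) where d > 0. The power of |\<alpha>|
  moves into the constant, and \<theta> is 1/p' for the conjugate exponent p' = p/(p-1).\<close>

lemma distance_interpolation:
  assumes d: "weak_gradient A g \<Omega> d Y"
    and d1: "AE x in vol. x \<in> \<Omega> \<longrightarrow> d x \<ge> 0 \<and> gnorm A g Y x = 1"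
    and \<rho>: "AE x in vol. x \<in> \<Omega> \<longrightarrow> \<rho> x = d x powr \<alpha>" and \<alpha>: "\<alpha> \<noteq> 0"
    and u: "u \<in> C1_0 A \<Omega>" and \<delta>: "\<delta> > 0" and s: "s = p - 1 + \<delta> / p"
  shows "set_integrable vol \<Omega> (\<lambda>x. \<bar>u x\<bar> powr s / d x powr (p - 1))"
    and "(LINT x:\<Omega>|vol. \<bar>u x\<bar> powr s / d x powr (p - 1))
      \<le> (p / (\<bar>\<alpha>\<bar> * (p - 1))) powr (p - 1) *
        (LINT x:\<Omega>|vol. gnorm A g (gradient g u) x powr p) powr (1 / (p / (p - 1))) *
        (LINT x:\<Omega>|vol. \<bar>u x\<bar> powr \<delta>) powr (1 / p)"
proof -
  interpret D: weakly_differentiable A g vol \<Omega> d Y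
    by unfold_locales (rule open_domain, rule d)
  define a where "a = (LINT x:\<Omega>|vol. gnorm A g (gradient g u) x powr p)"
  define c where "c = (LINT x:\<Omega>|vol. \<bar>u x\<bar> powr \<delta>)"
  have ac: "a \<ge> 0" "c \<ge> 0" by (simp_all add: a_def c_def set_integral_powr_nonneg)
  define k where "k = p / (p - 1)"
  have k: "k > 0" using p_gt_1 by (simp add: k_def)
  define \<theta> where "\<theta> = (p - 1) / p"
  have \<theta>: "0 < \<theta>" "\<theta> < 1" "p * \<theta> = p - 1" "1 - \<theta> = 1 / p"
    using p_gt_1 by (auto simp: \<theta>_def field_simps)
  have s\<theta>: "s = p * \<theta> + \<delta> * (1 - \<theta>)" using s \<theta> by simp
  note H = Hardy_interpolation[OF u \<delta> \<theta>(1,2) s\<theta>, unfolded \<theta>(3,4), folded k_def a_def c_def]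
  define m where "m = \<bar>\<alpha>\<bar> powr (- (p - 1))"
  have d0: "AE x in vol. x \<in> \<Omega> \<longrightarrow> d x \<ge> 0" using d1 by eventually_elim simp
  have "AE x in vol. x \<in> \<Omega> \<longrightarrow> \<bar>u x\<bar> powr s / d x powr (p - 1) =
      m * (\<bar>u x\<bar> powr s * (gnorm A g X x powr (p - 1) / \<rho> x powr (p - 1)))"
    using gnorm_powr_chain[OF d d0 \<rho> \<alpha>] d1 \<rho>
  proof eventually_elim
    case (elim x)
    show ?case
    proof
      assume x: "x \<in> \<Omega>"
      show "\<bar>u x\<bar> powr s / d x powr (p - 1) = m * (\<bar>u x\<bar> powr s * (gnorm A g X x powr (p - 1) / \<rho> x powr (p - 1)))"
      \<comment> \<open>At zeros of \<open>d\<close> both sides are 0: division by zero yields 0,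
        and \<rho> vanishes as well because \<open>0 powr \<alpha> = 0\<close> for either sign of
        \<alpha>.\<close>
      proof (cases "d x = 0")
        case True
        then show ?thesis using elim x by simp
      next
        case False
        then have dx: "d x > 0" using elim x by auto
        have "gnorm A g X x = \<bar>\<alpha>\<bar> * d x powr (\<alpha> - 1)" "\<rho> x = d x powr \<alpha>" using elim x dx by auto
        then have "gnorm A g X x / \<rho> x = \<bar>\<alpha>\<bar> / d x"
          using dx by (simp add: powr_diff)
        then have "(gnorm A g X x / \<rho> x) powr (p - 1) = (\<bar>\<alpha>\<bar> / d x) powr (p - 1)" by simp
        then have "gnorm A g X x powr (p - 1) / \<rho> x powr (p - 1) = \<bar>\<alpha>\<bar> powr (p - 1) / d x powr (p - 1)"
          using dx \<open>\<rho> x = d x powr \<alpha>\<close> by (simp add: powr_divide gnorm_nonneg)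
        moreover have "m * \<bar>\<alpha>\<bar> powr (p - 1) = 1"
          using \<alpha> by (simp add: m_def powr_add[symmetric])
        ultimately show ?thesis by simp
      qed
    qed
  qed
  moreover have "set_borel_measurable vol \<Omega> (\<lambda>x. \<bar>u x\<bar> powr s / d x powr (p - 1))"
  proof -
    have \<Omega>b: "\<Omega> \<in> sets borel" using open_domain by simp
    have rS: "set_borel_measurable vol \<Omega> f \<longleftrightarrow> f \<in> borel_measurable (restrict_space vol \<Omega>)" for f :: "'m \<Rightarrow> real"
      by (rule set_borel_measurable_restrict) (use \<Omega>b in simp)
    note [measurable] = D.rho_measurable[unfolded rS]
      continuous_set_borel_measurable[OF C1_continuous_on[OF C1_0D(1)[OF u]] \<Omega>b, unfolded rS]
    show ?thesis unfolding rS by measurable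
  qed
  ultimately have cong: "set_integrable vol \<Omega> (\<lambda>x. \<bar>u x\<bar> powr s / d x powr (p - 1))"
    "(LINT x:\<Omega>|vol. \<bar>u x\<bar> powr s / d x powr (p - 1)) =
     (LINT x:\<Omega>|vol. m * (\<bar>u x\<bar> powr s * (gnorm A g X x powr (p - 1) / \<rho> x powr (p - 1))))"
    using set_integral_cong_AE'[OF set_integrable_mult_right[OF H(1), of m]] by blast+
  show "set_integrable vol \<Omega> (\<lambda>x. \<bar>u x\<bar> powr s / d x powr (p - 1))" by (rule cong(1))
  have "(LINT x:\<Omega>|vol. \<bar>u x\<bar> powr s / d x powr (p - 1)) \<le> m * ((k powr p * a) powr \<theta> * c powr (1 / p))"
    unfolding cong(2) set_integral_mult_right using H(2) by (intro mult_left_mono) (auto simp: m_def)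
  also have "(k powr p * a) powr \<theta> = k powr (p - 1) * a powr (1 / (p / (p - 1)))"
    using k ac \<theta>(3) by (simp add: powr_mult powr_powr \<theta>_def)
  also have "m * (k powr (p - 1) * a powr (1 / (p / (p - 1))) * c powr (1 / p)) =
      (p / (\<bar>\<alpha>\<bar> * (p - 1))) powr (p - 1) * a powr (1 / (p / (p - 1))) * c powr (1 / p)"
  proof -
    have "p / (\<bar>\<alpha>\<bar> * (p - 1)) = k / \<bar>\<alpha>\<bar>" by (simp add: k_def)
    then have "(p / (\<bar>\<alpha>\<bar> * (p - 1))) powr (p - 1) = m * k powr (p - 1)"
      using k \<alpha> powr_minus_divide[of "\<bar>\<alpha>\<bar>" "p - 1"] by (simp add: m_def powr_divide)
    then show ?thesis by simp
  qed
  finally show "(LINT x:\<Omega>|vol. \<bar>u x\<bar> powr s / d x powr (p - 1))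
      \<le> (p / (\<bar>\<alpha>\<bar> * (p - 1))) powr (p - 1) *
        (LINT x:\<Omega>|vol. gnorm A g (gradient g u) x powr p) powr (1 / (p / (p - 1))) *
        (LINT x:\<Omega>|vol. \<bar>u x\<bar> powr \<delta>) powr (1 / p)"
    by (simp add: a_def c_def)
qed

end

lemma weak_gradient_weak_grad:
  assumes "f \<in> W1p_loc A g vol p \<Omega>"
  shows "weak_gradient A g \<Omega> f (weak_grad A g \<Omega> f)"
proof -
  have "\<exists>X. weak_gradient A g \<Omega> f X" using assms by (simp add: W1p_loc_def)
  then show ?thesis unfolding weak_grad_def by (rule someI_ex)
qed

theorem theorem3p5:
  fixes A :: "('m::{second_countable_topology, t2_space}, 'n::finite) chart set"
    and g :: "('m, 'n) metric" and vol :: "'m measure"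
    and \<Omega> :: "'m set" and \<rho> :: "'m \<Rightarrow> real" and p :: real
  assumes "p > 1"
    and "riemannian_manifold A g" and "riemannian_complete A g"
    and "riemannian_volume A g vol"
    and "open \<Omega>"
    and "\<rho> \<in> W1p_loc A g vol p \<Omega>"
    and "AE x in vol. x \<in> \<Omega> \<longrightarrow> \<rho> x \<ge> 0"
    and "p_superharmonic A g vol p \<Omega> \<rho>"
  shows
    "(\<forall>(\<delta>::real) (b::real) (s::real) (q::real). \<delta> > 0 \<longrightarrow> 0 \<le> b \<longrightarrow> b \<le> 1 \<longrightarrow>
        1 / s = b / p + (1 - b) / \<delta> \<longrightarrow>
        (if b = 0 then q = 0 else 1 / (q * (p - 1)) = 1 / p + (1 - b) / (b * \<delta>)) \<longrightarrow>
        (\<forall>u\<in>C1_0 A \<Omega>.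
          set_integrable vol \<Omega> (\<lambda>x. \<bar>u x\<bar> powr s *
            (rpow (gnorm A g (weak_grad A g \<Omega> \<rho>) x) (q * (p - 1)) / rpow (\<rho> x) (q * (p - 1)))) \<and>
          (LINT x:\<Omega>|vol. \<bar>u x\<bar> powr s *
            (rpow (gnorm A g (weak_grad A g \<Omega> \<rho>) x) (q * (p - 1)) / rpow (\<rho> x) (q * (p - 1))))
              powr (1 / s)
          \<le> (p / (p - 1)) powr (q * (p - 1) / s) *
            rpow (LINT x:\<Omega>|vol. gnorm A g (gradient g u) x powr p) (b / p) *
            rpow (LINT x:\<Omega>|vol. \<bar>u x\<bar> powr \<delta>) ((1 - b) / \<delta>)))
     \<and>
     (\<forall>(\<delta>::real) (s::real) (\<alpha>::real) (d :: 'm \<Rightarrow> real). \<delta> > 0 \<longrightarrow> s = p - 1 + \<delta> / p \<longrightarrow>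
        \<alpha> \<noteq> 0 \<longrightarrow>
        d \<in> W1p_loc A g vol 1 \<Omega> \<longrightarrow>
        (AE x in vol. x \<in> \<Omega> \<longrightarrow> d x \<ge> 0 \<and> gnorm A g (weak_grad A g \<Omega> d) x = 1) \<longrightarrow>
        (AE x in vol. x \<in> \<Omega> \<longrightarrow> \<rho> x = d x powr \<alpha>) \<longrightarrow>
        (\<forall>u\<in>C1_0 A \<Omega>.
          set_integrable vol \<Omega> (\<lambda>x. \<bar>u x\<bar> powr s / d x powr (p - 1)) \<and>
          (LINT x:\<Omega>|vol. \<bar>u x\<bar> powr s / d x powr (p - 1))
          \<le> (p / (\<bar>\<alpha>\<bar> * (p - 1))) powr (p - 1) *
            (LINT x:\<Omega>|vol. gnorm A g (gradient g u) x powr p) powr (1 / (p / (p - 1))) *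
            (LINT x:\<Omega>|vol. \<bar>u x\<bar> powr \<delta>) powr (1 / p)))"
proof -
  interpret M: riemannian_manifold A g by fact
  \<comment> \<open>The parameter \<open>X\<close> becomes the chosen weak gradient; membership in
    \<open>W1p_loc\<close> ensures that the choice has its defining property.\<close>
  interpret superharmonic A g vol \<Omega> \<rho> "weak_grad A g \<Omega> \<rho>" p
  proof unfold_locales
    show "riemannian_volume A g vol" "open \<Omega>" "p > 1" "AE x in vol. x \<in> \<Omega> \<longrightarrow> \<rho> x \<ge> 0" by fact+
    show "weak_gradient A g \<Omega> \<rho> (weak_grad A g \<Omega> \<rho>)"
      by (rule weak_gradient_weak_grad[OF assms(6)])
    show "locally_integrable vol \<Omega> (\<lambda>x. gnorm A g (weak_grad A g \<Omega> \<rho>) x powr p)"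
      using assms(6) by (simp add: W1p_loc_def)
    show "(LINT x:\<Omega>|vol. gnorm A g (weak_grad A g \<Omega> \<rho>) x powr (p - 2) *
        ginner A g (weak_grad A g \<Omega> \<rho>) (gradient g \<phi>) x) \<ge> 0"
      if "\<phi> \<in> C1_0 A \<Omega>" "\<And>x. \<phi> x \<ge> 0" for \<phi>
      using assms(8) that unfolding p_superharmonic_def by blast
  qed
  show ?thesis
  proof (intro conjI allI impI ballI)
    fix \<delta> b s q :: real and u
    assume "\<delta> > 0" "0 \<le> b" "b \<le> 1" "1 / s = b / p + (1 - b) / \<delta>"
      and "if b = 0 then q = 0 else 1 / (q * (p - 1)) = 1 / p + (1 - b) / (b * \<delta>)" and "u \<in> C1_0 A \<Omega>"
    note * = weighted_interpolation[OF \<open>u \<in> C1_0 A \<Omega>\<close> this(1-5)]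
    show "set_integrable vol \<Omega> (\<lambda>x. \<bar>u x\<bar> powr s *
        (rpow (gnorm A g (weak_grad A g \<Omega> \<rho>) x) (q * (p - 1)) / rpow (\<rho> x) (q * (p - 1))))"
      by (rule *(1))
    show "(LINT x:\<Omega>|vol. \<bar>u x\<bar> powr s *
        (rpow (gnorm A g (weak_grad A g \<Omega> \<rho>) x) (q * (p - 1)) / rpow (\<rho> x) (q * (p - 1)))) powr (1 / s)
      \<le> (p / (p - 1)) powr (q * (p - 1) / s) *
        rpow (LINT x:\<Omega>|vol. gnorm A g (gradient g u) x powr p) (b / p) *
        rpow (LINT x:\<Omega>|vol. \<bar>u x\<bar> powr \<delta>) ((1 - b) / \<delta>)"
      by (rule *(2))
  next
    fix \<delta> s \<alpha> :: real and d :: "'m \<Rightarrow> real" and u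
    assume "\<delta> > 0" "s = p - 1 + \<delta> / p" "\<alpha> \<noteq> 0" and d: "d \<in> W1p_loc A g vol 1 \<Omega>"
      and ae: "AE x in vol. x \<in> \<Omega> \<longrightarrow> d x \<ge> 0 \<and> gnorm A g (weak_grad A g \<Omega> d) x = 1"
        "AE x in vol. x \<in> \<Omega> \<longrightarrow> \<rho> x = d x powr \<alpha>"
      and u: "u \<in> C1_0 A \<Omega>"
    note * = distance_interpolation[OF weak_gradient_weak_grad[OF d] ae \<open>\<alpha> \<noteq> 0\<close> u \<open>\<delta> > 0\<close> \<open>s = _\<close>]
    show "set_integrable vol \<Omega> (\<lambda>x. \<bar>u x\<bar> powr s / d x powr (p - 1))"
      by (rule *(1))
    show "(LINT x:\<Omega>|vol. \<bar>u x\<bar> powr s / d x powr (p - 1))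
        \<le> (p / (\<bar>\<alpha>\<bar> * (p - 1))) powr (p - 1) *
          (LINT x:\<Omega>|vol. gnorm A g (gradient g u) x powr p) powr (1 / (p / (p - 1))) *
          (LINT x:\<Omega>|vol. \<bar>u x\<bar> powr \<delta>) powr (1 / p)"
      by (rule *(2))
  qed
qed

end
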